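(* (1) Let $X$ be a simple abelian variety over $\mathbb{C}$ such that $\mathrm{End}_{\mathbb{Q}}(X)$ is isomorphic to a totally real number field, a totally definite quaternion algebra, or a CM-field, and let $f\in\mathrm{End}(X)$ be a non-zero endomorphism. Then: (a) Suppose $\mathrm{End}_{\mathbb{Q}}(X)$ is a totally real number field or a CM-field. If $|f|=1$, then $f$ has zero entropy, and $f$ has positive entropy otherwise. (b) Suppose $\mathrm{End}_{\mathbb{Q}}(X)$ is a totally definite quaternion algebra $\left(\frac{\alpha,\beta}{F}\right)$ and write $f=a+bi+cj+dij$ with $a,b,c,d\in F$. If $|a+\sqrt{b^2\alpha+c^2\beta-d^2\alpha\beta}|=1$, then $f$ has zero entropy, and $f$ has positive entropy otherwise. (2) There exist simple abelian varieties over $\mathbb{C}$ with totally indefinite quaternion multiplication (i.e. $\mathrm{End}_{\mathbb{Q}}(X)$ is a totally indefinite quaternion algebra) possessing automorphisms of positive entropy $\log(\gamma)$ such that $\gamma$ is a Salem number.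
   Context: For an abelian variety $X$ over $\mathbb{C}$, $\mathrm{End}_{\mathbb{Q}}(X)=\mathrm{End}(X)\otimes_{\mathbb{Z}}\mathbb{Q}$. Entropy means topological entropy; for a surjective endomorphism $f$ of $X$ (on a simple $X$, every non-zero endomorphism is surjective) it equals $$\max_{1\le j\le\dim X}\log\rho\bigl(f^*:\mathrm{H}^{j,j}(X)\to\mathrm{H}^{j,j}(X)\bigr),$$ where $\rho$ denotes the spectral radius. A totally real number field is a number field $F$ with $\sigma(F)\subset\mathbb{R}$ for all embeddings $\sigma:F\hookrightarrow\mathbb{C}$ ($F=\mathbb{Q}$ is allowed). A CM-field is a totally imaginary quadratic extension of a totally real number field. For a totally real number field $F$ and $\alpha,\beta\in F\setminus\{0\}$, $\left(\frac{\alpha,\beta}{F}\right)$ is the quaternion algebra $F+iF+jF+ijF$ with $i^2=\alpha$, $j^2=\beta$, $ij=-ji$. A quaternion algebra $B$ over a totally real number field $F$ is totally definite if $B\otimes_\sigma\mathbb{R}\simeq\mathbb{H}$ for every embedding $\sigma:F\hookrightarrow\mathbb{R}$, and totally indefinite if $B\otimes_\sigma\mathbb{R}\simeq \mathrm{M}_2(\mathbb{R})$ for every such $\sigma$. Absolute values of elements of a number field are taken with respect to an embedding into $\mathbb{C}$: in (a), $|f|=|\sigma(f)|$ for an embedding $\sigma$ of the field $\mathrm{End}_{\mathbb{Q}}(X)$ into $\mathbb{C}$; in (b), $|a+\sqrt{t}|$ with $t=b^2\alpha+c^2\beta-d^2\alpha\beta\in F$ is $|\sigma(a)+\sqrt{\sigma(t)}|$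 for an embedding $\sigma:F\hookrightarrow\mathbb{R}$, where $\sqrt{\sigma(t)}$ is a complex square root. In these situations, whether the absolute value equals $1$ does not depend on the choices made. A Salem number is a real algebraic integer $\gamma>1$ all of whose other Galois conjugates have absolute value $\le 1$, with at least one of them of absolute value exactly $1$; its minimal polynomial is a Salem polynomial. *)

theory Defs
  imports
    "HOL-Analysis.Analysis"
    "HOL-Algebra.Algebra"
    "Jordan_Normal_Form.Matrix"
    "Jordan_Normal_Form.Conjugate"
    "Jordan_Normal_Form.VS_Connect"
begin

section \<open>Topological entropy\<close>

definition open_cover :: "'a topology \<Rightarrow> 'a set set \<Rightarrow> bool" where
  "open_cover T \<U> \<longleftrightarrow> (\<forall>U\<in>\<U>. openin T U) \<and> \<Union>\<U> = topspace T"

definition min_subcover_card :: "'a topology \<Rightarrow> 'a set set \<Rightarrow> nat" where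
  "min_subcover_card T \<U> =
     (LEAST n. \<exists>\<V>. \<V> \<subseteq> \<U> \<and> finite \<V> \<and> card \<V> = n \<and> \<Union>\<V> = topspace T)"

text \<open>The common refinement of \<open>\<U>, f\<^sup>-\<^sup>1 \<U>, \<dots>, f\<^sup>-\<^sup>(\<^sup>n\<^sup>-\<^sup>1\<^sup>) \<U>\<close>.\<close>

definition iterated_cover :: "'a topology \<Rightarrow> ('a \<Rightarrow> 'a) \<Rightarrow> 'a set set \<Rightarrow> nat \<Rightarrow> 'a set set" where
  "iterated_cover T f \<U> n =
     {topspace T \<inter> (\<Inter>i\<in>{..<n}. (f ^^ i) -` s i) | s. \<forall>i<n. s i \<in> \<U>}"

text \<open>The definition of Adler, Konheim and McAndrew, for a continuous self-map of a compact space.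
  The sequence inside the \<open>limsup\<close> converges, by subadditivity.\<close>

definition topological_entropy :: "'a topology \<Rightarrow> ('a \<Rightarrow> 'a) \<Rightarrow> ereal" where
  "topological_entropy T f =
     (SUP \<U> \<in> {\<U>. open_cover T \<U>}.
        limsup (\<lambda>n. ereal (ln (real (min_subcover_card T (iterated_cover T f \<U> n))) / real n)))"


section \<open>Complex abelian varieties\<close>

text \<open>A complex torus is \<open>\<complex>\<^sup>g / L\<close> for a full lattice \<open>L\<close> in \<open>\<complex>\<^sup>g = carrier_vec g\<close>.\<close>

definition complex_subspace :: "nat \<Rightarrow> complex vec set \<Rightarrow> bool" where
  "complex_subspace g W \<longleftrightarrow> VectorSpace.subspace class_ring W (module_vec TYPE(complex) g)"

text \<open>\<open>L\<close> is a full lattice in \<open>W\<close>: the columns of the period matrix \<open>P\<close> form both an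
  \<open>\<real>\<close>-basis of \<open>W\<close> and a \<open>\<int>\<close>-basis of \<open>L\<close>.\<close>

definition full_lattice :: "nat \<Rightarrow> complex vec set \<Rightarrow> complex vec set \<Rightarrow> bool" where
  "full_lattice g W L \<longleftrightarrow>
     (\<exists>n P. P \<in> carrier_mat g n \<and>
        bij_betw (\<lambda>x. P *\<^sub>v map_vec complex_of_real x) (carrier_vec n) W \<and>
        L = (\<lambda>m. P *\<^sub>v map_vec of_int m) ` (carrier_vec n :: int vec set))"

text \<open>A polarization: a positive definite Hermitian form \<open>(v, w) \<mapsto> (H v) \<bullet>c w\<close>, linear in \<open>v\<close>
  and antilinear in \<open>w\<close>, whose imaginary part is integral on the lattice.\<close>

definition polarization :: "nat \<Rightarrow> complex vec set \<Rightarrow> complex mat \<Rightarrow> bool" where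
  "polarization g L H \<longleftrightarrow>
     H \<in> carrier_mat g g \<and>
     (\<forall>v\<in>carrier_vec g. \<forall>w\<in>carrier_vec g. (H *\<^sub>v w) \<bullet>c v = cnj ((H *\<^sub>v v) \<bullet>c w)) \<and>
     (\<forall>v\<in>carrier_vec g. v \<noteq> 0\<^sub>v g \<longrightarrow> Re ((H *\<^sub>v v) \<bullet>c v) > 0) \<and>
     (\<forall>v\<in>L. \<forall>w\<in>L. Im ((H *\<^sub>v v) \<bullet>c w) \<in> \<int>)"

definition abelian_variety :: "nat \<Rightarrow> complex vec set \<Rightarrow> bool" where
  "abelian_variety g L \<longleftrightarrow> full_lattice g (carrier_vec g) L \<and> (\<exists>H. polarization g L H)"

text \<open>The abelian subvarieties of \<open>\<complex>\<^sup>g / L\<close> are the images of the complex subspaces \<open>W\<close>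
  in which \<open>L \<inter> W\<close> is a full lattice.\<close>

definition simple_abelian_variety :: "nat \<Rightarrow> complex vec set \<Rightarrow> bool" where
  "simple_abelian_variety g L \<longleftrightarrow>
     abelian_variety g L \<and> g > 0 \<and>
     (\<forall>W. complex_subspace g W \<and> full_lattice g W (L \<inter> W) \<longrightarrow> W = {0\<^sub>v g} \<or> W = carrier_vec g)"

text \<open>An endomorphism is identified with its analytic representation, i.e. with the unique
  linear map of \<open>\<complex>\<^sup>g\<close> that induces it.\<close>

definition End_ring :: "nat \<Rightarrow> complex vec set \<Rightarrow> complex mat ring" where
  "End_ring g L =
     (ring_mat TYPE(complex) g ())\<lparr>carrier := {A \<in> carrier_mat g g. \<forall>v\<in>L. A *\<^sub>v v \<in> L}\<rparr>"

text \<open>As \<open>End(X)\<close> is torsion-free, \<open>End(X) \<otimes> \<rat>\<close> is its \<open>\<rat>\<close>-span in the matrix ring.\<close>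

definition EndQ_ring :: "nat \<Rightarrow> complex vec set \<Rightarrow> complex mat ring" where
  "EndQ_ring g L =
     (ring_mat TYPE(complex) g ())\<lparr>carrier :=
        {of_rat q \<cdot>\<^sub>m A | q A. A \<in> carrier (End_ring g L)}\<rparr>"

definition torus_point :: "complex vec set \<Rightarrow> complex vec \<Rightarrow> complex vec set" where
  "torus_point L v = (\<lambda>l. v + l) ` L"

definition cvec_topology :: "nat \<Rightarrow> complex vec topology" where
  "cvec_topology g = pullback_topology (carrier_vec g) vec_index (euclidean :: (nat \<Rightarrow> complex) topology)"

definition torus_topology :: "nat \<Rightarrow> complex vec set \<Rightarrow> complex vec set topology" where
  "torus_topology g L =
     topology (\<lambda>U. U \<subseteq> torus_point L ` carrier_vec g \<and>
                   openin (cvec_topology g) {v \<in> carrier_vec g. torus_point L v \<in> U})"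

text \<open>For an endomorphism \<open>A\<close> all members of this union coincide.\<close>

definition torus_map :: "complex vec set \<Rightarrow> complex mat \<Rightarrow> complex vec set \<Rightarrow> complex vec set" where
  "torus_map L A p = (\<Union>v\<in>p. torus_point L (A *\<^sub>v v))"

definition entropy :: "nat \<Rightarrow> complex vec set \<Rightarrow> complex mat \<Rightarrow> ereal" where
  "entropy g L A = topological_entropy (torus_topology g L) (torus_map L A)"


section \<open>Number fields\<close>

definition number_field :: "'a ring \<Rightarrow> bool" where
  "number_field F \<longleftrightarrow>
     field F \<and>
     (\<exists>Q. subfield Q F \<and> (class_ring :: rat ring) \<simeq> F\<lparr>carrier := Q\<rparr> \<and>
          ring.finite_dimension F Q (carrier F))"

definition totally_real_field :: "'a ring \<Rightarrow> bool" where
  "totally_real_field F \<longleftrightarrow>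
     number_field F \<and> (\<forall>\<sigma> \<in> Ring.ring_hom F (class_ring :: complex ring). \<sigma> ` carrier F \<subseteq> \<real>)"

definition totally_imaginary_field :: "'a ring \<Rightarrow> bool" where
  "totally_imaginary_field F \<longleftrightarrow>
     number_field F \<and> (\<forall>\<sigma> \<in> Ring.ring_hom F (class_ring :: complex ring). \<not> \<sigma> ` carrier F \<subseteq> \<real>)"

definition CM_field :: "'a ring \<Rightarrow> bool" where
  "CM_field E \<longleftrightarrow>
     totally_imaginary_field E \<and>
     (\<exists>K. subfield K E \<and> totally_real_field (E\<lparr>carrier := K\<rparr>) \<and> ring.dimension E 2 K (carrier E))"


section \<open>Quaternion algebras\<close>

text \<open>The tuple \<open>(a, b, c, d)\<close> stands for \<open>a + b i + c j + d ij\<close>, where \<open>i\<^sup>2 = \<alpha>\<close>, \<open>j\<^sup>2 = \<beta>\<close>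
  and \<open>ij = - ji\<close>.\<close>

definition quaternion_algebra :: "'a ring \<Rightarrow> 'a \<Rightarrow> 'a \<Rightarrow> ('a \<times> 'a \<times> 'a \<times> 'a) ring" where
  "quaternion_algebra F \<alpha> \<beta> =
     \<lparr>carrier = carrier F \<times> carrier F \<times> carrier F \<times> carrier F,
      monoid.mult = (\<lambda>(a, b, c, d) (a', b', c', d').
        (a \<otimes>\<^bsub>F\<^esub> a' \<oplus>\<^bsub>F\<^esub> \<alpha> \<otimes>\<^bsub>F\<^esub> b \<otimes>\<^bsub>F\<^esub> b' \<oplus>\<^bsub>F\<^esub> \<beta> \<otimes>\<^bsub>F\<^esub> c \<otimes>\<^bsub>F\<^esub> c' \<ominus>\<^bsub>F\<^esub> \<alpha> \<otimes>\<^bsub>F\<^esub> \<beta> \<otimes>\<^bsub>F\<^esub> d \<otimes>\<^bsub>F\<^esub> d',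
         a \<otimes>\<^bsub>F\<^esub> b' \<oplus>\<^bsub>F\<^esub> b \<otimes>\<^bsub>F\<^esub> a' \<ominus>\<^bsub>F\<^esub> \<beta> \<otimes>\<^bsub>F\<^esub> c \<otimes>\<^bsub>F\<^esub> d' \<oplus>\<^bsub>F\<^esub> \<beta> \<otimes>\<^bsub>F\<^esub> d \<otimes>\<^bsub>F\<^esub> c',
         a \<otimes>\<^bsub>F\<^esub> c' \<oplus>\<^bsub>F\<^esub> c \<otimes>\<^bsub>F\<^esub> a' \<oplus>\<^bsub>F\<^esub> \<alpha> \<otimes>\<^bsub>F\<^esub> b \<otimes>\<^bsub>F\<^esub> d' \<ominus>\<^bsub>F\<^esub> \<alpha> \<otimes>\<^bsub>F\<^esub> d \<otimes>\<^bsub>F\<^esub> b',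
         a \<otimes>\<^bsub>F\<^esub> d' \<oplus>\<^bsub>F\<^esub> d \<otimes>\<^bsub>F\<^esub> a' \<oplus>\<^bsub>F\<^esub> b \<otimes>\<^bsub>F\<^esub> c' \<ominus>\<^bsub>F\<^esub> c \<otimes>\<^bsub>F\<^esub> b')),
      one = (\<one>\<^bsub>F\<^esub>, \<zero>\<^bsub>F\<^esub>, \<zero>\<^bsub>F\<^esub>, \<zero>\<^bsub>F\<^esub>),
      ring.zero = (\<zero>\<^bsub>F\<^esub>, \<zero>\<^bsub>F\<^esub>, \<zero>\<^bsub>F\<^esub>, \<zero>\<^bsub>F\<^esub>),
      add = (\<lambda>(a, b, c, d) (a', b', c', d').
        (a \<oplus>\<^bsub>F\<^esub> a', b \<oplus>\<^bsub>F\<^esub> b', c \<oplus>\<^bsub>F\<^esub> c', d \<oplus>\<^bsub>F\<^esub> d'))\<rparr>"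

definition hamilton_quaternions :: "(real \<times> real \<times> real \<times> real) ring" where
  "hamilton_quaternions = quaternion_algebra class_ring (- 1) (- 1)"

text \<open>The base change of \<open>(\<alpha>, \<beta> / F)\<close> along \<open>\<sigma> : F \<rightarrow> \<real>\<close> is \<open>(\<sigma> \<alpha>, \<sigma> \<beta> / \<real>)\<close>. A ring isomorphism
  between central \<open>\<real>\<close>-algebras is automatically \<open>\<real>\<close>-linear, because the identity is the only ring
  endomorphism of \<open>\<real>\<close>.\<close>

definition totally_definite_quaternion :: "'a ring \<Rightarrow> 'a \<Rightarrow> 'a \<Rightarrow> bool" where
  "totally_definite_quaternion F \<alpha> \<beta> \<longleftrightarrow>
     totally_real_field F \<and> \<alpha> \<in> carrier F - {\<zero>\<^bsub>F\<^esub>} \<and> \<beta> \<in> carrier F - {\<zero>\<^bsub>F\<^esub>} \<and>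
     (\<forall>\<sigma> \<in> Ring.ring_hom F (class_ring :: real ring).
        quaternion_algebra class_ring (\<sigma> \<alpha>) (\<sigma> \<beta>) \<simeq> hamilton_quaternions)"

definition totally_indefinite_quaternion :: "'a ring \<Rightarrow> 'a \<Rightarrow> 'a \<Rightarrow> bool" where
  "totally_indefinite_quaternion F \<alpha> \<beta> \<longleftrightarrow>
     totally_real_field F \<and> \<alpha> \<in> carrier F - {\<zero>\<^bsub>F\<^esub>} \<and> \<beta> \<in> carrier F - {\<zero>\<^bsub>F\<^esub>} \<and>
     (\<forall>\<sigma> \<in> Ring.ring_hom F (class_ring :: real ring).
        quaternion_algebra class_ring (\<sigma> \<alpha>) (\<sigma> \<beta>) \<simeq> ring_mat TYPE(real) 2 ())"


section \<open>Salem numbers\<close>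

definition galois_conjugate :: "real \<Rightarrow> complex \<Rightarrow> bool" where
  "galois_conjugate x z \<longleftrightarrow>
     (\<exists>p :: rat poly. Factorial_Ring.irreducible p \<and>
        poly (map_poly of_rat p) x = 0 \<and> poly (map_poly of_rat p) z = 0)"

definition salem_number :: "real \<Rightarrow> bool" where
  "salem_number x \<longleftrightarrow>
     algebraic_int x \<and> x > 1 \<and>
     (\<forall>z. galois_conjugate x z \<and> z \<noteq> of_real x \<longrightarrow> cmod z \<le> 1) \<and>
     (\<exists>z. galois_conjugate x z \<and> z \<noteq> of_real x \<and> cmod z = 1)"

end

theory Submission
  imports Defs "Jordan_Normal_Form.Spectral_Radius" "HOL-Real_Asymp.Real_Asymp"
begin

text \<open>Covering the torus by a grid adapted to the growth of the powers of \<open>A\<close> bounds the entropy of \<open>A\<close> from above, and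
  separating points on the eigenline of an eigenvalue \<open>\<mu>\<close> with \<open>\<bar>\<mu>\<bar> > 1\<close> shows that it is at least \<open>2 ln \<bar>\<mu>\<bar>\<close>. Hence the
  entropy vanishes if all eigenvalues are in the closed unit disc; it is positive if they are non-zero and off the unit
  circle, because a lattice admits no contracting endomorphism with non-zero eigenvalues.

  In part (1) the endomorphism \<open>f\<close> and the number field \<open>End\<^sub>\<rat>(X)\<close>, respectively \<open>F\<close>, have simultaneous eigenvectors,
  so the eigenvalues of \<open>f\<close> are values \<open>\<chi>(f)\<close> at complex embeddings \<open>\<chi>\<close>, respectively roots of the image under \<open>\<chi>\<close> of the
  reduced characteristic polynomial of \<open>f\<close>. Their being of modulus one does not depend on \<open>\<chi>\<close>: then \<open>f = \<plusminus>1\<close> in the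
  totally real case, and \<open>f\<close> has relative or reduced norm \<open>1\<close> in the other two.

  In part (2) let \<open>\<phi>\<close> be the golden ratio and \<open>B = (\<phi>, 3 / \<rat>(\<surd>5))\<close>. The order spanned over \<open>\<int>\<close> by the elements \<open>i\<^sup>k\<close> and
  \<open>i\<^sup>k j\<close> with \<open>k < 4\<close> is a lattice in \<open>B \<otimes> \<real> = \<real>\<^sup>8\<close>, on which the imaginary unit acts as right multiplication by a generic
  element. The endomorphisms are the left multiplications. The norm form is anisotropic by descent modulo \<open>3\<close>, so that
  \<open>B\<close> is a division algebra and the torus is simple. Left multiplication by the unit \<open>i + i\<^sup>2\<close>
  has the eigenvalues \<open>\<phi> \<plusminus> \<surd>\<phi>\<close> and two more of modulus one, so its entropy is \<open>ln \<gamma>\<close> with \<open>\<gamma> = (\<phi> + \<surd>\<phi>)\<^sup>2\<close>, a root of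
  \<open>x\<^sup>4 - 8 x\<^sup>3 - 2 x\<^sup>2 - 8 x + 1\<close>.\<close>

text \<open>The golden ratio is positive at one real place of \<open>\<rat>(\<surd>5)\<close> and
  negative at the other. So \<open>i\<close> takes real values at the first place and imaginary ones
  at the second, and a unit in \<open>i\<close> of relative norm 1 has two real eigenvalues with
  product 1 and two on the unit circle: the shape of a Salem number. For
  \<open>i + i\<^sup>2\<close> the norm is \<open>\<phi>\<^sup>2 - \<phi> = 1\<close>. The constant
  3 is positive, which splits the algebra at both places, and it is inert in
  \<open>\<rat>(\<surd>5)\<close> with \<open>\<phi>\<close> not a square modulo 3, which leaves a
  division algebra. The obstacle is to know the endomorphisms exactly, since special complex
  structures admit more. The structure is moved at the first place only, by one real parameter; each
  rational relation between its six coefficients excludes finitely many parameters. At a generic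
  parameter, functionals that are linear only over the rationals isolate the coefficients one by
  one, and endomorphisms and subtori become the commutant and the right ideals of the
  algebra.\<close>

unbundle no vec_syntax

section \<open>Lattices\<close>

text \<open>The entropy estimates see a lattice only through two facts about the maximum norm of the
  coordinates: non-zero points have size at least \<open>r\<close>, and every vector lies within
  \<open>R\<close> of the lattice.\<close>

locale cocompact_lattice =
  fixes g :: nat and L :: "complex vec set" and r R :: real
  assumes L_carrier: "L \<subseteq> carrier_vec g"
    and zero_mem: "0\<^sub>v g \<in> L"
    and diff_mem: "v \<in> L \<Longrightarrow> w \<in> L \<Longrightarrow> v - w \<in> L"
    and r_pos: "r > 0"
    and discrete: "l \<in> L \<Longrightarrow> (\<And>k. k < g \<Longrightarrow> cmod (l $ k) < r) \<Longrightarrow> l = 0\<^sub>v g"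
    and R_pos: "R > 0"
    and cobounded: "v \<in> carrier_vec g \<Longrightarrow> \<exists>l\<in>L. \<forall>k<g. cmod (v $ k - l $ k) \<le> R"

text \<open>The induction clears one coordinate at a time and splits it into real and imaginary
  part, because \<open>F\<close> is only real-linear. It will be applied to the coordinates with
  respect to a lattice basis.\<close>

lemma real_linear_bound:
  fixes F :: "complex vec \<Rightarrow> real"
  assumes add: "\<And>v w. v \<in> carrier_vec g \<Longrightarrow> w \<in> carrier_vec g \<Longrightarrow> F (v + w) = F v + F w"
    and scale: "\<And>c v. v \<in> carrier_vec g \<Longrightarrow> F (complex_of_real c \<cdot>\<^sub>v v) = c * F v"
  shows "\<exists>B\<ge>0. \<forall>v\<in>carrier_vec g. \<forall>M. (\<forall>k<g. cmod (v $ k) \<le> M) \<longrightarrow> \<bar>F v\<bar> \<le> B * M"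
proof -
  have zero: "F (0\<^sub>v g) = 0"
    using add[of "0\<^sub>v g" "0\<^sub>v g"] by simp
  define b where "b k = \<bar>F (unit_vec g k)\<bar> + \<bar>F (\<i> \<cdot>\<^sub>v unit_vec g k)\<bar>" for k
  have b0: "b k \<ge> 0" for k unfolding b_def by simp
  have main: "\<bar>F v\<bar> \<le> (\<Sum>k<m. b k) * M"
    if "m \<le> g" "v \<in> carrier_vec g" "\<forall>k<g. cmod (v $ k) \<le> M" "\<forall>k<g. k \<ge> m \<longrightarrow> v $ k = 0" "M \<ge> 0"
    for m v M
    using that
  proof (induction m arbitrary: v)
    case 0
    then have "v = 0\<^sub>v g" by (intro eq_vecI) auto
    then show ?case using zero by simp
  next
    case (Suc m)
    define v' where "v' = vec g (\<lambda>k. if k = m then 0 else v $ k)"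
    have v': "v' \<in> carrier_vec g" by (simp add: v'_def)
    have IH: "\<bar>F v'\<bar> \<le> (\<Sum>k<m. b k) * M"
      by (rule Suc.IH) (use Suc.prems in \<open>auto simp: v'_def\<close>)
    have dec: "v = v' + (complex_of_real (Re (v $ m)) \<cdot>\<^sub>v unit_vec g m
        + complex_of_real (Im (v $ m)) \<cdot>\<^sub>v (\<i> \<cdot>\<^sub>v unit_vec g m))"
    proof (rule eq_vecI)
      fix i assume "i < dim_vec (v' + (complex_of_real (Re (v $ m)) \<cdot>\<^sub>v unit_vec g m
        + complex_of_real (Im (v $ m)) \<cdot>\<^sub>v (\<i> \<cdot>\<^sub>v unit_vec g m)))"
      then have "i < g" by simp
      then show "v $ i = (v' + (complex_of_real (Re (v $ m)) \<cdot>\<^sub>v unit_vec g m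
        + complex_of_real (Im (v $ m)) \<cdot>\<^sub>v (\<i> \<cdot>\<^sub>v unit_vec g m))) $ i"
        using Suc.prems by (auto simp: v'_def unit_vec_def complex_eq_iff)
    qed (use Suc.prems in auto)
    have "F v = F v' + (Re (v $ m) * F (unit_vec g m) + Im (v $ m) * F (\<i> \<cdot>\<^sub>v unit_vec g m))"
      by (subst dec) (simp add: add scale v')
    then have "\<bar>F v\<bar> \<le> \<bar>F v'\<bar> + (\<bar>Re (v $ m)\<bar> * \<bar>F (unit_vec g m)\<bar> + \<bar>Im (v $ m)\<bar> * \<bar>F (\<i> \<cdot>\<^sub>v unit_vec g m)\<bar>)"
      using abs_triangle_ineq[of "F v'" "Re (v $ m) * F (unit_vec g m) + Im (v $ m) * F (\<i> \<cdot>\<^sub>v unit_vec g m)"]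
        abs_triangle_ineq[of "Re (v $ m) * F (unit_vec g m)" "Im (v $ m) * F (\<i> \<cdot>\<^sub>v unit_vec g m)"]
      by (simp add: abs_mult)
    moreover have "\<bar>Re (v $ m)\<bar> \<le> M" "\<bar>Im (v $ m)\<bar> \<le> M"
      using abs_Re_le_cmod[of "v $ m"] abs_Im_le_cmod[of "v $ m"] Suc.prems by (meson Suc_le_lessD order_trans)+
    then have "\<bar>Re (v $ m)\<bar> * \<bar>F (unit_vec g m)\<bar> + \<bar>Im (v $ m)\<bar> * \<bar>F (\<i> \<cdot>\<^sub>v unit_vec g m)\<bar> \<le> M * \<bar>F (unit_vec g m)\<bar> + M * \<bar>F (\<i> \<cdot>\<^sub>v unit_vec g m)\<bar>"
      by (intro add_mono mult_right_mono) auto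
    moreover have "M * \<bar>F (unit_vec g m)\<bar> + M * \<bar>F (\<i> \<cdot>\<^sub>v unit_vec g m)\<bar> = b m * M"
      by (simp add: b_def algebra_simps)
    moreover note IH
    ultimately show ?case by (simp add: distrib_right)
  qed
  show ?thesis
  proof (intro exI[of _ "\<Sum>k<g. b k"] conjI ballI allI impI)
    show "0 \<le> (\<Sum>k<g. b k)" by (simp add: sum_nonneg b0)
    fix v M assume v: "v \<in> carrier_vec g" "\<forall>k<g. cmod (v $ k) \<le> M"
    show "\<bar>F v\<bar> \<le> (\<Sum>k<g. b k) * M"
    proof (cases "g = 0")
      case True
      then have "v = 0\<^sub>v g" using v by auto
      then show ?thesis using zero True by simp
    next
      case False
      then have "M \<ge> 0" using v(2) by (meson bot_nat_0.not_eq_extremum norm_ge_zero order_trans)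
      then show ?thesis using main[of g v M] v by auto
    qed
  qed
qed

text \<open>The coordinates with respect to the lattice basis are bounded functionals, so a small
  lattice vector has integer coordinates of modulus below 1 and vanishes. Rounding down the
  coordinates of any vector gives a lattice point near it.\<close>

lemma full_lattice_cocompact:
  assumes "full_lattice g (carrier_vec g) L"
  shows "\<exists>r R. cocompact_lattice g L r R"
proof -
  from assms obtain n P where P: "P \<in> carrier_mat g n"
    and bij: "bij_betw (\<lambda>x. P *\<^sub>v map_vec complex_of_real x) (carrier_vec n) (carrier_vec g)"
    and L: "L = (\<lambda>m. P *\<^sub>v map_vec of_int m) ` (carrier_vec n :: int vec set)"
    unfolding full_lattice_def by blast
  define p where "p x = P *\<^sub>v map_vec complex_of_real x" for x
  have p_carrier: "p x \<in> carrier_vec g" if "x \<in> carrier_vec n" for x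
    using that P unfolding p_def by simp
  have p_add: "p (x + y) = p x + p y" if "x \<in> carrier_vec n" "y \<in> carrier_vec n" for x y
    unfolding p_def
    by (subst mult_add_distrib_mat_vec[OF P, symmetric]) (use that in \<open>auto intro!: arg_cong[of _ _ "\<lambda>v. P *\<^sub>v v"] eq_vecI\<close>)
  have p_scale: "p (a \<cdot>\<^sub>v x) = complex_of_real a \<cdot>\<^sub>v p x" if "x \<in> carrier_vec n" for a x
    unfolding p_def
    by (subst mult_mat_vec[OF P, symmetric]) (use that in \<open>auto intro!: arg_cong[of _ _ "\<lambda>v. P *\<^sub>v v"] eq_vecI\<close>)
  have inj: "inj_on p (carrier_vec n)" and surj: "p ` carrier_vec n = carrier_vec g"
    using bij unfolding bij_betw_def p_def by auto
  define c where "c = the_inv_into (carrier_vec n) p"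
  have c_carrier: "c v \<in> carrier_vec n" and pc: "p (c v) = v" if "v \<in> carrier_vec g" for v
    using that surj inj by (auto simp: c_def the_inv_into_into f_the_inv_into_f)
  have cp: "c (p x) = x" if "x \<in> carrier_vec n" for x
    using that inj by (simp add: c_def the_inv_into_f_f)
  have c_add: "c (v + w) = c v + c w" if "v \<in> carrier_vec g" "w \<in> carrier_vec g" for v w
    using cp[of "c v + c w"] p_add[of "c v" "c w"] c_carrier[OF that(1)] c_carrier[OF that(2)] pc[OF that(1)] pc[OF that(2)]
    by simp
  have c_scale: "c (complex_of_real a \<cdot>\<^sub>v v) = a \<cdot>\<^sub>v c v" if "v \<in> carrier_vec g" for a v
    using cp[of "a \<cdot>\<^sub>v c v"] p_scale[of "c v" a] c_carrier[OF that] pc[OF that] by simp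
  have "\<exists>B\<ge>0. \<forall>v\<in>carrier_vec g. \<forall>M. (\<forall>k<g. cmod (v $ k) \<le> M) \<longrightarrow> \<bar>c v $ j\<bar> \<le> B * M" if "j < n" for j
  proof (rule real_linear_bound)
    have dim: "dim_vec (c v) = n" if "v \<in> carrier_vec g" for v using c_carrier[OF that] by simp
    show "c (v + w) $ j = c v $ j + c w $ j" if "v \<in> carrier_vec g" "w \<in> carrier_vec g" for v w
      using dim[OF that(1)] dim[OF that(2)] \<open>j < n\<close> by (simp only: c_add[OF that] index_add_vec)
    show "c (complex_of_real a \<cdot>\<^sub>v v) $ j = a * c v $ j" if "v \<in> carrier_vec g" for a v
      using dim[OF that(1)] \<open>j < n\<close> by (simp only: c_scale[OF that] index_smult_vec)
  qed
  then have "\<forall>j. \<exists>B. j < n \<longrightarrow> B \<ge> 0 \<and> (\<forall>v\<in>carrier_vec g. \<forall>M. (\<forall>k<g. cmod (v $ k) \<le> M) \<longrightarrow> \<bar>c v $ j\<bar> \<le> B * M)"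
    by blast
  then obtain B where B_all: "\<forall>j. j < n \<longrightarrow> B j \<ge> 0 \<and> (\<forall>v\<in>carrier_vec g. \<forall>M. (\<forall>k<g. cmod (v $ k) \<le> M) \<longrightarrow> \<bar>c v $ j\<bar> \<le> B j * M)"
    using choice[of "\<lambda>j B. j < n \<longrightarrow> B \<ge> 0 \<and> (\<forall>v\<in>carrier_vec g. \<forall>M. (\<forall>k<g. cmod (v $ k) \<le> M) \<longrightarrow> \<bar>c v $ j\<bar> \<le> B * M)"] by blast
  have B0: "B j \<ge> 0" if "j < n" for j using B_all that by blast
  have B: "\<bar>c v $ j\<bar> \<le> B j * M" if "j < n" "v \<in> carrier_vec g" "\<And>k. k < g \<Longrightarrow> cmod (v $ k) \<le> M" for j v M
    using B_all that by blast
  define B' where "B' = (\<Sum>j<n. B j)"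
  have B'0: "B' \<ge> 0" unfolding B'_def by (rule sum_nonneg) (auto intro: B0)
  have BB': "B j \<le> B'" if "j < n" for j unfolding B'_def by (rule member_le_sum) (use that B0 in auto)
  \<comment> \<open>The summand 1 keeps \<open>R\<close> positive in dimension 0.\<close>
  define R where "R = (\<Sum>k<g. \<Sum>j<n. cmod (P $$ (k,j))) + 1"
  have int_real: "P *\<^sub>v map_vec (of_int :: int \<Rightarrow> complex) m = p (map_vec real_of_int m)" for m :: "int vec"
  proof -
    have "map_vec (of_int :: int \<Rightarrow> complex) m = map_vec complex_of_real (map_vec real_of_int m)"
      by (rule eq_vecI) auto
    then show ?thesis unfolding p_def by simp
  qed
  have Lp: "L = (\<lambda>m. p (map_vec real_of_int m)) ` (carrier_vec n :: int vec set)"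
    unfolding L int_real ..
  have p0: "p (0\<^sub>v n) = 0\<^sub>v g" unfolding p_def using P by (auto intro!: eq_vecI simp: scalar_prod_def)
  have p_minus: "p (x - y) = p x - p y" if "x \<in> carrier_vec n" "y \<in> carrier_vec n" for x y
  proof -
    have "x - y + y = x" using that by (intro eq_vecI) auto
    then have "p x = p (x - y) + p y" using p_add[of "x - y" y] that by simp
    then show ?thesis using p_carrier[of y] p_carrier[of "x - y"] that by (intro eq_vecI) auto
  qed
  have "cocompact_lattice g L (1 / (B' + 1)) R"
  proof
    show "L \<subseteq> carrier_vec g" unfolding Lp using p_carrier by auto
    have "map_vec real_of_int (0\<^sub>v n) = 0\<^sub>v n" by (rule eq_vecI) auto
    then have "0\<^sub>v g = p (map_vec real_of_int (0\<^sub>v n))" by (simp only: p0)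
    moreover have "0\<^sub>v n \<in> carrier_vec n" by simp
    ultimately show "0\<^sub>v g \<in> L" unfolding Lp by (rule image_eqI)
    show "v - w \<in> L" if vw: "v \<in> L" "w \<in> L" for v w
    proof -
      obtain x y where xy: "x \<in> carrier_vec n" "v = p (map_vec real_of_int x)" "y \<in> carrier_vec n" "w = p (map_vec real_of_int y)"
        using vw unfolding Lp by auto
      have "map_vec real_of_int (x - y) = (map_vec real_of_int x - map_vec real_of_int y :: real vec)"
        by (rule eq_vecI) (use xy in auto)
      moreover have "p (map_vec real_of_int x - map_vec real_of_int y) = v - w"
        using xy by (simp add: p_minus)
      ultimately have "v - w = p (map_vec real_of_int (x - y))" by (simp only:)
      moreover have "x - y \<in> carrier_vec n" using xy by simp
      ultimately show ?thesis unfolding Lp by (rule image_eqI)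
    qed
    show "0 < 1 / (B' + 1)" using B'0 by simp
    show "l = 0\<^sub>v g" if l: "l \<in> L" "\<And>k. k < g \<Longrightarrow> cmod (l $ k) < 1 / (B' + 1)" for l
    proof -
      obtain x where x: "x \<in> carrier_vec n" "l = p (map_vec real_of_int x)" using l(1) unfolding Lp by auto
      have lc: "l \<in> carrier_vec g" using x p_carrier by auto
      have cl: "c l = map_vec real_of_int x" using x by (simp add: cp)
      have "x $ j = 0" if j: "j < n" for j
      proof -
        have "\<bar>c l $ j\<bar> \<le> B j * (1 / (B' + 1))"
          by (rule B[OF j lc]) (use l(2) in \<open>simp add: less_imp_le\<close>)
        also have "\<dots> \<le> B' * (1 / (B' + 1))" by (rule mult_right_mono) (use BB' j B'0 in auto)
        also have "\<dots> < 1" using B'0 by (simp add: field_simps)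
        finally show ?thesis using cl x j by simp
      qed
      then have "map_vec real_of_int x = (0\<^sub>v n :: real vec)" by (intro eq_vecI) (use x in auto)
      then show ?thesis using x(2) p0 by (simp only:)
    qed
    show "R > 0" unfolding R_def by (simp add: sum_nonneg add_nonneg_pos)
    show "\<exists>l\<in>L. \<forall>k<g. cmod (v $ k - l $ k) \<le> R" if v: "v \<in> carrier_vec g" for v
    proof -
      define m where "m = map_vec floor (c v)"
      define y where "y = c v - map_vec real_of_int m"
      have m: "m \<in> carrier_vec n" and y: "y \<in> carrier_vec n" unfolding m_def y_def using c_carrier[OF v] by auto
      have yb: "\<bar>y $ j\<bar> \<le> 1" if "j < n" for j
        using that c_carrier[OF v] unfolding y_def m_def by (simp, linarith)
      have diff: "p y = v - p (map_vec real_of_int m)"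
        unfolding y_def using m c_carrier[OF v] by (simp add: p_minus pc v)
      have "cmod (v $ k - p (map_vec real_of_int m) $ k) \<le> R" if k: "k < g" for k
      proof -
        have "v $ k - p (map_vec real_of_int m) $ k = p y $ k"
          unfolding diff using k v p_carrier[of "map_vec real_of_int m"] m by simp
        also have "\<dots> = (\<Sum>j<n. P $$ (k,j) * complex_of_real (y $ j))"
          unfolding p_def using P k y by (auto simp: scalar_prod_def atLeast0LessThan intro!: sum.cong)
        finally have "cmod (v $ k - p (map_vec real_of_int m) $ k) \<le> (\<Sum>j<n. cmod (P $$ (k,j) * complex_of_real (y $ j)))"
          by (simp add: norm_sum)
        also have "\<dots> \<le> (\<Sum>j<n. cmod (P $$ (k,j)))"
          by (rule sum_mono) (use yb in \<open>auto simp: norm_mult intro!: mult_left_le\<close>)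
        also have "\<dots> \<le> (\<Sum>k<g. \<Sum>j<n. cmod (P $$ (k,j)))"
          by (rule member_le_sum[where f="\<lambda>k. \<Sum>j<n. cmod (P $$ (k,j))"]) (use k in \<open>auto intro: sum_nonneg\<close>)
        finally show ?thesis unfolding R_def by simp
      qed
      then show ?thesis unfolding Lp using m by auto
    qed
  qed
  then show ?thesis by blast
qed

section \<open>Topology of a torus\<close>

text \<open>\<open>cvec_topology\<close> pulls back the product topology on all functions of the
  naturals and thus sees entries beyond the dimension. These are default values shared by all
  vectors of the same dimension, so they do not influence the topology.\<close>

lemma vec_index_outside:
  assumes "v \<in> carrier_vec g" "w \<in> carrier_vec g" "\<not> i < g"
  shows "v $ i = w $ i"
proof -
  have "v $ i = undef_vec (i - g)" if "v \<in> carrier_vec g" for v :: "'a vec"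
  proof -
    have "v = vec g (vec_index v)" using that by (intro eq_vecI) auto
    then have "v $ i = vec g (vec_index v) $ i" by simp
    also have "\<dots> = mk_vec g (vec_index v) i" by (simp add: vec_index.rep_eq vec.rep_eq)
    finally show ?thesis using assms(3) by (simp add: mk_vec_def)
  qed
  then show ?thesis using assms by metis
qed

lemma open_coordinate_box:
  "open {h :: nat \<Rightarrow> complex. \<forall>k<g. cmod (h k - c k) < d k}"
proof -
  have "open {h :: nat \<Rightarrow> complex. cmod (h k - c k) < d k}" for k
    by (intro open_Collect_less continuous_intros continuous_on_product_coordinates)
  then have "open (\<Inter>k\<in>{..<g}. {h :: nat \<Rightarrow> complex. cmod (h k - c k) < d k})"
    by (intro open_INT) auto
  moreover have "(\<Inter>k\<in>{..<g}. {h :: nat \<Rightarrow> complex. cmod (h k - c k) < d k}) = {h. \<forall>k<g. cmod (h k - c k) < d k}"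
    by auto
  ultimately show ?thesis by simp
qed

lemma openin_cvec_topology:
  "openin (cvec_topology g) U \<longleftrightarrow> U \<subseteq> carrier_vec g \<and>
     (\<forall>v\<in>U. \<exists>del>0. \<forall>w\<in>carrier_vec g. (\<forall>k<g. cmod (w $ k - v $ k) < del) \<longrightarrow> w \<in> U)"
  (is "?l \<longleftrightarrow> ?r")
proof
  assume ?l
  then obtain V where V: "open V" "U = vec_index -` V \<inter> carrier_vec g"
    unfolding cvec_topology_def openin_pullback_topology by auto
  have "\<exists>del>0. \<forall>w\<in>carrier_vec g. (\<forall>k<g. cmod (w $ k - v $ k) < del) \<longrightarrow> w \<in> U" if v: "v \<in> U" for v
  proof -
    have vV: "vec_index v \<in> V" and vc: "v \<in> carrier_vec g" using v V(2) by auto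
    have op: "openin (product_topology (\<lambda>i. euclidean) UNIV) V"
      using V(1) by (simp add: euclidean_product_topology)
    obtain XX where XX: "vec_index v \<in> PiE UNIV XX" "\<And>i. open (XX i)" "PiE UNIV XX \<subseteq> V"
      using product_topology_open_contains_basis[OF op vV] by auto
    have "\<exists>e>0. ball (v $ k) e \<subseteq> XX k" for k
      using XX(1,2) by (auto simp: open_contains_ball PiE_iff)
    then obtain e where e: "\<And>k. e k > 0" "\<And>k. ball (v $ k) (e k) \<subseteq> XX k" by metis
    define del where "del = Min (insert 1 (e ` {..<g}))"
    have del: "del > 0" "\<And>k. k < g \<Longrightarrow> del \<le> e k" unfolding del_def using e(1) by auto
    have "w \<in> U" if w: "w \<in> carrier_vec g" "\<forall>k<g. cmod (w $ k - v $ k) < del" for w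
    proof -
      have "w $ i \<in> XX i" for i
      proof (cases "i < g")
        case True
        then have "dist (v $ i) (w $ i) < e i" using w(2) del(2)[OF True] by (auto simp: dist_norm norm_minus_commute intro: less_le_trans)
        then show ?thesis using e(2)[of i] by auto
      next
        case False
        have "v $ i \<in> XX i" using XX(1) by (auto simp: PiE_iff)
          then show ?thesis using vec_index_outside[OF vc w(1) False] by simp
      qed
      then have "vec_index w \<in> V" using XX(3) by auto
      then show ?thesis using V(2) w(1) by simp
    qed
    then show ?thesis using del(1) by blast
  qed
  then show ?r using V(2) by auto
next
  assume r: ?r
  then have "\<forall>v. \<exists>del. v \<in> U \<longrightarrow> del > 0 \<and> (\<forall>w\<in>carrier_vec g. (\<forall>k<g. cmod (w $ k - v $ k) < del) \<longrightarrow> w \<in> U)" by blast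
  then obtain d where d: "\<And>v. v \<in> U \<Longrightarrow> d v > 0"
    "\<And>v w. v \<in> U \<Longrightarrow> w \<in> carrier_vec g \<Longrightarrow> \<forall>k<g. cmod (w $ k - v $ k) < d v \<Longrightarrow> w \<in> U"
    by metis
  define V where "V = (\<Union>v\<in>U. {h :: nat \<Rightarrow> complex. \<forall>k<g. cmod (h k - v $ k) < d v})"
  have "open V" unfolding V_def by (intro open_UN ballI open_coordinate_box)
  moreover have "U = vec_index -` V \<inter> carrier_vec g"
  proof (intro equalityI subsetI)
    fix u assume "u \<in> U"
    moreover have "\<forall>k<g. cmod (u $ k - u $ k) < d u" using d(1)[OF \<open>u \<in> U\<close>] by simp
    ultimately show "u \<in> vec_index -` V \<inter> carrier_vec g" unfolding V_def using r by blast
  next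
    fix u assume "u \<in> vec_index -` V \<inter> carrier_vec g"
    then show "u \<in> U" unfolding V_def using d(2) by blast
  qed
  ultimately show ?l unfolding cvec_topology_def openin_pullback_topology by auto
qed

text \<open>The constructor \<open>topology\<close> is meaningful only once its argument is known to
  be a topology, which is the content of the proof.\<close>

lemma openin_torus_topology:
  "openin (torus_topology g L) U \<longleftrightarrow> U \<subseteq> torus_point L ` carrier_vec g \<and>
     openin (cvec_topology g) {v \<in> carrier_vec g. torus_point L v \<in> U}"
proof -
  have "istopology (\<lambda>U. U \<subseteq> torus_point L ` carrier_vec g \<and>
          openin (cvec_topology g) {v \<in> carrier_vec g. torus_point L v \<in> U})"
    unfolding istopology_def
  proof (intro conjI allI impI)
    fix S T
    assume *: "S \<subseteq> torus_point L ` carrier_vec g \<and> openin (cvec_topology g) {v \<in> carrier_vec g. torus_point L v \<in> S}"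
      "T \<subseteq> torus_point L ` carrier_vec g \<and> openin (cvec_topology g) {v \<in> carrier_vec g. torus_point L v \<in> T}"
    then show "S \<inter> T \<subseteq> torus_point L ` carrier_vec g" by blast
    have "{v \<in> carrier_vec g. torus_point L v \<in> S \<inter> T} =
       {v \<in> carrier_vec g. torus_point L v \<in> S} \<inter> {v \<in> carrier_vec g. torus_point L v \<in> T}" by auto
    then show "openin (cvec_topology g) {v \<in> carrier_vec g. torus_point L v \<in> S \<inter> T}"
      using * by (simp add: openin_Int)
  next
    fix K assume *: "\<forall>S\<in>K. S \<subseteq> torus_point L ` carrier_vec g \<and> openin (cvec_topology g) {v \<in> carrier_vec g. torus_point L v \<in> S}"
    then show "\<Union>K \<subseteq> torus_point L ` carrier_vec g" by blast
    have "{v \<in> carrier_vec g. torus_point L v \<in> \<Union>K} = (\<Union>S\<in>K. {v \<in> carrier_vec g. torus_point L v \<in> S})" by auto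
    then show "openin (cvec_topology g) {v \<in> carrier_vec g. torus_point L v \<in> \<Union>K}"
      using * by auto
  qed
  then show ?thesis unfolding torus_topology_def by simp
qed

lemma topspace_torus_topology: "topspace (torus_topology g L) = torus_point L ` carrier_vec g"
proof
  show "topspace (torus_topology g L) \<subseteq> torus_point L ` carrier_vec g"
    unfolding topspace_def openin_torus_topology by blast
  have "{v \<in> carrier_vec g. torus_point L v \<in> torus_point L ` carrier_vec g} = carrier_vec g" by auto
  moreover have "openin (cvec_topology g) (carrier_vec g)"
    unfolding openin_cvec_topology by (auto intro: exI[of _ 1])
  ultimately have "openin (torus_topology g L) (torus_point L ` carrier_vec g)"
    unfolding openin_torus_topology by simp
  then show "torus_point L ` carrier_vec g \<subseteq> topspace (torus_topology g L)"
    by (rule openin_subset)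
qed

context cocompact_lattice
begin

lemma uminus_mem: "l \<in> L \<Longrightarrow> - l \<in> L" (is "_ \<Longrightarrow> ?thesis")
proof -
  assume l: "l \<in> L"
  have "- l = 0\<^sub>v g - l" using l L_carrier by (intro eq_vecI) auto
  then show ?thesis using diff_mem[OF zero_mem l] by simp
qed

lemma add_mem: "l \<in> L \<Longrightarrow> m \<in> L \<Longrightarrow> l + m \<in> L"
proof -
  assume *: "l \<in> L" "m \<in> L"
  then have c: "l \<in> carrier_vec g" "m \<in> carrier_vec g" using L_carrier by auto
  have "l + m = l - (- m)" using c by (intro eq_vecI) auto
  then show ?thesis using diff_mem[OF *(1) uminus_mem[OF *(2)]] by simp
qed

lemma torus_point_self: "v \<in> carrier_vec g \<Longrightarrow> v \<in> torus_point L v"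
  unfolding torus_point_def using zero_mem by (intro image_eqI[of _ _ "0\<^sub>v g"]) auto

lemma torus_point_eq_iff:
  assumes v: "v \<in> carrier_vec g" and w: "w \<in> carrier_vec g"
  shows "torus_point L v = torus_point L w \<longleftrightarrow> v - w \<in> L"
proof
  assume "torus_point L v = torus_point L w"
  then have "v \<in> torus_point L w" using torus_point_self[OF v] by simp
  then obtain l where l: "l \<in> L" "v = w + l" unfolding torus_point_def by auto
  then have "v - w = l" using w L_carrier by (intro eq_vecI) auto
  then show "v - w \<in> L" using l by simp
next
  assume d: "v - w \<in> L"
  have "torus_point L a \<subseteq> torus_point L b" if a: "a \<in> carrier_vec g" and b: "b \<in> carrier_vec g" and ab: "a - b \<in> L" for a b
  proof
    fix x assume "x \<in> torus_point L a"
    then obtain l where l: "l \<in> L" "x = a + l" unfolding torus_point_def by auto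
    have "x = b + ((a - b) + l)" using l a b L_carrier by (intro eq_vecI) auto
    then show "x \<in> torus_point L b" unfolding torus_point_def using add_mem[OF ab l(1)] by blast
  qed
  moreover have "w - v \<in> L"
  proof -
    have "w - v = - (v - w)" using v w by (intro eq_vecI) auto
    then show ?thesis using uminus_mem[OF d] by simp
  qed
  ultimately show "torus_point L v = torus_point L w" using d v w by blast
qed

lemma torus_point_representative:
  assumes "v \<in> carrier_vec g"
  obtains w where "w \<in> carrier_vec g" "torus_point L w = torus_point L v" "\<And>k. k < g \<Longrightarrow> cmod (w $ k) \<le> R"
proof -
  obtain l where l: "l \<in> L" "\<forall>k<g. cmod (v $ k - l $ k) \<le> R" using cobounded[OF assms] by auto
  have lc: "l \<in> carrier_vec g" using l L_carrier by auto
  have "v - l - v = - l" using assms lc by (intro eq_vecI) auto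
  then have "torus_point L (v - l) = torus_point L v"
    using assms lc uminus_mem[OF l(1)] by (subst torus_point_eq_iff) auto
  then show ?thesis using that[of "v - l"] assms lc l(2) by auto
qed

text \<open>Finitely many neighbourhoods of half size cover the compact polydisc of radius
  \<open>R\<close>, and a lattice translation moves every vector into it. Working with vectors
  instead of torus points avoids a metric on the quotient.\<close>

lemma Lebesgue_number:
  assumes "open_cover (torus_topology g L) \<U>"
  obtains del where "del > 0" "\<And>v. v \<in> carrier_vec g \<Longrightarrow>
    \<exists>U\<in>\<U>. \<forall>w\<in>carrier_vec g. (\<forall>k<g. cmod (w $ k - v $ k) < del) \<longrightarrow> torus_point L w \<in> U"
proof -
  have "\<exists>U e. v \<in> carrier_vec g \<longrightarrow> U \<in> \<U> \<and> e > 0 \<and>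
     (\<forall>w\<in>carrier_vec g. (\<forall>k<g. cmod (w $ k - v $ k) < 2 * e) \<longrightarrow> torus_point L w \<in> U)" for v
  proof (cases "v \<in> carrier_vec g")
    case True
    have "torus_point L v \<in> \<Union>\<U>" and op: "\<forall>U\<in>\<U>. openin (torus_topology g L) U"
      using assms True unfolding open_cover_def topspace_torus_topology by simp_all
    then obtain U where U: "U \<in> \<U>" "torus_point L v \<in> U" by (elim UnionE)
    have "openin (cvec_topology g) {v \<in> carrier_vec g. torus_point L v \<in> U}"
      using op U(1) openin_torus_topology by simp
    then have "\<forall>v\<in>{v \<in> carrier_vec g. torus_point L v \<in> U}. \<exists>del>0. \<forall>w\<in>carrier_vec g.
        (\<forall>k<g. cmod (w $ k - v $ k) < del) \<longrightarrow> w \<in> {v \<in> carrier_vec g. torus_point L v \<in> U}"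
      unfolding openin_cvec_topology by (rule conjunct2)
    from bspec[OF this, of v] True U(2)
    obtain d where "d > 0" "\<forall>w\<in>carrier_vec g. (\<forall>k<g. cmod (w $ k - v $ k) < d) \<longrightarrow> torus_point L w \<in> U"
      by auto
    then show ?thesis using U(1) by (intro exI[of _ U] exI[of _ "d/2"]) auto
  qed auto
  then obtain U e where Ue: "\<And>v. v \<in> carrier_vec g \<Longrightarrow> U v \<in> \<U>" "\<And>v. v \<in> carrier_vec g \<Longrightarrow> e v > 0"
     "\<And>v w. v \<in> carrier_vec g \<Longrightarrow> w \<in> carrier_vec g \<Longrightarrow> (\<forall>k<g. cmod (w $ k - v $ k) < 2 * e v) \<Longrightarrow> torus_point L w \<in> U v"
    by metis
  \<comment> \<open>The entries beyond the dimension are pinned to their common default value; a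
    product with unbounded factors would not be compact.\<close>
  define K where "K = PiE UNIV (\<lambda>k. if k < g then cball 0 R else {0\<^sub>v g $ k :: complex})"
  have "compactin (product_topology (\<lambda>i. euclidean) UNIV) K"
    unfolding K_def compactin_PiE by auto
  then have "compact K" by (simp add: euclidean_product_topology)
  moreover have "open {h :: nat \<Rightarrow> complex. \<forall>k<g. cmod (h k - v $ k) < e v}" for v
    by (rule open_coordinate_box)
  moreover have "K \<subseteq> (\<Union>v\<in>carrier_vec g. {h :: nat \<Rightarrow> complex. \<forall>k<g. cmod (h k - v $ k) < e v})"
  proof
    fix h assume "h \<in> K"
    have "h \<in> {h. \<forall>k<g. cmod (h k - vec g h $ k) < e (vec g h)}" using Ue(2)[of "vec g h"] by simp
    then show "h \<in> (\<Union>v\<in>carrier_vec g. {h :: nat \<Rightarrow> complex. \<forall>k<g. cmod (h k - v $ k) < e v})"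
      by (intro UN_I[of "vec g h"]) auto
  qed
  ultimately obtain C where C: "C \<subseteq> carrier_vec g" "finite C" "K \<subseteq> (\<Union>v\<in>C. {h :: nat \<Rightarrow> complex. \<forall>k<g. cmod (h k - v $ k) < e v})"
    by (rule compactE_image)
  define del where "del = Min (insert 1 (e ` C))"
  have del: "del > 0" "\<And>c. c \<in> C \<Longrightarrow> del \<le> e c" unfolding del_def using C Ue(2) by auto
  show ?thesis
  proof (rule that[OF del(1)])
    fix v :: "complex vec" assume v: "v \<in> carrier_vec g"
    obtain l where l: "l \<in> L" "\<forall>k<g. cmod (v $ k - l $ k) \<le> R" using cobounded[OF v] by auto
    have lc: "l \<in> carrier_vec g" using l L_carrier by auto
    have "vec_index (v - l) \<in> K" unfolding K_def
    proof (intro PiE_I)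
      fix k show "(v - l) $ k \<in> (if k < g then cball 0 R else {0\<^sub>v g $ k})"
      proof (cases "k < g")
        case True then show ?thesis using l v lc by simp
      next
        case False
        then show ?thesis using vec_index_outside[of "v - l" g "0\<^sub>v g" k] v lc by simp
      qed
    qed auto
    then obtain c where c: "c \<in> C" "\<forall>k<g. cmod ((v - l) $ k - c $ k) < e c" using C(3) by auto
    have cc: "c \<in> carrier_vec g" using c C by auto
    have "torus_point L w \<in> U c" if w: "w \<in> carrier_vec g" "\<forall>k<g. cmod (w $ k - v $ k) < del" for w
    proof -
      have "cmod ((w - l) $ k - c $ k) < 2 * e c" if k: "k < g" for k
      proof -
        have "(w - l) $ k - c $ k = (w $ k - v $ k) + ((v - l) $ k - c $ k)" using k w v lc by simp
        then have "cmod ((w - l) $ k - c $ k) \<le> cmod (w $ k - v $ k) + cmod ((v - l) $ k - c $ k)"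
          using norm_triangle_ineq[of "w $ k - v $ k" "(v - l) $ k - c $ k"] by (simp only:)
        then show ?thesis using w(2) c k del(2)[OF c(1)] by (smt (verit))
      qed
      then have "torus_point L (w - l) \<in> U c" using Ue(3)[OF cc] w lc by auto
      moreover have "torus_point L (w - l) = torus_point L w"
      proof -
        have "w - l - w = - l" using w lc by (intro eq_vecI) auto
        then show ?thesis using w lc uminus_mem[OF l(1)] by (subst torus_point_eq_iff) auto
      qed
      ultimately show ?thesis by simp
    qed
    then show "\<exists>U\<in>\<U>. \<forall>w\<in>carrier_vec g. (\<forall>k<g. cmod (w $ k - v $ k) < del) \<longrightarrow> torus_point L w \<in> U"
      using Ue(1)[OF cc] by blast
  qed
qed

end

lemma mat_vec_index_sum:
  assumes "B \<in> carrier_mat m n" "w \<in> carrier_vec n" "k < m"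
  shows "(B *\<^sub>v w) $ k = (\<Sum>j<n. B $$ (k,j) * w $ j)"
  using assms by (auto simp: scalar_prod_def atLeast0LessThan intro!: sum.cong)

section \<open>Entropy of toral endomorphisms\<close>

locale torus_endomorphism = cocompact_lattice +
  fixes A :: "complex mat"
  assumes A: "A \<in> carrier_mat g g" and AL: "v \<in> L \<Longrightarrow> A *\<^sub>v v \<in> L"
begin

lemma A_pow: "A ^\<^sub>m i \<in> carrier_mat g g"
  using A by simp

lemma A_pow_vec [simp]: "v \<in> carrier_vec g \<Longrightarrow> A ^\<^sub>m i *\<^sub>v v \<in> carrier_vec g"
  using A_pow[of i] by simp

lemma A_vec [simp]: "v \<in> carrier_vec g \<Longrightarrow> A *\<^sub>v v \<in> carrier_vec g"
  using A by simp

lemma torus_map_point: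
  assumes v: "v \<in> carrier_vec g"
  shows "torus_map L A (torus_point L v) = torus_point L (A *\<^sub>v v)"
proof -
  have "torus_point L (A *\<^sub>v u) = torus_point L (A *\<^sub>v v)" if "u \<in> torus_point L v" for u
  proof -
    obtain l where l: "l \<in> L" "u = v + l" using \<open>u \<in> torus_point L v\<close> unfolding torus_point_def by (elim imageE)
    have lc: "l \<in> carrier_vec g" using l L_carrier by auto
    have "A *\<^sub>v u = A *\<^sub>v v + A *\<^sub>v l" using l v lc A by (simp add: mult_add_distrib_mat_vec)
    then have "A *\<^sub>v u - A *\<^sub>v v = A *\<^sub>v l" using A v lc by (intro eq_vecI) auto
    then show ?thesis using AL[OF l(1)] A v lc l(2) by (subst torus_point_eq_iff) auto
  qed
  then have "(\<Union>u\<in>torus_point L v. torus_point L (A *\<^sub>v u)) = (\<Union>u\<in>torus_point L v. torus_point L (A *\<^sub>v v))"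
    by (rule SUP_cong[OF refl])
  also have "\<dots> = torus_point L (A *\<^sub>v v)" using torus_point_self[OF v] by (intro UN_constant_eq) auto
  finally show ?thesis unfolding torus_map_def .
qed

lemma torus_map_funpow:
  "v \<in> carrier_vec g \<Longrightarrow> (torus_map L A ^^ i) (torus_point L v) = torus_point L (A ^\<^sub>m i *\<^sub>v v)"
proof (induction i arbitrary: v)
  case 0 then show ?case using A by simp
next
  case (Suc i)
  have "(torus_map L A ^^ Suc i) (torus_point L v) = (torus_map L A ^^ i) (torus_point L (A *\<^sub>v v))"
    by (simp only: funpow_Suc_right o_apply torus_map_point[OF Suc.prems])
  also have "\<dots> = torus_point L (A ^\<^sub>m i *\<^sub>v (A *\<^sub>v v))"
    by (rule Suc.IH) (use A Suc.prems in auto)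
  also have "A ^\<^sub>m i *\<^sub>v (A *\<^sub>v v) = A ^\<^sub>m Suc i *\<^sub>v v"
    using assoc_mult_mat_vec[OF A_pow A Suc.prems] by simp
  finally show ?case .
qed

section \<open>Upper bounds: counting grid cells\<close>

abbreviation T :: "complex vec set topology" where "T \<equiv> torus_topology g L"
abbreviation f :: "complex vec set \<Rightarrow> complex vec set" where "f \<equiv> torus_map L A"

text \<open>A grid with mesh proportional to \<open>\<rho> k\<close> in coordinate \<open>k\<close>
  is so fine that a point and its grid neighbour stay \<open>del\<close>-close for \<open>n\<close>
  iterates; the orbit of the grid point then selects a member of the iterated cover that contains
  the point. The square counts a complex coordinate as two real ones.\<close>

lemma grid_cover:
  assumes U: "open_cover T \<U>" and del: "del > 0"
    and Leb: "\<And>v. v \<in> carrier_vec g \<Longrightarrow>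
      \<exists>U\<in>\<U>. \<forall>w\<in>carrier_vec g. (\<forall>k<g. cmod (w $ k - v $ k) < del) \<longrightarrow> torus_point L w \<in> U"
    and \<rho>: "\<And>k. k < g \<Longrightarrow> 0 < \<rho> k" "\<And>k. k < g \<Longrightarrow> \<rho> k \<le> 1"
    and contr: "\<And>w i k. w \<in> carrier_vec g \<Longrightarrow> (\<And>k. k < g \<Longrightarrow> cmod (w $ k) \<le> \<rho> k) \<Longrightarrow> i < n \<Longrightarrow> k < g \<Longrightarrow>
      cmod ((A ^\<^sub>m i *\<^sub>v w) $ k) \<le> 1"
  shows "\<exists>\<V> \<subseteq> iterated_cover T f \<U> n. finite \<V> \<and> \<Union>\<V> = topspace T \<and>
      real (card \<V>) \<le> (\<Prod>k<g. ((8 * R / del + 5) / \<rho> k)\<^sup>2)"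
proof -
  \<comment> \<open>Rounding both real parts costs at most \<open>2 * s k\<close>, which is half of
    \<open>del * \<rho> k\<close>; the other half makes the final inequality strict.\<close>
  define s where "s k = del * \<rho> k / 4" for k
  have s: "s k > 0" if "k < g" for k using del \<rho>(1)[OF that] by (simp add: s_def)
  define M where "M k = \<lceil>R / s k\<rceil> + 1" for k
  define G where "G = PiE {..<g} (\<lambda>k. {- M k..M k} \<times> {- M k..M k})"
  define center where "center \<gamma> = vec g (\<lambda>k. Complex (s k * of_int (fst (\<gamma> k))) (s k * of_int (snd (\<gamma> k))))" for \<gamma> :: "nat \<Rightarrow> int \<times> int"
  have cc: "center \<gamma> \<in> carrier_vec g" for \<gamma> by (simp add: center_def)
  have "\<forall>v. \<exists>U. v \<in> carrier_vec g \<longrightarrow> U \<in> \<U> \<and> (\<forall>w\<in>carrier_vec g. (\<forall>k<g. cmod (w $ k - v $ k) < del) \<longrightarrow> torus_point L w \<in> U)"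
    using Leb by (meson)
  then obtain UU where UU: "\<forall>v. v \<in> carrier_vec g \<longrightarrow> UU v \<in> \<U> \<and> (\<forall>w\<in>carrier_vec g. (\<forall>k<g. cmod (w $ k - v $ k) < del) \<longrightarrow> torus_point L w \<in> UU v)"
    by (rule choice[THEN exE])
  define cell where "cell \<gamma> = topspace T \<inter> (\<Inter>i\<in>{..<n}. (f ^^ i) -` UU (A ^\<^sub>m i *\<^sub>v center \<gamma>))" for \<gamma>
  have cell_mem: "cell \<gamma> \<in> iterated_cover T f \<U> n" for \<gamma>
    unfolding iterated_cover_def cell_def using UU cc
    by (intro CollectI exI[of _ "\<lambda>i. UU (A ^\<^sub>m i *\<^sub>v center \<gamma>)"]) simp
  have finG: "finite G" unfolding G_def by (intro finite_PiE) auto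
  have cover: "\<exists>\<gamma>\<in>G. p \<in> cell \<gamma>" if p: "p \<in> topspace T" for p
  proof -
    obtain v0 where v0: "v0 \<in> carrier_vec g" "p = torus_point L v0" using p unfolding topspace_torus_topology by auto
    obtain v where v: "v \<in> carrier_vec g" "p = torus_point L v" "\<And>k. k < g \<Longrightarrow> cmod (v $ k) \<le> R"
      using torus_point_representative[OF v0(1)] v0(2) by metis
    define \<gamma> where "\<gamma> = restrict (\<lambda>k. (\<lfloor>Re (v $ k) / s k\<rfloor>, \<lfloor>Im (v $ k) / s k\<rfloor>)) {..<g}"
    have fl: "\<lfloor>x / s k\<rfloor> \<in> {- M k..M k}" if "k < g" "\<bar>x\<bar> \<le> R" for k x
    proof -
      have "\<bar>x / s k\<bar> \<le> R / s k" using that s[OF that(1)] by (simp add: divide_right_mono)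
      then have "x / s k \<le> R / s k" "- (R / s k) \<le> x / s k" by linarith+
      then show ?thesis unfolding M_def by simp linarith
    qed
    have "\<bar>Re (v $ k)\<bar> \<le> R" "\<bar>Im (v $ k)\<bar> \<le> R" if "k < g" for k
      using v(3)[OF that] abs_Re_le_cmod[of "v $ k"] abs_Im_le_cmod[of "v $ k"] by linarith+
    then have G: "\<gamma> \<in> G" unfolding G_def \<gamma>_def
      using fl by (intro restrict_PiE_iff[THEN iffD2] ballI SigmaI) auto
    have near: "cmod (v $ k - center \<gamma> $ k) \<le> del / 2 * \<rho> k" if k: "k < g" for k
    proof -
      have fr: "\<bar>x - s k * of_int \<lfloor>x / s k\<rfloor>\<bar> \<le> s k" for x
      proof -
        have "x - s k * of_int \<lfloor>x / s k\<rfloor> = s k * (x / s k - of_int \<lfloor>x / s k\<rfloor>)"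
          using s[OF k] by (simp add: field_simps)
        moreover have "\<bar>x / s k - of_int \<lfloor>x / s k\<rfloor>\<bar> \<le> 1" by linarith
        ultimately show ?thesis using s[OF k] by (simp add: abs_mult mult_left_le)
      qed
      have "cmod (v $ k - center \<gamma> $ k) \<le> \<bar>Re (v $ k - center \<gamma> $ k)\<bar> + \<bar>Im (v $ k - center \<gamma> $ k)\<bar>"
        by (rule cmod_le)
      also have "\<dots> \<le> s k + s k"
        using fr[of "Re (v $ k)"] fr[of "Im (v $ k)"] k by (simp add: center_def \<gamma>_def)
      finally show ?thesis by (simp add: s_def)
    qed
    have "torus_point L (A ^\<^sub>m i *\<^sub>v v) \<in> UU (A ^\<^sub>m i *\<^sub>v center \<gamma>)" if i: "i < n" for i
    proof -
      \<comment> \<open>\<open>contr\<close> speaks of the box with radii \<open>\<rho> k\<close>,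
        so the displacement is scaled by \<open>2 / del\<close> and the resulting bound 1 is scaled
        back to \<open>del / 2\<close>.\<close>
      define u where "u = complex_of_real (2 / del) \<cdot>\<^sub>v (v - center \<gamma>)"
      have u: "u \<in> carrier_vec g" using v(1) cc by (simp add: u_def)
      have "cmod (u $ k) \<le> \<rho> k" if "k < g" for k
      proof -
        have "u $ k = complex_of_real (2 / del) * (v $ k - center \<gamma> $ k)"
          using that v(1) cc[of \<gamma>] by (simp add: u_def del: of_real_divide)
        then have "cmod (u $ k) = 2 / del * cmod (v $ k - center \<gamma> $ k)"
          using del by (simp only: norm_mult norm_of_real) simp
        moreover have "2 / del * cmod (v $ k - center \<gamma> $ k) \<le> 2 / del * (del / 2 * \<rho> k)"
          by (rule mult_left_mono[OF near[OF that]]) (use del in simp)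
        ultimately show ?thesis using del by simp
      qed
      then have c1: "cmod ((A ^\<^sub>m i *\<^sub>v u) $ k) \<le> 1" if "k < g" for k
        by (rule contr[OF u _ i that])
      have "cmod ((A ^\<^sub>m i *\<^sub>v v) $ k - (A ^\<^sub>m i *\<^sub>v center \<gamma>) $ k) < del" if k: "k < g" for k
      proof -
        have "A ^\<^sub>m i *\<^sub>v u = complex_of_real (2 / del) \<cdot>\<^sub>v (A ^\<^sub>m i *\<^sub>v v - A ^\<^sub>m i *\<^sub>v center \<gamma>)"
          unfolding u_def using v(1) cc A_pow by (simp add: mult_mat_vec[OF A_pow] mult_minus_distrib_mat_vec[OF A_pow])
        then have "(A ^\<^sub>m i *\<^sub>v u) $ k = complex_of_real (2 / del) * ((A ^\<^sub>m i *\<^sub>v v) $ k - (A ^\<^sub>m i *\<^sub>v center \<gamma>) $ k)"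
          using k carrier_vecD[OF A_pow_vec[OF v(1)]] carrier_vecD[OF A_pow_vec[OF cc[of \<gamma>]]]
          by (simp only: index_smult_vec index_minus_vec index_minus_vec(2))
        then have "cmod ((A ^\<^sub>m i *\<^sub>v u) $ k) = 2 / del * cmod ((A ^\<^sub>m i *\<^sub>v v) $ k - (A ^\<^sub>m i *\<^sub>v center \<gamma>) $ k)"
          using del by (simp only: norm_mult norm_of_real) simp
        then have "2 / del * cmod ((A ^\<^sub>m i *\<^sub>v v) $ k - (A ^\<^sub>m i *\<^sub>v center \<gamma>) $ k) \<le> 1"
          using c1[OF k] by simp
        then show ?thesis using del by (simp add: field_simps)
      qed
      then show ?thesis using UU cc[of \<gamma>] A_pow[of i] v(1) by simp
    qed
    then have "p \<in> cell \<gamma>" unfolding cell_def using p by (simp add: v(2) torus_map_funpow[OF v(1)])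
    then show ?thesis using G by blast
  qed
  have "card (cell ` G) \<le> card G" using finG by (rule card_image_le)
  also have "card G = (\<Prod>k<g. card ({- M k..M k} \<times> {- M k..M k}))" unfolding G_def by (rule card_PiE) simp
  finally have "real (card (cell ` G)) \<le> (\<Prod>k<g. real (card ({- M k..M k} \<times> {- M k..M k})))"
    by (simp only: of_nat_prod[symmetric] of_nat_le_iff)
  also have "\<dots> \<le> (\<Prod>k<g. ((8 * R / del + 5) / \<rho> k)\<^sup>2)"
  proof (rule prod_mono, intro conjI)
    fix k assume "k \<in> {..<g}"
    then have k: "k < g" by simp
    have M0: "M k \<ge> 0" using s[OF k] R_pos unfolding M_def by (intro add_nonneg_nonneg) (simp_all add: zero_le_ceiling less_le_trans[of _ 0])
    have "real_of_int (2 * M k + 1) \<le> 2 * (R / s k) + 5" unfolding M_def by simp linarith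
    also have "2 * (R / s k) = 8 * R / del / \<rho> k" using del \<rho>(1)[OF k] by (simp add: s_def field_simps)
    also have "8 * R / del / \<rho> k + 5 \<le> (8 * R / del + 5) / \<rho> k"
      using \<rho>(1)[OF k] \<rho>(2)[OF k] by (simp add: field_simps)
    finally have "real_of_int (2 * M k + 1) \<le> (8 * R / del + 5) / \<rho> k" .
    moreover have "real (card ({- M k..M k} \<times> {- M k..M k})) = (real_of_int (2 * M k + 1))\<^sup>2"
      using M0 by (simp add: card_cartesian_product power2_eq_square)
    ultimately show "real (card ({- M k..M k} \<times> {- M k..M k})) \<le> ((8 * R / del + 5) / \<rho> k)\<^sup>2"
      using M0 by (simp add: power_mono)
  qed simp
  finally have "real (card (cell ` G)) \<le> (\<Prod>k<g. ((8 * R / del + 5) / \<rho> k)\<^sup>2)" .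
  moreover have "\<Union>(cell ` G) = topspace T" using cover unfolding cell_def by blast
  ultimately show ?thesis using cell_mem finG by (intro exI[of _ "cell ` G"]) auto
qed

text \<open>A crude \<open>\<rho>\<close> obtained from the entries of the first \<open>n\<close>
  powers suffices for mere finiteness. It guarantees that the \<open>LEAST\<close> in
  \<open>min_subcover_card\<close> is attained.\<close>

lemma finite_subcover:
  assumes U: "open_cover T \<U>"
  shows "\<exists>\<V> \<subseteq> iterated_cover T f \<U> n. finite \<V> \<and> \<Union>\<V> = topspace T"
proof -
  obtain del where del: "del > 0" "\<And>v. v \<in> carrier_vec g \<Longrightarrow>
      \<exists>U\<in>\<U>. \<forall>w\<in>carrier_vec g. (\<forall>k<g. cmod (w $ k - v $ k) < del) \<longrightarrow> torus_point L w \<in> U"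
    by (rule Lebesgue_number[OF U]) blast
  define a where "a i k = (\<Sum>j<g. cmod ((A ^\<^sub>m i) $$ (k,j)))" for i k
  have a0: "a i k \<ge> 0" for i k unfolding a_def by (simp add: sum_nonneg)
  define c where "c = 1 + (\<Sum>i<n. \<Sum>k<g. a i k)"
  have c1: "c \<ge> 1" unfolding c_def by (simp add: sum_nonneg a0)
  have "\<exists>\<V> \<subseteq> iterated_cover T f \<U> n. finite \<V> \<and> \<Union>\<V> = topspace T \<and>
      real (card \<V>) \<le> (\<Prod>k<g. ((8 * R / del + 5) / (1 / c))\<^sup>2)"
  proof (rule grid_cover[OF U del])
    show "cmod ((A ^\<^sub>m i *\<^sub>v w) $ k) \<le> 1"
      if w: "w \<in> carrier_vec g" "\<And>k. k < g \<Longrightarrow> cmod (w $ k) \<le> 1 / c" and ik: "i < n" "k < g" for w i k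
    proof -
      have "(A ^\<^sub>m i *\<^sub>v w) $ k = (\<Sum>j<g. (A ^\<^sub>m i) $$ (k,j) * w $ j)"
        by (rule mat_vec_index_sum[OF A_pow w(1) ik(2)])
      then have "cmod ((A ^\<^sub>m i *\<^sub>v w) $ k) \<le> (\<Sum>j<g. cmod ((A ^\<^sub>m i) $$ (k,j) * w $ j))"
        by (simp add: norm_sum)
      also have "\<dots> \<le> (\<Sum>j<g. cmod ((A ^\<^sub>m i) $$ (k,j)) * (1 / c))"
        unfolding norm_mult by (intro sum_mono mult_left_mono w(2)) auto
      also have "\<dots> = a i k / c" by (simp add: a_def sum_divide_distrib)
      also have "a i k \<le> (\<Sum>k<g. a i k)" by (rule member_le_sum) (use ik a0 in auto)
      also have "(\<Sum>k<g. a i k) \<le> (\<Sum>i<n. \<Sum>k<g. a i k)"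
        by (rule member_le_sum[where f="\<lambda>i. \<Sum>k<g. a i k"]) (use ik a0 in \<open>auto intro: sum_nonneg\<close>)
      also have "\<dots> \<le> c" unfolding c_def by simp
      finally show ?thesis using c1 by (simp add: divide_right_mono)
    qed
  qed (use c1 in auto)
  then show ?thesis by blast
qed

lemma min_subcover_attained:
  assumes "open_cover T \<U>"
  obtains \<V> where "\<V> \<subseteq> iterated_cover T f \<U> n" "finite \<V>" "\<Union>\<V> = topspace T"
    "card \<V> = min_subcover_card T (iterated_cover T f \<U> n)"
proof -
  let ?P = "\<lambda>m. \<exists>\<V>. \<V> \<subseteq> iterated_cover T f \<U> n \<and> finite \<V> \<and> card \<V> = m \<and> \<Union>\<V> = topspace T"
  obtain \<W> where "\<W> \<subseteq> iterated_cover T f \<U> n" "finite \<W>" "\<Union>\<W> = topspace T"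
    using finite_subcover[OF assms, of n] by (elim exE conjE)
  then have "?P (card \<W>)" by blast
  then have "?P (LEAST m. ?P m)" by (rule LeastI)
  then obtain \<V> where "\<V> \<subseteq> iterated_cover T f \<U> n" "finite \<V>" "card \<V> = (LEAST m. ?P m)" "\<Union>\<V> = topspace T"
    by (elim exE conjE)
  then show ?thesis by (intro that[of \<V>]) (simp_all only: min_subcover_card_def)
qed

lemma topspace_nonempty: "topspace T \<noteq> {}"
  unfolding topspace_torus_topology using zero_carrier_vec by blast

lemma min_subcover_pos:
  assumes "open_cover T \<U>"
  shows "min_subcover_card T (iterated_cover T f \<U> n) \<ge> 1"
proof -
  obtain \<V> where V: "\<V> \<subseteq> iterated_cover T f \<U> n" "finite \<V>" "\<Union>\<V> = topspace T"
      "card \<V> = min_subcover_card T (iterated_cover T f \<U> n)"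
    by (rule min_subcover_attained[OF assms])
  have "\<V> \<noteq> {}"
  proof
    assume "\<V> = {}"
    then have "topspace T = {}" using V(3) by (simp only: Union_empty)
    then show False using topspace_nonempty by (rule notE[rotated])
  qed
  then have "card \<V> > 0" using V(2) by (simp add: card_gt_0_iff)
  then show ?thesis using V(4) by linarith
qed

lemma entropy_nonneg: "entropy g L A \<ge> 0"
proof -
  have "open_cover T {topspace T}" unfolding open_cover_def by simp
  moreover have "0 \<le> limsup (\<lambda>n. ereal (ln (real (min_subcover_card T (iterated_cover T f {topspace T} n))) / real n))"
  proof -
    have "limsup (\<lambda>n. 0) \<le> limsup (\<lambda>n. ereal (ln (real (min_subcover_card T (iterated_cover T f {topspace T} n))) / real n))"
      using min_subcover_pos[OF \<open>open_cover T {topspace T}\<close>]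
      by (intro Limsup_mono always_eventually) (simp add: ln_ge_zero)
    then show ?thesis by (simp add: Limsup_const)
  qed
  ultimately show ?thesis unfolding entropy_def topological_entropy_def
    by (intro SUP_upper2[of "{topspace T}"]) auto
qed

text \<open>The radii may shrink with the length \<open>n\<close> of the orbit. Only the exponential
  rate of the number of grid points survives the division by \<open>n\<close>; the factor depending
  on the cover is constant and disappears in the limit.\<close>

lemma entropy_le:
  fixes \<rho> :: "nat \<Rightarrow> nat \<Rightarrow> real"
  assumes \<rho>: "\<And>n k. k < g \<Longrightarrow> 0 < \<rho> n k" "\<And>n k. k < g \<Longrightarrow> \<rho> n k \<le> 1"
    and contr: "\<And>w i k n. w \<in> carrier_vec g \<Longrightarrow> (\<And>k. k < g \<Longrightarrow> cmod (w $ k) \<le> \<rho> n k) \<Longrightarrow> i < n \<Longrightarrow> k < g \<Longrightarrow>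
      cmod ((A ^\<^sub>m i *\<^sub>v w) $ k) \<le> 1"
    and lim: "(\<lambda>n. (\<Sum>k<g. - 2 * ln (\<rho> n k)) / real n) \<longlonglongrightarrow> h"
  shows "entropy g L A \<le> ereal h"
  unfolding entropy_def topological_entropy_def
proof (rule SUP_least)
  fix \<U> assume "\<U> \<in> {\<U>. open_cover T \<U>}"
  then have U: "open_cover T \<U>" by simp
  obtain del where del: "del > 0" "\<And>v. v \<in> carrier_vec g \<Longrightarrow>
      \<exists>U\<in>\<U>. \<forall>w\<in>carrier_vec g. (\<forall>k<g. cmod (w $ k - v $ k) < del) \<longrightarrow> torus_point L w \<in> U"
    by (rule Lebesgue_number[OF U]) blast
  define C where "C = 8 * R / del + 5"
  have C: "C > 0" unfolding C_def using R_pos del(1) by (simp add: add_pos_pos)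
  let ?N = "\<lambda>n. min_subcover_card T (iterated_cover T f \<U> n)"
  have bound: "ln (real (?N n)) \<le> real g * (2 * ln C) + (\<Sum>k<g. - 2 * ln (\<rho> n k))" for n
  proof -
    obtain \<V> where V: "\<V> \<subseteq> iterated_cover T f \<U> n" "finite \<V>" "\<Union>\<V> = topspace T"
      "real (card \<V>) \<le> (\<Prod>k<g. (C / \<rho> n k)\<^sup>2)"
    proof -
      have "\<exists>\<V> \<subseteq> iterated_cover T f \<U> n. finite \<V> \<and> \<Union>\<V> = topspace T \<and>
        real (card \<V>) \<le> (\<Prod>k<g. ((8 * R / del + 5) / \<rho> n k)\<^sup>2)"
      proof (rule grid_cover[OF U del])
        show "cmod ((A ^\<^sub>m i *\<^sub>v w) $ k) \<le> 1"
          if "w \<in> carrier_vec g" "\<And>k. k < g \<Longrightarrow> cmod (w $ k) \<le> \<rho> n k" "i < n" "k < g" for w i k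
          using that by (rule contr)
      qed (use \<rho> in auto)
      then show ?thesis using that unfolding C_def by (elim exE conjE)
    qed
    have "?N n \<le> card \<V>" unfolding min_subcover_card_def using V(1-3) by (intro Least_le) blast
    then have "real (?N n) \<le> (\<Prod>k<g. (C / \<rho> n k)\<^sup>2)" using V(4) by linarith
    then have "ln (real (?N n)) \<le> ln (\<Prod>k<g. (C / \<rho> n k)\<^sup>2)"
      using min_subcover_pos[OF U, of n] by (intro ln_mono) auto
    also have "\<dots> = (\<Sum>k<g. ln ((C / \<rho> n k)\<^sup>2))"
      using C \<rho>(1)[of _ n] by (intro ln_prod) (auto simp: less_imp_neq[THEN not_sym])
    also have "\<dots> = (\<Sum>k<g. 2 * ln C + - 2 * ln (\<rho> n k))"
    proof (rule sum.cong[OF refl])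
      fix k assume "k \<in> {..<g}"
      then have "0 < \<rho> n k" using \<rho>(1) by simp
      then show "ln ((C / \<rho> n k)\<^sup>2) = 2 * ln C + - 2 * ln (\<rho> n k)"
        using C by (simp add: ln_realpow ln_div)
    qed
    also have "\<dots> = real g * (2 * ln C) + (\<Sum>k<g. - 2 * ln (\<rho> n k))"
      by (simp only: sum.distrib sum_constant card_lessThan)
    finally show ?thesis .
  qed
  have "(\<lambda>n. real g * (2 * ln C) / real n) \<longlonglongrightarrow> 0" by (rule lim_const_over_n)
  then have "(\<lambda>n. real g * (2 * ln C) / real n + (\<Sum>k<g. - 2 * ln (\<rho> n k)) / real n) \<longlonglongrightarrow> 0 + h"
    using lim by (rule tendsto_add)
  then have "limsup (\<lambda>n. ereal (real g * (2 * ln C) / real n + (\<Sum>k<g. - 2 * ln (\<rho> n k)) / real n)) = ereal h"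
    by (intro lim_imp_Limsup) auto
  moreover have "limsup (\<lambda>n. ereal (ln (real (?N n)) / real n)) \<le>
     limsup (\<lambda>n. ereal (real g * (2 * ln C) / real n + (\<Sum>k<g. - 2 * ln (\<rho> n k)) / real n))"
    using bound by (intro Limsup_mono always_eventually allI)
      (simp add: add_divide_distrib[symmetric] divide_right_mono)
  ultimately show "limsup (\<lambda>n. ereal (ln (real (?N n)) / real n)) \<le> ereal h" by simp
qed

section \<open>Lower bounds: separation along an eigenline\<close>

text \<open>One step multiplies \<open>z\<close> by \<open>\<mu>\<close>, so a small point remains within \<open>r\<close> of the origin. By discreteness the
  lattice point close to it is \<open>0\<close>, and so the new point is small again.\<close>

lemma eigenline_expansion:
  assumes v: "\<And>k. k < g \<Longrightarrow> cmod (v $ k) \<le> 1" "k0 < g" "cmod (v $ k0) = 1"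
    and lam: "cmod \<mu> > 1"
    and z: "cmod z \<le> r / (cmod \<mu> + 2)"
    and close: "\<And>i. i < n \<Longrightarrow> \<exists>l\<in>L. \<forall>k<g. cmod (\<mu> ^ i * z * v $ k - l $ k) < r / (cmod \<mu> + 2)"
    and i: "i < n"
  shows "cmod (\<mu> ^ i * z) < r / (cmod \<mu> + 2)"
proof -
  let ?\<rho> = "r / (cmod \<mu> + 2)"
  have "0 < cmod \<mu> + 2" using lam by linarith
  then have \<rho>: "?\<rho> > 0" "(cmod \<mu> + 2) * ?\<rho> = r" using r_pos by auto
  have small: "cmod (\<mu> ^ i * z) < ?\<rho>" if lt: "i < n" and le: "cmod (\<mu> ^ i * z) \<le> cmod \<mu> * ?\<rho>" for i
  proof -
    obtain l where l: "l \<in> L" "\<And>k. k < g \<Longrightarrow> cmod (\<mu> ^ i * z * v $ k - l $ k) < ?\<rho>"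
      using close[OF lt] by blast
    have "cmod (l $ k) < r" if k: "k < g" for k
    proof -
      have "cmod (l $ k) \<le> cmod (\<mu> ^ i * z * v $ k) + cmod (\<mu> ^ i * z * v $ k - l $ k)"
        using norm_triangle_ineq4[of "\<mu> ^ i * z * v $ k" "\<mu> ^ i * z * v $ k - l $ k"] by simp
      moreover have "cmod (\<mu> ^ i * z * v $ k) \<le> cmod (\<mu> ^ i * z)"
        using mult_left_mono[OF v(1)[OF k], of "cmod (\<mu> ^ i * z)"] by (simp only: norm_mult[of "\<mu> ^ i * z"]) simp
      moreover have "cmod \<mu> * ?\<rho> + 2 * ?\<rho> = r" using \<rho>(2) by (simp only: distrib_right)
      ultimately show ?thesis using l(2)[OF k] le \<rho>(1) by linarith
    qed
    then have "l = 0\<^sub>v g" using discrete[OF l(1)] by blast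
    then have "cmod (\<mu> ^ i * z * v $ k0) < ?\<rho>" using l(2)[OF v(2)] v(2) by simp
    then show ?thesis using v(3) by (simp only: norm_mult[of "\<mu> ^ i * z"] mult_1_right)
  qed
  show ?thesis using i
  proof (induction i)
    case 0
    have "1 * ?\<rho> \<le> cmod \<mu> * ?\<rho>" using lam \<rho>(1) by (intro mult_right_mono) auto
    then show ?case using small[OF 0] z by simp
  next
    case (Suc i)
    have "cmod (\<mu> ^ Suc i * z) = cmod \<mu> * cmod (\<mu> ^ i * z)" by (simp add: norm_mult)
    also have "\<dots> \<le> cmod \<mu> * ?\<rho>" using Suc by (intro mult_left_mono) auto
    finally show ?case by (rule small[OF Suc.prems])
  qed
qed

text \<open>Two points of the eigenline in the same member of the iterated cover stay close modulo
  the lattice, and by \<open>eigenline_expansion\<close> their distance is then exponentially small.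
  So a grid on the eigenline needs as many members as it has points. The eigenline is a real plane,
  whence the factor 2.\<close>

lemma entropy_ge:
  assumes ev: "eigenvalue A \<mu>" and lam: "cmod \<mu> > 1"
  shows "entropy g L A \<ge> ereal (2 * ln (cmod \<mu>))"
proof -
  have mu0: "\<mu> \<noteq> 0" using lam by auto
  \<comment> \<open>Here \<open>(cmod \<mu> + 2) * \<rho> = r\<close>: a step enlarges a point of
    size \<open>\<rho>\<close> to at most \<open>cmod \<mu> * \<rho>\<close>, closeness costs
    another \<open>\<rho>\<close>, and the nearby lattice point is still smaller than
    \<open>r\<close>.\<close>
  define \<rho> where "\<rho> = r / (cmod \<mu> + 2)"
  have \<rho>: "\<rho> > 0" unfolding \<rho>_def using r_pos lam by (intro divide_pos_pos) linarith+
  obtain u where u: "u \<in> carrier_vec g" "u \<noteq> 0\<^sub>v g" "A *\<^sub>v u = \<mu> \<cdot>\<^sub>v u"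
    using ev A unfolding eigenvalue_def eigenvector_def by auto
  have "\<exists>k<g. u $ k \<noteq> 0" using u by (metis carrier_vecD eq_vecI index_zero_vec)
  then have gpos: "g > 0" by auto
  have "Max ((\<lambda>k. cmod (u $ k)) ` {..<g}) \<in> (\<lambda>k. cmod (u $ k)) ` {..<g}"
    using gpos by (intro Max_in) auto
  then obtain k0 where k0_max: "k0 < g" "Max ((\<lambda>k. cmod (u $ k)) ` {..<g}) = cmod (u $ k0)" by auto
  then have k0: "k0 < g" "\<And>k. k < g \<Longrightarrow> cmod (u $ k) \<le> cmod (u $ k0)"
    using Max_ge[of "(\<lambda>k. cmod (u $ k)) ` {..<g}"] by auto
  have uk0: "u $ k0 \<noteq> 0" using k0 \<open>\<exists>k<g. u $ k \<noteq> 0\<close> by (metis norm_le_zero_iff norm_zero)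
  define v where "v = inverse (u $ k0) \<cdot>\<^sub>v u"
  have v: "v \<in> carrier_vec g" "\<And>k. k < g \<Longrightarrow> cmod (v $ k) \<le> 1" "cmod (v $ k0) = 1"
  proof -
    show "v \<in> carrier_vec g" using u(1) by (simp add: v_def)
    have eq: "cmod (v $ k) = cmod (u $ k) / cmod (u $ k0)" if "k < g" for k
      using that u(1) by (simp add: v_def norm_mult norm_inverse divide_inverse)
    show "cmod (v $ k) \<le> 1" if "k < g" for k
      using k0(2)[OF that] uk0 by (simp add: eq[OF that])
    show "cmod (v $ k0) = 1" using uk0 by (simp add: eq[OF k0(1)])
  qed
  have Av: "A *\<^sub>v v = \<mu> \<cdot>\<^sub>v v"
    unfolding v_def using u(1,3) A by (simp add: mult_mat_vec smult_smult_assoc mult.commute)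
  have Apow: "A ^\<^sub>m i *\<^sub>v v = \<mu> ^ i \<cdot>\<^sub>v v" for i
  proof (induction i)
    case 0 then show ?case using v(1) A by simp
  next
    case (Suc i)
    have "A ^\<^sub>m Suc i *\<^sub>v v = A ^\<^sub>m i *\<^sub>v (A *\<^sub>v v)" using assoc_mult_mat_vec[OF A_pow A v(1)] by simp
    also have "\<dots> = \<mu> \<cdot>\<^sub>v (A ^\<^sub>m i *\<^sub>v v)" unfolding Av using v(1) by (simp add: mult_mat_vec[OF A_pow])
    finally show ?case by (simp add: Suc smult_smult_assoc)
  qed
  \<comment> \<open>The radius is halved so that two points of one box differ by less than
    \<open>\<rho>\<close>.\<close>
  define box where "box w = {x \<in> carrier_vec g. \<forall>k<g. cmod (x $ k - w $ k) < \<rho> / 2}" for w :: "complex vec"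
  define \<U> where "\<U> = (\<lambda>w. torus_point L ` box w) ` carrier_vec g"
  have U: "open_cover T \<U>"
    unfolding open_cover_def
  proof (intro conjI ballI)
    fix V assume "V \<in> \<U>"
    then obtain w where w: "w \<in> carrier_vec g" "V = torus_point L ` box w" unfolding \<U>_def by auto
    have "\<exists>del>0. \<forall>y\<in>carrier_vec g. (\<forall>k<g. cmod (y $ k - x $ k) < del) \<longrightarrow> y \<in> {x \<in> carrier_vec g. torus_point L x \<in> V}"
      if x: "x \<in> carrier_vec g" "torus_point L x \<in> V" for x
    proof -
      obtain b where b: "b \<in> carrier_vec g" "\<And>k. k < g \<Longrightarrow> cmod (b $ k - w $ k) < \<rho> / 2" "torus_point L x = torus_point L b"
        using x(2) w(2) unfolding box_def by auto
      have xb: "x - b \<in> L" using torus_point_eq_iff[OF x(1) b(1)] b(3) by simp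
      define del where "del = Min (insert 1 ((\<lambda>k. \<rho> / 2 - cmod (b $ k - w $ k)) ` {..<g}))"
      have del: "del > 0" "\<And>k. k < g \<Longrightarrow> del \<le> \<rho> / 2 - cmod (b $ k - w $ k)"
        unfolding del_def using b(2) by (auto intro: Min_le)
      have "torus_point L y \<in> V" if y: "y \<in> carrier_vec g" "\<And>k. k < g \<Longrightarrow> cmod (y $ k - x $ k) < del" for y
      proof -
        have "cmod ((y - x + b) $ k - w $ k) < \<rho> / 2" if k: "k < g" for k
        proof -
          have eq: "(y - x + b) $ k - w $ k = (y $ k - x $ k) + (b $ k - w $ k)" using k y(1) x(1) b(1) by simp
          show ?thesis unfolding eq
            using norm_triangle_ineq[of "y $ k - x $ k" "b $ k - w $ k"] y(2)[OF k] del(2)[OF k] by linarith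
        qed
        then have "y - x + b \<in> box w" unfolding box_def using y(1) x(1) b(1) by simp
        moreover have "torus_point L y = torus_point L (y - x + b)"
        proof -
          have "y - (y - x + b) = x - b" using y(1) x(1) b(1) by (intro eq_vecI) auto
          then show ?thesis using xb y(1) x(1) b(1) by (subst torus_point_eq_iff) auto
        qed
        ultimately show ?thesis unfolding w(2) by (simp only: image_eqI)
      qed
      then show ?thesis using del(1) by (intro exI[of _ del]) simp
    qed
    moreover have "V \<subseteq> torus_point L ` carrier_vec g" unfolding w(2) box_def by auto
    ultimately show "openin T V" unfolding openin_torus_topology openin_cvec_topology by simp
  next
    show "\<Union>\<U> = topspace T"
    proof
      show "\<Union>\<U> \<subseteq> topspace T" unfolding topspace_torus_topology \<U>_def box_def by auto
      show "topspace T \<subseteq> \<Union>\<U>"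
      proof
        fix p assume "p \<in> topspace T"
        then obtain w where w: "w \<in> carrier_vec g" "p = torus_point L w" unfolding topspace_torus_topology by auto
        have "w \<in> box w" unfolding box_def using w \<rho> by simp
        then show "p \<in> \<Union>\<U>" unfolding \<U>_def w(2) using w(1) by blast
      qed
    qed
  qed
  have same: "\<exists>l\<in>L. \<forall>k<g. cmod ((x - y) $ k - l $ k) < \<rho>"
    if VU: "V \<in> \<U>" and xV: "torus_point L x \<in> V" and yV: "torus_point L y \<in> V" and x: "x \<in> carrier_vec g" and y: "y \<in> carrier_vec g" for V x y
  proof -
    obtain w where w: "V = torus_point L ` box w" using VU unfolding \<U>_def by auto
    obtain b where b: "b \<in> carrier_vec g" "\<And>k. k < g \<Longrightarrow> cmod (b $ k - w $ k) < \<rho> / 2" "torus_point L x = torus_point L b"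
      using xV w unfolding box_def by auto
    obtain c where c: "c \<in> carrier_vec g" "\<And>k. k < g \<Longrightarrow> cmod (c $ k - w $ k) < \<rho> / 2" "torus_point L y = torus_point L c"
      using yV w unfolding box_def by auto
    have "x - b \<in> L" "y - c \<in> L" using torus_point_eq_iff b c x y by auto
    then have "(x - b) - (y - c) \<in> L" by (rule diff_mem)
    moreover have "cmod ((x - y) $ k - ((x - b) - (y - c)) $ k) < \<rho>" if k: "k < g" for k
    proof -
      have eq: "(x - y) $ k - ((x - b) - (y - c)) $ k = (b $ k - w $ k) - (c $ k - w $ k)" using k x y b(1) c(1) by simp
      show ?thesis unfolding eq
        using norm_triangle_ineq4[of "b $ k - w $ k" "c $ k - w $ k"] b(2)[OF k] c(2)[OF k] by linarith
    qed
    ultimately show ?thesis by blast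
  qed
  let ?N = "\<lambda>n. min_subcover_card T (iterated_cover T f \<U> n)"
  \<comment> \<open>The cover iterated \<open>Suc m\<close> times tests the iterates
    \<open>0, ..., m\<close>, so the last expansion factor available is the \<open>m\<close>-th
    power.\<close>
  have count: "(cmod \<mu> ^ m / 2)\<^sup>2 \<le> real (?N (Suc m))" for m
  proof -
    let ?n = "Suc m"
    \<comment> \<open>The spacing that grows to exactly \<open>\<rho>\<close> after \<open>m\<close>
      steps, so that distinct grid points are separated by then.\<close>
    define h where "h = \<rho> / cmod \<mu> ^ m"
    have mu_pos: "cmod \<mu> ^ m > 0" by (rule zero_less_power) (use lam in linarith)
    then have h: "h > 0" "cmod \<mu> ^ m * h = \<rho>" unfolding h_def using \<rho> mu0 by simp_all
    \<comment> \<open>Differences of grid points are bounded by \<open>2 * M * h\<close>, which must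
      not exceed the initial size \<open>\<rho>\<close> allowed in
      \<open>eigenline_expansion\<close>.\<close>
    define M where "M = nat \<lfloor>cmod \<mu> ^ m / 2\<rfloor>"
    have M: "real M \<le> cmod \<mu> ^ m / 2" "cmod \<mu> ^ m / 2 \<le> real (Suc M)"
      using mu_pos unfolding M_def by linarith+
    define pt where "pt = (\<lambda>(a,b). Complex (h * real a) (h * real b))"
    obtain \<V> where V: "\<V> \<subseteq> iterated_cover T f \<U> ?n" "finite \<V>" "\<Union>\<V> = topspace T" "card \<V> = ?N ?n"
      by (rule min_subcover_attained[OF U])
    have "\<forall>q. \<exists>V. V \<in> \<V> \<and> torus_point L (pt q \<cdot>\<^sub>v v) \<in> V"
      using V(3) v(1) unfolding topspace_torus_topology by (metis UnionE image_eqI smult_carrier_vec)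
    then obtain VV where VV: "\<And>q. VV q \<in> \<V>" "\<And>q. torus_point L (pt q \<cdot>\<^sub>v v) \<in> VV q" by metis
    have "inj_on VV ({..M} \<times> {..M})"
    proof (rule inj_onI, rule ccontr)
      fix q q' assume q: "q \<in> {..M} \<times> {..M}" "q' \<in> {..M} \<times> {..M}" "VV q = VV q'" "q \<noteq> q'"
      define z where "z = pt q - pt q'"
      obtain a b a' b' where ab: "q = (a,b)" "q' = (a',b')" by (metis surj_pair)
      have zz: "z = Complex (h * (real a - real a')) (h * (real b - real b'))"
        unfolding z_def pt_def ab by (simp add: complex_eq_iff algebra_simps)
      have "cmod z \<ge> h"
      proof -
        have "a \<noteq> a' \<or> b \<noteq> b'" using q(4) ab by auto
        then have "\<bar>real a - real a'\<bar> \<ge> 1 \<or> \<bar>real b - real b'\<bar> \<ge> 1" by linarith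
        then have "\<bar>h * (real a - real a')\<bar> \<ge> h \<or> \<bar>h * (real b - real b')\<bar> \<ge> h" using h(1) by (simp add: abs_mult)
        then show ?thesis using abs_Re_le_cmod[of z] abs_Im_le_cmod[of z] unfolding zz by auto
      qed
      have abs_le: "\<bar>h * (real x - real x')\<bar> \<le> h * M" if "x \<le> M" "x' \<le> M" for x x'
        using h(1) that by (simp add: abs_mult)
      have "cmod z \<le> \<bar>h * (real a - real a')\<bar> + \<bar>h * (real b - real b')\<bar>"
        using cmod_le[of z] unfolding zz by simp
      also have "\<dots> \<le> h * M + h * M" using q(1,2) ab by (intro add_mono abs_le) auto
      also have "\<dots> = h * (2 * M)" by simp
      also have "\<dots> \<le> h * cmod \<mu> ^ m" using M(1) h(1) by (intro mult_left_mono) auto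
      finally have z\<rho>: "cmod z \<le> \<rho>" using h(2) by (simp add: mult.commute)
      have cl: "\<exists>l\<in>L. \<forall>k<g. cmod (\<mu> ^ i * z * v $ k - l $ k) < \<rho>" if i: "i < ?n" for i
      proof -
        obtain s where s: "VV q = topspace T \<inter> (\<Inter>i\<in>{..<?n}. (f ^^ i) -` s i)" "\<forall>i<?n. s i \<in> \<U>"
          using VV(1)[of q] V(1) unfolding iterated_cover_def by auto
        have *: "torus_point L ((\<mu> ^ i * pt q'') \<cdot>\<^sub>v v) \<in> s i" if "VV q'' = VV q" for q''
        proof -
          have "(f ^^ i) (torus_point L (pt q'' \<cdot>\<^sub>v v)) \<in> s i" using VV(2)[of q''] s(1) i that by auto
          moreover have "A ^\<^sub>m i *\<^sub>v (pt q'' \<cdot>\<^sub>v v) = (\<mu> ^ i * pt q'') \<cdot>\<^sub>v v"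
            using v(1) by (simp add: mult_mat_vec[OF A_pow] Apow smult_smult_assoc mult.commute)
          ultimately show ?thesis using torus_map_funpow[of "pt q'' \<cdot>\<^sub>v v" i] v(1) by simp
        qed
        obtain l where l: "l \<in> L" "\<forall>k<g. cmod (((\<mu> ^ i * pt q) \<cdot>\<^sub>v v - (\<mu> ^ i * pt q') \<cdot>\<^sub>v v) $ k - l $ k) < \<rho>"
          using same[of "s i" "(\<mu> ^ i * pt q) \<cdot>\<^sub>v v" "(\<mu> ^ i * pt q') \<cdot>\<^sub>v v"] s(2) i *[of q] *[of q'] q(3) v(1) by auto
        moreover have "((\<mu> ^ i * pt q) \<cdot>\<^sub>v v - (\<mu> ^ i * pt q') \<cdot>\<^sub>v v) $ k = \<mu> ^ i * z * v $ k" if "k < g" for k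
          using that v(1) by (simp add: z_def algebra_simps)
        ultimately show ?thesis by auto
      qed
      have "cmod (\<mu> ^ m * z) < \<rho>"
        unfolding \<rho>_def
        by (rule eigenline_expansion[OF v(2) k0(1) v(3) lam _ _, where n = ?n]) (use z\<rho> cl in \<open>auto simp: \<rho>_def\<close>)
      moreover have "cmod (\<mu> ^ m * z) \<ge> cmod \<mu> ^ m * h"
        using \<open>cmod z \<ge> h\<close> by (simp add: norm_mult norm_power mult_left_mono)
      ultimately show False using h(2) by simp
    qed
    then have "card ({..M} \<times> {..M}) \<le> card \<V>"
      using V(2) VV(1) by (intro card_inj_on_le[of VV]) auto
    then have "real (Suc M) * real (Suc M) \<le> real (?N ?n)"
      using V(4) by (simp add: card_cartesian_product del: of_nat_Suc mult_Suc mult_Suc_right of_nat_mult add: of_nat_mult[symmetric])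
    moreover have "(cmod \<mu> ^ m / 2)\<^sup>2 \<le> real (Suc M) * real (Suc M)"
      unfolding power2_eq_square using M(2) by (intro mult_mono) auto
    ultimately show ?thesis by linarith
  qed
  have "ereal (2 * ln (cmod \<mu>)) \<le> limsup (\<lambda>n. ereal (ln (real (?N n)) / real n))"
  proof -
    have "(\<lambda>n. (2 * ln (cmod \<mu>) * (real n - 1) - 2 * ln 2) / real n) \<longlonglongrightarrow> 2 * ln (cmod \<mu>)"
      by real_asymp
    then have "limsup (\<lambda>n. ereal ((2 * ln (cmod \<mu>) * (real n - 1) - 2 * ln 2) / real n)) = ereal (2 * ln (cmod \<mu>))"
      by (intro lim_imp_Limsup) auto
    moreover have "limsup (\<lambda>n. ereal ((2 * ln (cmod \<mu>) * (real n - 1) - 2 * ln 2) / real n)) \<le> limsup (\<lambda>n. ereal (ln (real (?N n)) / real n))"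
    proof (rule Limsup_mono, rule eventually_mono[OF eventually_gt_at_top[of 0]])
      fix n :: nat assume "n > 0"
      then obtain m where m: "n = Suc m" by (cases n) auto
      have "ln ((cmod \<mu> ^ m / 2)\<^sup>2) \<le> ln (real (?N n))"
        unfolding m using zero_less_power[of "cmod \<mu>" m] lam by (intro ln_mono count zero_less_power divide_pos_pos) linarith+
      moreover have "ln ((cmod \<mu> ^ m / 2)\<^sup>2) = 2 * ln (cmod \<mu>) * (real n - 1) - 2 * ln 2"
        using mu0 by (simp add: m ln_realpow ln_div algebra_simps)
      ultimately show "ereal ((2 * ln (cmod \<mu>) * (real n - 1) - 2 * ln 2) / real n) \<le> ereal (ln (real (?N n)) / real n)"
        by (simp add: divide_right_mono)
    qed
    ultimately show ?thesis by simp
  qed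
  then show ?thesis unfolding entropy_def topological_entropy_def
    by (intro SUP_upper2[of \<U>]) (use U in auto)
qed

end

text \<open>With spectral radius at most 1, the Jordan blocks let the powers grow only polynomially.
  A grid of polynomially small mesh is then fine enough, and the logarithm of its size is
  \<open>o(n)\<close>.\<close>

lemma (in torus_endomorphism) entropy_zero:
  assumes g: "g > 0" and ev: "\<And>\<mu>. eigenvalue A \<mu> \<Longrightarrow> cmod \<mu> \<le> 1"
  shows "entropy g L A = 0"
proof -
  have "spectral_radius A \<le> 1"
    using spectral_radius_mem_max(1)[OF A g] ev unfolding spectrum_def by auto
  then obtain c1 c2 where c: "\<And>k. norm_bound (A ^\<^sub>m k) (c1 + c2 * real k ^ (g - 1))"
    using spectral_radius_jnf_norm_bound_le_1_upper_triangular[OF A] by blast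
  define K where "K = 1 + \<bar>c1\<bar> + \<bar>c2\<bar>"
  \<comment> \<open>A bound for the row sums of all powers with exponent below \<open>n\<close>; the
    shift by 1 keeps it at least 1 when \<open>n = 0\<close>.\<close>
  define B where "B n = real g * (K * (real n + 1) ^ (g - 1))" for n :: nat
  have K: "K \<ge> 1" unfolding K_def by simp
  have B: "B n \<ge> 1" for n
  proof -
    have "1 \<le> (real n + 1) ^ (g - 1)" by (rule one_le_power) simp
    then have "1 * 1 \<le> K * (real n + 1) ^ (g - 1)" using K by (intro mult_mono) auto
    then have "1 * 1 \<le> real g * (K * (real n + 1) ^ (g - 1))" using g by (intro mult_mono) auto
    then show ?thesis by (simp add: B_def)
  qed
  have "entropy g L A \<le> ereal 0"
  proof (rule entropy_le[where \<rho> = "\<lambda>n k. 1 / B n"])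
    show "0 < 1 / B n" for n using B[of n] by simp
    show "1 / B n \<le> 1" for n using B[of n] by simp
    show "cmod ((A ^\<^sub>m i *\<^sub>v w) $ k) \<le> 1"
      if w: "w \<in> carrier_vec g" "\<And>k. k < g \<Longrightarrow> cmod (w $ k) \<le> 1 / B n" and i: "i < n" and k: "k < g" for w i k n
    proof -
      have entry: "cmod ((A ^\<^sub>m i) $$ (k,j)) \<le> K * (real n + 1) ^ (g - 1)" if j: "j < g" for j
      proof -
        have "cmod ((A ^\<^sub>m i) $$ (k,j)) \<le> c1 + c2 * real i ^ (g - 1)"
          using c[of i] k j unfolding norm_bound_def carrier_matD[OF A_pow] by simp
        also have "\<dots> \<le> \<bar>c1\<bar> * 1 + \<bar>c2\<bar> * (real n + 1) ^ (g - 1)"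
        proof (rule add_mono)
          have "c2 * real i ^ (g - 1) \<le> \<bar>c2\<bar> * real i ^ (g - 1)" by (intro mult_right_mono) auto
          also have "\<dots> \<le> \<bar>c2\<bar> * (real n + 1) ^ (g - 1)" using i by (intro mult_left_mono power_mono) auto
          finally show "c2 * real i ^ (g - 1) \<le> \<bar>c2\<bar> * (real n + 1) ^ (g - 1)" .
        qed simp
        also have "\<dots> \<le> \<bar>c1\<bar> * (real n + 1) ^ (g - 1) + \<bar>c2\<bar> * (real n + 1) ^ (g - 1)"
          by (intro add_mono mult_left_mono one_le_power) auto
        also have "\<dots> \<le> K * (real n + 1) ^ (g - 1)" unfolding K_def by (simp add: algebra_simps)
        finally show ?thesis .
      qed
      have "(A ^\<^sub>m i *\<^sub>v w) $ k = (\<Sum>j<g. (A ^\<^sub>m i) $$ (k,j) * w $ j)"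
        by (rule mat_vec_index_sum[OF A_pow w(1) k])
      then have "cmod ((A ^\<^sub>m i *\<^sub>v w) $ k) \<le> (\<Sum>j<g. cmod ((A ^\<^sub>m i) $$ (k,j) * w $ j))"
        by (simp add: norm_sum)
      also have "\<dots> \<le> (\<Sum>j<g. K * (real n + 1) ^ (g - 1) * (1 / B n))"
        unfolding norm_mult using K by (intro sum_mono mult_mono w(2) entry) auto
      also have "\<dots> = B n * (1 / B n)" by (simp add: B_def)
      also have "\<dots> = 1" using B[of n] by simp
      finally show ?thesis .
    qed
    have eq: "(\<Sum>k<g. - 2 * ln (1 / B n)) / real n =
        2 * real g * (ln (real g) + ln K) / real n + 2 * real g * real (g - 1) * (ln (real n + 1) / real n)" for n
    proof -
      have "ln (B n) = ln (real g) + (ln K + real (g - 1) * ln (real n + 1))"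
        unfolding B_def using g K by (simp add: ln_mult ln_realpow)
      then have "ln (1 / B n) = - (ln (real g) + (ln K + real (g - 1) * ln (real n + 1)))"
        using B[of n] by (simp add: ln_div)
      then show ?thesis by (simp only: sum_constant card_lessThan) (simp add: add_divide_distrib algebra_simps)
    qed
    have "(\<lambda>n. 2 * real g * (ln (real g) + ln K) / real n) \<longlonglongrightarrow> 0" by (rule lim_const_over_n)
    moreover have "(\<lambda>n. ln (real n + 1) / real n) \<longlonglongrightarrow> 0" by real_asymp
    then have "(\<lambda>n. 2 * real g * real (g - 1) * (ln (real n + 1) / real n)) \<longlonglongrightarrow> 0"
      by (rule tendsto_mult_right_zero)
    ultimately show "(\<lambda>n. (\<Sum>k<g. - 2 * ln (1 / B n)) / real n) \<longlonglongrightarrow> 0"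
      unfolding eq using tendsto_add[where a = 0 and b = 0] by fastforce
  qed
  then show ?thesis using entropy_nonneg by (simp add: zero_ereal_def)
qed

lemma smult_pow_mat:
  fixes A :: "'a :: comm_ring_1 mat"
  assumes "A \<in> carrier_mat n n"
  shows "(c \<cdot>\<^sub>m A) ^\<^sub>m k = c ^ k \<cdot>\<^sub>m (A ^\<^sub>m k)"
proof (induction k)
  case 0 then show ?case using assms by (intro eq_matI) auto
next
  case (Suc k)
  have p: "A ^\<^sub>m k \<in> carrier_mat n n" using assms by simp
  have "(c \<cdot>\<^sub>m A) ^\<^sub>m Suc k = (c ^ k \<cdot>\<^sub>m (A ^\<^sub>m k)) * (c \<cdot>\<^sub>m A)" by (simp add: Suc)
  also have "\<dots> = c ^ k \<cdot>\<^sub>m (c \<cdot>\<^sub>m (A ^\<^sub>m k * A))"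
    using mult_smult_assoc_mat[OF p, of "c \<cdot>\<^sub>m A" n "c ^ k"] mult_smult_distrib[OF p assms, of c] assms by simp
  also have "\<dots> = c ^ Suc k \<cdot>\<^sub>m (A ^\<^sub>m k * A)" using p assms by (intro eq_matI) auto
  finally show ?case by simp
qed

text \<open>If all eigenvalues were inside the unit disc, then the powers of \<open>A\<close> would tend to zero and
  hence, by discreteness, kill every lattice point.\<close>

lemma (in torus_endomorphism) expanding_eigenvalue:
  assumes g: "g > 0" and ev: "\<And>\<mu>. eigenvalue A \<mu> \<Longrightarrow> \<mu> \<noteq> 0 \<and> cmod \<mu> \<noteq> 1"
  shows "\<exists>\<mu>. eigenvalue A \<mu> \<and> cmod \<mu> > 1"
proof (rule ccontr)
  assume neg: "\<not> ?thesis"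
  have lt1: "cmod \<mu> < 1" if "eigenvalue A \<mu>" for \<mu>
    using neg ev[OF that] that by (meson linorder_less_linear)
  define \<rho> where "\<rho> = spectral_radius A"
  obtain \<mu> where \<mu>: "eigenvalue A \<mu>" "\<rho> = cmod \<mu>"
    using spectral_radius_mem_max(1)[OF A g] unfolding spectrum_def \<rho>_def by auto
  have \<rho>: "0 \<le> \<rho>" "\<rho> < 1" using \<mu> lt1 by auto
  \<comment> \<open>Any \<open>c > 1\<close> with \<open>c * \<rho> < 1\<close> serves: the spectrum
    of \<open>c A\<close> remains inside the disc, so its powers are bounded and those of
    \<open>A\<close> decay geometrically.\<close>
  define c where "c = 2 / (1 + \<rho>)"
  have c: "c > 1" "c * \<rho> < 1" unfolding c_def using \<rho> by (auto simp: field_simps)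
  define B where "B = complex_of_real c \<cdot>\<^sub>m A"
  have B: "B \<in> carrier_mat g g" using A by (simp add: B_def)
  have evB: "cmod \<nu> < 1" if nu: "eigenvalue B \<nu>" for \<nu>
  proof -
    obtain v where v: "v \<in> carrier_vec g" "v \<noteq> 0\<^sub>v g" "B *\<^sub>v v = \<nu> \<cdot>\<^sub>v v"
      using nu B unfolding eigenvalue_def eigenvector_def by auto
    have "B *\<^sub>v v = complex_of_real c \<cdot>\<^sub>v (A *\<^sub>v v)"
      using v(1) A unfolding B_def by (intro eq_vecI) (auto simp: scalar_prod_def sum_distrib_left mult.assoc)
    then have "complex_of_real c \<cdot>\<^sub>v (A *\<^sub>v v) = \<nu> \<cdot>\<^sub>v v" using v(3) by simp
    then have "(1 / complex_of_real c) \<cdot>\<^sub>v (complex_of_real c \<cdot>\<^sub>v (A *\<^sub>v v)) = (1 / complex_of_real c) \<cdot>\<^sub>v (\<nu> \<cdot>\<^sub>v v)" by simp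
    then have "A *\<^sub>v v = (\<nu> / complex_of_real c) \<cdot>\<^sub>v v" using c(1) by (simp add: smult_smult_assoc)
    then have e: "eigenvalue A (\<nu> / complex_of_real c)" using v A unfolding eigenvalue_def eigenvector_def by auto
    then have "cmod (\<nu> / complex_of_real c) \<in> norm ` spectrum A" unfolding spectrum_def by auto
    then have "cmod (\<nu> / complex_of_real c) \<le> \<rho>"
      unfolding \<rho>_def by (rule spectral_radius_mem_max(2)[OF A g])
    then have "cmod \<nu> \<le> c * \<rho>" using c(1) by (simp add: norm_divide field_simps)
    then show ?thesis using c(2) by simp
  qed
  have "spectral_radius B < 1"
    using spectral_radius_mem_max(1)[OF B g] evB unfolding spectrum_def by auto
  then obtain C where C: "\<And>k. norm_bound (B ^\<^sub>m k) C"
    using spectral_radius_jnf_norm_bound_less_1_upper_triangular[OF B] by blast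
  have entry: "cmod ((A ^\<^sub>m i) $$ (k,j)) \<le> C / c ^ i" if "k < g" "j < g" for i j k
  proof -
    have "cmod ((B ^\<^sub>m i) $$ (k,j)) \<le> C"
      using C[of i] B that unfolding norm_bound_def by auto
    moreover have "(B ^\<^sub>m i) $$ (k,j) = complex_of_real c ^ i * (A ^\<^sub>m i) $$ (k,j)"
      unfolding B_def smult_pow_mat[OF A] using that by (subst index_smult_mat(1)) (simp_all only: carrier_matD[OF A_pow])
    ultimately have "c ^ i * cmod ((A ^\<^sub>m i) $$ (k,j)) \<le> C" using c(1) by (simp add: norm_mult norm_power)
    then show ?thesis using c(1) by (simp add: field_simps)
  qed
  have inj: "w = 0\<^sub>v g" if "w \<in> carrier_vec g" "A *\<^sub>v w = 0\<^sub>v g" for w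
  proof (rule ccontr)
    assume "w \<noteq> 0\<^sub>v g"
    moreover have "A *\<^sub>v w = 0 \<cdot>\<^sub>v w" using that by auto
    ultimately have "eigenvalue A 0" using that A unfolding eigenvalue_def eigenvector_def by auto
    then show False using ev by blast
  qed
  have inj_pow: "w = 0\<^sub>v g" if "w \<in> carrier_vec g" "A ^\<^sub>m i *\<^sub>v w = 0\<^sub>v g" for w i
    using that
  proof (induction i arbitrary: w)
    case 0 then show ?case using A by simp
  next
    case (Suc i)
    have "A ^\<^sub>m i *\<^sub>v (A *\<^sub>v w) = 0\<^sub>v g" using Suc.prems assoc_mult_mat_vec[OF A_pow A Suc.prems(1)] by simp
    then have "A *\<^sub>v w = 0\<^sub>v g" using Suc.IH[of "A *\<^sub>v w"] Suc.prems(1) by simp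
    then show ?case by (rule inj[OF Suc.prems(1)])
  qed
  have AiL: "A ^\<^sub>m i *\<^sub>v l \<in> L" if "l \<in> L" for i l
    using that
  proof (induction i arbitrary: l)
    case 0 then show ?case using A L_carrier by auto
  next
    case (Suc i)
    have "A ^\<^sub>m Suc i *\<^sub>v l = A ^\<^sub>m i *\<^sub>v (A *\<^sub>v l)"
      using assoc_mult_mat_vec[OF A_pow A] Suc.prems L_carrier by auto
    then show ?case using Suc.IH[OF AL[OF Suc.prems]] by simp
  qed
  have L0: "l = 0\<^sub>v g" if l: "l \<in> L" for l
  proof -
    have lc: "l \<in> carrier_vec g" using l L_carrier by auto
    define S where "S = (\<Sum>j<g. cmod (l $ j))"
    have "(\<lambda>i. C * S * inverse c ^ i) \<longlonglongrightarrow> C * S * 0"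
      by (intro tendsto_mult_left LIMSEQ_power_zero) (use c(1) in \<open>simp add: inverse_less_1_iff\<close>)
    then have "eventually (\<lambda>i. C * S * inverse c ^ i < r) sequentially"
      using r_pos by (intro order_tendstoD(2)) auto
    then obtain i where i: "C * S * inverse c ^ i < r" by (auto simp: eventually_sequentially)
    have "cmod ((A ^\<^sub>m i *\<^sub>v l) $ k) < r" if k: "k < g" for k
    proof -
      have "cmod ((A ^\<^sub>m i *\<^sub>v l) $ k) \<le> (\<Sum>j<g. cmod ((A ^\<^sub>m i) $$ (k,j) * l $ j))"
        unfolding mat_vec_index_sum[OF A_pow lc k] by (rule norm_sum)
      also have "\<dots> \<le> (\<Sum>j<g. C / c ^ i * cmod (l $ j))"
        unfolding norm_mult using k by (intro sum_mono mult_right_mono entry) auto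
      also have "\<dots> = C * S * inverse c ^ i" unfolding S_def by (simp add: sum_distrib_left power_inverse divide_inverse algebra_simps)
      finally show ?thesis using i by simp
    qed
    then have "A ^\<^sub>m i *\<^sub>v l = 0\<^sub>v g" using discrete[OF AiL[OF l]] by blast
    then show ?thesis by (rule inj_pow[OF lc])
  qed
  \<comment> \<open>The zero lattice is not cobounded: a vector with all entries \<open>2 R\<close>
    is too far from the origin.\<close>
  obtain l where "l \<in> L" "\<forall>k<g. cmod (vec g (\<lambda>_. complex_of_real (2 * R)) $ k - l $ k) \<le> R"
    using cobounded[of "vec g (\<lambda>_. complex_of_real (2 * R))"] by auto
  then have "cmod (complex_of_real (2 * R) - 0) \<le> R" using L0[of l] g by auto
  then show False using R_pos by (simp add: norm_mult)
qed

section \<open>Simultaneous eigenvectors\<close>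

text \<open>The vector \<open>p(B) v\<close>, computed by Horner's rule within the space of
  vectors.\<close>

definition horner_apply :: "nat \<Rightarrow> complex mat \<Rightarrow> complex vec \<Rightarrow> complex poly \<Rightarrow> complex vec" where
  "horner_apply g B v p = fold_coeffs (\<lambda>a w. a \<cdot>\<^sub>v v + B *\<^sub>v w) p (0\<^sub>v g)"

context
  fixes g :: nat and B :: "complex mat" and v :: "complex vec"
  assumes B: "B \<in> carrier_mat g g" and v: "v \<in> carrier_vec g"
begin

lemma horner_apply_0 [simp]: "horner_apply g B v 0 = 0\<^sub>v g"
  by (simp add: horner_apply_def)

lemma horner_apply_pCons: "horner_apply g B v (pCons a p) = a \<cdot>\<^sub>v v + B *\<^sub>v horner_apply g B v p"
proof (cases "a = 0 \<and> p = 0")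
  case True
  have "B *\<^sub>v 0\<^sub>v g = 0\<^sub>v g" using B by (intro eq_vecI) auto
  then show ?thesis using True v by (auto simp: horner_apply_def)
next
  case False
  then show ?thesis by (auto simp: horner_apply_def)
qed

lemma horner_apply_carrier [simp]: "horner_apply g B v p \<in> carrier_vec g"
proof (induction p)
  case (pCons a p)
  then show ?case using B v by (simp add: horner_apply_pCons)
qed simp

lemma dim_horner_apply [simp]: "dim_vec (horner_apply g B v p) = g"
  using horner_apply_carrier carrier_vecD by blast

lemma horner_apply_smult: "horner_apply g B v (Polynomial.smult c p) = c \<cdot>\<^sub>v horner_apply g B v p"
proof (induction p)
  case 0 then show ?case by (auto intro!: eq_vecI)
next
  case (pCons a p)
  have "horner_apply g B v (Polynomial.smult c (pCons a p)) = (c * a) \<cdot>\<^sub>v v + B *\<^sub>v (c \<cdot>\<^sub>v horner_apply g B v p)"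
    by (simp add: horner_apply_pCons pCons.IH)
  also have "\<dots> = c \<cdot>\<^sub>v (a \<cdot>\<^sub>v v + B *\<^sub>v horner_apply g B v p)"
    using B v by (simp add: mult_mat_vec[OF B] smult_add_distrib_vec[of _ g] smult_smult_assoc)
  finally show ?case by (simp add: horner_apply_pCons)
qed

lemma horner_apply_add: "horner_apply g B v (p + q) = horner_apply g B v p + horner_apply g B v q"
proof (induction p arbitrary: q)
  case 0 show ?case by (auto intro!: eq_vecI)
next
  case (pCons c p)
  obtain b q' where q: "q = pCons b q'" by (cases q)
  have "horner_apply g B v (pCons c p + q) = (c + b) \<cdot>\<^sub>v v + B *\<^sub>v (horner_apply g B v p + horner_apply g B v q')"
    by (simp add: q horner_apply_pCons pCons.IH)
  also have "\<dots> = (c \<cdot>\<^sub>v v + B *\<^sub>v horner_apply g B v p) + (b \<cdot>\<^sub>v v + B *\<^sub>v horner_apply g B v q')"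
  proof -
    have "B *\<^sub>v (horner_apply g B v p + horner_apply g B v q') = B *\<^sub>v horner_apply g B v p + B *\<^sub>v horner_apply g B v q'"
      by (rule mult_add_distrib_mat_vec[OF B]) simp_all
    then show ?thesis using v B by (intro eq_vecI) (auto simp: algebra_simps)
  qed
  finally show ?case by (simp add: q horner_apply_pCons)
qed

lemma horner_apply_linear_factor:
  "horner_apply g B v ([:- a, 1:] * q) = B *\<^sub>v horner_apply g B v q - a \<cdot>\<^sub>v horner_apply g B v q"
proof -
  have "[:- a, 1:] * q = Polynomial.smult (- a) q + pCons 0 q" by simp
  then have "horner_apply g B v ([:- a, 1:] * q) = (- a) \<cdot>\<^sub>v horner_apply g B v q + (0 \<cdot>\<^sub>v v + B *\<^sub>v horner_apply g B v q)"
    by (simp only: horner_apply_add horner_apply_smult horner_apply_pCons)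
  also have "\<dots> = B *\<^sub>v horner_apply g B v q - a \<cdot>\<^sub>v horner_apply g B v q"
    using v B carrier_vecD[OF horner_apply_carrier[of q]] by (intro eq_vecI) auto
  finally show ?thesis .
qed

lemma horner_apply_index:
  assumes "Polynomial.degree p < n" "i < g"
  shows "horner_apply g B v p $ i = (\<Sum>j<n. Polynomial.coeff p j * (B ^\<^sub>m j *\<^sub>v v) $ i)"
  using assms
proof (induction p arbitrary: n i)
  case 0 then show ?case by simp
next
  case (pCons a p)
  obtain m where n: "n = Suc m" using pCons.prems by (cases n) auto
  have Bj: "B ^\<^sub>m j *\<^sub>v v \<in> carrier_vec g" for j by (rule mult_mat_vec_carrier[OF pow_carrier_mat[OF B] v])
  have BSuc: "(B *\<^sub>v (B ^\<^sub>m j *\<^sub>v v)) = B ^\<^sub>m Suc j *\<^sub>v v" for j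
  proof -
    have "B * B ^\<^sub>m j = B ^\<^sub>m j * B"
    proof (induction j)
      case (Suc j)
      have "B * (B ^\<^sub>m j * B) = (B * B ^\<^sub>m j) * B" using B by (simp add: assoc_mult_mat[of _ g g _ g _ g])
      then show ?case using Suc by simp
    qed (use B in simp)
    then show ?thesis using assoc_mult_mat_vec[OF B pow_carrier_mat[OF B] v, of j] by simp
  qed
  show ?case
  proof (cases "p = 0")
    case True
    have "B *\<^sub>v 0\<^sub>v g = 0\<^sub>v g" using B by (intro eq_vecI) auto
    moreover have "(\<Sum>j<n. Polynomial.coeff (pCons a p) j * (B ^\<^sub>m j *\<^sub>v v) $ i) = a * (B ^\<^sub>m 0 *\<^sub>v v) $ i"
      unfolding n sum.lessThan_Suc_shift using True by simp
    ultimately show ?thesis using True pCons.prems v B by (simp add: horner_apply_pCons)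
  next
    case False
    then have deg: "Polynomial.degree p < m" using pCons.prems n by simp
    have "horner_apply g B v (pCons a p) $ i = a * v $ i + (B *\<^sub>v horner_apply g B v p) $ i"
      using pCons.prems v B by (simp add: horner_apply_pCons)
    also have "(B *\<^sub>v horner_apply g B v p) $ i = (\<Sum>k<g. B $$ (i,k) * (\<Sum>j<m. Polynomial.coeff p j * (B ^\<^sub>m j *\<^sub>v v) $ k))"
      unfolding mat_vec_index_sum[OF B horner_apply_carrier pCons.prems(2)]
      using pCons.IH[OF deg] by (intro sum.cong) auto
    also have "\<dots> = (\<Sum>j<m. Polynomial.coeff p j * (\<Sum>k<g. B $$ (i,k) * (B ^\<^sub>m j *\<^sub>v v) $ k))"
      unfolding sum_distrib_left by (subst sum.swap) (simp add: mult.left_commute)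
    also have "\<dots> = (\<Sum>j<m. Polynomial.coeff p j * (B ^\<^sub>m Suc j *\<^sub>v v) $ i)"
      unfolding BSuc[symmetric] mat_vec_index_sum[OF B Bj pCons.prems(2)] ..
    also have "a * v $ i + \<dots> = (\<Sum>j<n. Polynomial.coeff (pCons a p) j * (B ^\<^sub>m j *\<^sub>v v) $ i)"
      unfolding n sum.lessThan_Suc_shift using B v by simp
    finally show ?thesis .
  qed
qed

text \<open>The \<open>g + 1\<close> vectors \<open>v, B v, ..., B^g v\<close> are dependent. A zero
  row makes their matrix square, so that the vanishing determinant yields a kernel vector; its
  entries are the coefficients of \<open>p\<close>.\<close>

lemma annihilating_polynomial: "\<exists>p. p \<noteq> 0 \<and> horner_apply g B v p = 0\<^sub>v g"
proof -
  define M where "M = mat (Suc g) (Suc g) (\<lambda>(i,j). if i < g then (B ^\<^sub>m j *\<^sub>v v) $ i else 0)"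
  have M: "M \<in> carrier_mat (Suc g) (Suc g)" by (simp add: M_def)
  have MT: "M\<^sup>T \<in> carrier_mat (Suc g) (Suc g)" using M by simp
  have "M\<^sup>T *\<^sub>v unit_vec (Suc g) g = 0\<^sub>v (Suc g)"
  proof (rule eq_vecI)
    fix i assume "i < dim_vec (0\<^sub>v (Suc g) :: complex vec)"
    then have i: "i < Suc g" by simp
    then show "(M\<^sup>T *\<^sub>v unit_vec (Suc g) g) $ i = 0\<^sub>v (Suc g) $ i"
      unfolding mat_vec_index_sum[OF MT unit_vec_carrier i]
      by (simp add: M_def unit_vec_def)
  qed (use M in simp)
  then have "det M\<^sup>T = 0"
    unfolding det_0_iff_vec_prod_zero[OF MT] by (intro exI[of _ "unit_vec (Suc g) g"]) simp
  then have "det M = 0" using det_transpose[OF M] by simp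
  then obtain c where c: "c \<in> carrier_vec (Suc g)" "c \<noteq> 0\<^sub>v (Suc g)" "M *\<^sub>v c = 0\<^sub>v (Suc g)"
    unfolding det_0_iff_vec_prod_zero[OF M] by auto
  define p where "p = (\<Sum>j<Suc g. Polynomial.monom (c $ j) j)"
  have cp: "Polynomial.coeff p j = (if j < Suc g then c $ j else 0)" for j
    unfolding p_def coeff_sum coeff_monom by (simp del: sum.lessThan_Suc)
  have "\<exists>j<Suc g. c $ j \<noteq> 0"
  proof (rule ccontr)
    assume "\<not> ?thesis"
    then have "c = 0\<^sub>v (Suc g)" using c(1) by (intro eq_vecI) auto
    then show False using c(2) by simp
  qed
  then have "p \<noteq> 0" using cp by (metis coeff_0)
  moreover have "Polynomial.degree p \<le> g" by (rule degree_le) (simp add: cp)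
  then have deg: "Polynomial.degree p < Suc g" by simp
  have "horner_apply g B v p = 0\<^sub>v g"
  proof (rule eq_vecI)
    fix i assume "i < dim_vec (0\<^sub>v g :: complex vec)"
    then have i: "i < g" by simp
    have "(M *\<^sub>v c) $ i = (\<Sum>j<Suc g. M $$ (i,j) * c $ j)"
      by (rule mat_vec_index_sum[OF M c(1)]) (use i in simp)
    also have "\<dots> = (\<Sum>j<Suc g. Polynomial.coeff p j * (B ^\<^sub>m j *\<^sub>v v) $ i)"
      using i by (intro sum.cong) (auto simp: M_def cp)
    also have "\<dots> = horner_apply g B v p $ i"
      by (rule horner_apply_index[OF deg i, symmetric])
    finally show "horner_apply g B v p $ i = 0\<^sub>v g $ i" using c(3) i by simp
  qed (use carrier_vecD[OF horner_apply_carrier[of p]] in simp)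
  ultimately show ?thesis by blast
qed

text \<open>Linear factors are removed from an annihilating polynomial until the remaining
  \<open>q\<close> no longer kills \<open>v\<close>; then \<open>q(B) v\<close> is an eigenvector
  for the root removed last. The form \<open>q(B) v\<close> matters, because it preserves
  eigenvectors of matrices commuting with \<open>B\<close>.\<close>

lemma eigenvector_in_cyclic_subspace:
  assumes v0: "v \<noteq> 0\<^sub>v g"
  obtains q \<mu> where "horner_apply g B v q \<noteq> 0\<^sub>v g" "B *\<^sub>v horner_apply g B v q = \<mu> \<cdot>\<^sub>v horner_apply g B v q"
proof -
  have "\<exists>q \<mu>. horner_apply g B v q \<noteq> 0\<^sub>v g \<and> B *\<^sub>v horner_apply g B v q = \<mu> \<cdot>\<^sub>v horner_apply g B v q"
    if "p \<noteq> 0" "horner_apply g B v p = 0\<^sub>v g" for p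
    using that
  proof (induction "Polynomial.degree p" arbitrary: p)
    case 0
    then obtain c where c: "p = [:c:]" by (metis degree_eq_zeroE)
    have "B *\<^sub>v 0\<^sub>v g = 0\<^sub>v g" using B by (intro eq_vecI) auto
    then have "c \<cdot>\<^sub>v v = 0\<^sub>v g" using 0 c v by (simp add: horner_apply_pCons)
    moreover have "c \<noteq> 0" using 0 c by simp
    moreover have "c * v $ i = (c \<cdot>\<^sub>v v) $ i" if "i < g" for i using that v by simp
    ultimately have "v = 0\<^sub>v g" using v by (intro eq_vecI) auto
    then show ?case using v0 by simp
  next
    case (Suc d)
    then obtain a where "poly p a = 0"
      using fundamental_theorem_of_algebra_alt[of p] by (metis degree_pCons_0 nat.distinct(1) that)
    then obtain q where q: "p = [:- a, 1:] * q" by (metis dvdE poly_eq_0_iff_dvd)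
    have q0: "q \<noteq> 0" using Suc.prems q by auto
    have "Polynomial.degree p = Suc (Polynomial.degree q)" unfolding q using q0 by (subst degree_mult_eq) auto
    then have dq: "d = Polynomial.degree q" using Suc by simp
    show ?case
    proof (cases "horner_apply g B v q = 0\<^sub>v g")
      case True
      show ?thesis by (rule Suc.hyps(1)[OF dq q0 True])
    next
      case False
      have "B *\<^sub>v horner_apply g B v q - a \<cdot>\<^sub>v horner_apply g B v q = 0\<^sub>v g"
        using Suc.prems(2) unfolding q horner_apply_linear_factor .
      then have eq: "(B *\<^sub>v horner_apply g B v q - a \<cdot>\<^sub>v horner_apply g B v q) $ i = 0" if "i < g" for i
        using that by simp
      have "B *\<^sub>v horner_apply g B v q = a \<cdot>\<^sub>v horner_apply g B v q"
        using eq B carrier_vecD[OF horner_apply_carrier[of q]] by (intro eq_vecI) (auto simp del: index_mult_mat_vec)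
      then show ?thesis using False by blast
    qed
  qed
  then show ?thesis using annihilating_polynomial that by blast
qed

lemma horner_apply_eigen:
  assumes C: "C \<in> carrier_mat g g" and comm: "C * B = B * C" and ev: "C *\<^sub>v v = c \<cdot>\<^sub>v v"
  shows "C *\<^sub>v horner_apply g B v p = c \<cdot>\<^sub>v horner_apply g B v p"
proof (induction p)
  case 0 show ?case using C by (auto intro!: eq_vecI)
next
  case (pCons a p)
  let ?w = "horner_apply g B v p"
  have "C *\<^sub>v (a \<cdot>\<^sub>v v + B *\<^sub>v ?w) = a \<cdot>\<^sub>v (C *\<^sub>v v) + (C * B) *\<^sub>v ?w"
    using B C v by (simp add: mult_add_distrib_mat_vec[OF C] mult_mat_vec[OF C] assoc_mult_mat_vec[OF C B])
  also have "\<dots> = a \<cdot>\<^sub>v (c \<cdot>\<^sub>v v) + B *\<^sub>v (c \<cdot>\<^sub>v ?w)"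
    unfolding comm ev using assoc_mult_mat_vec[OF B C horner_apply_carrier[of p]] pCons.IH by simp
  also have "\<dots> = c \<cdot>\<^sub>v (a \<cdot>\<^sub>v v + B *\<^sub>v ?w)"
    using B v by (simp add: mult_mat_vec[OF B] smult_add_distrib_vec[of _ g] smult_smult_assoc mult.commute)
  finally show ?case by (simp only: horner_apply_pCons)
qed

end

section \<open>From commuting matrices to embeddings of a number field\<close>

lemma rational_scalars:
  fixes \<theta> :: "rat \<Rightarrow> complex mat"
  assumes car: "\<And>q. \<theta> q \<in> carrier_mat g g"
    and add: "\<And>p q. \<theta> (p + q) = \<theta> p + \<theta> q"
    and mult: "\<And>p q. \<theta> (p * q) = \<theta> p * \<theta> q"
    and one: "\<theta> 1 = 1\<^sub>m g"
    and v: "v \<in> carrier_vec g"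
  shows "\<theta> q *\<^sub>v v = of_rat q \<cdot>\<^sub>v v"
proof -
  define P where "P q \<longleftrightarrow> (\<forall>w\<in>carrier_vec g. \<theta> q *\<^sub>v w = of_rat q \<cdot>\<^sub>v w)" for q
  have tv: "\<theta> q *\<^sub>v w \<in> carrier_vec g" if "w \<in> carrier_vec g" for q w
    using car that by (rule mult_mat_vec_carrier)
  have addv: "\<theta> (p + q) *\<^sub>v w = \<theta> p *\<^sub>v w + \<theta> q *\<^sub>v w" if "w \<in> carrier_vec g" for p q w
    unfolding add by (rule add_mult_distrib_mat_vec[OF car car that])
  have P1: "P 1" unfolding P_def one by simp
  have P0: "P 0" unfolding P_def
  proof
    fix w :: "complex vec" assume w: "w \<in> carrier_vec g"
    have "\<theta> 0 *\<^sub>v w = \<theta> 0 *\<^sub>v w + \<theta> 0 *\<^sub>v w" using addv[OF w, of 0 0] by simp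
    then have "(\<theta> 0 *\<^sub>v w) $ i = (\<theta> 0 *\<^sub>v w) $ i + (\<theta> 0 *\<^sub>v w) $ i" if "i < g" for i
      using that tv[OF w, of 0] by (metis carrier_vecD index_add_vec(1))
    then show "\<theta> 0 *\<^sub>v w = of_rat 0 \<cdot>\<^sub>v w"
      using carrier_vecD[OF tv[OF w, of 0]] w by (intro eq_vecI) (auto simp del: index_mult_mat_vec)
  qed
  have Padd: "P (p + q)" if "P p" "P q" for p q
    using that unfolding P_def by (auto simp: addv of_rat_add add_smult_distrib_vec)
  have Pminus: "P (- q)" if "P q" for q unfolding P_def
  proof
    fix w :: "complex vec" assume w: "w \<in> carrier_vec g"
    have "\<theta> (- q) *\<^sub>v w + of_rat q \<cdot>\<^sub>v w = 0 \<cdot>\<^sub>v w"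
      using addv[OF w, of "- q" q] P0 that w unfolding P_def by simp
    then have "(\<theta> (- q) *\<^sub>v w) $ i + of_rat q * w $ i = 0" if "i < g" for i
      using that w carrier_vecD[OF tv[OF w, of "- q"]]
      by (metis carrier_vecD index_add_vec(1) index_smult_vec(1) index_smult_vec(2) mult_zero_left)
    then show "\<theta> (- q) *\<^sub>v w = of_rat (- q) \<cdot>\<^sub>v w"
      using carrier_vecD[OF tv[OF w, of "- q"]] w
      by (intro eq_vecI) (auto simp: of_rat_minus eq_neg_iff_add_eq_0 simp del: index_mult_mat_vec)
  qed
  have Pnat: "P (of_nat n)" for n
    by (induction n) (auto simp: P0 intro: Padd P1)
  have Pint: "P (of_int m)" for m
    by (cases m rule: int_cases2) (auto simp: Pnat Pminus)
  obtain a b where ab: "quotient_of q = (a, b)" by (cases "quotient_of q")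
  then have q: "q = of_int a / of_int b" and b: "b > 0"
    by (auto simp: quotient_of_div quotient_of_denom_pos)
  have "\<theta> (of_int b) *\<^sub>v (\<theta> q *\<^sub>v v) = \<theta> (of_int a) *\<^sub>v v"
  proof -
    have "of_int b * q = of_int a" using q b by simp
    then have "\<theta> (of_int b) * \<theta> q = \<theta> (of_int a)" by (metis mult)
    then show ?thesis using assoc_mult_mat_vec[OF car car v] by metis
  qed
  then have "of_int b \<cdot>\<^sub>v (\<theta> q *\<^sub>v v) = of_int a \<cdot>\<^sub>v v"
    using Pint[of a] Pint[of b] v tv[OF v] unfolding P_def by simp
  then have "of_int b * (\<theta> q *\<^sub>v v) $ i = of_int a * v $ i" if "i < g" for i
    using that v tv[OF v, of q] by (metis carrier_vecD index_smult_vec(1))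
  then have "(\<theta> q *\<^sub>v v) $ i = of_rat q * v $ i" if "i < g" for i
    using that b by (simp add: q of_rat_divide field_simps del: index_mult_mat_vec)
  then show ?thesis using carrier_vecD[OF tv[OF v, of q]] v
    by (intro eq_vecI) (auto simp del: index_mult_mat_vec)
qed

text \<open>An eigenvector \<open>v\<close> of \<open>A\<close> may be replaced by \<open>p(B) v\<close> for a polynomial \<open>p\<close> in some \<open>B\<close> that commutes with \<open>A\<close>;
  this makes \<open>v\<close> an eigenvector for the elements of a \<open>\<rat>\<close>-basis of \<open>F\<close>, one after the other.\<close>

lemma common_eigenvector:
  fixes F :: "'k ring" and \<psi> :: "'k \<Rightarrow> complex mat"
  assumes nf: "number_field F"
    and car: "\<And>x. x \<in> carrier F \<Longrightarrow> \<psi> x \<in> carrier_mat g g"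
    and add: "\<And>x y. x \<in> carrier F \<Longrightarrow> y \<in> carrier F \<Longrightarrow> \<psi> (x \<oplus>\<^bsub>F\<^esub> y) = \<psi> x + \<psi> y"
    and mult: "\<And>x y. x \<in> carrier F \<Longrightarrow> y \<in> carrier F \<Longrightarrow> \<psi> (x \<otimes>\<^bsub>F\<^esub> y) = \<psi> x * \<psi> y"
    and one: "\<psi> \<one>\<^bsub>F\<^esub> = 1\<^sub>m g"
    and A: "A \<in> carrier_mat g g"
    and comm: "\<And>x. x \<in> carrier F \<Longrightarrow> \<psi> x * A = A * \<psi> x"
    and ev: "eigenvalue A \<mu>"
  obtains \<chi> v where "\<chi> \<in> Ring.ring_hom F (class_ring :: complex ring)" "v \<in> carrier_vec g" "v \<noteq> 0\<^sub>v g"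
    "A *\<^sub>v v = \<mu> \<cdot>\<^sub>v v" "\<And>x. x \<in> carrier F \<Longrightarrow> \<psi> x *\<^sub>v v = \<chi> x \<cdot>\<^sub>v v"
proof -
  from nf interpret field F unfolding number_field_def by simp
  obtain Q where Q: "subfield Q F" "(class_ring :: rat ring) \<simeq> F\<lparr>carrier := Q\<rparr>" "finite_dimension Q (carrier F)"
    using nf unfolding number_field_def by auto
  have QF: "Q \<subseteq> carrier F" using Q(1) by (rule subfieldE(3))
  obtain h where h: "h \<in> ring_iso (class_ring :: rat ring) (F\<lparr>carrier := Q\<rparr>)"
    using Q(2) unfolding is_ring_iso_def by auto
  have hh: "h \<in> Ring.ring_hom (class_ring :: rat ring) (F\<lparr>carrier := Q\<rparr>)"
    using h unfolding ring_iso_def by simp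
  have h_mem: "h q \<in> Q" for q using ring_hom_closed[OF hh, of q] by simp
  have h_surj: "\<exists>q. x = h q" if "x \<in> Q" for x
    using h that unfolding ring_iso_def bij_betw_def by auto
  have scal: "\<exists>c. \<forall>v\<in>carrier_vec g. \<psi> k *\<^sub>v v = c \<cdot>\<^sub>v v" if k: "k \<in> Q" for k
  proof -
    obtain q where q: "k = h q" using h_surj[OF k] by auto
    have hF: "h q \<in> carrier F" for q using h_mem QF by auto
    have "\<psi> (h q) *\<^sub>v v = of_rat q \<cdot>\<^sub>v v" if v: "v \<in> carrier_vec g" for v
    proof (rule rational_scalars[where \<theta> = "\<lambda>q. \<psi> (h q)", OF _ _ _ _ v])
      show "\<psi> (h q) \<in> carrier_mat g g" for q using car hF .
      show "\<psi> (h (p + q)) = \<psi> (h p) + \<psi> (h q)" for p q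
        using ring_hom_add[OF hh, of p q] add[OF hF hF, of p q] by simp
      show "\<psi> (h (p * q)) = \<psi> (h p) * \<psi> (h q)" for p q
        using ring_hom_mult[OF hh, of p q] mult[OF hF hF, of p q] by simp
      show "\<psi> (h 1) = 1\<^sub>m g" using ring_hom_one[OF hh] one by simp
    qed
    then show ?thesis unfolding q by blast
  qed
  have zero: "\<psi> \<zero>\<^bsub>F\<^esub> *\<^sub>v v = 0 \<cdot>\<^sub>v v" if v: "v \<in> carrier_vec g" for v
  proof -
    have t: "\<psi> \<zero>\<^bsub>F\<^esub> *\<^sub>v v \<in> carrier_vec g" using car[OF zero_closed] v by simp
    have "\<psi> \<zero>\<^bsub>F\<^esub> *\<^sub>v v = \<psi> \<zero>\<^bsub>F\<^esub> *\<^sub>v v + \<psi> \<zero>\<^bsub>F\<^esub> *\<^sub>v v"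
      using add[OF zero_closed zero_closed] add_mult_distrib_mat_vec[OF car[OF zero_closed] car[OF zero_closed] v] by simp
    then have "(\<psi> \<zero>\<^bsub>F\<^esub> *\<^sub>v v) $ i = (\<psi> \<zero>\<^bsub>F\<^esub> *\<^sub>v v) $ i + (\<psi> \<zero>\<^bsub>F\<^esub> *\<^sub>v v) $ i" if "i < g" for i
      using that t by (metis carrier_vecD index_add_vec(1))
    then show ?thesis using carrier_vecD[OF t] v by (intro eq_vecI) (auto simp del: index_mult_mat_vec)
  qed
  \<comment> \<open>Induction over the construction of \<open>carrier F\<close> as a
    finite-dimensional space over \<open>Q\<close>. The equation \<open>K = Q\<close> is carried
    along because the induction rule generalizes the base field.\<close>
  have claim: "E \<subseteq> carrier F \<and> (\<exists>v\<in>carrier_vec g. v \<noteq> 0\<^sub>v g \<and> A *\<^sub>v v = \<mu> \<cdot>\<^sub>v v \<and> (\<forall>x\<in>E. \<exists>c. \<psi> x *\<^sub>v v = c \<cdot>\<^sub>v v))"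
    if "dimension n K E" "K = Q" for n K E
    using that
  proof (induction rule: dimension.induct)
    case (zero_dim K)
    obtain v where "v \<in> carrier_vec g" "v \<noteq> 0\<^sub>v g" "A *\<^sub>v v = \<mu> \<cdot>\<^sub>v v"
      using ev A unfolding eigenvalue_def eigenvector_def by auto
    then show ?case using zero by auto
  next
    case (Suc_dim u E n K)
    then obtain v where v: "v \<in> carrier_vec g" "v \<noteq> 0\<^sub>v g" "A *\<^sub>v v = \<mu> \<cdot>\<^sub>v v"
      and E: "E \<subseteq> carrier F" and Ev: "\<And>x. x \<in> E \<Longrightarrow> \<exists>c. \<psi> x *\<^sub>v v = c \<cdot>\<^sub>v v" by auto
    have u: "\<psi> u \<in> carrier_mat g g" using car Suc_dim by simp
    obtain q \<nu> where q: "horner_apply g (\<psi> u) v q \<noteq> 0\<^sub>v g"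
      "\<psi> u *\<^sub>v horner_apply g (\<psi> u) v q = \<nu> \<cdot>\<^sub>v horner_apply g (\<psi> u) v q"
      using eigenvector_in_cyclic_subspace[OF u v(1,2)] by blast
    define w where "w = horner_apply g (\<psi> u) v q"
    have w: "w \<in> carrier_vec g" unfolding w_def by (rule horner_apply_carrier[OF u v(1)])
    have Aw: "A *\<^sub>v w = \<mu> \<cdot>\<^sub>v w" unfolding w_def
      by (rule horner_apply_eigen[OF u v(1) A _ v(3)]) (use comm Suc_dim in simp)
    have Ew: "\<exists>c. \<psi> x *\<^sub>v w = c \<cdot>\<^sub>v w" if x: "x \<in> E" for x
    proof -
      have xF: "x \<in> carrier F" using x E by auto
      obtain c where c: "\<psi> x *\<^sub>v v = c \<cdot>\<^sub>v v" using Ev[OF x] by auto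
      have "\<psi> x * \<psi> u = \<psi> u * \<psi> x"
        using mult[OF xF Suc_dim(1)] mult[OF Suc_dim(1) xF] m_comm[OF xF Suc_dim(1)] by simp
      then show ?thesis unfolding w_def using horner_apply_eigen[OF u v(1) car[OF xF] _ c] by blast
    qed
    have sub: "line_extension K u E \<subseteq> carrier F"
    proof
      fix x assume "x \<in> line_extension K u E"
      then obtain k e where ke: "k \<in> Q" "e \<in> E" "x = k \<otimes>\<^bsub>F\<^esub> u \<oplus>\<^bsub>F\<^esub> e"
        using Suc_dim(5) by (auto simp: line_extension_mem_iff)
      then have "k \<in> carrier F" "e \<in> carrier F" using QF E by auto
      then show "x \<in> carrier F" unfolding ke(3) using Suc_dim(1) by simp
    qed
    moreover have "\<exists>c. \<psi> x *\<^sub>v w = c \<cdot>\<^sub>v w" if x: "x \<in> line_extension K u E" for x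
    proof -
      obtain k e where ke: "k \<in> Q" "e \<in> E" "x = k \<otimes>\<^bsub>F\<^esub> u \<oplus>\<^bsub>F\<^esub> e" using x Suc_dim(5) by (auto simp: line_extension_mem_iff)
      have kF: "k \<in> carrier F" and eF: "e \<in> carrier F" using ke QF E by auto
      obtain c1 where c1: "\<psi> k *\<^sub>v w = c1 \<cdot>\<^sub>v w" using scal[OF ke(1)] w by blast
      obtain c2 where c2: "\<psi> e *\<^sub>v w = c2 \<cdot>\<^sub>v w" using Ew[OF ke(2)] by auto
      have "\<psi> x = \<psi> k * \<psi> u + \<psi> e" unfolding ke(3) using add mult kF eF Suc_dim(1) by simp
      then have "\<psi> x *\<^sub>v w = \<psi> k *\<^sub>v (\<psi> u *\<^sub>v w) + \<psi> e *\<^sub>v w"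
        using add_mult_distrib_mat_vec[OF mult_carrier_mat[OF car[OF kF] u] car[OF eF] w] assoc_mult_mat_vec[OF car[OF kF] u w] by simp
      also have "\<dots> = \<nu> \<cdot>\<^sub>v (c1 \<cdot>\<^sub>v w) + c2 \<cdot>\<^sub>v w"
        using q(2) c1 c2 mult_mat_vec[OF car[OF kF] w] unfolding w_def by simp
      also have "\<dots> = (\<nu> * c1 + c2) \<cdot>\<^sub>v w" using w by (simp add: add_smult_distrib_vec smult_smult_assoc)
      finally show ?thesis by blast
    qed
    moreover have "w \<noteq> 0\<^sub>v g" using q(1) by (simp add: w_def)
    ultimately show ?case using w Aw by blast
  qed
  obtain n where "dimension n Q (carrier F)" using Q(3) unfolding finite_dimension_def by auto
  from claim[OF this refl] obtain v where v: "v \<in> carrier_vec g" "v \<noteq> 0\<^sub>v g" "A *\<^sub>v v = \<mu> \<cdot>\<^sub>v v"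
    and "\<forall>x\<in>carrier F. \<exists>c. \<psi> x *\<^sub>v v = c \<cdot>\<^sub>v v" by blast
  then obtain \<chi> where \<chi>: "\<And>x. x \<in> carrier F \<Longrightarrow> \<psi> x *\<^sub>v v = \<chi> x \<cdot>\<^sub>v v" by metis
  obtain i where i: "i < g" "v $ i \<noteq> 0" using v(1,2) by (metis carrier_vecD eq_vecI index_zero_vec)
  \<comment> \<open>The eigenvalue at a common non-zero vector is unique, so the ring laws pass from
    \<open>\<psi>\<close> to \<open>\<chi>\<close>.\<close>
  have unique: "c = d" if "c \<cdot>\<^sub>v v = d \<cdot>\<^sub>v v" for c d
  proof -
    have "(c \<cdot>\<^sub>v v) $ i = (d \<cdot>\<^sub>v v) $ i" using that by simp
    then show ?thesis using i v(1) by simp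
  qed
  have "\<chi> \<in> Ring.ring_hom F (class_ring :: complex ring)"
  proof (rule ring_hom_memI)
    fix x y assume xy: "x \<in> carrier F" "y \<in> carrier F"
    have "\<chi> (x \<otimes>\<^bsub>F\<^esub> y) \<cdot>\<^sub>v v = \<psi> x *\<^sub>v (\<psi> y *\<^sub>v v)"
      using \<chi>[OF m_closed[OF xy]] mult[OF xy] assoc_mult_mat_vec[OF car[OF xy(1)] car[OF xy(2)] v(1)] by simp
    also have "\<dots> = (\<chi> x * \<chi> y) \<cdot>\<^sub>v v"
      using \<chi> xy mult_mat_vec[OF car[OF xy(1)] v(1)] by (simp add: smult_smult_assoc mult.commute)
    finally show "\<chi> (x \<otimes>\<^bsub>F\<^esub> y) = \<chi> x \<otimes>\<^bsub>class_ring\<^esub> \<chi> y" using unique by simp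
    have "\<chi> (x \<oplus>\<^bsub>F\<^esub> y) \<cdot>\<^sub>v v = \<psi> x *\<^sub>v v + \<psi> y *\<^sub>v v"
      using \<chi>[OF a_closed[OF xy]] add[OF xy] add_mult_distrib_mat_vec[OF car[OF xy(1)] car[OF xy(2)] v(1)] by simp
    also have "\<dots> = (\<chi> x + \<chi> y) \<cdot>\<^sub>v v" using \<chi> xy by (simp add: add_smult_distrib_vec)
    finally show "\<chi> (x \<oplus>\<^bsub>F\<^esub> y) = \<chi> x \<oplus>\<^bsub>class_ring\<^esub> \<chi> y" using unique by simp
  next
    have "\<chi> \<one>\<^bsub>F\<^esub> \<cdot>\<^sub>v v = 1 \<cdot>\<^sub>v v" using \<chi>[OF one_closed] one v(1) by simp
    then show "\<chi> \<one>\<^bsub>F\<^esub> = \<one>\<^bsub>class_ring\<^esub>" using unique by simp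
  qed simp
  then show ?thesis using that v \<chi> by blast
qed

section \<open>Homomorphisms between fields\<close>

context
  fixes E :: "'k ring" and \<sigma> :: "'k \<Rightarrow> 'b :: field"
  assumes E: "field E" and \<sigma>: "\<sigma> \<in> Ring.ring_hom E (class_ring :: 'b ring)"
begin

lemma hom_add: "x \<in> carrier E \<Longrightarrow> y \<in> carrier E \<Longrightarrow> \<sigma> (x \<oplus>\<^bsub>E\<^esub> y) = \<sigma> x + \<sigma> y"
  using ring_hom_add[OF \<sigma>] by simp

lemma hom_mult: "x \<in> carrier E \<Longrightarrow> y \<in> carrier E \<Longrightarrow> \<sigma> (x \<otimes>\<^bsub>E\<^esub> y) = \<sigma> x * \<sigma> y"
  using ring_hom_mult[OF \<sigma>] by simp

lemma hom_one: "\<sigma> \<one>\<^bsub>E\<^esub> = 1"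
  using ring_hom_one[OF \<sigma>] by simp

lemma hom_zero: "\<sigma> \<zero>\<^bsub>E\<^esub> = 0"
proof -
  interpret field E by (rule E)
  have "\<sigma> (\<zero>\<^bsub>E\<^esub> \<oplus>\<^bsub>E\<^esub> \<zero>\<^bsub>E\<^esub>) = \<sigma> \<zero>\<^bsub>E\<^esub> + \<sigma> \<zero>\<^bsub>E\<^esub>" by (rule hom_add) simp_all
  then have "\<sigma> \<zero>\<^bsub>E\<^esub> + 0 = \<sigma> \<zero>\<^bsub>E\<^esub> + \<sigma> \<zero>\<^bsub>E\<^esub>" by simp
  then show ?thesis by (simp only: add_left_cancel)
qed

lemma hom_uminus: "x \<in> carrier E \<Longrightarrow> \<sigma> (\<ominus>\<^bsub>E\<^esub> x) = - \<sigma> x"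
proof -
  interpret field E by (rule E)
  assume x: "x \<in> carrier E"
  have "\<sigma> (\<ominus>\<^bsub>E\<^esub> x \<oplus>\<^bsub>E\<^esub> x) = \<sigma> (\<ominus>\<^bsub>E\<^esub> x) + \<sigma> x" by (rule hom_add) (simp_all add: x)
  then show ?thesis using x hom_zero by (simp add: l_neg eq_neg_iff_add_eq_0)
qed

lemma hom_minus: "x \<in> carrier E \<Longrightarrow> y \<in> carrier E \<Longrightarrow> \<sigma> (x \<ominus>\<^bsub>E\<^esub> y) = \<sigma> x - \<sigma> y"
proof -
  interpret field E by (rule E)
  assume "x \<in> carrier E" "y \<in> carrier E"
  then show ?thesis by (simp add: a_minus_def hom_add hom_uminus)
qed

lemma hom_eq_0:
  assumes x: "x \<in> carrier E" "\<sigma> x = 0"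
  shows "x = \<zero>\<^bsub>E\<^esub>"
proof (rule ccontr)
  interpret field E by (rule E)
  assume "x \<noteq> \<zero>\<^bsub>E\<^esub>"
  then have u: "x \<in> Units E" using x(1) field_Units by auto
  have "\<sigma> (x \<otimes>\<^bsub>E\<^esub> inv\<^bsub>E\<^esub> x) = \<sigma> x * \<sigma> (inv\<^bsub>E\<^esub> x)" using u by (intro hom_mult) auto
  then show False using u x(2) hom_one by (simp add: Units_r_inv)
qed

lemma hom_inj: "x \<in> carrier E \<Longrightarrow> y \<in> carrier E \<Longrightarrow> \<sigma> x = \<sigma> y \<Longrightarrow> x = y"
proof -
  interpret field E by (rule E)
  assume xy: "x \<in> carrier E" "y \<in> carrier E" "\<sigma> x = \<sigma> y"
  then have "x \<ominus>\<^bsub>E\<^esub> y = \<zero>\<^bsub>E\<^esub>" by (intro hom_eq_0) (simp_all add: hom_minus)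
  then show "x = y" using xy by (simp add: r_right_minus_eq)
qed

end

section \<open>Entropy and the number field of endomorphisms\<close>

lemma EndQ_ring_simps [simp]:
  "monoid.mult (EndQ_ring g L) = (*)" "ring.add (EndQ_ring g L) = (+)"
  "monoid.one (EndQ_ring g L) = 1\<^sub>m g" "ring.zero (EndQ_ring g L) = 0\<^sub>m g g"
  unfolding EndQ_ring_def ring_mat_def by simp_all

lemma EndQ_ring_carrier_mat: "x \<in> carrier (EndQ_ring g L) \<Longrightarrow> x \<in> carrier_mat g g"
  unfolding EndQ_ring_def End_ring_def by auto

lemma End_ring_carrier:
  "A \<in> carrier (End_ring g L) \<longleftrightarrow> A \<in> carrier_mat g g \<and> (\<forall>v\<in>L. A *\<^sub>v v \<in> L)"
  unfolding End_ring_def by simp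

lemma EndQ_ring_carrier:
  "x \<in> carrier (EndQ_ring g L) \<longleftrightarrow> (\<exists>q A. x = of_rat q \<cdot>\<^sub>m A \<and> A \<in> carrier (End_ring g L))"
  unfolding EndQ_ring_def by auto

lemma End_in_EndQ: "A \<in> carrier (End_ring g L) \<Longrightarrow> A \<in> carrier (EndQ_ring g L)"
  unfolding EndQ_ring_carrier by (intro exI[of _ 1] exI[of _ A]) auto

lemma End_torus_endomorphism:
  assumes "full_lattice g (carrier_vec g) L" "A \<in> carrier (End_ring g L)"
  shows "\<exists>r R. torus_endomorphism g L r R A"
proof -
  obtain r R where "cocompact_lattice g L r R" using full_lattice_cocompact[OF assms(1)] by auto
  then have "torus_endomorphism g L r R A"
    using assms(2) by (simp add: torus_endomorphism_def torus_endomorphism_axioms_def End_ring_carrier)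
  then show ?thesis by blast
qed

lemma cmod_1_independent_totally_real:
  assumes E: "totally_real_field E" and f: "f \<in> carrier E"
    and \<sigma>: "\<sigma> \<in> Ring.ring_hom E (class_ring :: complex ring)" "cmod (\<sigma> f) = 1"
    and \<chi>: "\<chi> \<in> Ring.ring_hom E (class_ring :: complex ring)"
  shows "cmod (\<chi> f) = 1"
proof -
  have fE: "field E" using E unfolding totally_real_field_def number_field_def by simp
  interpret field E by (rule fE)
  have "\<sigma> f \<in> \<real>" using E \<sigma>(1) f unfolding totally_real_field_def by auto
  then obtain x where x: "\<sigma> f = complex_of_real x" by (auto elim: Reals_cases)
  then have "x = 1 \<or> x = - 1" using \<sigma>(2) by auto
  then show ?thesis
  proof
    assume "x = 1"
    then have "f = \<one>\<^bsub>E\<^esub>" using x f by (intro hom_inj[OF fE \<sigma>(1)]) (simp_all add: hom_one[OF fE \<sigma>(1)])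
    then show ?thesis by (simp add: hom_one[OF fE \<chi>])
  next
    assume "x = - 1"
    then have "f = \<ominus>\<^bsub>E\<^esub> \<one>\<^bsub>E\<^esub>" using x f
      by (intro hom_inj[OF fE \<sigma>(1)]) (simp_all add: hom_one[OF fE \<sigma>(1)] hom_uminus[OF fE \<sigma>(1)])
    then show ?thesis by (simp add: hom_one[OF fE \<chi>] hom_uminus[OF fE \<chi>])
  qed
qed

text \<open>The other root of the real quadratic is the complex conjugate, and the product of the
  roots is \<open>- n\<close>.\<close>

lemma nonreal_root_norm:
  assumes "z\<^sup>2 = complex_of_real t * z + complex_of_real n" "z \<notin> \<real>"
  shows "(cmod z)\<^sup>2 = - n"
proof -
  have im: "Im z \<noteq> 0" using assms(2) complex_is_Real_iff by blast
  have "Im (z\<^sup>2) = t * Im z" "Re (z\<^sup>2) = t * Re z + n" using assms(1) by simp_all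
  then have "2 * Re z * Im z = t * Im z" and re: "(Re z)\<^sup>2 - (Im z)\<^sup>2 = t * Re z + n"
    by (simp_all add: power2_eq_square)
  then have "t = 2 * Re z" using im by simp
  then show ?thesis using re unfolding cmod_power2 by (simp add: power2_eq_square)
qed

text \<open>If \<open>f\<close> lies outside the real subfield \<open>K\<close>, then
  \<open>f\<^sup>2 = t f + n\<close> over \<open>K\<close> and no embedding makes \<open>f\<close>
  real. Hence \<open>|f|\<^sup>2 = - n\<close> in every embedding, and \<open>n = - 1\<close> is an
  equation in the field itself.\<close>

lemma cmod_1_independent_CM:
  assumes E: "CM_field E" and f: "f \<in> carrier E"
    and \<sigma>: "\<sigma> \<in> Ring.ring_hom E (class_ring :: complex ring)" "cmod (\<sigma> f) = 1"
    and \<chi>: "\<chi> \<in> Ring.ring_hom E (class_ring :: complex ring)"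
  shows "cmod (\<chi> f) = 1"
proof -
  have fE: "field E" using E unfolding CM_field_def totally_imaginary_field_def number_field_def by simp
  interpret field E by (rule fE)
  obtain K where K: "subfield K E" "totally_real_field (E\<lparr>carrier := K\<rparr>)" "dimension 2 K (carrier E)"
    using E unfolding CM_field_def by auto
  have KE: "K \<subseteq> carrier E" using K(1) by (rule subfieldE(3))
  have restrict: "\<tau> \<in> Ring.ring_hom (E\<lparr>carrier := K\<rparr>) (class_ring :: complex ring)"
    if "\<tau> \<in> Ring.ring_hom E (class_ring :: complex ring)" for \<tau>
    using KE by (intro ring_hom_memI) (auto simp: hom_add[OF fE that] hom_mult[OF fE that] hom_one[OF fE that] subset_iff)
  have realK: "\<tau> k \<in> \<real>" if "\<tau> \<in> Ring.ring_hom E (class_ring :: complex ring)" "k \<in> K" for \<tau> k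
    using K(2) restrict[OF that(1)] that(2) unfolding totally_real_field_def by auto
  show ?thesis
  proof (cases "f \<in> K")
    case True
    show ?thesis
      using cmod_1_independent_totally_real[OF K(2) _ restrict[OF \<sigma>(1)] \<sigma>(2) restrict[OF \<chi>]] True by simp
  next
    case False
    have span1: "Span K [\<one>\<^bsub>E\<^esub>] = K"
    proof -
      have "u \<in> Span K [\<one>\<^bsub>E\<^esub>] \<longleftrightarrow> u \<in> K" for u
        using KE by (auto simp: line_extension_mem_iff subset_iff)
      then show ?thesis by blast
    qed
    have ind: "independent K [f, \<one>\<^bsub>E\<^esub>]"
    proof (rule li_Cons)
      show "f \<notin> Span K [\<one>\<^bsub>E\<^esub>]" unfolding span1 by (rule False)
      show "independent K [\<one>\<^bsub>E\<^esub>]" by (rule li_Cons) simp_all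
    qed (rule f)
    have span: "Span K [f, \<one>\<^bsub>E\<^esub>] = carrier E"
      using independent_length_eq_dimension[OF K(1) K(3) ind] f by simp
    have dec: "\<exists>k\<in>K. \<exists>l\<in>K. u = k \<otimes>\<^bsub>E\<^esub> f \<oplus>\<^bsub>E\<^esub> l" if "u \<in> carrier E" for u
    proof -
      have "u \<in> line_extension K f (Span K [\<one>\<^bsub>E\<^esub>])" using that span by simp
      then show ?thesis unfolding span1 line_extension_mem_iff .
    qed
    obtain t n where tn: "t \<in> K" "n \<in> K" "f \<otimes>\<^bsub>E\<^esub> f = t \<otimes>\<^bsub>E\<^esub> f \<oplus>\<^bsub>E\<^esub> n"
      using dec[of "f \<otimes>\<^bsub>E\<^esub> f"] f by auto
    have tE: "t \<in> carrier E" and nE: "n \<in> carrier E" using tn KE by auto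
    have norm: "complex_of_real ((cmod (\<tau> f))\<^sup>2) = - \<tau> n" if \<tau>: "\<tau> \<in> Ring.ring_hom E (class_ring :: complex ring)" for \<tau>
    proof -
      obtain t' where t': "\<tau> t = complex_of_real t'" using realK[OF \<tau> tn(1)] by (auto elim: Reals_cases)
      obtain n' where n': "\<tau> n = complex_of_real n'" using realK[OF \<tau> tn(2)] by (auto elim: Reals_cases)
      have "\<tau> (f \<otimes>\<^bsub>E\<^esub> f) = \<tau> t * \<tau> f + \<tau> n"
        unfolding tn(3) using f tE nE by (simp add: hom_add[OF fE \<tau>] hom_mult[OF fE \<tau>])
      then have eq: "(\<tau> f)\<^sup>2 = complex_of_real t' * \<tau> f + complex_of_real n'"
        using f by (simp add: hom_mult[OF fE \<tau>] power2_eq_square t' n')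
      \<comment> \<open>A real value of \<open>f\<close> would make all of
        \<open>E = K f + K\<close> real, against total imaginarity.\<close>
      have "\<tau> f \<notin> \<real>"
      proof
        assume r: "\<tau> f \<in> \<real>"
        have "\<tau> u \<in> \<real>" if u: "u \<in> carrier E" for u
        proof -
          obtain k l where kl: "k \<in> K" "l \<in> K" "u = k \<otimes>\<^bsub>E\<^esub> f \<oplus>\<^bsub>E\<^esub> l" using dec[OF u] by auto
          then have "\<tau> u = \<tau> k * \<tau> f + \<tau> l" using KE f by (simp add: hom_add[OF fE \<tau>] hom_mult[OF fE \<tau>] subset_iff)
          then show ?thesis using r realK[OF \<tau> kl(1)] realK[OF \<tau> kl(2)] by simp
        qed
        then have "\<tau> ` carrier E \<subseteq> \<real>" by auto
        then show False using E \<tau> unfolding CM_field_def totally_imaginary_field_def by blast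
      qed
      from nonreal_root_norm[OF eq this] show ?thesis by (simp add: n')
    qed
    have "\<sigma> n = - 1" using norm[OF \<sigma>(1)] \<sigma>(2) by (simp add: minus_equation_iff)
    then have "n = \<ominus>\<^bsub>E\<^esub> \<one>\<^bsub>E\<^esub>"
      by (intro hom_inj[OF fE \<sigma>(1) nE]) (simp_all add: hom_one[OF fE \<sigma>(1)] hom_uminus[OF fE \<sigma>(1)])
    then have "\<chi> n = - 1" by (simp add: hom_one[OF fE \<chi>] hom_uminus[OF fE \<chi>])
    then have "complex_of_real ((cmod (\<chi> f))\<^sup>2) = complex_of_real 1" using norm[OF \<chi>] by simp
    then have "(cmod (\<chi> f))\<^sup>2 = 1" by (simp only: of_real_eq_iff)
    then show ?thesis by (simp add: power2_eq_1_iff) (metis norm_ge_zero not_one_le_zero neg_0_le_iff_le zero_le_one order_trans)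
  qed
qed

text \<open>The common end of both cases of part (1), with \<open>P\<close> the condition that the
  absolute value is 1.\<close>

lemma entropy_dichotomy:
  assumes lat: "full_lattice g (carrier_vec g) L" and g: "g > 0" and f: "f \<in> carrier (End_ring g L)"
    and zero: "P \<Longrightarrow> (\<And>\<mu>. eigenvalue f \<mu> \<Longrightarrow> cmod \<mu> \<le> 1)"
    and pos: "\<not> P \<Longrightarrow> (\<And>\<mu>. eigenvalue f \<mu> \<Longrightarrow> \<mu> \<noteq> 0 \<and> cmod \<mu> \<noteq> 1)"
  shows "(P \<longrightarrow> entropy g L f = 0) \<and> (\<not> P \<longrightarrow> entropy g L f > 0)"
proof -
  obtain r R where "torus_endomorphism g L r R f" using End_torus_endomorphism[OF lat f] by auto
  then interpret torus_endomorphism g L r R f .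
  have "entropy g L f > 0" if np: "\<not> P"
  proof -
    obtain \<mu> where mu: "eigenvalue f \<mu>" "cmod \<mu> > 1" using expanding_eigenvalue[OF g pos[OF np]] by auto
    have "ereal 0 < ereal (2 * ln (cmod \<mu>))" using ln_gt_zero[OF mu(2)] by simp
    also have "\<dots> \<le> entropy g L f" by (rule entropy_ge[OF mu])
    finally show ?thesis by (simp add: zero_ereal_def)
  qed
  then show ?thesis using entropy_zero[OF g zero] by blast
qed

lemma entropy_field:
  assumes lat: "full_lattice g (carrier_vec g) L" and g: "g > 0"
    and f: "f \<in> carrier (End_ring g L)" "f \<noteq> 0\<^sub>m g g"
    and E: "totally_real_field (EndQ_ring g L) \<or> CM_field (EndQ_ring g L)"
    and \<sigma>: "\<sigma> \<in> Ring.ring_hom (EndQ_ring g L) (class_ring :: complex ring)"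
  shows "(cmod (\<sigma> f) = 1 \<longrightarrow> entropy g L f = 0) \<and> (cmod (\<sigma> f) \<noteq> 1 \<longrightarrow> entropy g L f > 0)"
proof -
  let ?E = "EndQ_ring g L"
  have nf: "number_field ?E"
    using E unfolding totally_real_field_def CM_field_def totally_imaginary_field_def by auto
  then have fE: "field ?E" unfolding number_field_def by simp
  interpret field ?E by (rule fE)
  have fQ: "f \<in> carrier ?E" by (rule End_in_EndQ[OF f(1)])
  have same: "cmod (\<chi> f) = 1 \<longleftrightarrow> cmod (\<sigma> f) = 1" if \<chi>: "\<chi> \<in> Ring.ring_hom ?E (class_ring :: complex ring)" for \<chi>
    using E
  proof
    assume "totally_real_field ?E"
    then show ?thesis using cmod_1_independent_totally_real[OF _ fQ] \<sigma> \<chi> by blast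
  next
    assume "CM_field ?E"
    then show ?thesis using cmod_1_independent_CM[OF _ fQ] \<sigma> \<chi> by blast
  qed
  have eig: "\<exists>\<chi>\<in>Ring.ring_hom ?E (class_ring :: complex ring). \<mu> = \<chi> f" if mu: "eigenvalue f \<mu>" for \<mu>
  proof -
    have comm: "x * f = f * x" if "x \<in> carrier ?E" for x using m_comm[OF that fQ] by simp
    obtain \<chi> v where \<chi>: "\<chi> \<in> Ring.ring_hom ?E (class_ring :: complex ring)" and v: "v \<in> carrier_vec g" "v \<noteq> 0\<^sub>v g"
      "f *\<^sub>v v = \<mu> \<cdot>\<^sub>v v" "\<And>x. x \<in> carrier ?E \<Longrightarrow> x *\<^sub>v v = \<chi> x \<cdot>\<^sub>v v"
    proof (rule common_eigenvector[OF nf, of "\<lambda>x. x" g f \<mu>])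
      show "x \<in> carrier_mat g g" if "x \<in> carrier ?E" for x using that by (rule EndQ_ring_carrier_mat)
      show "x * f = f * x" if "x \<in> carrier ?E" for x using that by (rule comm)
      show "f \<in> carrier_mat g g" using fQ by (rule EndQ_ring_carrier_mat)
    qed (use mu in simp_all)
    obtain i where i: "i < g" "v $ i \<noteq> 0" using v(1,2) by (metis carrier_vecD eq_vecI index_zero_vec)
    have "(\<mu> \<cdot>\<^sub>v v) $ i = (\<chi> f \<cdot>\<^sub>v v) $ i" using v(3) v(4)[OF fQ] by simp
    then have "\<mu> = \<chi> f" using i v(1) by simp
    then show ?thesis using \<chi> by blast
  qed
  show ?thesis
  proof (rule entropy_dichotomy[OF lat g f(1)])
    show "cmod \<mu> \<le> 1" if "cmod (\<sigma> f) = 1" "eigenvalue f \<mu>" for \<mu>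
      using eig[OF that(2)] same that(1) by fastforce
    show "\<mu> \<noteq> 0 \<and> cmod \<mu> \<noteq> 1" if ne: "cmod (\<sigma> f) \<noteq> 1" and mu: "eigenvalue f \<mu>" for \<mu>
    proof -
      obtain \<chi> where \<chi>: "\<chi> \<in> Ring.ring_hom ?E (class_ring :: complex ring)" "\<mu> = \<chi> f" using eig[OF mu] by auto
      have "\<chi> f \<noteq> 0" using hom_eq_0[OF fE \<chi>(1) fQ] f(2) by auto
      then show ?thesis using \<chi> same[OF \<chi>(1)] ne by simp
    qed
  qed
qed

section \<open>Quaternion algebras\<close>

lemma quaternion_algebra_simps:
  "carrier (quaternion_algebra F \<alpha> \<beta>) = carrier F \<times> carrier F \<times> carrier F \<times> carrier F"
  "monoid.mult (quaternion_algebra F \<alpha> \<beta>) (a, b, c, d) (a', b', c', d') =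
    (a \<otimes>\<^bsub>F\<^esub> a' \<oplus>\<^bsub>F\<^esub> \<alpha> \<otimes>\<^bsub>F\<^esub> b \<otimes>\<^bsub>F\<^esub> b' \<oplus>\<^bsub>F\<^esub> \<beta> \<otimes>\<^bsub>F\<^esub> c \<otimes>\<^bsub>F\<^esub> c' \<ominus>\<^bsub>F\<^esub> \<alpha> \<otimes>\<^bsub>F\<^esub> \<beta> \<otimes>\<^bsub>F\<^esub> d \<otimes>\<^bsub>F\<^esub> d',
     a \<otimes>\<^bsub>F\<^esub> b' \<oplus>\<^bsub>F\<^esub> b \<otimes>\<^bsub>F\<^esub> a' \<ominus>\<^bsub>F\<^esub> \<beta> \<otimes>\<^bsub>F\<^esub> c \<otimes>\<^bsub>F\<^esub> d' \<oplus>\<^bsub>F\<^esub> \<beta> \<otimes>\<^bsub>F\<^esub> d \<otimes>\<^bsub>F\<^esub> c',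
     a \<otimes>\<^bsub>F\<^esub> c' \<oplus>\<^bsub>F\<^esub> c \<otimes>\<^bsub>F\<^esub> a' \<oplus>\<^bsub>F\<^esub> \<alpha> \<otimes>\<^bsub>F\<^esub> b \<otimes>\<^bsub>F\<^esub> d' \<ominus>\<^bsub>F\<^esub> \<alpha> \<otimes>\<^bsub>F\<^esub> d \<otimes>\<^bsub>F\<^esub> b',
     a \<otimes>\<^bsub>F\<^esub> d' \<oplus>\<^bsub>F\<^esub> d \<otimes>\<^bsub>F\<^esub> a' \<oplus>\<^bsub>F\<^esub> b \<otimes>\<^bsub>F\<^esub> c' \<ominus>\<^bsub>F\<^esub> c \<otimes>\<^bsub>F\<^esub> b')"
  "monoid.one (quaternion_algebra F \<alpha> \<beta>) = (\<one>\<^bsub>F\<^esub>, \<zero>\<^bsub>F\<^esub>, \<zero>\<^bsub>F\<^esub>, \<zero>\<^bsub>F\<^esub>)"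
  "ring.zero (quaternion_algebra F \<alpha> \<beta>) = (\<zero>\<^bsub>F\<^esub>, \<zero>\<^bsub>F\<^esub>, \<zero>\<^bsub>F\<^esub>, \<zero>\<^bsub>F\<^esub>)"
  "ring.add (quaternion_algebra F \<alpha> \<beta>) (a, b, c, d) (a', b', c', d') =
    (a \<oplus>\<^bsub>F\<^esub> a', b \<oplus>\<^bsub>F\<^esub> b', c \<oplus>\<^bsub>F\<^esub> c', d \<oplus>\<^bsub>F\<^esub> d')"
  unfolding quaternion_algebra_def by simp_all

lemma class_ring_minus: "a \<ominus>\<^bsub>(class_ring :: 'a::ring_1 ring)\<^esub> b = a - b"
  by (simp add: class_ring_simps)

text \<open>Euler's four-square identity makes the sum of squares multiplicative.\<close>

lemma hamilton_no_zero_divisors: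
  assumes "x \<otimes>\<^bsub>hamilton_quaternions\<^esub> y = (0, 0, 0, 0)"
  shows "x = (0, 0, 0, 0) \<or> y = (0, 0, 0, 0)"
proof -
  obtain a b c d a' b' c' d' where xy: "x = (a,b,c,d)" "y = (a',b',c',d')" by (metis prod_cases4)
  have eqs: "a * a' - b * b' - c * c' - d * d' = 0" "a * b' + b * a' + c * d' - d * c' = 0"
    "a * c' + c * a' - b * d' + d * b' = 0" "a * d' + d * a' + b * c' - c * b' = 0"
    using assms unfolding xy hamilton_quaternions_def quaternion_algebra_simps class_ring_minus by simp_all
  have "(a\<^sup>2 + b\<^sup>2 + c\<^sup>2 + d\<^sup>2) * (a'\<^sup>2 + b'\<^sup>2 + c'\<^sup>2 + d'\<^sup>2) =
    (a * a' - b * b' - c * c' - d * d')\<^sup>2 + (a * b' + b * a' + c * d' - d * c')\<^sup>2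
    + (a * c' + c * a' - b * d' + d * b')\<^sup>2 + (a * d' + d * a' + b * c' - c * b')\<^sup>2"
    by (simp add: power2_eq_square algebra_simps)
  also have "\<dots> = 0" unfolding eqs by simp
  finally have "a\<^sup>2 + b\<^sup>2 + c\<^sup>2 + d\<^sup>2 = 0 \<or> a'\<^sup>2 + b'\<^sup>2 + c'\<^sup>2 + d'\<^sup>2 = 0" by simp
  moreover have "p = 0 \<and> q = 0 \<and> r = 0 \<and> s = 0" if "p\<^sup>2 + q\<^sup>2 + r\<^sup>2 + s\<^sup>2 = 0" for p q r s :: real
  proof -
    have "p\<^sup>2 = 0" "q\<^sup>2 = 0" "r\<^sup>2 = 0" "s\<^sup>2 = 0"
      using that zero_le_power2[of p] zero_le_power2[of q] zero_le_power2[of r] zero_le_power2[of s] by linarith+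
    then show ?thesis by simp
  qed
  ultimately show ?thesis unfolding xy by blast
qed

text \<open>A non-negative \<open>p\<close> has a real square root, and then
  \<open>(i - sqrt p) (i + sqrt p) = 0\<close> exhibits zero divisors, which the Hamilton
  quaternions lack; likewise for \<open>q\<close> and \<open>j\<close>.\<close>

lemma hamilton_iso_negative:
  assumes "quaternion_algebra (class_ring :: real ring) p q \<simeq> hamilton_quaternions"
  shows "p < 0" "q < 0"
proof -
  let ?H = "hamilton_quaternions" and ?Q = "quaternion_algebra (class_ring :: real ring) p q"
  obtain h where h: "h \<in> Ring.ring_hom ?Q ?H" "bij_betw h (carrier ?Q) (carrier ?H)"
    using assms unfolding is_ring_iso_def ring_iso_def by auto
  have car: "x \<in> carrier ?Q" for x unfolding quaternion_algebra_simps by (cases x) simp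
  have h0: "h (0,0,0,0) = (0,0,0,0)"
  proof -
    obtain a b c d where abcd: "h (0,0,0,0) = (a,b,c,d)" by (metis prod_cases4)
    have "h ((0,0,0,0) \<oplus>\<^bsub>?Q\<^esub> (0,0,0,0)) = h (0,0,0,0) \<oplus>\<^bsub>?H\<^esub> h (0,0,0,0)"
      by (rule ring_hom_add[OF h(1) car car])
    then show ?thesis unfolding abcd unfolding quaternion_algebra_simps hamilton_quaternions_def by (simp add: abcd)
  qed
  have inj: "x = y" if "h x = h y" for x y
    using h(2) that car unfolding bij_betw_def inj_on_def by blast
  have no_zd: "x = (0,0,0,0) \<or> y = (0,0,0,0)" if "x \<otimes>\<^bsub>?Q\<^esub> y = (0,0,0,0)" for x y
  proof -
    have "h x \<otimes>\<^bsub>?H\<^esub> h y = (0,0,0,0)" using ring_hom_mult[OF h(1) car car, of x y] that h0 by simp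
    then have "h x = h (0,0,0,0) \<or> h y = h (0,0,0,0)" unfolding h0 by (rule hamilton_no_zero_divisors)
    then show ?thesis using inj by blast
  qed
  show "p < 0"
  proof (rule ccontr)
    assume "\<not> p < 0"
    then have "(- sqrt p, 1, 0, 0) \<otimes>\<^bsub>?Q\<^esub> (sqrt p, 1, 0, 0) = (0,0,0,0)"
      unfolding quaternion_algebra_simps class_ring_minus by simp
    then show False using no_zd by fastforce
  qed
  show "q < 0"
  proof (rule ccontr)
    assume "\<not> q < 0"
    then have "(- sqrt q, 0, 1, 0) \<otimes>\<^bsub>?Q\<^esub> (sqrt q, 0, 1, 0) = (0,0,0,0)"
      unfolding quaternion_algebra_simps class_ring_minus by simp
    then show False using no_zd by fastforce
  qed
qed

lemma nonpositive_square_norm: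
  assumes "w\<^sup>2 = complex_of_real t" "t \<le> 0"
  shows "(cmod (complex_of_real p + w))\<^sup>2 = p\<^sup>2 - t"
proof -
  have re: "(Re w)\<^sup>2 - (Im w)\<^sup>2 = t" and im: "Re w * Im w = 0"
    using assms(1) by (auto simp: complex_eq_iff power2_eq_square)
  have "Re w = 0"
  proof (rule ccontr)
    assume n: "Re w \<noteq> 0"
    then have "Im w = 0" using im by simp
    moreover have "(Re w)\<^sup>2 > 0" using n by simp
    moreover have "(Re w)\<^sup>2 - (Im w)\<^sup>2 \<le> 0" using re assms(2) by (simp only:)
    ultimately show False by simp
  qed
  then show ?thesis using re unfolding cmod_power2 by simp
qed

text \<open>Total definiteness makes \<open>t = b\<^sup>2 \<alpha> + c\<^sup>2 \<beta> - d\<^sup>2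
  \<alpha> \<beta>\<close> non-positive at every real place, so both roots
  \<open>a \<plusminus> \<surd>t\<close> of the reduced characteristic polynomial have squared
  modulus \<open>a\<^sup>2 - t\<close>. This is why either square root \<open>s\<close> may be
  taken.\<close>

lemma entropy_quaternion:
  fixes F :: "'k ring"
  assumes lat: "full_lattice g (carrier_vec g) L" and g: "g > 0"
    and f: "f \<in> carrier (End_ring g L)" "f \<noteq> 0\<^sub>m g g"
    and Q: "totally_definite_quaternion F \<alpha> \<beta>"
    and \<phi>: "\<phi> \<in> ring_iso (quaternion_algebra F \<alpha> \<beta>) (EndQ_ring g L)"
    and abcd: "a \<in> carrier F" "b \<in> carrier F" "c \<in> carrier F" "d \<in> carrier F" "f = \<phi> (a, b, c, d)"
    and \<sigma>: "\<sigma> \<in> Ring.ring_hom F (class_ring :: real ring)"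
    and s: "s\<^sup>2 = complex_of_real (\<sigma> (b \<otimes>\<^bsub>F\<^esub> b \<otimes>\<^bsub>F\<^esub> \<alpha> \<oplus>\<^bsub>F\<^esub> c \<otimes>\<^bsub>F\<^esub> c \<otimes>\<^bsub>F\<^esub> \<beta> \<ominus>\<^bsub>F\<^esub> d \<otimes>\<^bsub>F\<^esub> d \<otimes>\<^bsub>F\<^esub> \<alpha> \<otimes>\<^bsub>F\<^esub> \<beta>))"
  shows "(cmod (complex_of_real (\<sigma> a) + s) = 1 \<longrightarrow> entropy g L f = 0) \<and>
    (cmod (complex_of_real (\<sigma> a) + s) \<noteq> 1 \<longrightarrow> entropy g L f > 0)"
proof -
  let ?Q = "quaternion_algebra F \<alpha> \<beta>" and ?E = "EndQ_ring g L"
  have nf: "number_field F" and trF: "totally_real_field F"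
    using Q unfolding totally_definite_quaternion_def totally_real_field_def by auto
  then have fF: "field F" unfolding number_field_def by simp
  interpret field F by (rule fF)
  have \<alpha>: "\<alpha> \<in> carrier F" and \<beta>: "\<beta> \<in> carrier F" using Q unfolding totally_definite_quaternion_def by auto
  define t where "t = b \<otimes>\<^bsub>F\<^esub> b \<otimes>\<^bsub>F\<^esub> \<alpha> \<oplus>\<^bsub>F\<^esub> c \<otimes>\<^bsub>F\<^esub> c \<otimes>\<^bsub>F\<^esub> \<beta> \<ominus>\<^bsub>F\<^esub> d \<otimes>\<^bsub>F\<^esub> d \<otimes>\<^bsub>F\<^esub> \<alpha> \<otimes>\<^bsub>F\<^esub> \<beta>"
  \<comment> \<open>The reduced norm of \<open>f\<close>; its reduced trace is
    \<open>a \<oplus> a\<close>.\<close>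
  define N where "N = a \<otimes>\<^bsub>F\<^esub> a \<ominus>\<^bsub>F\<^esub> t"
  have t: "t \<in> carrier F" and N: "N \<in> carrier F" unfolding t_def N_def using abcd \<alpha> \<beta> by auto
  have real_hom: "\<tau> t = (\<tau> b)\<^sup>2 * \<tau> \<alpha> + (\<tau> c)\<^sup>2 * \<tau> \<beta> + (\<tau> d)\<^sup>2 * - (\<tau> \<alpha> * \<tau> \<beta>)"
      "\<tau> N = (\<tau> a)\<^sup>2 - \<tau> t" "\<tau> \<alpha> < 0" "\<tau> \<beta> < 0"
    if \<tau>: "\<tau> \<in> Ring.ring_hom F (class_ring :: real ring)" for \<tau>
  proof -
    show "\<tau> t = (\<tau> b)\<^sup>2 * \<tau> \<alpha> + (\<tau> c)\<^sup>2 * \<tau> \<beta> + (\<tau> d)\<^sup>2 * - (\<tau> \<alpha> * \<tau> \<beta>)"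
      unfolding t_def using abcd \<alpha> \<beta>
      by (simp add: hom_add[OF fF \<tau>] hom_mult[OF fF \<tau>] hom_minus[OF fF \<tau>] power2_eq_square)
    show "\<tau> N = (\<tau> a)\<^sup>2 - \<tau> t"
      unfolding N_def using abcd t by (simp add: hom_mult[OF fF \<tau>] hom_minus[OF fF \<tau>] power2_eq_square)
    have "quaternion_algebra (class_ring :: real ring) (\<tau> \<alpha>) (\<tau> \<beta>) \<simeq> hamilton_quaternions"
      using Q \<tau> unfolding totally_definite_quaternion_def by blast
    then show "\<tau> \<alpha> < 0" "\<tau> \<beta> < 0" using hamilton_iso_negative by blast+
  qed
  have terms: "(\<tau> b)\<^sup>2 * \<tau> \<alpha> \<le> 0" "(\<tau> c)\<^sup>2 * \<tau> \<beta> \<le> 0" "(\<tau> d)\<^sup>2 * - (\<tau> \<alpha> * \<tau> \<beta>) \<le> 0"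
    if "\<tau> \<in> Ring.ring_hom F (class_ring :: real ring)" for \<tau>
    using real_hom(3,4)[OF that]
    by (simp_all add: mult_nonneg_nonpos mult_nonneg_nonneg mult_nonpos_nonpos)
  have t_le: "\<tau> t \<le> 0" if "\<tau> \<in> Ring.ring_hom F (class_ring :: real ring)" for \<tau>
    using terms[OF that] real_hom(1)[OF that] by linarith
  have \<phi>hom: "\<phi> \<in> Ring.ring_hom ?Q ?E" and \<phi>bij: "bij_betw \<phi> (carrier ?Q) (carrier ?E)"
    using \<phi> unfolding ring_iso_def by auto
  define \<psi> where "\<psi> x = \<phi> (x, \<zero>\<^bsub>F\<^esub>, \<zero>\<^bsub>F\<^esub>, \<zero>\<^bsub>F\<^esub>)" for x
  have qcar: "(x, \<zero>\<^bsub>F\<^esub>, \<zero>\<^bsub>F\<^esub>, \<zero>\<^bsub>F\<^esub>) \<in> carrier ?Q" if "x \<in> carrier F" for x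
    using that by (simp add: quaternion_algebra_simps)
  have fcar: "(a, b, c, d) \<in> carrier ?Q" using abcd by (simp add: quaternion_algebra_simps)
  have \<psi>car: "\<psi> x \<in> carrier_mat g g" if "x \<in> carrier F" for x
    unfolding \<psi>_def by (rule EndQ_ring_carrier_mat) (rule ring_hom_closed[OF \<phi>hom qcar[OF that]])
  have fmat: "f \<in> carrier_mat g g" using f(1) by (simp add: End_ring_carrier)
  have \<psi>add: "\<psi> (x \<oplus>\<^bsub>F\<^esub> y) = \<psi> x + \<psi> y" if "x \<in> carrier F" "y \<in> carrier F" for x y
    using ring_hom_add[OF \<phi>hom qcar[OF that(1)] qcar[OF that(2)]] that
    unfolding \<psi>_def by (simp add: quaternion_algebra_simps)
  have \<psi>mult: "\<psi> (x \<otimes>\<^bsub>F\<^esub> y) = \<psi> x * \<psi> y" if "x \<in> carrier F" "y \<in> carrier F" for x y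
    using ring_hom_mult[OF \<phi>hom qcar[OF that(1)] qcar[OF that(2)]] that \<alpha> \<beta>
    unfolding \<psi>_def by (simp add: quaternion_algebra_simps a_minus_def)
  have \<psi>one: "\<psi> \<one>\<^bsub>F\<^esub> = 1\<^sub>m g"
    using ring_hom_one[OF \<phi>hom] unfolding \<psi>_def by (simp add: quaternion_algebra_simps)
  have left: "(x, \<zero>\<^bsub>F\<^esub>, \<zero>\<^bsub>F\<^esub>, \<zero>\<^bsub>F\<^esub>) \<otimes>\<^bsub>?Q\<^esub> (a, b, c, d) = (x \<otimes>\<^bsub>F\<^esub> a, x \<otimes>\<^bsub>F\<^esub> b, x \<otimes>\<^bsub>F\<^esub> c, x \<otimes>\<^bsub>F\<^esub> d)"
    if "x \<in> carrier F" for x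
    using that abcd \<alpha> \<beta> by (simp add: quaternion_algebra_simps a_minus_def)
  have right: "(a, b, c, d) \<otimes>\<^bsub>?Q\<^esub> (x, \<zero>\<^bsub>F\<^esub>, \<zero>\<^bsub>F\<^esub>, \<zero>\<^bsub>F\<^esub>) = (x \<otimes>\<^bsub>F\<^esub> a, x \<otimes>\<^bsub>F\<^esub> b, x \<otimes>\<^bsub>F\<^esub> c, x \<otimes>\<^bsub>F\<^esub> d)"
    if "x \<in> carrier F" for x
    using that abcd \<alpha> \<beta> by (simp add: quaternion_algebra_simps a_minus_def m_comm[of _ x])
  have comm: "\<psi> x * f = f * \<psi> x" if "x \<in> carrier F" for x
    using ring_hom_mult[OF \<phi>hom qcar[OF that] fcar] ring_hom_mult[OF \<phi>hom fcar qcar[OF that]]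
    unfolding left[OF that] right[OF that] \<psi>_def abcd(5) by simp
  have quad: "f * f + \<psi> N = \<psi> (a \<oplus>\<^bsub>F\<^esub> a) * f"
  proof -
    have aa: "a \<oplus>\<^bsub>F\<^esub> a \<in> carrier F" using abcd by simp
    \<comment> \<open>The identities in \<open>F\<close> are verified among real numbers, after
      applying the injective embedding \<open>\<sigma>\<close>.\<close>
    have "((a, b, c, d) \<otimes>\<^bsub>?Q\<^esub> (a, b, c, d)) \<oplus>\<^bsub>?Q\<^esub> (N, \<zero>\<^bsub>F\<^esub>, \<zero>\<^bsub>F\<^esub>, \<zero>\<^bsub>F\<^esub>) =
       (a \<oplus>\<^bsub>F\<^esub> a, \<zero>\<^bsub>F\<^esub>, \<zero>\<^bsub>F\<^esub>, \<zero>\<^bsub>F\<^esub>) \<otimes>\<^bsub>?Q\<^esub> (a, b, c, d)"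
      unfolding left[OF aa] unfolding quaternion_algebra_simps N_def t_def prod.inject using abcd(1-4) \<alpha> \<beta>
      by (intro conjI; intro hom_inj[OF fF \<sigma>])
        (simp_all add: hom_add[OF fF \<sigma>] hom_mult[OF fF \<sigma>] hom_minus[OF fF \<sigma>] hom_zero[OF fF \<sigma>] algebra_simps)
    moreover have "(a, b, c, d) \<otimes>\<^bsub>?Q\<^esub> (a, b, c, d) \<in> carrier ?Q"
      using abcd(1-4) \<alpha> \<beta> by (simp add: quaternion_algebra_simps)
    ultimately show ?thesis
      using ring_hom_add[OF \<phi>hom _ qcar[OF N], of "(a, b, c, d) \<otimes>\<^bsub>?Q\<^esub> (a, b, c, d)"]
        ring_hom_mult[OF \<phi>hom fcar fcar] ring_hom_mult[OF \<phi>hom qcar[OF aa] fcar]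
      unfolding \<psi>_def abcd(5) by simp
  qed
  have eig: "\<exists>\<tau>\<in>Ring.ring_hom F (class_ring :: real ring). (cmod \<mu>)\<^sup>2 = \<tau> N" if mu: "eigenvalue f \<mu>" for \<mu>
  proof -
    obtain \<chi> v where \<chi>: "\<chi> \<in> Ring.ring_hom F (class_ring :: complex ring)" and v: "v \<in> carrier_vec g" "v \<noteq> 0\<^sub>v g"
      "f *\<^sub>v v = \<mu> \<cdot>\<^sub>v v" "\<And>x. x \<in> carrier F \<Longrightarrow> \<psi> x *\<^sub>v v = \<chi> x \<cdot>\<^sub>v v"
    proof (rule common_eigenvector[OF nf \<psi>car \<psi>add \<psi>mult \<psi>one fmat comm mu])
      fix \<chi> v
      assume that': "\<And>\<chi> v. \<chi> \<in> Ring.ring_hom F (class_ring :: complex ring) \<Longrightarrow> v \<in> carrier_vec g \<Longrightarrow> v \<noteq> 0\<^sub>v g \<Longrightarrow>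
          f *\<^sub>v v = \<mu> \<cdot>\<^sub>v v \<Longrightarrow> (\<And>x. x \<in> carrier F \<Longrightarrow> \<psi> x *\<^sub>v v = \<chi> x \<cdot>\<^sub>v v) \<Longrightarrow> thesis"
        and v: "\<chi> \<in> Ring.ring_hom F (class_ring :: complex ring)" "v \<in> carrier_vec g" "v \<noteq> 0\<^sub>v g"
          "f *\<^sub>v v = \<mu> \<cdot>\<^sub>v v" "\<And>x. x \<in> carrier F \<Longrightarrow> \<psi> x *\<^sub>v v = \<chi> x \<cdot>\<^sub>v v"
      show thesis by (rule that'[OF v])
    qed
    define \<tau> where "\<tau> x = Re (\<chi> x)" for x
    have \<chi>\<tau>: "\<chi> x = complex_of_real (\<tau> x)" if "x \<in> carrier F" for x
    proof -
      have "\<chi> x \<in> \<real>" using trF \<chi> that unfolding totally_real_field_def by blast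
      then show ?thesis unfolding \<tau>_def by simp
    qed
    have \<tau>: "\<tau> \<in> Ring.ring_hom F (class_ring :: real ring)"
    proof (rule ring_hom_memI)
      fix x y assume xy: "x \<in> carrier F" "y \<in> carrier F"
      have "\<chi> (x \<otimes>\<^bsub>F\<^esub> y) = complex_of_real (\<tau> x * \<tau> y)"
        using hom_mult[OF fF \<chi> xy] \<chi>\<tau>[OF xy(1)] \<chi>\<tau>[OF xy(2)] by simp
      then have "Re (\<chi> (x \<otimes>\<^bsub>F\<^esub> y)) = \<tau> x * \<tau> y" by (simp only: Re_complex_of_real)
      then show "\<tau> (x \<otimes>\<^bsub>F\<^esub> y) = \<tau> x \<otimes>\<^bsub>class_ring\<^esub> \<tau> y" by (simp add: \<tau>_def)
      show "\<tau> (x \<oplus>\<^bsub>F\<^esub> y) = \<tau> x \<oplus>\<^bsub>class_ring\<^esub> \<tau> y"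
        using hom_add[OF fF \<chi> xy] by (simp add: \<tau>_def)
    next
      show "\<tau> \<one>\<^bsub>F\<^esub> = \<one>\<^bsub>class_ring\<^esub>" using hom_one[OF fF \<chi>] by (simp add: \<tau>_def)
    qed simp
    obtain i where i: "i < g" "v $ i \<noteq> 0" using v(1,2) by (metis carrier_vecD eq_vecI index_zero_vec)
    have "(f * f + \<psi> N) *\<^sub>v v = (\<mu> * \<mu> + \<chi> N) \<cdot>\<^sub>v v"
    proof -
      have "(f * f + \<psi> N) *\<^sub>v v = f *\<^sub>v (f *\<^sub>v v) + \<psi> N *\<^sub>v v"
        using add_mult_distrib_mat_vec[OF mult_carrier_mat[OF fmat fmat] \<psi>car[OF N] v(1)] assoc_mult_mat_vec[OF fmat fmat v(1)] by simp
      also have "\<dots> = \<mu> \<cdot>\<^sub>v (\<mu> \<cdot>\<^sub>v v) + \<chi> N \<cdot>\<^sub>v v"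
        using v(3) v(4)[OF N] mult_mat_vec[OF fmat v(1)] by simp
      finally show ?thesis by (simp add: add_smult_distrib_vec smult_smult_assoc)
    qed
    moreover have "(\<psi> (a \<oplus>\<^bsub>F\<^esub> a) * f) *\<^sub>v v = (\<mu> * \<chi> (a \<oplus>\<^bsub>F\<^esub> a)) \<cdot>\<^sub>v v"
    proof -
      have aa: "a \<oplus>\<^bsub>F\<^esub> a \<in> carrier F" using abcd by simp
      have "(\<psi> (a \<oplus>\<^bsub>F\<^esub> a) * f) *\<^sub>v v = \<psi> (a \<oplus>\<^bsub>F\<^esub> a) *\<^sub>v (\<mu> \<cdot>\<^sub>v v)"
        using assoc_mult_mat_vec[OF \<psi>car[OF aa] fmat v(1)] v(3) by simp
      also have "\<dots> = \<mu> \<cdot>\<^sub>v (\<chi> (a \<oplus>\<^bsub>F\<^esub> a) \<cdot>\<^sub>v v)"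
        using mult_mat_vec[OF \<psi>car[OF aa] v(1)] v(4)[OF aa] by simp
      finally show ?thesis by (simp add: smult_smult_assoc)
    qed
    ultimately have "((\<mu> * \<mu> + \<chi> N) \<cdot>\<^sub>v v) $ i = ((\<mu> * \<chi> (a \<oplus>\<^bsub>F\<^esub> a)) \<cdot>\<^sub>v v) $ i" using quad by simp
    then have "\<mu> * \<mu> + \<chi> N = \<mu> * (\<chi> a + \<chi> a)" using i v(1) abcd(1) by (simp add: hom_add[OF fF \<chi>])
    then have eq: "\<mu> * \<mu> + complex_of_real (\<tau> N) = \<mu> * (2 * complex_of_real (\<tau> a))"
      by (simp add: \<chi>\<tau> N abcd)
    have "(\<mu> - complex_of_real (\<tau> a))\<^sup>2 = complex_of_real (\<tau> t)"
    proof -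
      have "(\<mu> - complex_of_real (\<tau> a))\<^sup>2 = \<mu> * \<mu> - \<mu> * (2 * complex_of_real (\<tau> a)) + (complex_of_real (\<tau> a))\<^sup>2"
        by (simp add: power2_eq_square algebra_simps)
      also have "\<dots> = (complex_of_real (\<tau> a))\<^sup>2 - complex_of_real (\<tau> N)" unfolding eq[symmetric] by simp
      finally show ?thesis by (simp add: real_hom(2)[OF \<tau>])
    qed
    from nonpositive_square_norm[OF this t_le[OF \<tau>], of "\<tau> a"] have "(cmod \<mu>)\<^sup>2 = \<tau> N"
      by (simp add: real_hom(2)[OF \<tau>])
    then show ?thesis using \<tau> by blast
  qed
  \<comment> \<open>At a real place the norm is a sum of non-negative terms, so it vanishes only if
    \<open>f\<close> does.\<close>
  have N0: "\<tau> N \<noteq> 0" if \<tau>: "\<tau> \<in> Ring.ring_hom F (class_ring :: real ring)" for \<tau>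
  proof
    assume "\<tau> N = 0"
    then have sum0: "(\<tau> a)\<^sup>2 - \<tau> t = 0" using real_hom(2)[OF \<tau>] by simp
    have le: "(\<tau> a)\<^sup>2 \<ge> 0" by simp
    have "(\<tau> a)\<^sup>2 = 0" "(\<tau> b)\<^sup>2 * \<tau> \<alpha> = 0" "(\<tau> c)\<^sup>2 * \<tau> \<beta> = 0" "(\<tau> d)\<^sup>2 * - (\<tau> \<alpha> * \<tau> \<beta>) = 0"
      using sum0 le terms[OF \<tau>] real_hom(1)[OF \<tau>] by linarith+
    then have "\<tau> a = 0" "\<tau> b = 0" "\<tau> c = 0" "\<tau> d = 0" using real_hom(3,4)[OF \<tau>] by auto
    then have "a = \<zero>\<^bsub>F\<^esub>" "b = \<zero>\<^bsub>F\<^esub>" "c = \<zero>\<^bsub>F\<^esub>" "d = \<zero>\<^bsub>F\<^esub>"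
      using hom_eq_0[OF fF \<tau>] abcd by auto
    then have "f = \<psi> \<zero>\<^bsub>F\<^esub>" using abcd(5) by (simp add: \<psi>_def)
    moreover have "\<psi> \<zero>\<^bsub>F\<^esub> = 0\<^sub>m g g"
    proof -
      have z: "\<psi> \<zero>\<^bsub>F\<^esub> = \<psi> \<zero>\<^bsub>F\<^esub> + \<psi> \<zero>\<^bsub>F\<^esub>" using \<psi>add[of "\<zero>\<^bsub>F\<^esub>" "\<zero>\<^bsub>F\<^esub>"] by simp
      have car: "\<psi> \<zero>\<^bsub>F\<^esub> \<in> carrier_mat g g" by (rule \<psi>car) simp
      have "\<psi> \<zero>\<^bsub>F\<^esub> $$ (i,j) = \<psi> \<zero>\<^bsub>F\<^esub> $$ (i,j) + \<psi> \<zero>\<^bsub>F\<^esub> $$ (i,j)" if "i < g" "j < g" for i j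
        using arg_cong[OF z, of "\<lambda>M. M $$ (i,j)"] car that by simp
      then show ?thesis using car by (intro eq_matI) auto
    qed
    ultimately show False using f(2) by simp
  qed
  \<comment> \<open>The equation \<open>N = 1\<close> in \<open>F\<close> does not mention a place;
    this gives the independence of \<open>\<tau>\<close>.\<close>
  have one_iff: "\<tau> N = 1 \<longleftrightarrow> N = \<one>\<^bsub>F\<^esub>" if \<tau>: "\<tau> \<in> Ring.ring_hom F (class_ring :: real ring)" for \<tau>
    using hom_inj[OF fF \<tau> N one_closed] hom_one[OF fF \<tau>] by auto
  have "(cmod (complex_of_real (\<sigma> a) + s))\<^sup>2 = \<sigma> N"
    using nonpositive_square_norm[OF s[folded t_def] t_le[OF \<sigma>], of "\<sigma> a"] by (simp add: real_hom(2)[OF \<sigma>])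
  moreover have sq1: "x\<^sup>2 = 1 \<longleftrightarrow> x = 1" if "x \<ge> 0" for x :: real using that by (simp add: power2_eq_1_iff)
  ultimately have cond: "cmod (complex_of_real (\<sigma> a) + s) = 1 \<longleftrightarrow> N = \<one>\<^bsub>F\<^esub>"
    using one_iff[OF \<sigma>] norm_ge_zero by metis
  show ?thesis
  proof (rule entropy_dichotomy[OF lat g f(1)])
    show "cmod \<mu> \<le> 1" if c1: "cmod (complex_of_real (\<sigma> a) + s) = 1" and mu: "eigenvalue f \<mu>" for \<mu>
    proof -
      obtain \<tau> where \<tau>: "\<tau> \<in> Ring.ring_hom F (class_ring :: real ring)" "(cmod \<mu>)\<^sup>2 = \<tau> N" using eig[OF mu] by auto
      have "(cmod \<mu>)\<^sup>2 = 1" using \<tau>(2) one_iff[OF \<tau>(1)] cond c1 by simp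
      then show ?thesis using sq1[of "cmod \<mu>"] by simp
    qed
    show "\<mu> \<noteq> 0 \<and> cmod \<mu> \<noteq> 1" if c1: "cmod (complex_of_real (\<sigma> a) + s) \<noteq> 1" and mu: "eigenvalue f \<mu>" for \<mu>
    proof -
      obtain \<tau> where \<tau>: "\<tau> \<in> Ring.ring_hom F (class_ring :: real ring)" "(cmod \<mu>)\<^sup>2 = \<tau> N" using eig[OF mu] by auto
      have "(cmod \<mu>)\<^sup>2 \<noteq> 1" "(cmod \<mu>)\<^sup>2 \<noteq> 0" using \<tau>(2) one_iff[OF \<tau>(1)] N0[OF \<tau>(1)] cond c1 by simp_all
      then show ?thesis by auto
    qed
  qed
qed

section \<open>The golden ratio and its square root\<close>

definition gold :: real where "gold = (1 + sqrt 5) / 2"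
text \<open>The generator \<open>i\<close> will be sent to \<open>\<plusminus> th\<close> at the
  first real place, and to \<open>\<plusminus> et\<close> times the imaginary unit at the
  second.\<close>

definition th :: real where "th = sqrt gold"
definition et :: real where "et = 1 / th"

lemma gold_sq: "gold * gold = gold + 1"
  unfolding gold_def by (simp add: field_simps)

lemma gold_bounds: "1.6 < gold" "gold < 1.7"
proof -
  have "2.2 < sqrt 5" by (rule real_less_rsqrt) (simp add: power2_eq_square)
  moreover have "sqrt 5 < 2.4" by (rule real_less_lsqrt) (simp_all add: power2_eq_square)
  ultimately show "1.6 < gold" "gold < 1.7" unfolding gold_def by simp_all
qed

lemma th_pos: "th > 0" and th_sq: "th * th = gold"
  using gold_bounds unfolding th_def by simp_all

lemma et_pos: "et > 0" and et_sq: "et * et = gold - 1" and th_et: "th * et = 1"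
proof -
  show "et > 0" "th * et = 1" using th_pos unfolding et_def by simp_all
  have "et * et = 1 / gold" unfolding et_def using th_sq by simp
  also have "\<dots> = gold - 1" using gold_sq gold_bounds by (simp add: field_simps)
  finally show "et * et = gold - 1" .
qed

lemma gold_not_rat: "gold \<noteq> of_rat q"
proof
  assume "gold = of_rat q"
  then have rat: "gold \<in> Rats" using Rats_of_rat[of q, where 'a = real] by simp
  have "algebraic_int gold"
  proof (rule algebraic_int.intros)
    show "Polynomial.lead_coeff [:-1, -1, 1 :: real:] = 1" by simp
    show "\<forall>i. Polynomial.coeff [:-1, -1, 1 :: real:] i \<in> \<int>"
      by (auto simp: coeff_pCons split: nat.splits)
    show "poly [:-1, -1, 1:] gold = 0" using gold_sq by (simp add: algebra_simps)
  qed
  then have "gold \<in> \<int>" using rat by (rule rational_algebraic_int_is_int)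
  then obtain n where n: "gold = of_int n" by (auto elim: Ints_cases)
  then have "real_of_int n < of_int 2" "of_int 1 < real_of_int n" using gold_bounds by simp_all
  then show False by (simp only: of_int_less_iff)
qed

lemma gold_independent:
  assumes "of_rat p + of_rat q * gold = 0"
  shows "p = 0 \<and> q = 0"
proof -
  have "q = 0"
  proof (rule ccontr)
    assume q: "q \<noteq> 0"
    then have "gold = of_rat (- p / q)" using assms by (simp add: of_rat_divide of_rat_minus field_simps)
    then show False using gold_not_rat by blast
  qed
  then show ?thesis using assms by simp
qed

lemma gold_independent_eq:
  assumes "of_rat p + of_rat q * gold = of_rat p' + of_rat q' * gold"
  shows "p = p' \<and> q = q'"
proof -
  have "of_rat (p - p') + of_rat (q - q') * gold = 0" using assms by (simp add: of_rat_diff algebra_simps)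
  then show ?thesis using gold_independent by force
qed

text \<open>Squaring and comparing the rational parts gives
  \<open>a\<^sup>2 + b\<^sup>2 = 0\<close>.\<close>

lemma th_not_in_field: "th \<noteq> of_rat a + of_rat b * gold"
proof
  assume eq: "th = of_rat a + of_rat b * gold"
  have "gold = th * th" using th_sq by simp
  also have "\<dots> = of_rat a * of_rat a + 2 * of_rat a * of_rat b * gold + of_rat b * of_rat b * (gold * gold)"
    unfolding eq by (simp add: algebra_simps)
  also have "\<dots> = of_rat (a * a + b * b) + of_rat (2 * a * b + b * b) * gold"
    unfolding gold_sq by (simp add: of_rat_add of_rat_mult algebra_simps)
  finally have "of_rat 0 + of_rat 1 * gold = of_rat (a * a + b * b) + of_rat (2 * a * b + b * b) * gold" by simp
  then have "a * a + b * b = 0" using gold_independent_eq by metis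
  then have "a = 0 \<and> b = 0" by (simp add: sum_squares_eq_zero_iff)
  then show False using eq th_pos by simp
qed

lemma gold_field_inverse:
  assumes "of_rat c + of_rat d * gold \<noteq> 0"
  shows "\<exists>a b. inverse (of_rat c + of_rat d * gold) = of_rat a + of_rat b * gold"
proof -
  \<comment> \<open>The norm of \<open>c + d \<phi>\<close>, whose conjugate is
    \<open>c + d - d \<phi>\<close>.\<close>
  define N where "N = c * c + c * d - d * d"
  have prod: "(of_rat c + of_rat d * gold) * (of_rat (c + d) - of_rat d * gold) = of_rat N"
  proof -
    have "(of_rat c + of_rat d * gold) * (of_rat (c + d) - of_rat d * gold) =
      of_rat c * of_rat (c + d) + of_rat d * of_rat (c + d) * gold - of_rat c * of_rat d * gold - of_rat d * of_rat d * (gold * gold)"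
      by (simp add: algebra_simps)
    also have "\<dots> = of_rat N" unfolding gold_sq N_def by (simp add: of_rat_add of_rat_mult of_rat_diff algebra_simps)
    finally show ?thesis .
  qed
  have N: "N \<noteq> 0"
  proof
    assume "N = 0"
    then have "of_rat (c + d) - of_rat d * gold = 0" using prod assms by simp
    then have "of_rat (c + d) + of_rat (- d) * gold = 0" by (simp add: of_rat_minus)
    then have "c + d = 0 \<and> - d = 0" by (rule gold_independent)
    then show False using assms by simp
  qed
  have "inverse (of_rat c + of_rat d * gold) = (of_rat (c + d) - of_rat d * gold) / of_rat N"
    using prod assms N by (simp add: field_simps)
  also have "\<dots> = of_rat ((c + d) / N) + of_rat (- d / N) * gold"
    using N by (simp add: of_rat_divide of_rat_minus field_simps)
  finally show ?thesis by blast
qed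

lemma gold_field_mult:
  "(of_rat a + of_rat b * gold) * (of_rat c + of_rat d * gold) =
    of_rat (a * c + b * d) + of_rat (a * d + b * c + b * d) * gold"
proof -
  have "(of_rat a + of_rat b * gold) * (of_rat c + of_rat d * gold) =
    of_rat a * of_rat c + (of_rat a * of_rat d + of_rat b * of_rat c) * gold + of_rat b * of_rat d * (gold * gold)"
    by (simp add: algebra_simps)
  then show ?thesis unfolding gold_sq by (simp add: of_rat_add of_rat_mult algebra_simps)
qed

text \<open>Two quadratic steps: \<open>th\<close> lies outside \<open>\<rat>(\<surd>5)\<close>, so
  the odd and the even part vanish separately, and then \<open>1, \<phi>\<close> are independent
  over the rationals.\<close>

lemma th_independent:
  assumes "of_rat q0 + of_rat q1 * th + of_rat q2 * th ^ 2 + of_rat q3 * th ^ 3 = 0"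
  shows "q0 = 0 \<and> q1 = 0 \<and> q2 = 0 \<and> q3 = 0"
proof -
  have th2: "th ^ 2 = gold" "th ^ 3 = gold * th" using th_sq by (simp_all add: power2_eq_square power3_eq_cube)
  have eq: "(of_rat q0 + of_rat q2 * gold) + th * (of_rat q1 + of_rat q3 * gold) = 0"
    using assms unfolding th2 by (simp add: algebra_simps)
  have "of_rat q1 + of_rat q3 * gold = 0"
  proof (rule ccontr)
    assume n: "of_rat q1 + of_rat q3 * gold \<noteq> 0"
    obtain a b where ab: "inverse (of_rat q1 + of_rat q3 * gold) = of_rat a + of_rat b * gold"
      using gold_field_inverse[OF n] by blast
    have "th = - (of_rat q0 + of_rat q2 * gold) * inverse (of_rat q1 + of_rat q3 * gold)"
      using eq n by (simp add: field_simps)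
    also have "\<dots> = (of_rat (- q0) + of_rat (- q2) * gold) * (of_rat a + of_rat b * gold)"
      unfolding ab by (simp add: of_rat_minus algebra_simps)
    finally show False unfolding gold_field_mult using th_not_in_field by blast
  qed
  then have "q1 = 0 \<and> q3 = 0" by (rule gold_independent)
  moreover have "of_rat q0 + of_rat q2 * gold = 0" using eq \<open>of_rat q1 + of_rat q3 * gold = 0\<close> by simp
  then have "q0 = 0 \<and> q2 = 0" by (rule gold_independent)
  ultimately show ?thesis by simp
qed

text \<open>Multiplication by \<open>th ^ 3\<close> turns this into a relation for \<open>th\<close>
  with the coefficients in reverse order.\<close>

lemma et_independent:
  assumes "of_rat q0 + of_rat q1 * et + of_rat q2 * et ^ 2 + of_rat q3 * et ^ 3 = 0"
  shows "q0 = 0 \<and> q1 = 0 \<and> q2 = 0 \<and> q3 = 0"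
proof -
  have t: "th ^ 3 * et = th ^ 2" "th ^ 3 * et ^ 2 = th" "th ^ 3 * et ^ 3 = 1"
    using th_pos unfolding et_def by (simp_all add: power2_eq_square power3_eq_cube)
  have "th ^ 3 * (of_rat q0 + of_rat q1 * et + of_rat q2 * et ^ 2 + of_rat q3 * et ^ 3) =
    of_rat q0 * th ^ 3 + of_rat q1 * (th ^ 3 * et) + of_rat q2 * (th ^ 3 * et ^ 2) + of_rat q3 * (th ^ 3 * et ^ 3)"
    by (simp add: algebra_simps)
  then have "of_rat q3 + of_rat q2 * th + of_rat q1 * th ^ 2 + of_rat q0 * th ^ 3 = 0"
    unfolding assms t by simp
  then show ?thesis using th_independent by blast
qed

section \<open>A generic complex structure\<close>

text \<open>The coefficients of right multiplication by \<open>p + q j\<close>, \<open>p = p\<^sub>1 i + p\<^sub>3 i\<^sup>3\<close>, \<open>q = v' + u' i + v i\<^sup>2 + u i\<^sup>3\<close>,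
  which is the multiplication by the imaginary unit on the torus with period \<open>x + \<i>\<close>.\<close>

definition p3 :: "real \<Rightarrow> real" where "p3 x = (x * et + th) / (2 * gold - 1)"
definition p1 :: "real \<Rightarrow> real" where "p1 x = p3 x * et ^ 2 - th"
definition cu :: "real \<Rightarrow> real" where "cu x = - (x\<^sup>2 + 4) * et / (6 * (2 * gold - 1))"
definition cv :: "real \<Rightarrow> real" where "cv x = (2 - x\<^sup>2) / (6 * (2 * gold - 1))"

definition jcoeff :: "real \<Rightarrow> nat \<Rightarrow> real" where
  "jcoeff x k = [p1 x, p3 x, cv x * et ^ 2, cu x * et ^ 2, cv x, cu x] ! k"

text \<open>The relation is a polynomial in \<open>x\<close> of degree at most 2. Up to non-zero
  factors its quadratic coefficient is the combination \<open>a\<close> of powers of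
  \<open>et\<close> and its linear one the combination \<open>b\<close>. Together they involve all
  six rationals, so independence of these powers excludes the zero polynomial.\<close>

lemma countable_bad_parameters:
  assumes "r \<noteq> (0, 0, 0, 0, 0, 0)"
  shows "countable {x. case r of (r0, r1, r2, r3, r4, r5) \<Rightarrow>
    of_rat r0 * p1 x + of_rat r1 * p3 x + of_rat r2 * (cv x * et ^ 2) + of_rat r3 * (cu x * et ^ 2)
      + of_rat r4 * cv x + of_rat r5 * cu x = 0}"
proof -
  obtain r0 r1 r2 r3 r4 r5 where r: "r = (r0, r1, r2, r3, r4, r5)" by (metis surj_pair)
  let ?s = "2 * gold - 1"
  have s: "?s > 0" using gold_bounds by simp
  define a where "a = of_rat r4 + of_rat r5 * et + of_rat r2 * et ^ 2 + of_rat r3 * et ^ 3"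
  define b where "b = of_rat r1 + of_rat r0 * et ^ 2"
  define c0 where "c0 = of_rat r0 * (th * et ^ 2 / ?s - th) + of_rat r1 * th / ?s
     + of_rat r2 * 2 * et ^ 2 / (6 * ?s) + of_rat r3 * (- 4 * et ^ 3 / (6 * ?s)) + of_rat r4 * 2 / (6 * ?s) + of_rat r5 * (- 4 * et / (6 * ?s))"
  have eq: "of_rat r0 * p1 x + of_rat r1 * p3 x + of_rat r2 * (cv x * et ^ 2) + of_rat r3 * (cu x * et ^ 2)
      + of_rat r4 * cv x + of_rat r5 * cu x = poly [:c0, b * et / ?s, - a / (6 * ?s):] x" for x
    using s unfolding p1_def p3_def cu_def cv_def c0_def a_def b_def
    by (simp add: divide_simps) (simp add: algebra_simps power2_eq_square power3_eq_cube)
  have "a \<noteq> 0 \<or> b \<noteq> 0"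
  proof (rule ccontr)
    assume "\<not> ?thesis"
    then have ab: "a = 0" "b = 0" by auto
    have "r4 = 0 \<and> r5 = 0 \<and> r2 = 0 \<and> r3 = 0" using ab(1) unfolding a_def by (rule et_independent)
    moreover have "r1 = 0 \<and> 0 = (0::rat) \<and> r0 = 0 \<and> 0 = (0::rat)"
      using ab(2) unfolding b_def by (intro et_independent) simp
    ultimately show False using assms r by simp
  qed
  then have "[:c0, b * et / ?s, - a / (6 * ?s):] \<noteq> 0" using s et_pos by auto
  then have "finite {x. poly [:c0, b * et / ?s, - a / (6 * ?s):] x = 0}" by (rule poly_roots_finite)
  then show ?thesis unfolding r prod.case eq by (rule countable_finite)
qed

text \<open>There are countably many rational relations and each has countably many solutions, which
  cannot exhaust the real line.\<close>

lemma generic_parameter: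
  "\<exists>x. \<forall>r :: nat \<Rightarrow> rat. (\<Sum>k<6. of_rat (r k) * jcoeff x k) = 0 \<longrightarrow> (\<forall>k<6. r k = 0)"
proof -
  let ?bad = "\<lambda>r. {x. case r of (r0, r1, r2, r3, r4, r5) \<Rightarrow>
    of_rat r0 * p1 x + of_rat r1 * p3 x + of_rat r2 * (cv x * et ^ 2) + of_rat r3 * (cu x * et ^ 2)
      + of_rat r4 * cv x + of_rat r5 * cu x = 0}"
  have "countable (\<Union>r\<in>UNIV - {(0, 0, 0, 0, 0, 0)}. ?bad r)"
    by (intro countable_UN uncountable_minus_countable countable_bad_parameters) auto
  moreover have ex_not_mem: "\<exists>x. x \<notin> S" if "countable S" for S :: "real set"
    using that uncountable_UNIV_real by (metis UNIV_eq_I)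
  ultimately have "\<exists>x. x \<notin> (\<Union>r\<in>UNIV - {(0, 0, 0, 0, 0, 0)}. ?bad r)" by (simp only:)
  then obtain x where "x \<notin> (\<Union>r\<in>UNIV - {(0, 0, 0, 0, 0, 0)}. ?bad r)" ..
  then have x: "x \<notin> ?bad r" if "r \<noteq> (0, 0, 0, 0, 0, 0)" for r using that by (simp only: UN_iff) simp
  have "r k = 0" if r: "(\<Sum>k<6. of_rat (r k) * jcoeff x k) = 0" and k: "k < 6" for r :: "nat \<Rightarrow> rat" and k
  proof -
    have "x \<in> ?bad (r 0, r 1, r 2, r 3, r 4, r 5)"
      using r by (simp add: jcoeff_def eval_nat_numeral add.assoc)
    then have "(r 0, r 1, r 2, r 3, r 4, r 5) = (0, 0, 0, 0, 0, 0)" using x[of "(r 0, r 1, r 2, r 3, r 4, r 5)"] by argo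
    then show ?thesis using k by (auto simp: less_Suc_eq eval_nat_numeral)
  qed
  then show ?thesis by blast
qed

text \<open>A parameter at which the six coefficients are linearly independent over \<open>\<rat>\<close>: a rational matrix that commutes
  with the complex structure then commutes with all six right multiplications.\<close>

definition xp :: real where
  "xp = (SOME x. \<forall>r :: nat \<Rightarrow> rat. (\<Sum>k<6. of_rat (r k) * jcoeff x k) = 0 \<longrightarrow> (\<forall>k<6. r k = 0))"

lemma xp_generic: "(\<Sum>k<6. of_rat (r k) * jcoeff xp k) = 0 \<Longrightarrow> k < 6 \<Longrightarrow> r k = (0 :: rat)"
  using someI_ex[OF generic_parameter] unfolding xp_def by blast

text \<open>The dual functional of one of finitely many independent reals, extended to the whole
  line by a basis of the reals over the rationals. It is not continuous in general; only rational
  linearity will be used.\<close>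

lemma rational_functional:
  fixes e :: "nat \<Rightarrow> real"
  assumes ind: "\<And>(r :: nat \<Rightarrow> rat) i. (\<Sum>i<n. of_rat (r i) * e i) = 0 \<Longrightarrow> i < n \<Longrightarrow> r i = 0"
  shows "\<exists>h :: real \<Rightarrow> real. (\<forall>x y. h (x + y) = h x + h y) \<and> (\<forall>q x. h (of_rat q * x) = of_rat q * h x) \<and>
    (\<forall>i<n. h (e i) = (if i = k then 1 else 0))"
proof -
  interpret V: vector_space "\<lambda>(q :: rat) (x :: real). of_rat q * x"
    by unfold_locales (simp_all add: of_rat_add of_rat_mult algebra_simps)
  interpret VV: vector_space_pair "\<lambda>(q :: rat) (x :: real). of_rat q * x" "\<lambda>(q :: rat) (x :: real). of_rat q * x"
    by unfold_locales
  have inj: "inj_on e {..<n}"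
  proof (rule inj_onI, rule ccontr)
    fix i j assume ij: "i \<in> {..<n}" "j \<in> {..<n}" "e i = e j" "i \<noteq> j"
    define r where "r l = (if l = i then 1 else if l = j then - 1 else 0 :: rat)" for l
    have "(\<Sum>l<n. of_rat (r l) * e l) = (\<Sum>l<n. (if l = i then e i else 0) + (if l = j then - e j else 0))"
      using ij(4) by (intro sum.cong) (auto simp: r_def)
    also have "\<dots> = 0" using ij by (simp add: sum.distrib)
    finally show False using ind[of r i] ij(1) by (simp add: r_def)
  qed
  have "V.independent (e ` {..<n})"
  proof (rule V.independent_if_scalars_zero)
    fix f x assume f: "(\<Sum>x\<in>e ` {..<n}. of_rat (f x) * x) = 0" and "x \<in> e ` {..<n}"
    then obtain i where i: "i < n" "x = e i" by auto
    have "(\<Sum>i<n. of_rat (f (e i)) * e i) = 0" using f by (simp add: sum.reindex[OF inj])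
    then show "f x = 0" using ind[of "\<lambda>i. f (e i)" i] i by simp
  qed simp
  then obtain h where h: "Vector_Spaces.linear (\<lambda>(q :: rat) (x :: real). of_rat q * x) (\<lambda>(q :: rat) (x :: real). of_rat q * x) h"
    "\<forall>x\<in>e ` {..<n}. h x = (if x = e k \<and> k < n then 1 else 0)"
    using VV.linear_independent_extend[of "e ` {..<n}" "\<lambda>x. if x = e k \<and> k < n then 1 else 0"] by blast
  have "h (e i) = (if i = k then 1 else 0)" if "i < n" for i
    using h(2) that inj by (auto simp: inj_on_def)
  moreover have "h (x + y) = h x + h y" for x y
    using h(1) unfolding Vector_Spaces.linear_iff by blast
  moreover have "h (of_rat q * x) = of_rat q * h x" for q x
    using h(1) unfolding Vector_Spaces.linear_iff by blast
  ultimately show ?thesis by blast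
qed

section \<open>The quaternion algebra in coordinates\<close>

text \<open>The coordinates \<open>m\<^sub>0, \<dots>, m\<^sub>7\<close> stand for \<open>z + w j\<close> with \<open>z = m\<^sub>0 + m\<^sub>1 i + m\<^sub>2 i\<^sup>2 + m\<^sub>3 i\<^sup>3\<close> and
  \<open>w = m\<^sub>4 + m\<^sub>5 i + m\<^sub>6 i\<^sup>2 + m\<^sub>7 i\<^sup>3\<close>, where \<open>i\<^sup>4 = i\<^sup>2 + 1\<close> and \<open>j\<^sup>2 = 3\<close>. The maps \<open>LX\<close>, \<open>RX\<close> are the
  multiplications by \<open>i\<close>, and \<open>Lj\<close>, \<open>Rj\<close> those by \<open>j\<close>.\<close>

definition zev :: "(nat \<Rightarrow> 'a::comm_ring_1) \<Rightarrow> 'a \<Rightarrow> 'a" where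
  "zev m t = m 0 + m 1 * t + m 2 * t ^ 2 + m 3 * t ^ 3"

definition wev :: "(nat \<Rightarrow> 'a::comm_ring_1) \<Rightarrow> 'a \<Rightarrow> 'a" where
  "wev m t = m 4 + m 5 * t + m 6 * t ^ 2 + m 7 * t ^ 3"

text \<open>Outside the list the value is 0, so that coordinate functions built this way can be
  equal as functions and not just on their first eight arguments.\<close>

definition sel :: "'a::zero list \<Rightarrow> nat \<Rightarrow> 'a" where
  "sel xs k = (if k < length xs then xs ! k else 0)"

definition LX :: "(nat \<Rightarrow> 'a::comm_ring_1) \<Rightarrow> nat \<Rightarrow> 'a" where
  "LX m = sel [m 3, m 0, m 1 + m 3, m 2, m 7, m 4, m 5 + m 7, m 6]"

definition Lj :: "(nat \<Rightarrow> 'a::comm_ring_1) \<Rightarrow> nat \<Rightarrow> 'a" where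
  "Lj m = sel [3 * m 4, - 3 * m 5, 3 * m 6, - 3 * m 7, m 0, - m 1, m 2, - m 3]"

definition RX :: "(nat \<Rightarrow> 'a::comm_ring_1) \<Rightarrow> nat \<Rightarrow> 'a" where
  "RX m = sel [m 3, m 0, m 1 + m 3, m 2, - m 7, - m 4, - (m 5 + m 7), - m 6]"

definition Rj :: "(nat \<Rightarrow> 'a::comm_ring_1) \<Rightarrow> nat \<Rightarrow> 'a" where
  "Rj m = sel [3 * m 4, 3 * m 5, 3 * m 6, 3 * m 7, m 0, m 1, m 2, m 3]"

lemma less_8_cases: "k < 8 \<Longrightarrow> k = 0 \<or> k = 1 \<or> k = 2 \<or> k = 3 \<or> k = 4 \<or> k = 5 \<or> k = 6 \<or> k = (7::nat)"
  by auto

lemma sum_less_6: "(\<Sum>k<6. f k) = f 0 + f 1 + f 2 + f 3 + f 4 + f (5::nat)"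
  by (simp add: eval_nat_numeral)

lemma sel_simps [simp]: "sel (x # xs) 0 = x" "sel (x # xs) (Suc k) = sel xs k" "sel [] k = 0"
  "sel (x # xs) (numeral n) = sel xs (pred_numeral n)" "sel (x # xs) 1 = sel xs 0"
  by (simp_all add: sel_def numeral_eq_Suc)

lemma sel_map: "c 0 = 0 \<Longrightarrow> sel (map c xs) k = c (sel xs k)"
  by (simp add: sel_def)

lemma ev_LX:
  assumes "t ^ 4 = t ^ 2 + 1"
  shows "zev (LX m) t = t * zev m t" "wev (LX m) t = t * wev m t"
proof -
  have "t * zev m t = m 0 * t + m 1 * t ^ 2 + m 2 * t ^ 3 + m 3 * t ^ 4"
    "t * wev m t = m 4 * t + m 5 * t ^ 2 + m 6 * t ^ 3 + m 7 * t ^ 4"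
    unfolding zev_def wev_def by (simp_all add: algebra_simps eval_nat_numeral)
  then show "zev (LX m) t = t * zev m t" "wev (LX m) t = t * wev m t"
    unfolding assms by (simp_all add: zev_def wev_def LX_def algebra_simps)
qed

text \<open>Multiplying \<open>w j\<close> by \<open>i\<close> from the right changes the sign,
  since \<open>j i = - i j\<close>. For the same reason a left factor \<open>j\<close> in
  \<open>ev_Lj\<close> replaces \<open>t\<close> by \<open>- t\<close>.\<close>

lemma ev_RX:
  assumes "t ^ 4 = t ^ 2 + 1"
  shows "zev (RX m) t = t * zev m t" "wev (RX m) t = - t * wev m t"
proof -
  have "zev (RX m) t = zev (LX m) t" "wev (RX m) t = - wev (LX m) t"
    by (simp_all add: zev_def wev_def RX_def LX_def algebra_simps)
  then show "zev (RX m) t = t * zev m t" "wev (RX m) t = - t * wev m t"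
    using ev_LX[OF assms] by simp_all
qed

lemma ev_Rj: "zev (Rj m) t = 3 * wev m t" "wev (Rj m) t = zev m t"
  by (simp_all add: zev_def wev_def Rj_def algebra_simps)

lemma ev_Lj: "zev (Lj m) t = 3 * wev m (- t)" "wev (Lj m) t = zev m (- t)"
  by (simp_all add: zev_def wev_def Lj_def algebra_simps power2_eq_square power3_eq_cube)

text \<open>Right multiplication by \<open>i\<close>, \<open>i\<^sup>3\<close>, \<open>j\<close>,
  \<open>i j\<close>, \<open>i\<^sup>2 j\<close>, \<open>i\<^sup>3 j\<close>, in the order of the
  coefficients in \<open>jcoeff\<close>.\<close>

definition op :: "nat \<Rightarrow> (nat \<Rightarrow> 'a::comm_ring_1) \<Rightarrow> nat \<Rightarrow> 'a" where
  "op k m = [RX m, RX (RX (RX m)), Rj m, Rj (RX m), Rj (RX (RX m)), Rj (RX (RX (RX m)))] ! k"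

definition cstr :: "(nat \<Rightarrow> real) \<Rightarrow> nat \<Rightarrow> real" where
  "cstr y l = (\<Sum>k<6. jcoeff xp k * op k y l)"

section \<open>The period map\<close>

definition tau :: complex where "tau = Complex xp 1"
definition t0 :: complex where "t0 = complex_of_real th"
definition t2 :: complex where "t2 = - \<i> * complex_of_real et"

text \<open>The entries of \<open>per m\<close> at \<open>0, 1\<close> are the row \<open>(\<tau>, 1)\<close> applied to the image of the quaternion in
  \<open>M\<^sub>2(\<real>)\<close> under the real place where \<open>i\<^sup>2 = \<phi>\<close>. Those at \<open>2, 3\<close> come from the other real place, where \<open>i\<close> is sent
  to the non-real number \<open>t2\<close>.\<close>

definition per :: "(nat \<Rightarrow> complex) \<Rightarrow> complex vec" where
  "per m = vec 4 (\<lambda>k. [tau * zev m t0 + 3 * wev m t0, tau * wev m (- t0) + zev m (- t0), zev m t2, wev m (- t2)] ! k)"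

abbreviation (input) cfun :: "('b \<Rightarrow> complex) \<Rightarrow> (nat \<Rightarrow> 'b) \<Rightarrow> nat \<Rightarrow> complex" where
  "cfun c m \<equiv> (\<lambda>k. c (m k))"

lemma per_carrier [simp]: "per m \<in> carrier_vec 4" "dim_vec (per m) = 4"
  by (simp_all add: per_def)

lemma less_4_cases: "k < 4 \<Longrightarrow> k = 0 \<or> k = 1 \<or> k = 2 \<or> k = (3::nat)"
  by auto

lemma eq_vec4I:
  assumes "dim_vec v = 4" "dim_vec w = 4" "v $ 0 = w $ 0" "v $ 1 = w $ 1" "v $ 2 = w $ 2" "v $ 3 = w $ 3"
  shows "v = w"
  using assms by (intro eq_vecI) (auto dest!: less_4_cases)

lemma per_index [simp]:
  "per m $ 0 = tau * zev m t0 + 3 * wev m t0" "per m $ Suc 0 = tau * wev m (- t0) + zev m (- t0)"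
  "per m $ 2 = zev m t2" "per m $ 3 = wev m (- t2)"
  by (simp_all add: per_def)

lemma per_index1: "per m $ 1 = tau * wev m (- t0) + zev m (- t0)"
  by simp

lemma per_cong: "(\<And>k. k < 8 \<Longrightarrow> m k = m' k) \<Longrightarrow> per m = per m'"
  unfolding per_def zev_def wev_def by simp

lemma per_add: "per (\<lambda>k. m k + m' k) = per m + per m'"
  by (rule eq_vec4I) (simp_all add: zev_def wev_def algebra_simps)

lemma per_minus: "per (\<lambda>k. m k - m' k) = per m - per m'"
  by (rule eq_vec4I) (simp_all add: zev_def wev_def algebra_simps)

lemma per_smult: "per (\<lambda>k. c * m k) = c \<cdot>\<^sub>v per m"
  by (rule eq_vec4I) (simp_all add: zev_def wev_def algebra_simps)

lemma root_t0: "t0 ^ 4 = t0 ^ 2 + 1" "(- t0) ^ 4 = (- t0) ^ 2 + 1" "t0 ^ 2 = complex_of_real gold"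
proof -
  have sq: "t0 ^ 2 = complex_of_real gold" unfolding t0_def using th_sq by (simp add: power2_eq_square flip: of_real_mult)
  have "t0 ^ 4 = (t0 ^ 2) ^ 2" by (simp flip: power_mult)
  also have "\<dots> = complex_of_real (gold * gold)" unfolding sq by (simp add: power2_eq_square)
  also have "\<dots> = t0 ^ 2 + 1" unfolding gold_sq sq by simp
  finally show "t0 ^ 4 = t0 ^ 2 + 1" .
  then show "(- t0) ^ 4 = (- t0) ^ 2 + 1" by simp
  show "t0 ^ 2 = complex_of_real gold" by (rule sq)
qed

lemma root_t2: "t2 ^ 4 = t2 ^ 2 + 1" "(- t2) ^ 4 = (- t2) ^ 2 + 1" "t2 ^ 2 = complex_of_real (1 - gold)"
proof -
  have sq: "t2 ^ 2 = complex_of_real (1 - gold)"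
  proof -
    have "t2 ^ 2 = - complex_of_real (et * et)" unfolding t2_def by (simp add: power2_eq_square complex_eq_iff)
    then show ?thesis unfolding et_sq by simp
  qed
  have "t2 ^ 4 = (t2 ^ 2) ^ 2" by (simp flip: power_mult)
  also have "\<dots> = complex_of_real ((1 - gold) * (1 - gold))" unfolding sq by (simp add: power2_eq_square)
  also have "(1 - gold) * (1 - gold) = (1 - gold) + 1" using gold_sq by (simp add: algebra_simps)
  also have "complex_of_real ((1 - gold) + 1) = t2 ^ 2 + 1" unfolding sq by simp
  finally show "t2 ^ 4 = t2 ^ 2 + 1" .
  then show "(- t2) ^ 4 = (- t2) ^ 2 + 1" by simp
  show "t2 ^ 2 = complex_of_real (1 - gold)" by (rule sq)
qed

section \<open>The period map as a real isomorphism\<close>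

lemma ev_real:
  "zev (cfun complex_of_real y) t0 = complex_of_real (zev y th)" "wev (cfun complex_of_real y) t0 = complex_of_real (wev y th)"
  "zev (cfun complex_of_real y) (- t0) = complex_of_real (zev y (- th))" "wev (cfun complex_of_real y) (- t0) = complex_of_real (wev y (- th))"
  unfolding zev_def wev_def t0_def by simp_all

lemma ev_t2:
  "zev (cfun complex_of_real y) t2 = Complex (y 0 - y 2 * (gold - 1)) (- et * (y 1 - y 3 * (gold - 1)))"
  "wev (cfun complex_of_real y) (- t2) = Complex (y 4 - y 6 * (gold - 1)) (et * (y 5 - y 7 * (gold - 1)))"
proof -
  have sq: "t2 ^ 2 = - complex_of_real (gold - 1)" "(- t2) ^ 2 = - complex_of_real (gold - 1)"
    using root_t2(3) by simp_all
  have cu: "t2 ^ 3 = - complex_of_real (gold - 1) * t2" "(- t2) ^ 3 = - complex_of_real (gold - 1) * (- t2)"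
    unfolding power3_eq_cube using sq by (simp_all add: power2_eq_square mult.assoc)
  show "zev (cfun complex_of_real y) t2 = Complex (y 0 - y 2 * (gold - 1)) (- et * (y 1 - y 3 * (gold - 1)))"
    "wev (cfun complex_of_real y) (- t2) = Complex (y 4 - y 6 * (gold - 1)) (et * (y 5 - y 7 * (gold - 1)))"
    unfolding zev_def wev_def sq cu unfolding t2_def by (simp_all add: complex_eq_iff algebra_simps)
qed

text \<open>The four conditions say that a real cubic vanishes at the roots
  \<open>\<plusminus> th\<close>, \<open>\<plusminus> t2\<close> of
  \<open>x\<^sup>4 - x\<^sup>2 - 1\<close>: the last two are the real part and, up to the factor
  \<open>- et\<close>, the imaginary part of its value at \<open>t2\<close>.\<close>

lemma quartic_unique:
  fixes a b c d :: real
  assumes "a + b * th + c * th ^ 2 + d * th ^ 3 = 0" "a + b * - th + c * (- th) ^ 2 + d * (- th) ^ 3 = 0"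
    "a - c * (gold - 1) = 0" "b - d * (gold - 1) = 0"
  shows "a = 0 \<and> b = 0 \<and> c = 0 \<and> d = 0"
proof -
  have th2: "th ^ 2 = gold" "(- th) ^ 2 = gold" "th ^ 3 = gold * th" "(- th) ^ 3 = - (gold * th)"
    using th_sq by (simp_all add: power2_eq_square power3_eq_cube)
  have e: "a + c * gold = 0" using assms(1,2) unfolding th2 by simp
  have "(b + d * gold) * th = 0" using assms(1,2) unfolding th2 by (simp add: algebra_simps)
  then have f: "b + d * gold = 0" using th_pos by simp
  have g: "2 * gold - 1 \<noteq> 0" using gold_bounds by simp
  have "c * (2 * gold - 1) = (a + c * gold) - (a - c * (gold - 1))" "d * (2 * gold - 1) = (b + d * gold) - (b - d * (gold - 1))"
    by (simp_all add: algebra_simps)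
  then have "c * (2 * gold - 1) = 0" "d * (2 * gold - 1) = 0" using e f assms(3,4) by simp_all
  then have "c = 0" "d = 0" using g by simp_all
  then show ?thesis using e f by simp
qed

text \<open>The even and the odd coefficients decouple into two linear systems of size 2, both with
  determinant \<open>2 gold - 1\<close> up to sign.\<close>

lemma quartic_exists:
  fixes z0 z1 e f :: real
  shows "\<exists>a b c d. a + b * th + c * th ^ 2 + d * th ^ 3 = z0 \<and> a + b * - th + c * (- th) ^ 2 + d * (- th) ^ 3 = z1 \<and>
    a - c * (gold - 1) = e \<and> b - d * (gold - 1) = f"
proof -
  have th2: "th ^ 2 = gold" "(- th) ^ 2 = gold" "th ^ 3 = gold * th" "(- th) ^ 3 = - (gold * th)"
    using th_sq by (simp_all add: power2_eq_square power3_eq_cube)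
  define s where "s = 2 * gold - 1"
  have s: "s \<noteq> 0" using gold_bounds by (simp add: s_def)
  define c where "c = ((z0 + z1) / 2 - e) / s"
  define a where "a = (z0 + z1) / 2 - c * gold"
  define d where "d = ((z0 - z1) / (2 * th) - f) / s"
  define b where "b = (z0 - z1) / (2 * th) - d * gold"
  have "c * s = (z0 + z1) / 2 - e" "d * s = (z0 - z1) / (2 * th) - f" unfolding c_def d_def using s by simp_all
  moreover have "a - c * (gold - 1) = (z0 + z1) / 2 - c * s" "b - d * (gold - 1) = (z0 - z1) / (2 * th) - d * s"
    unfolding a_def b_def s_def by (simp_all add: algebra_simps)
  ultimately have 1: "a - c * (gold - 1) = e" "b - d * (gold - 1) = f" by simp_all
  have "b * th = (z0 - z1) / 2 - d * gold * th" unfolding b_def using th_pos by (simp add: field_simps)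
  then have 2: "a + b * th + c * gold + d * (gold * th) = z0" "a - b * th + c * gold - d * (gold * th) = z1"
    unfolding a_def by (simp_all add: field_simps)
  show ?thesis unfolding th2 using 1 2 by (intro exI[of _ a] exI[of _ b] exI[of _ c] exI[of _ d]) simp
qed

lemma per_injective:
  assumes "per (cfun complex_of_real y) = 0\<^sub>v 4" "k < 8"
  shows "y k = 0"
proof -
  have i: "per (cfun complex_of_real y) $ i = 0" if "i < 4" for i using assms(1) that by simp
  have 0: "tau * complex_of_real (zev y th) + 3 * complex_of_real (wev y th) = 0" using i[of 0] by (simp add: ev_real)
  \<comment> \<open>Both evaluations are real and \<open>tau\<close> is not, so the two terms vanish
    separately.\<close>
  then have z0: "zev y th = 0" and w0: "wev y th = 0" by (auto simp: tau_def complex_eq_iff)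
  have 1: "tau * complex_of_real (wev y (- th)) + complex_of_real (zev y (- th)) = 0" using i[of 1] by (simp add: ev_real)
  then have w1: "wev y (- th) = 0" and z1: "zev y (- th) = 0" by (auto simp: tau_def complex_eq_iff)
  have "zev (cfun complex_of_real y) t2 = 0" "wev (cfun complex_of_real y) (- t2) = 0" using i[of 2] i[of 3] by simp_all
  then have 2: "y 0 - y 2 * (gold - 1) = 0" "y 1 - y 3 * (gold - 1) = 0" "y 4 - y 6 * (gold - 1) = 0" "y 5 - y 7 * (gold - 1) = 0"
    unfolding ev_t2 using et_pos by (simp_all add: complex_eq_iff)
  have "y 0 = 0 \<and> y 1 = 0 \<and> y 2 = 0 \<and> y 3 = 0" "y 4 = 0 \<and> y 5 = 0 \<and> y 6 = 0 \<and> y 7 = 0"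
    by (intro quartic_unique; use z0 z1 w0 w1 2 in \<open>simp add: zev_def wev_def\<close>)+
  then show ?thesis using less_8_cases[OF assms(2)] by auto
qed

lemma per_inj:
  assumes "per (cfun complex_of_real y) = per (cfun complex_of_real y')" "k < 8"
  shows "y k = y' k"
proof -
  have "per (cfun complex_of_real (\<lambda>k. y k - y' k)) = per (cfun complex_of_real y) - per (cfun complex_of_real y')"
    using per_minus[of "cfun complex_of_real y" "cfun complex_of_real y'"] by simp
  also have "\<dots> = 0\<^sub>v 4" unfolding assms(1) by simp
  finally have "y k - y' k = 0" using assms(2) by (rule per_injective[of "\<lambda>k. y k - y' k"])
  then show ?thesis by simp
qed

lemma per_surjective:
  assumes c: "c \<in> carrier_vec 4"
  shows "\<exists>y. per (cfun complex_of_real y) = c"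
proof -
  \<comment> \<open>The prescribed values are read off from \<open>c\<close>: since
    \<open>tau\<close> has imaginary part 1, the imaginary parts of entries 0 and 1 are the values
    of \<open>z\<close> at \<open>th\<close> and of \<open>w\<close> at \<open>- th\<close>.\<close>
  obtain a0 a1 a2 a3 where a: "a0 + a1 * th + a2 * th ^ 2 + a3 * th ^ 3 = Im (c $ 0)"
    "a0 + a1 * - th + a2 * (- th) ^ 2 + a3 * (- th) ^ 3 = Re (c $ 1) - xp * Im (c $ 1)"
    "a0 - a2 * (gold - 1) = Re (c $ 2)" "a1 - a3 * (gold - 1) = - Im (c $ 2) / et"
    using quartic_exists by blast
  obtain b0 b1 b2 b3 where b: "b0 + b1 * th + b2 * th ^ 2 + b3 * th ^ 3 = (Re (c $ 0) - xp * Im (c $ 0)) / 3"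
    "b0 + b1 * - th + b2 * (- th) ^ 2 + b3 * (- th) ^ 3 = Im (c $ 1)"
    "b0 - b2 * (gold - 1) = Re (c $ 3)" "b1 - b3 * (gold - 1) = Im (c $ 3) / et"
    using quartic_exists by blast
  define y where "y k = [a0, a1, a2, a3, b0, b1, b2, b3] ! k" for k
  have yk: "y 0 = a0" "y 1 = a1" "y 2 = a2" "y 3 = a3" "y 4 = b0" "y 5 = b1" "y 6 = b2" "y 7 = b3"
    by (simp_all add: y_def)
  have ev: "zev y th = Im (c $ 0)" "zev y (- th) = Re (c $ 1) - xp * Im (c $ 1)"
    "wev y th = (Re (c $ 0) - xp * Im (c $ 0)) / 3" "wev y (- th) = Im (c $ 1)"
    unfolding zev_def wev_def yk by (rule a b)+
  have "per (cfun complex_of_real y) = c"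
  proof (rule eq_vec4I)
    show "per (cfun complex_of_real y) $ 0 = c $ 0"
      by (simp add: ev_real ev tau_def complex_eq_iff field_simps)
    show "per (cfun complex_of_real y) $ 1 = c $ 1"
      by (simp add: ev_real ev tau_def complex_eq_iff)
    show "per (cfun complex_of_real y) $ 2 = c $ 2" "per (cfun complex_of_real y) $ 3 = c $ 3"
      unfolding per_index ev_t2 yk a b using et_pos by (simp_all add: complex_eq_iff)
  qed (use c in simp_all)
  then show ?thesis by blast
qed

text \<open>\<open>cstr\<close> is right multiplication by the quaternion \<open>p + q j\<close>.
  Its matrix at the first place has the eigenvector \<open>(tau, 1)\<close>, that at the second
  place the eigenvector \<open>(1, 0)\<close>, both with eigenvalue \<open>\<i>\<close>; the entries
  of \<open>per\<close> are the matrices of the quaternion applied to these vectors.\<close>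

lemma complex_structure:
  "per (cfun complex_of_real (cstr y)) = \<i> \<cdot>\<^sub>v per (cfun complex_of_real y)"
proof -
  let ?c = "\<lambda>k. complex_of_real (jcoeff xp k)"
  let ?y = "cfun complex_of_real y"
  have RX_of_real: "RX (cfun complex_of_real m) = cfun complex_of_real (RX m)"
    and Rj_of_real: "Rj (cfun complex_of_real m) = cfun complex_of_real (Rj m)" for m
    unfolding RX_def Rj_def by (simp_all flip: sel_map)
  have op_of_real: "complex_of_real (op k y l) = op k ?y l" if "k < 6" for k l
  proof -
    have "k = 0 \<or> k = 1 \<or> k = 2 \<or> k = 3 \<or> k = 4 \<or> k = 5" using that by auto
    then show ?thesis by (elim disjE) (simp_all add: op_def RX_of_real Rj_of_real)
  qed
  have lin: "zev (\<lambda>l. \<Sum>k<6. ?c k * op k ?y l) t = (\<Sum>k<6. ?c k * zev (op k ?y) t)"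
    "wev (\<lambda>l. \<Sum>k<6. ?c k * op k ?y l) t = (\<Sum>k<6. ?c k * wev (op k ?y) t)" for t
    unfolding sum_less_6 zev_def wev_def by (simp_all add: algebra_simps)
  have per_eq: "per (cfun complex_of_real (cstr y)) = per (\<lambda>l. \<Sum>k<6. ?c k * op k ?y l)"
    by (rule per_cong) (simp add: cstr_def op_of_real)
  let ?p = "\<lambda>t. ?c 0 * t + ?c 1 * t ^ 3" and ?q = "\<lambda>t. ?c 2 + ?c 3 * t + ?c 4 * t ^ 2 + ?c 5 * t ^ 3"
  have ev: "zev (\<lambda>l. \<Sum>k<6. ?c k * op k ?y l) t = ?p t * zev ?y t + 3 * ?q (- t) * wev ?y t"
    "wev (\<lambda>l. \<Sum>k<6. ?c k * op k ?y l) t = ?q t * zev ?y t - ?p t * wev ?y t" if "t ^ 4 = t ^ 2 + 1" for t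
    unfolding lin unfolding sum_less_6 op_def
    by (simp_all add: ev_RX[OF that] ev_Rj algebra_simps power2_eq_square power3_eq_cube)
  have pe: "complex_of_real (p1 xp) * t + complex_of_real (p3 xp) * t ^ 3 = complex_of_real (p1 xp + p3 xp * s) * t"
    if "t ^ 2 = complex_of_real s" for t s
  proof -
    have "t ^ 3 = t ^ 2 * t" by (simp add: power3_eq_cube power2_eq_square)
    then show ?thesis unfolding that by (simp add: algebra_simps)
  qed
  have qe: "complex_of_real (cv xp * et ^ 2) + complex_of_real (cu xp * et ^ 2) * t + complex_of_real (cv xp) * t ^ 2
     + complex_of_real (cu xp) * t ^ 3 = complex_of_real (et ^ 2 + s) * (complex_of_real (cv xp) + complex_of_real (cu xp) * t)"
    if "t ^ 2 = complex_of_real s" for t s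
  proof -
    have "t ^ 3 = t ^ 2 * t" by (simp add: power3_eq_cube power2_eq_square)
    then show ?thesis unfolding that by (simp add: algebra_simps)
  qed
  have cs: "jcoeff xp 0 = p1 xp" "jcoeff xp 1 = p3 xp" "jcoeff xp 2 = cv xp * et ^ 2" "jcoeff xp 3 = cu xp * et ^ 2"
    "jcoeff xp 4 = cv xp" "jcoeff xp 5 = cu xp" by (simp_all add: jcoeff_def)
  have sq: "(- t0) ^ 2 = complex_of_real gold" "(- t2) ^ 2 = complex_of_real (1 - gold)"
    using root_t0(3) root_t2(3) by simp_all
  let ?s = "2 * gold - 1"
  have s: "?s > 0" using gold_bounds by simp
  have ets: "et ^ 2 = gold - 1" using et_sq by (simp add: power2_eq_square)
  have et1: "et ^ 2 + gold = ?s" "et ^ 2 + (1 - gold) = 0" unfolding ets by simp_all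
  have p3s: "p3 xp * ?s = xp * et + th" unfolding p3_def using s by simp
  have pp: "p1 xp + p3 xp * gold = xp * et"
  proof -
    have "p1 xp + p3 xp * gold = p3 xp * ?s - th" unfolding p1_def ets by (simp add: algebra_simps)
    then show ?thesis unfolding p3s by simp
  qed
  have pm: "p1 xp + p3 xp * (1 - gold) = - th" unfolding p1_def ets by (simp add: algebra_simps)
  \<comment> \<open>The origin of \<open>p1\<close> and \<open>p3\<close>: they solve the
    interpolation problem that these four values pose for an odd cubic.\<close>
  have P: "?p t0 = complex_of_real xp" "?p (- t0) = - complex_of_real xp" "?p t2 = \<i>" "?p (- t2) = - \<i>"
    unfolding cs pe[OF root_t0(3)] pe[OF sq(1)] pe[OF root_t2(3)] pe[OF sq(2)] pp pm
    using th_et unfolding t0_def t2_def by (simp_all add: mult.commute mult.left_commute flip: of_real_mult)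
  have cvs: "?s * cv xp = (2 - xp\<^sup>2) / 6" "?s * (cu xp * th) = - (xp\<^sup>2 + 4) / 6"
  proof -
    have aux: "v * (a / (6 * v)) = a / 6" if "v > 0" for v a :: real using that by simp
    show "?s * cv xp = (2 - xp\<^sup>2) / 6" unfolding cv_def by (rule aux[OF s])
    have "?s * (cu xp * th) = - (xp\<^sup>2 + 4) / 6 * (th * et)"
      using aux[OF s, of "- (xp\<^sup>2 + 4) * (th * et)"] unfolding cu_def by (simp add: ac_simps)
    then show "?s * (cu xp * th) = - (xp\<^sup>2 + 4) / 6" unfolding th_et by simp
  qed
  have "?s * (cv xp + cu xp * th) = - (xp\<^sup>2 + 1) / 3" "?s * (cv xp - cu xp * th) = 1"
    unfolding distrib_left right_diff_distrib cvs by (simp_all add: field_simps)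
  note Qr = this
  have ofr: "complex_of_real a * (complex_of_real b + complex_of_real c * complex_of_real d) = complex_of_real (a * (b + c * d))"
    "complex_of_real a * (complex_of_real b + complex_of_real c * - complex_of_real d) = complex_of_real (a * (b - c * d))"
    for a b c d by simp_all
  \<comment> \<open>The factor \<open>et ^ 2 + t ^ 2\<close> of \<open>q\<close> vanishes at
    \<open>\<plusminus> t2\<close>, and \<open>cv\<close>, \<open>cu\<close> are determined by the
    values at \<open>\<plusminus> t0\<close>. The matrix of \<open>p + q j\<close> at the first
    place thus has the rows \<open>(xp, - (xp\<^sup>2 + 1))\<close> and \<open>(1, - xp)\<close> and
    multiplies \<open>(tau, 1)\<close> by \<open>\<i>\<close>.\<close>
  have Q: "?q t0 = complex_of_real (- (xp\<^sup>2 + 1) / 3)" "?q (- t0) = complex_of_real 1" "?q t2 = 0" "?q (- t2) = 0"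
    unfolding cs qe[OF root_t0(3)] qe[OF sq(1)] qe[OF root_t2(3)] qe[OF sq(2)] et1
    unfolding t0_def ofr Qr by simp_all
  have tau: "tau = complex_of_real xp + \<i>" by (simp add: tau_def complex_eq_iff)
  show ?thesis unfolding per_eq
  proof (rule eq_vec4I)
    let ?m = "\<lambda>l. \<Sum>k<6. ?c k * op k ?y l"
    have "per ?m $ 0 = tau * (complex_of_real xp * zev ?y t0 + 3 * wev ?y t0)
       + 3 * (complex_of_real (- (xp\<^sup>2 + 1) / 3) * zev ?y t0 - complex_of_real xp * wev ?y t0)"
      unfolding per_index ev[OF root_t0(1)] P Q by simp
    also have "\<dots> = \<i> * (tau * zev ?y t0 + 3 * wev ?y t0)"
      unfolding tau by (simp add: field_simps power2_eq_square)
    finally show "per ?m $ 0 = (\<i> \<cdot>\<^sub>v per ?y) $ 0" by simp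
    have "per ?m $ 1 = tau * (1 * zev ?y (- t0) + complex_of_real xp * wev ?y (- t0))
       + (- complex_of_real xp * zev ?y (- t0) + 3 * complex_of_real (- (xp\<^sup>2 + 1) / 3) * wev ?y (- t0))"
      unfolding per_index1 ev[OF root_t0(2)] minus_minus P Q by simp
    also have "\<dots> = \<i> * (tau * wev ?y (- t0) + zev ?y (- t0))"
      unfolding tau by (simp add: field_simps power2_eq_square)
    finally show "per ?m $ 1 = (\<i> \<cdot>\<^sub>v per ?y) $ 1" by simp
    show "per ?m $ 2 = (\<i> \<cdot>\<^sub>v per ?y) $ 2"
      unfolding per_index ev[OF root_t2(1)] P Q by simp
    have "per ?m $ 3 = \<i> * wev ?y (- t2)"
      unfolding per_index ev[OF root_t2(2)] minus_minus P Q by simp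
    then show "per ?m $ 3 = (\<i> \<cdot>\<^sub>v per ?y) $ 3" by simp
  qed simp_all
qed

section \<open>The lattice and its endomorphisms\<close>

lemma of_real_of_rat: "complex_of_real (real_of_rat q) = complex_of_rat q"
proof -
  obtain a b where "quotient_of q = (a, b)" by (cases "quotient_of q")
  then have "q = of_int a / of_int b" by (rule quotient_of_div)
  then show ?thesis by (simp add: of_rat_divide)
qed

definition Lat :: "complex vec set" where "Lat = range (\<lambda>m :: nat \<Rightarrow> int. per (cfun of_int m))"
definition QLat :: "complex vec set" where "QLat = range (\<lambda>m :: nat \<Rightarrow> rat. per (cfun of_rat m))"

lemma QLatI: "per (cfun of_rat n) \<in> QLat"
  unfolding QLat_def by blast

definition dlt :: "nat \<Rightarrow> nat \<Rightarrow> 'a::zero_neq_one" where "dlt j k = (if k = j then 1 else 0)"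

lemma per_sum:
  assumes "finite S" "i < 4"
  shows "per (\<lambda>k. \<Sum>j\<in>S. c j * f j k) $ i = (\<Sum>j\<in>S. c j * per (f j) $ i)"
  using assms(1)
proof (induction S)
  case empty
  have "per (\<lambda>k. 0) $ i = 0" using less_4_cases[OF assms(2)] by (auto simp: zev_def wev_def)
  then show ?case by simp
next
  case (insert x S)
  have "per (\<lambda>k. \<Sum>j\<in>insert x S. c j * f j k) = per (\<lambda>k. c x * f x k) + per (\<lambda>k. \<Sum>j\<in>S. c j * f j k)"
    using insert.hyps by (simp add: per_add)
  then show ?case using insert assms(2) by (simp add: per_smult)
qed

lemma per_expand: "i < 4 \<Longrightarrow> per m $ i = (\<Sum>j<8. m j * per (dlt j) $ i)"
proof -
  assume i: "i < 4"
  have "per m = per (\<lambda>k. \<Sum>j<8. m j * dlt j k)"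
    by (rule per_cong) (simp add: dlt_def if_distrib cong: if_cong)
  then show ?thesis using per_sum[of "{..<8}" i m dlt] i by simp
qed

lemma full_lattice_Lat: "full_lattice 4 (carrier_vec 4) Lat"
proof -
  define P where "P = mat 4 8 (\<lambda>(i,j). per (dlt j) $ i)"
  have P: "P \<in> carrier_mat 4 8" by (simp add: P_def)
  have Pper: "P *\<^sub>v v = per (vec_index v)" if v: "v \<in> carrier_vec 8" for v
  proof (rule eq_vecI)
    fix i assume "i < dim_vec (per (vec_index v))"
    then have i: "i < 4" by simp
    have "(P *\<^sub>v v) $ i = (\<Sum>j<8. P $$ (i,j) * v $ j)" by (rule mat_vec_index_sum[OF P v i])
    also have "\<dots> = (\<Sum>j<8. v $ j * per (dlt j) $ i)"
      by (intro sum.cong) (use i in \<open>auto simp: P_def\<close>)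
    also have "\<dots> = per (vec_index v) $ i" by (rule per_expand[OF i, symmetric])
    finally show "(P *\<^sub>v v) $ i = per (vec_index v) $ i" .
  qed (use P in simp)
  have PR: "P *\<^sub>v map_vec complex_of_real x = per (cfun complex_of_real (vec_index x))" if "x \<in> carrier_vec 8" for x :: "real vec"
    using Pper[of "map_vec complex_of_real x"] that by (auto intro!: per_cong)
  have PZ: "P *\<^sub>v map_vec (of_int :: int \<Rightarrow> complex) x = per (cfun of_int (vec_index x))" if "x \<in> carrier_vec 8" for x :: "int vec"
    using Pper[of "map_vec (of_int :: int \<Rightarrow> complex) x"] that by (auto intro!: per_cong)
  have bij: "bij_betw (\<lambda>x. P *\<^sub>v map_vec complex_of_real x) (carrier_vec 8) (carrier_vec 4)"
    unfolding bij_betw_def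
  proof
    show "inj_on (\<lambda>x. P *\<^sub>v map_vec complex_of_real x) (carrier_vec 8)"
    proof (rule inj_onI)
      fix x y :: "real vec" assume xy: "x \<in> carrier_vec 8" "y \<in> carrier_vec 8"
        "P *\<^sub>v map_vec complex_of_real x = P *\<^sub>v map_vec complex_of_real y"
      then have "per (cfun complex_of_real (vec_index x)) = per (cfun complex_of_real (vec_index y))" using PR by simp
      then have "x $ k = y $ k" if "k < 8" for k using per_inj that by blast
      then show "x = y" using xy by (intro eq_vecI) auto
    qed
    show "(\<lambda>x. P *\<^sub>v map_vec complex_of_real x) ` carrier_vec 8 = carrier_vec 4"
    proof
      show "(\<lambda>x. P *\<^sub>v map_vec complex_of_real x) ` carrier_vec 8 \<subseteq> carrier_vec 4" using P by auto
      show "carrier_vec 4 \<subseteq> (\<lambda>x. P *\<^sub>v map_vec complex_of_real x) ` carrier_vec 8"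
      proof
        fix c :: "complex vec" assume "c \<in> carrier_vec 4"
        then obtain y where y: "per (cfun complex_of_real y) = c" using per_surjective by blast
        have "P *\<^sub>v map_vec complex_of_real (vec 8 y) = c" unfolding y[symmetric] using PR[of "vec 8 y"] by (auto intro!: per_cong)
        then show "c \<in> (\<lambda>x. P *\<^sub>v map_vec complex_of_real x) ` carrier_vec 8" by (intro image_eqI[of _ _ "vec 8 y"]) simp_all
      qed
    qed
  qed
  have LatP: "Lat = (\<lambda>m. P *\<^sub>v map_vec (of_int :: int \<Rightarrow> complex) m) ` (carrier_vec 8 :: int vec set)"
  proof
    show "Lat \<subseteq> (\<lambda>m. P *\<^sub>v map_vec (of_int :: int \<Rightarrow> complex) m) ` (carrier_vec 8 :: int vec set)"
    proof
      fix c assume "c \<in> Lat"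
      then obtain m :: "nat \<Rightarrow> int" where m: "c = per (cfun of_int m)" unfolding Lat_def by auto
      have "P *\<^sub>v map_vec (of_int :: int \<Rightarrow> complex) (vec 8 m) = c" unfolding m using PZ[of "vec 8 m"] by (auto intro!: per_cong)
      then show "c \<in> (\<lambda>m. P *\<^sub>v map_vec (of_int :: int \<Rightarrow> complex) m) ` (carrier_vec 8 :: int vec set)" by (intro image_eqI[of _ _ "vec 8 m"]) simp_all
    qed
    show "(\<lambda>m. P *\<^sub>v map_vec (of_int :: int \<Rightarrow> complex) m) ` (carrier_vec 8 :: int vec set) \<subseteq> Lat"
      using PZ unfolding Lat_def by auto
  qed
  show ?thesis unfolding full_lattice_def
    by (intro exI[of _ 8] exI[of _ P] conjI P bij LatP)
qed

lemma Lat_carrier: "Lat \<subseteq> carrier_vec 4"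
  unfolding Lat_def by auto

section \<open>Endomorphisms up to isogeny as rational matrices\<close>

lemma common_denominator:
  "finite (S :: rat set) \<Longrightarrow> \<exists>N :: int. N > 0 \<and> (\<forall>q\<in>S. \<exists>k :: int. of_int N * q = of_int k)"
proof (induction S rule: finite_induct)
  case empty show ?case by (intro exI[of _ 1]) simp
next
  case (insert q S)
  then obtain N where N: "N > 0" "\<forall>q\<in>S. \<exists>k :: int. of_int N * q = of_int k" by auto
  obtain a b where ab: "quotient_of q = (a, b)" by (cases "quotient_of q")
  then have q: "q = of_int a / of_int b" and b: "b > 0" by (auto simp: quotient_of_div quotient_of_denom_pos)
  have "\<exists>k :: int. of_int (b * N) * p = of_int k" if p: "p \<in> insert q S" for p
  proof (cases "p = q")
    case True
    have "of_int (b * N) * p = of_int (N * a)" unfolding True q using b by simp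
    then show ?thesis by blast
  next
    case False
    then obtain k :: int where "of_int N * p = of_int k" using p N(2) by blast
    then have "of_int (b * N) * p = of_int (b * k)" by (simp add: mult.assoc)
    then show ?thesis by blast
  qed
  then show ?case using N(1) b by (intro exI[of _ "b * N"]) simp
qed

lemma EndQ_rational_matrix:
  assumes T: "T \<in> carrier_mat 4 4" "\<And>v. v \<in> Lat \<Longrightarrow> T *\<^sub>v v \<in> QLat"
  obtains M :: "nat \<Rightarrow> nat \<Rightarrow> rat" where "\<And>x. T *\<^sub>v per x = per (\<lambda>k. \<Sum>j<8. of_rat (M k j) * x j)"
proof -
  have "\<exists>n :: nat \<Rightarrow> rat. T *\<^sub>v per (dlt j) = per (cfun of_rat n)" for j
  proof -
    have "per (dlt j) = per (cfun of_int (dlt j))" by (rule per_cong) (simp add: dlt_def)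
    then have "per (dlt j) \<in> Lat" unfolding Lat_def by blast
    then have "T *\<^sub>v per (dlt j) \<in> QLat" by (rule T(2))
    then show ?thesis unfolding QLat_def by (elim rangeE exI)
  qed
  then obtain n :: "nat \<Rightarrow> nat \<Rightarrow> rat" where n: "\<And>j. T *\<^sub>v per (dlt j) = per (cfun of_rat (n j))" by metis
  have "T *\<^sub>v per x = per (\<lambda>k. \<Sum>j<8. of_rat (n j k) * x j)" for x
  proof (rule eq_vecI)
    fix i assume "i < dim_vec (per (\<lambda>k. \<Sum>j<8. of_rat (n j k) * x j))"
    then have i: "i < 4" by simp
    have "(T *\<^sub>v per x) $ i = (\<Sum>l<4. T $$ (i,l) * (\<Sum>j<8. x j * per (dlt j) $ l))"
      unfolding mat_vec_index_sum[OF T(1) per_carrier(1) i]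
      by (intro sum.cong refl arg_cong[where f = "\<lambda>y. _ * y"] per_expand) simp
    also have "\<dots> = (\<Sum>j<8. x j * (\<Sum>l<4. T $$ (i,l) * per (dlt j) $ l))"
      unfolding sum_distrib_left by (subst sum.swap) (simp add: mult.left_commute)
    also have "\<dots> = (\<Sum>j<8. x j * per (cfun of_rat (n j)) $ i)"
      unfolding mat_vec_index_sum[OF T(1) per_carrier(1) i, symmetric] n ..
    also have "\<dots> = per (\<lambda>k. \<Sum>j<8. x j * of_rat (n j k)) $ i"
      by (rule per_sum[symmetric]) (use i in auto)
    finally show "(T *\<^sub>v per x) $ i = per (\<lambda>k. \<Sum>j<8. of_rat (n j k) * x j) $ i" by (simp add: mult.commute)
  qed (use T(1) in simp)
  then show ?thesis using that[of "\<lambda>k j. n j k"] by blast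
qed

text \<open>Finitely many rational matrix entries have a common denominator, and multiplying by it
  gives an endomorphism of the lattice.\<close>

lemma EndQ_iff:
  "T \<in> carrier (EndQ_ring 4 Lat) \<longleftrightarrow> T \<in> carrier_mat 4 4 \<and> (\<forall>v\<in>Lat. T *\<^sub>v v \<in> QLat)"
proof
  assume T: "T \<in> carrier (EndQ_ring 4 Lat)"
  then obtain q A where qA: "T = of_rat q \<cdot>\<^sub>m A" "A \<in> carrier_mat 4 4" "\<forall>v\<in>Lat. A *\<^sub>v v \<in> Lat"
    unfolding EndQ_ring_carrier End_ring_carrier by auto
  have "T *\<^sub>v v \<in> QLat" if v: "v \<in> Lat" for v
  proof -
    obtain m :: "nat \<Rightarrow> int" where m: "A *\<^sub>v v = per (cfun of_int m)" using qA(3) v unfolding Lat_def by auto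
    have vc: "v \<in> carrier_vec 4" using v Lat_carrier by auto
    have "T *\<^sub>v v = of_rat q \<cdot>\<^sub>v (A *\<^sub>v v)"
      unfolding qA(1) using qA(2) vc by (intro eq_vecI) (auto simp: scalar_prod_def sum_distrib_left mult.assoc)
    also have "\<dots> = per (cfun of_rat (\<lambda>k. q * of_int (m k)))"
      unfolding m per_smult[symmetric] by (rule per_cong) (simp add: of_rat_mult)
    finally show ?thesis using QLatI[of "\<lambda>k. q * of_int (m k)"] by simp
  qed
  then show "T \<in> carrier_mat 4 4 \<and> (\<forall>v\<in>Lat. T *\<^sub>v v \<in> QLat)" using qA by simp
next
  assume T: "T \<in> carrier_mat 4 4 \<and> (\<forall>v\<in>Lat. T *\<^sub>v v \<in> QLat)"
  then obtain M :: "nat \<Rightarrow> nat \<Rightarrow> rat" where M: "\<And>x. T *\<^sub>v per x = per (\<lambda>k. \<Sum>j<8. of_rat (M k j) * x j)"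
    using EndQ_rational_matrix[of T] by blast
  obtain N :: int where N: "N > 0" "\<And>k j. k < 8 \<Longrightarrow> j < 8 \<Longrightarrow> \<exists>l :: int. of_int N * M k j = of_int l"
    using common_denominator[of "(\<lambda>(k,j). M k j) ` ({..<8} \<times> {..<8})"] by auto
  define A where "A = of_int N \<cdot>\<^sub>m T"
  have A: "A \<in> carrier_mat 4 4" using T by (simp add: A_def)
  have "A *\<^sub>v v \<in> Lat" if v: "v \<in> Lat" for v
  proof -
    obtain m :: "nat \<Rightarrow> int" where m: "v = per (cfun of_int m)" using v unfolding Lat_def by auto
    have "\<exists>l :: int. (\<Sum>j<8. of_int N * M k j * of_int (m j)) = of_int l" if k: "k < 8" for k
    proof -
      have "(\<Sum>j<8. of_int N * M k j * of_int (m j)) \<in> Ints"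
      proof (rule Ints_sum)
        fix j :: nat assume "j \<in> {..<8}"
        then obtain l :: int where "of_int N * M k j = of_int l" using N(2)[OF k] by auto
        then show "of_int N * M k j * of_int (m j) \<in> Ints" by (simp only: Ints_mult Ints_of_int)
      qed
      then show ?thesis by (auto elim: Ints_cases)
    qed
    then obtain l :: "nat \<Rightarrow> int" where l: "\<And>k. k < 8 \<Longrightarrow> (\<Sum>j<8. of_int N * M k j * of_int (m j)) = of_int (l k)" by metis
    have "A *\<^sub>v v = of_int N \<cdot>\<^sub>v (T *\<^sub>v v)"
      unfolding A_def using T v Lat_carrier by (intro eq_vecI) (auto simp: scalar_prod_def sum_distrib_left mult.assoc)
    also have "\<dots> = per (\<lambda>k. of_int N * (\<Sum>j<8. of_rat (M k j) * of_int (m j)))" unfolding m M per_smult ..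
    also have "\<dots> = per (cfun of_int l)"
    proof (rule per_cong)
      fix k :: nat assume k: "k < 8"
      have "of_int N * (\<Sum>j<8. of_rat (M k j) * of_int (m j)) = (of_rat (\<Sum>j<8. of_int N * M k j * of_int (m j)) :: complex)"
        by (simp add: of_rat_sum of_rat_mult sum_distrib_left mult.assoc)
      then show "of_int N * (\<Sum>j<8. of_rat (M k j) * of_int (m j)) = (of_int (l k) :: complex)" unfolding l[OF k] by simp
    qed
    finally show ?thesis unfolding Lat_def by blast
  qed
  then have "A \<in> carrier (End_ring 4 Lat)" using A by (simp add: End_ring_carrier)
  moreover have "T = of_rat (1 / of_int N) \<cdot>\<^sub>m A"
    unfolding A_def using N(1) T by (intro eq_matI) (auto simp: of_rat_divide)
  ultimately show "T \<in> carrier (EndQ_ring 4 Lat)" unfolding EndQ_ring_carrier by blast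
qed

section \<open>Rationality of the complex structure\<close>

text \<open>The right multiplications have integer structure constants and therefore commute with a
  change of scalars.\<close>

lemma op_hom:
  assumes "c 0 = 0" "\<And>a b. c (a + b) = c a + c b" "\<And>a. c (- a) = - c a" "\<And>a. c (3 * a) = 3 * c a" "k < 6"
  shows "op k (\<lambda>i. c (m i)) l = c (op k m l)"
proof -
  have RX: "RX (\<lambda>i. c (m i)) = (\<lambda>i. c (RX m i))" and Rj: "Rj (\<lambda>i. c (m i)) = (\<lambda>i. c (Rj m i))" for m
  proof -
    show "RX (\<lambda>i. c (m i)) = (\<lambda>i. c (RX m i))"
      unfolding RX_def sel_map[where c = c, OF assms(1), symmetric] by (simp only: list.map assms(2-4))
    show "Rj (\<lambda>i. c (m i)) = (\<lambda>i. c (Rj m i))"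
      unfolding Rj_def sel_map[where c = c, OF assms(1), symmetric] by (simp only: list.map assms(2-4))
  qed
  have "k = 0 \<or> k = 1 \<or> k = 2 \<or> k = 3 \<or> k = 4 \<or> k = 5" using assms(5) by auto
  then show ?thesis by (elim disjE) (simp_all add: op_def RX Rj)
qed

lemma op_cong: "(\<And>k. k < 8 \<Longrightarrow> m k = m' k) \<Longrightarrow> c < 6 \<Longrightarrow> op c m l = op c m' l"
proof -
  assume *: "\<And>k. k < 8 \<Longrightarrow> m k = m' k" and c: "c < 6"
  have "RX m = RX m'" "Rj m = Rj m'" unfolding RX_def Rj_def using * by simp_all
  moreover have "c = 0 \<or> c = 1 \<or> c = 2 \<or> c = 3 \<or> c = 4 \<or> c = 5" using c by auto
  ultimately show ?thesis by (auto simp: op_def)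
qed

text \<open>On rational coordinates \<open>n\<close>, each entry of \<open>cstr\<close> combines the
  rational entries of the \<open>op k n\<close> with the independent coefficients
  \<open>jcoeff xp k\<close>; the dual functional of coefficient \<open>c\<close> extracts the entry
  of \<open>op c n\<close>.\<close>

lemma cstr_functional:
  assumes c: "c < 6"
  obtains h :: "real \<Rightarrow> real" where "\<And>x y. h (x + y) = h x + h y" "\<And>q x. h (of_rat q * x) = of_rat q * h x"
    "\<And>n :: nat \<Rightarrow> rat. \<And>l. h (cstr (\<lambda>k. of_rat (n k)) l) = of_rat (op c n l)"
proof -
  obtain h :: "real \<Rightarrow> real" where h: "\<And>x y. h (x + y) = h x + h y" "\<And>q x. h (of_rat q * x) = of_rat q * h x"
    "\<And>i. i < 6 \<Longrightarrow> h (jcoeff xp i) = (if i = c then 1 else 0)"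
  proof -
    have "\<exists>h :: real \<Rightarrow> real. (\<forall>x y. h (x + y) = h x + h y) \<and> (\<forall>q x. h (of_rat q * x) = of_rat q * h x) \<and>
        (\<forall>i<6. h (jcoeff xp i) = (if i = c then 1 else 0))"
      by (rule rational_functional) (rule xp_generic)
    then obtain h :: "real \<Rightarrow> real" where "\<forall>x y. h (x + y) = h x + h y" "\<forall>q x. h (of_rat q * x) = of_rat q * h x"
        "\<forall>i<6. h (jcoeff xp i) = (if i = c then 1 else 0)"
      by (elim exE conjE)
    then show ?thesis by (intro that[of h]) simp_all
  qed
  have "h (cstr (\<lambda>k. of_rat (n k)) l) = of_rat (op c n l)" for n :: "nat \<Rightarrow> rat" and l
  proof -
    have "cstr (\<lambda>k. of_rat (n k)) l = (\<Sum>k<6. of_rat (op k n l) * jcoeff xp k)"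
      unfolding cstr_def
    proof (intro sum.cong refl)
      fix k :: nat assume "k \<in> {..<6}"
      then have "op k (\<lambda>k. real_of_rat (n k)) l = of_rat (op k n l)"
        by (intro op_hom[where c = real_of_rat]) (simp_all add: of_rat_add of_rat_minus of_rat_mult)
      then show "jcoeff xp k * op k (\<lambda>k. real_of_rat (n k)) l = of_rat (op k n l) * jcoeff xp k" by simp
    qed
    then have "h (cstr (\<lambda>k. of_rat (n k)) l) = (\<Sum>k<6. of_rat (op k n l) * h (jcoeff xp k))"
      unfolding sum_less_6 by (simp add: h(1,2))
    also have "\<dots> = (\<Sum>k<6. if k = c then of_rat (op k n l) else 0)"
      by (intro sum.cong) (auto simp: h(3))
    finally show ?thesis using c by simp
  qed
  then show ?thesis using that h(1,2) by blast
qed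

lemma additive_sum:
  fixes h :: "real \<Rightarrow> real"
  assumes "\<And>x y. h (x + y) = h x + h y"
  shows "h (\<Sum>j<(n::nat). f j) = (\<Sum>j<n. h (f j))"
proof -
  have "h (0 + 0) = h 0 + h 0" by (rule assms)
  then have "h 0 = 0" by simp
  then show ?thesis by (induction n) (simp_all add: assms)
qed

text \<open>A complex-linear \<open>T\<close> commutes with the complex structure. Its matrix is
  rational, so a functional linear over the rationals passes through it and selects a single right
  multiplication on both sides.\<close>

lemma EndQ_commutes:
  fixes M :: "nat \<Rightarrow> nat \<Rightarrow> rat" and n :: "nat \<Rightarrow> rat"
  assumes T: "T \<in> carrier_mat 4 4" and M: "\<And>x. T *\<^sub>v per x = per (\<lambda>k. \<Sum>j<8. of_rat (M k j) * x j)"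
    and c: "c < 6" and k: "k < 8"
  shows "(\<Sum>j<8. M k j * op c n j) = op c (\<lambda>k. \<Sum>j<8. M k j * n j) k"
proof -
  define Mn where "Mn k = (\<Sum>j<8. M k j * n j)" for k
  let ?n = "\<lambda>k. real_of_rat (n k)" and ?Mn = "\<lambda>k. real_of_rat (Mn k)"
  have TR: "T *\<^sub>v per (cfun complex_of_real y) = per (cfun complex_of_real (\<lambda>k. \<Sum>j<8. of_rat (M k j) * y j))" for y
    unfolding M by (rule per_cong) (simp add: of_real_of_rat)
  have "per (cfun complex_of_real (\<lambda>k. \<Sum>j<8. of_rat (M k j) * cstr ?n j)) = T *\<^sub>v (\<i> \<cdot>\<^sub>v per (cfun complex_of_real ?n))"
    unfolding TR[symmetric] complex_structure ..
  also have "\<dots> = \<i> \<cdot>\<^sub>v per (cfun complex_of_real (\<lambda>k. \<Sum>j<8. of_rat (M k j) * ?n j))"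
    using mult_mat_vec[OF T per_carrier(1)] TR by simp
  also have "(\<lambda>k. \<Sum>j<8. of_rat (M k j) * ?n j) = ?Mn"
    unfolding Mn_def by (simp add: of_rat_sum of_rat_mult)
  also have "\<i> \<cdot>\<^sub>v per (cfun complex_of_real ?Mn) = per (cfun complex_of_real (cstr ?Mn))"
    by (rule complex_structure[symmetric])
  finally have eq: "(\<Sum>j<8. of_rat (M k j) * cstr ?n j) = cstr ?Mn k"
    using per_inj[of "\<lambda>k. \<Sum>j<8. of_rat (M k j) * cstr ?n j" "cstr ?Mn"] k by blast
  obtain h :: "real \<Rightarrow> real" where h: "\<And>x y. h (x + y) = h x + h y" "\<And>q x. h (of_rat q * x) = of_rat q * h x"
    "\<And>n :: nat \<Rightarrow> rat. \<And>l. h (cstr (\<lambda>k. of_rat (n k)) l) = of_rat (op c n l)"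
    using cstr_functional[OF c] by metis
  have "real_of_rat (\<Sum>j<8. M k j * op c n j) = (\<Sum>j<8. of_rat (M k j) * h (cstr ?n j))"
    unfolding h(3) by (simp add: of_rat_sum of_rat_mult)
  also have "\<dots> = h (\<Sum>j<8. of_rat (M k j) * cstr ?n j)"
    unfolding additive_sum[OF h(1)] h(2) ..
  also have "\<dots> = real_of_rat (op c Mn k)" unfolding eq h(3) ..
  finally show ?thesis unfolding Mn_def by simp
qed

text \<open>The coordinates \<open>dlt 0\<close> correspond to \<open>1\<close>, which generates the algebra under right multiplications.\<close>

lemma EndQ_zero:
  assumes T: "T \<in> carrier (EndQ_ring 4 Lat)" and T0: "T *\<^sub>v per (dlt 0) = 0\<^sub>v 4"
  shows "T = 0\<^sub>m 4 4"
proof -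
  have Tc: "T \<in> carrier_mat 4 4" and TQ: "\<And>v. v \<in> Lat \<Longrightarrow> T *\<^sub>v v \<in> QLat" using T unfolding EndQ_iff by auto
  obtain M :: "nat \<Rightarrow> nat \<Rightarrow> rat" where M: "\<And>x. T *\<^sub>v per x = per (\<lambda>k. \<Sum>j<8. of_rat (M k j) * x j)"
    using EndQ_rational_matrix[OF Tc TQ] by blast
  define Z where "Z = {n :: nat \<Rightarrow> rat. \<forall>k<8. (\<Sum>j<8. M k j * n j) = 0}"
  have step: "n' \<in> Z" if n: "n \<in> Z" and c: "c = 2 \<or> c = 3" and s: "s \<noteq> 0" and n': "\<And>k. k < 8 \<Longrightarrow> s * n' k = op c n k" for n n' :: "nat \<Rightarrow> rat" and c s
  proof -
    have c6: "c < 6" using c by auto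
    have "s * (\<Sum>j<8. M k j * n' j) = 0" if k: "k < 8" for k
    proof -
      have "s * (\<Sum>j<8. M k j * n' j) = (\<Sum>j<8. M k j * op c n j)"
        unfolding sum_distrib_left by (intro sum.cong) (auto simp: n'[symmetric])
      also have "\<dots> = op c (\<lambda>k. \<Sum>j<8. M k j * n j) k" by (rule EndQ_commutes[OF Tc M c6 k])
      also have "\<dots> = op c (\<lambda>k. 0) k" by (rule op_cong) (use n c6 in \<open>auto simp: Z_def\<close>)
      also have "\<dots> = 0" using c less_8_cases[OF k] by (auto simp: op_def RX_def Rj_def)
      finally show ?thesis .
    qed
    then show ?thesis using s by (simp add: Z_def)
  qed
  have d0: "dlt 0 \<in> Z"
  proof -
    have "per (cfun complex_of_real (\<lambda>k. \<Sum>j<8. of_rat (M k j) * dlt 0 j)) = T *\<^sub>v per (dlt 0)"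
      unfolding M by (rule per_cong) (simp add: dlt_def if_distrib of_real_of_rat cong: if_cong)
    then have "per (cfun complex_of_real (\<lambda>k. \<Sum>j<8. of_rat (M k j) * dlt 0 j)) = 0\<^sub>v 4" using T0 by simp
    then have "(\<Sum>j<8. real_of_rat (M k j) * dlt 0 j) = 0" if "k < 8" for k
      using per_injective[of "\<lambda>k. \<Sum>j<8. of_rat (M k j) * dlt 0 j"] that by blast
    then show ?thesis unfolding Z_def by (simp add: dlt_def if_distrib cong: if_cong)
  qed
  \<comment> \<open>Right multiplications by \<open>j\<close> and \<open>i j\<close> lead from
    \<open>1\<close> to every basis element; the factors 3 come from
    \<open>j\<^sup>2 = 3\<close>.\<close>
  have ops: "k < 8 \<Longrightarrow> 1 * (dlt 4 k :: rat) = op 2 (dlt 0) k" "k < 8 \<Longrightarrow> 1 * (dlt 5 k :: rat) = op 3 (dlt 0) k"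
    "k < 8 \<Longrightarrow> 3 * (dlt 1 k :: rat) = op 2 (dlt 5) k" "k < 8 \<Longrightarrow> 1 * (dlt 6 k :: rat) = op 3 (dlt 1) k"
    "k < 8 \<Longrightarrow> 3 * (dlt 2 k :: rat) = op 2 (dlt 6) k" "k < 8 \<Longrightarrow> 1 * (dlt 7 k :: rat) = op 3 (dlt 2) k"
    "k < 8 \<Longrightarrow> 3 * (dlt 3 k :: rat) = op 2 (dlt 7) k" for k
    by (drule less_8_cases, elim disjE; simp add: op_def RX_def Rj_def dlt_def)+
  have d4: "dlt 4 \<in> Z" by (rule step[OF d0 _ _ ops(1)]) simp_all
  have d5: "dlt 5 \<in> Z" by (rule step[OF d0 _ _ ops(2)]) simp_all
  have d1: "dlt 1 \<in> Z" by (rule step[OF d5 _ _ ops(3)]) simp_all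
  have d6: "dlt 6 \<in> Z" by (rule step[OF d1 _ _ ops(4)]) simp_all
  have d2: "dlt 2 \<in> Z" by (rule step[OF d6 _ _ ops(5)]) simp_all
  have d7: "dlt 7 \<in> Z" by (rule step[OF d2 _ _ ops(6)]) simp_all
  have d3: "dlt 3 \<in> Z" by (rule step[OF d7 _ _ ops(7)]) simp_all
  have M0: "M k j = 0" if "k < 8" "j < 8" for k j
  proof -
    have "dlt j \<in> Z" using less_8_cases[OF that(2)] d0 d1 d2 d3 d4 d5 d6 d7 by auto
    then show ?thesis unfolding Z_def using that by (simp add: dlt_def if_distrib cong: if_cong)
  qed
  have Tx: "T *\<^sub>v v = 0\<^sub>v 4" if v: "v \<in> carrier_vec 4" for v
  proof -
    obtain y where y: "per (cfun complex_of_real y) = v" using per_surjective[OF v] by blast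
    have "T *\<^sub>v v = per (\<lambda>k. 0)" unfolding y[symmetric] M by (rule per_cong) (simp add: M0)
    also have "\<dots> = 0\<^sub>v 4" by (rule eq_vec4I) (simp_all add: zev_def wev_def)
    finally show ?thesis .
  qed
  show ?thesis
  proof (rule eq_matI)
    fix i j assume "i < dim_row (0\<^sub>m 4 4 :: complex mat)" "j < dim_col (0\<^sub>m 4 4 :: complex mat)"
    then have ij: "i < 4" "j < 4" by simp_all
    have "(T *\<^sub>v unit_vec 4 j) $ i = (\<Sum>l<4. T $$ (i,l) * unit_vec 4 j $ l)"
      by (rule mat_vec_index_sum[OF Tc unit_vec_carrier ij(1)])
    also have "\<dots> = T $$ (i,j)" using ij by (simp add: unit_vec_def if_distrib cong: if_cong)
    finally show "T $$ (i,j) = 0\<^sub>m 4 4 $$ (i,j)" using Tx[of "unit_vec 4 j"] ij by simp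
  qed (use Tc in auto)
qed

section \<open>Left multiplications\<close>

text \<open>Each block is the matrix of \<open>z + w j\<close> at one real place, where conjugation
  by \<open>j\<close> replaces the value of \<open>i\<close> by its negative.\<close>

definition lmul :: "(nat \<Rightarrow> complex) \<Rightarrow> complex mat" where
  "lmul r = mat 4 4 (\<lambda>(i,j).
     [[zev r t0, 3 * wev r t0, 0, 0], [wev r (- t0), zev r (- t0), 0, 0],
      [0, 0, zev r t2, 3 * wev r t2], [0, 0, wev r (- t2), zev r (- t2)]] ! i ! j)"

text \<open>The product of the quaternion algebra in coordinates, polymorphic so that one formula
  serves integers, rationals and complex numbers.\<close>

definition lact :: "(nat \<Rightarrow> 'a::comm_ring_1) \<Rightarrow> (nat \<Rightarrow> 'a) \<Rightarrow> nat \<Rightarrow> 'a" where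
  "lact r m l = r 0 * m l + r 1 * LX m l + r 2 * LX (LX m) l + r 3 * LX (LX (LX m)) l
     + r 4 * Lj m l + r 5 * LX (Lj m) l + r 6 * LX (LX (Lj m)) l + r 7 * LX (LX (LX (Lj m))) l"

lemma lmul_carrier [simp]: "lmul r \<in> carrier_mat 4 4" "dim_row (lmul r) = 4" "dim_col (lmul r) = 4"
  by (simp_all add: lmul_def)

lemma sum_less_4: "(\<Sum>k<4. f k) = f 0 + f 1 + f 2 + f (3::nat)"
  by (simp add: eval_nat_numeral)

lemma lmul_index:
  "lmul r $$ (0,0) = zev r t0" "lmul r $$ (0,1) = 3 * wev r t0" "lmul r $$ (0,2) = 0" "lmul r $$ (0,3) = 0"
  "lmul r $$ (1,0) = wev r (- t0)" "lmul r $$ (1,1) = zev r (- t0)" "lmul r $$ (1,2) = 0" "lmul r $$ (1,3) = 0"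
  "lmul r $$ (2,0) = 0" "lmul r $$ (2,1) = 0" "lmul r $$ (2,2) = zev r t2" "lmul r $$ (2,3) = 3 * wev r t2"
  "lmul r $$ (3,0) = 0" "lmul r $$ (3,1) = 0" "lmul r $$ (3,2) = wev r (- t2)" "lmul r $$ (3,3) = zev r (- t2)"
  by (simp_all add: lmul_def)

lemma lmul_mult_vec:
  assumes "v \<in> carrier_vec 4"
  shows "(lmul r *\<^sub>v v) $ 0 = zev r t0 * v $ 0 + 3 * wev r t0 * v $ 1"
    "(lmul r *\<^sub>v v) $ 1 = wev r (- t0) * v $ 0 + zev r (- t0) * v $ 1"
    "(lmul r *\<^sub>v v) $ 2 = zev r t2 * v $ 2 + 3 * wev r t2 * v $ 3"
    "(lmul r *\<^sub>v v) $ 3 = wev r (- t2) * v $ 2 + zev r (- t2) * v $ 3"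
proof -
  have m: "(lmul r *\<^sub>v v) $ i = (\<Sum>j<4. lmul r $$ (i,j) * v $ j)" if "i < 4" for i
    by (rule mat_vec_index_sum[OF lmul_carrier(1) assms that])
  show "(lmul r *\<^sub>v v) $ 0 = zev r t0 * v $ 0 + 3 * wev r t0 * v $ 1"
    using m[of 0] unfolding sum_less_4 lmul_index by (simp only: mult_zero_left add_0_right)
  show "(lmul r *\<^sub>v v) $ 1 = wev r (- t0) * v $ 0 + zev r (- t0) * v $ 1"
    using m[of 1] unfolding sum_less_4 lmul_index by (simp only: mult_zero_left add_0_right)
  show "(lmul r *\<^sub>v v) $ 2 = zev r t2 * v $ 2 + 3 * wev r t2 * v $ 3"
    using m[of 2] unfolding sum_less_4 lmul_index by (simp only: mult_zero_left add_0_right) simp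
  show "(lmul r *\<^sub>v v) $ 3 = wev r (- t2) * v $ 2 + zev r (- t2) * v $ 3"
    using m[of 3] unfolding sum_less_4 lmul_index by (simp only: mult_zero_left add_0_right) simp
qed

lemma ev_lact:
  assumes "t ^ 4 = t ^ 2 + 1"
  shows "zev (lact r m) t = zev r t * zev m t + 3 * wev r t * wev m (- t)"
    "wev (lact r m) t = zev r t * wev m t + wev r t * zev m (- t)"
proof -
  have "zev (lact r m) t = r 0 * zev m t + r 1 * zev (LX m) t + r 2 * zev (LX (LX m)) t + r 3 * zev (LX (LX (LX m))) t
      + r 4 * zev (Lj m) t + r 5 * zev (LX (Lj m)) t + r 6 * zev (LX (LX (Lj m))) t + r 7 * zev (LX (LX (LX (Lj m)))) t"
    unfolding lact_def zev_def[of "\<lambda>l. _ l + _ l"] zev_def[of "LX _"] zev_def[of "Lj _"] zev_def[of m]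
    by (simp add: zev_def algebra_simps)
  then show "zev (lact r m) t = zev r t * zev m t + 3 * wev r t * wev m (- t)"
    unfolding ev_LX[OF assms] ev_Lj unfolding zev_def[of r] wev_def[of r]
    by (simp add: algebra_simps power2_eq_square power3_eq_cube)
  have "wev (lact r m) t = r 0 * wev m t + r 1 * wev (LX m) t + r 2 * wev (LX (LX m)) t + r 3 * wev (LX (LX (LX m))) t
      + r 4 * wev (Lj m) t + r 5 * wev (LX (Lj m)) t + r 6 * wev (LX (LX (Lj m))) t + r 7 * wev (LX (LX (LX (Lj m)))) t"
    by (simp add: lact_def wev_def algebra_simps)
  then show "wev (lact r m) t = zev r t * wev m t + wev r t * zev m (- t)"
    unfolding ev_LX[OF assms] ev_Lj unfolding zev_def[of r] wev_def[of r]
    by (simp add: algebra_simps power2_eq_square power3_eq_cube)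
qed

text \<open>At each place the period vector is the matrix of \<open>m\<close> applied to a fixed
  vector, so this is the multiplicativity of the matrix representation.\<close>

lemma lmul_per: "lmul r *\<^sub>v per m = per (lact r m)"
proof (rule eq_vec4I)
  show "(lmul r *\<^sub>v per m) $ 0 = per (lact r m) $ 0"
    unfolding lmul_mult_vec(1)[OF per_carrier(1)] per_index per_index1 ev_lact[OF root_t0(1)] by (simp add: algebra_simps)
  show "(lmul r *\<^sub>v per m) $ 1 = per (lact r m) $ 1"
    unfolding lmul_mult_vec(2)[OF per_carrier(1)] per_index per_index1 ev_lact[OF root_t0(2)] minus_minus by (simp add: algebra_simps)
  show "(lmul r *\<^sub>v per m) $ 2 = per (lact r m) $ 2"
    unfolding lmul_mult_vec(3)[OF per_carrier(1)] per_index ev_lact[OF root_t2(1)] by (simp add: algebra_simps)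
  show "(lmul r *\<^sub>v per m) $ 3 = per (lact r m) $ 3"
    unfolding lmul_mult_vec(4)[OF per_carrier(1)] per_index ev_lact[OF root_t2(2)] minus_minus by (simp add: algebra_simps)
qed simp_all

lemma lact_hom:
  assumes "c 0 = 0" "\<And>a b. c (a + b) = c a + c b" "\<And>a. c (- a) = - c a" "\<And>a b. c (a * b) = c a * c b" "c 3 = 3"
  shows "lact (\<lambda>i. c (r i)) (\<lambda>i. c (m i)) l = c (lact r m l)"
proof -
  have LX: "LX (\<lambda>i. c (m i)) = (\<lambda>i. c (LX m i))" and Lj: "Lj (\<lambda>i. c (m i)) = (\<lambda>i. c (Lj m i))" for m
  proof -
    show "LX (\<lambda>i. c (m i)) = (\<lambda>i. c (LX m i))"
      unfolding LX_def sel_map[where c = c, OF assms(1), symmetric] by (simp only: list.map assms(2-5))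
    show "Lj (\<lambda>i. c (m i)) = (\<lambda>i. c (Lj m i))"
      unfolding Lj_def sel_map[where c = c, OF assms(1), symmetric] by (simp only: list.map assms(2-5))
  qed
  show ?thesis unfolding lact_def LX Lj by (simp only: assms(2,4))
qed

lemma lmul_rat_in_EndQ: "lmul (cfun of_rat r) \<in> carrier (EndQ_ring 4 Lat)"
  unfolding EndQ_iff
proof (intro conjI ballI)
  fix v assume "v \<in> Lat"
  then obtain m :: "nat \<Rightarrow> int" where m: "v = per (cfun of_int m)" unfolding Lat_def by auto
  have "v = per (cfun of_rat (\<lambda>k. of_int (m k)))" unfolding m by simp
  then have "lmul (cfun of_rat r) *\<^sub>v v = per (lact (cfun of_rat r) (cfun of_rat (\<lambda>k. of_int (m k))))"
    by (simp only: lmul_per)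
  also have "\<dots> = per (cfun of_rat (lact r (\<lambda>k. of_int (m k))))"
    by (rule per_cong, rule lact_hom[where c = of_rat]) (simp_all add: of_rat_add of_rat_minus of_rat_mult)
  finally show "lmul (cfun of_rat r) *\<^sub>v v \<in> QLat" by (simp only: QLatI)
qed simp

lemma lmul_int_in_End: "lmul (cfun of_int r) \<in> carrier (End_ring 4 Lat)"
  unfolding End_ring_carrier
proof (intro conjI ballI)
  fix v assume "v \<in> Lat"
  then obtain m :: "nat \<Rightarrow> int" where m: "v = per (cfun of_int m)" unfolding Lat_def by auto
  have "lmul (cfun of_int r) *\<^sub>v v = per (cfun of_int (lact r m))"
    unfolding m lmul_per by (rule per_cong, rule lact_hom[where c = of_int]) simp_all
  then show "lmul (cfun of_int r) *\<^sub>v v \<in> Lat" unfolding Lat_def by simp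
qed simp

text \<open>An endomorphism is compared with the left multiplication by its image of
  \<open>1\<close>. The difference kills \<open>1\<close> and is therefore zero.\<close>

lemma EndQ_lmul:
  assumes T: "T \<in> carrier (EndQ_ring 4 Lat)"
  shows "\<exists>n :: nat \<Rightarrow> rat. T = lmul (cfun of_rat n)"
proof -
  have Tc: "T \<in> carrier_mat 4 4" and TQ: "\<And>v. v \<in> Lat \<Longrightarrow> T *\<^sub>v v \<in> QLat" using T unfolding EndQ_iff by auto
  have dZ: "per (dlt 0) = per (cfun of_int (dlt 0))" by (rule per_cong) (simp add: dlt_def)
  then have "per (dlt 0) \<in> Lat" unfolding Lat_def by simp
  then have "T *\<^sub>v per (dlt 0) \<in> QLat" by (rule TQ)
  then obtain n :: "nat \<Rightarrow> rat" where n: "T *\<^sub>v per (dlt 0) = per (cfun of_rat n)" unfolding QLat_def by (elim rangeE)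
  define D where "D = T - lmul (cfun of_rat n)"
  have Dc: "D \<in> carrier_mat 4 4" unfolding D_def by (rule minus_carrier_mat[OF lmul_carrier(1)])
  have Dv: "D *\<^sub>v v = T *\<^sub>v v - lmul (cfun of_rat n) *\<^sub>v v" if "v \<in> carrier_vec 4" for v
    unfolding D_def by (rule minus_mult_distrib_mat_vec[OF Tc lmul_carrier(1) that])
  have "D *\<^sub>v v \<in> QLat" if v: "v \<in> Lat" for v
  proof -
    obtain a :: "nat \<Rightarrow> rat" where a: "T *\<^sub>v v = per (cfun of_rat a)" using TQ[OF v] unfolding QLat_def by (elim rangeE)
    have "lmul (cfun of_rat n) *\<^sub>v v \<in> QLat" using lmul_rat_in_EndQ v unfolding EndQ_iff by blast
    then obtain b :: "nat \<Rightarrow> rat" where b: "lmul (cfun of_rat n) *\<^sub>v v = per (cfun of_rat b)" unfolding QLat_def by (elim rangeE)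
    have "D *\<^sub>v v = per (cfun of_rat (\<lambda>k. a k - b k))"
      unfolding Dv[OF subsetD[OF Lat_carrier v]] a b by (simp add: of_rat_diff per_minus)
    then show ?thesis by (simp only: QLatI)
  qed
  then have DE: "D \<in> carrier (EndQ_ring 4 Lat)" unfolding EndQ_iff using Dc by blast
  have "lact (cfun of_rat n) (dlt 0) k = (of_rat (n k) :: complex)" if "k < 8" for k
    using less_8_cases[OF that] by (elim disjE) (simp_all add: lact_def LX_def Lj_def dlt_def)
  then have "lmul (cfun of_rat n) *\<^sub>v per (dlt 0) = per (cfun of_rat n)"
    unfolding lmul_per by (intro per_cong) simp
  then have "D *\<^sub>v per (dlt 0) = 0\<^sub>v 4" using Dv[of "per (dlt 0)"] n by simp
  then have D0: "D = 0\<^sub>m 4 4" by (rule EndQ_zero[OF DE])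
  have "T = lmul (cfun of_rat n)"
  proof (rule eq_matI)
    fix i j assume "i < dim_row (lmul (cfun of_rat n))" "j < dim_col (lmul (cfun of_rat n))"
    then have ij: "i < 4" "j < 4" by simp_all
    have "D $$ (i,j) = 0" using D0 ij by simp
    then show "T $$ (i,j) = lmul (cfun of_rat n) $$ (i,j)" using Tc ij by (simp add: D_def)
  qed (use Tc in auto)
  then show ?thesis by blast
qed

section \<open>The norm form is anisotropic\<close>

text \<open>The norm of \<open>a + b i + c i\<^sup>2 + d i\<^sup>3\<close> over \<open>\<rat>(\<surd>5)\<close> is \<open>nf0 a b c d + nf1 a b c d \<cdot> \<phi>\<close>.\<close>

definition nf0 :: "'a::comm_ring_1 \<Rightarrow> 'a \<Rightarrow> 'a \<Rightarrow> 'a \<Rightarrow> 'a" where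
  "nf0 a b c d = a * a + c * c - 2 * b * d - d * d"
definition nf1 :: "'a::comm_ring_1 \<Rightarrow> 'a \<Rightarrow> 'a \<Rightarrow> 'a \<Rightarrow> 'a" where
  "nf1 a b c d = 2 * a * c + c * c - b * b - 2 * d * d - 2 * b * d"

text \<open>The residue field at 3 has nine elements, and \<open>\<phi>\<^sup>4 = - 1\<close> in it.
  So \<open>\<phi>\<close> has order 8 and is not a square, and the form
  \<open>x\<^sup>2 - \<phi> y\<^sup>2\<close> has no non-trivial zero; the proof checks all
  residues.\<close>

lemma nf_mod_3:
  fixes a b c d :: int
  assumes "3 dvd nf0 a b c d" "3 dvd nf1 a b c d"
  shows "3 dvd a \<and> 3 dvd b \<and> 3 dvd c \<and> 3 dvd d"
proof -
  have m: "nf0 a b c d mod 3 = nf0 (a mod 3) (b mod 3) (c mod 3) (d mod 3) mod 3"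
    "nf1 a b c d mod 3 = nf1 (a mod 3) (b mod 3) (c mod 3) (d mod 3) mod 3"
    unfolding nf0_def nf1_def by (auto intro!: mod_add_cong mod_diff_cong mod_mult_cong simp: mod_mod_trivial)
  have r: "x mod 3 \<in> {0, 1, 2}" for x :: int by simp presburger
  have h: "nf0 (a mod 3) (b mod 3) (c mod 3) (d mod 3) mod 3 = 0" "nf1 (a mod 3) (b mod 3) (c mod 3) (d mod 3) mod 3 = 0"
    using assms unfolding m[symmetric] dvd_eq_mod_eq_0 by auto
  have key: "\<forall>a\<in>{0, 1, 2}. \<forall>b\<in>{0, 1, 2}. \<forall>c\<in>{0, 1, 2}. \<forall>d\<in>{0, 1, 2 :: int}.
      nf0 a b c d mod 3 = 0 \<longrightarrow> nf1 a b c d mod 3 = 0 \<longrightarrow> a = 0 \<and> b = 0 \<and> c = 0 \<and> d = 0"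
    by (simp add: nf0_def nf1_def)
  have "a mod 3 = 0 \<and> b mod 3 = 0 \<and> c mod 3 = 0 \<and> d mod 3 = 0"
    by (rule key[rule_format, OF r r r r h])
  then show ?thesis by (simp add: dvd_eq_mod_eq_0)
qed

lemma nf_smult: "nf0 (s * a) (s * b) (s * c) (s * d) = s * s * nf0 a b c d"
  "nf1 (s * a) (s * b) (s * c) (s * d) = s * s * nf1 a b c d"
  unfolding nf0_def nf1_def by (simp_all add: algebra_simps)

text \<open>If the norm of \<open>z\<close> is three times that of \<open>w\<close>, then 3 divides
  \<open>z\<close>; hence the norm of \<open>w\<close> is three times that of \<open>z / 3\<close>,
  and 3 divides \<open>w\<close>. Dividing both by 3 gives a smaller solution.\<close>

lemma norm_form_anisotropic:
  fixes m :: "nat \<Rightarrow> int"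
  assumes "nf0 (m 0) (m 1) (m 2) (m 3) = 3 * nf0 (m 4) (m 5) (m 6) (m 7)"
    "nf1 (m 0) (m 1) (m 2) (m 3) = 3 * nf1 (m 4) (m 5) (m 6) (m 7)"
  shows "\<forall>k<8. m k = 0"
  using assms
proof (induction "nat (\<Sum>k<8. \<bar>m k\<bar>)" arbitrary: m rule: less_induct)
  case less
  have "3 dvd m 0 \<and> 3 dvd m 1 \<and> 3 dvd m 2 \<and> 3 dvd m 3"
    by (rule nf_mod_3) (use less.prems in simp_all)
  then obtain a b c d where z: "m 0 = 3 * a" "m 1 = 3 * b" "m 2 = 3 * c" "m 3 = 3 * d" by (auto elim!: dvdE)
  have "3 * nf0 a b c d = nf0 (m 4) (m 5) (m 6) (m 7)" "3 * nf1 a b c d = nf1 (m 4) (m 5) (m 6) (m 7)"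
    using less.prems unfolding z nf_smult by simp_all
  then have w3: "3 dvd nf0 (m 4) (m 5) (m 6) (m 7)" "3 dvd nf1 (m 4) (m 5) (m 6) (m 7)" by (metis dvd_triv_left)+
  have "3 dvd m 4 \<and> 3 dvd m 5 \<and> 3 dvd m 6 \<and> 3 dvd m 7" by (rule nf_mod_3[OF w3])
  then obtain e f g h where w: "m 4 = 3 * e" "m 5 = 3 * f" "m 6 = 3 * g" "m 7 = 3 * h" by (auto elim!: dvdE)
  define m' where "m' = sel [a, b, c, d, e, f, g, h]"
  have mm': "m k = 3 * m' k" if "k < 8" for k
    using less_8_cases[OF that] z w by (elim disjE) (simp_all add: m'_def)
  have sum: "(\<Sum>k<8. \<bar>m k\<bar>) = 3 * (\<Sum>k<8. \<bar>m' k\<bar>)"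
    unfolding sum_distrib_left by (intro sum.cong) (auto simp: mm')
  have eqs: "nf0 (m' 0) (m' 1) (m' 2) (m' 3) = 3 * nf0 (m' 4) (m' 5) (m' 6) (m' 7)"
    "nf1 (m' 0) (m' 1) (m' 2) (m' 3) = 3 * nf1 (m' 4) (m' 5) (m' 6) (m' 7)"
    using less.prems unfolding z w nf_smult by (simp_all add: m'_def)
  show ?case
  proof (cases "(\<Sum>k<8. \<bar>m' k\<bar>) = 0")
    case True
    then have "\<forall>k<8. m' k = 0" by (simp add: sum_nonneg_eq_0_iff)
    then show ?thesis using mm' by simp
  next
    case False
    moreover have "(\<Sum>k<8. \<bar>m' k\<bar>) \<ge> 0" by (simp add: sum_nonneg)
    ultimately have "(\<Sum>k<8. \<bar>m' k\<bar>) > 0" by linarith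
    then have "nat (\<Sum>k<8. \<bar>m' k\<bar>) < nat (\<Sum>k<8. \<bar>m k\<bar>)" unfolding sum by simp
    then have "\<forall>k<8. m' k = 0" by (rule less.hyps) (rule eqs)+
    then show ?thesis using mm' by simp
  qed
qed

section \<open>Simplicity\<close>

lemma complex_subspaceD:
  assumes "complex_subspace g W"
  shows "W \<subseteq> carrier_vec g" "\<And>v w. v \<in> W \<Longrightarrow> w \<in> W \<Longrightarrow> v + w \<in> W" "\<And>c v. v \<in> W \<Longrightarrow> c \<cdot>\<^sub>v v \<in> W" "0\<^sub>v g \<in> W"
proof -
  have s: "LinearCombinations.submodule class_ring W (module_vec TYPE(complex) g)"
    using assms unfolding complex_subspace_def VectorSpace.subspace_def by simp
  note d = s[unfolded LinearCombinations.submodule_def module_vec_def]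
  show "W \<subseteq> carrier_vec g" "0\<^sub>v g \<in> W" using d by simp_all
  show "v + w \<in> W" if "v \<in> W" "w \<in> W" for v w using d that by simp
  show "c \<cdot>\<^sub>v v \<in> W" if "v \<in> W" for c v using d that by simp
qed

text \<open>The lattice points in \<open>W\<close> are stable under the six right multiplications,
  hence behave like a right ideal in a division algebra. A non-zero one can be multiplied into the
  non-zero integers, and the multiples of \<open>1\<close> generate the whole space.\<close>

lemma lattice_subspace_dichotomy:
  assumes W: "complex_subspace 4 W" and lat: "full_lattice 4 W (Lat \<inter> W)"
  shows "W = {0\<^sub>v 4} \<or> W = carrier_vec 4"
proof -
  note Wc = complex_subspaceD(1)[OF W] and Wadd = complex_subspaceD(2)[OF W]
    and Wsmult = complex_subspaceD(3)[OF W] and W0 = complex_subspaceD(4)[OF W]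
  obtain n P where P: "P \<in> carrier_mat 4 n"
    and bij: "bij_betw (\<lambda>x. P *\<^sub>v map_vec complex_of_real x) (carrier_vec n) W"
    and LP: "Lat \<inter> W = (\<lambda>m. P *\<^sub>v map_vec (of_int :: int \<Rightarrow> complex) m) ` (carrier_vec n :: int vec set)"
    using lat unfolding full_lattice_def by blast
  have col: "\<exists>m :: nat \<Rightarrow> int. (\<forall>i<4. P $$ (i,j) = per (cfun of_int m) $ i) \<and> per (cfun of_int m) \<in> W" if j: "j < n" for j
  proof -
    have u: "map_vec (of_int :: int \<Rightarrow> complex) (unit_vec n j) = unit_vec n j"
      by (rule eq_vecI) (auto simp: unit_vec_def)
    have "P *\<^sub>v unit_vec n j \<in> Lat \<inter> W"
      unfolding LP by (rule image_eqI[of _ _ "unit_vec n j"]) (simp_all add: u)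
    then obtain m :: "nat \<Rightarrow> int" where m: "P *\<^sub>v unit_vec n j = per (cfun of_int m)" "P *\<^sub>v unit_vec n j \<in> W"
      unfolding Lat_def by auto
    have "P $$ (i,j) = per (cfun of_int m) $ i" if i: "i < 4" for i
    proof -
      have "(P *\<^sub>v unit_vec n j) $ i = (\<Sum>k<n. P $$ (i,k) * unit_vec n j $ k)"
        by (rule mat_vec_index_sum[OF P unit_vec_carrier i])
      also have "\<dots> = P $$ (i,j)" using j by (simp add: unit_vec_def if_distrib cong: if_cong)
      finally show ?thesis using m by simp
    qed
    then show ?thesis using m by auto
  qed
  then obtain N :: "nat \<Rightarrow> nat \<Rightarrow> int" where N: "\<And>i j. j < n \<Longrightarrow> i < 4 \<Longrightarrow> P $$ (i,j) = per (cfun of_int (N j)) $ i"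
    and NW: "\<And>j. j < n \<Longrightarrow> per (cfun of_int (N j)) \<in> W" by metis
  have Pper: "P *\<^sub>v map_vec complex_of_real x = per (\<lambda>k. \<Sum>j<n. complex_of_real (x $ j) * of_int (N j k))"
    if x: "x \<in> carrier_vec n" for x :: "real vec"
  proof (rule eq_vecI)
    fix i assume "i < dim_vec (per (\<lambda>k. \<Sum>j<n. complex_of_real (x $ j) * of_int (N j k)))"
    then have i: "i < 4" by simp
    have "(P *\<^sub>v map_vec complex_of_real x) $ i = (\<Sum>j<n. P $$ (i,j) * map_vec complex_of_real x $ j)"
      by (rule mat_vec_index_sum[OF P _ i]) (use x in simp)
    also have "\<dots> = (\<Sum>j<n. complex_of_real (x $ j) * per (cfun of_int (N j)) $ i)"
      using x i by (intro sum.cong) (auto simp: N)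
    also have "\<dots> = per (\<lambda>k. \<Sum>j<n. complex_of_real (x $ j) * of_int (N j k)) $ i"
      by (rule per_sum[symmetric]) (use i in auto)
    finally show "(P *\<^sub>v map_vec complex_of_real x) $ i = per (\<lambda>k. \<Sum>j<n. complex_of_real (x $ j) * of_int (N j k)) $ i" .
  qed (use P in simp)
  have imW: "P *\<^sub>v map_vec complex_of_real x \<in> W" if "x \<in> carrier_vec n" for x :: "real vec"
    using bij that unfolding bij_betw_def by blast
  define \<Lambda> where "\<Lambda> = {m :: nat \<Rightarrow> int. per (cfun of_int m) \<in> W}"
  \<comment> \<open>Apply a \<open>\<rat>\<close>-linear functional that isolates one coefficient of the complex structure.\<close>
  have op_mem: "op c m \<in> \<Lambda>" if m: "m \<in> \<Lambda>" and c: "c < 6" for c m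
  proof -
    let ?m = "\<lambda>k. real_of_rat (of_int (m k))"
    have mR: "per (cfun complex_of_real ?m) = per (cfun of_int m)" by (rule per_cong) simp
    have "\<i> \<cdot>\<^sub>v per (cfun of_int m) \<in> W" using m Wsmult unfolding \<Lambda>_def by simp
    then obtain x where x: "x \<in> carrier_vec n" "\<i> \<cdot>\<^sub>v per (cfun of_int m) = P *\<^sub>v map_vec complex_of_real x"
      using bij unfolding bij_betw_def by auto
    have "per (cfun complex_of_real (cstr ?m)) = per (cfun complex_of_real (\<lambda>k. \<Sum>j<n. x $ j * of_int (N j k)))"
      unfolding complex_structure mR x(2) Pper[OF x(1)] by (rule per_cong) simp
    then have eq: "cstr ?m k = (\<Sum>j<n. x $ j * of_int (N j k))" if "k < 8" for k
      by (rule per_inj[of "cstr ?m" "\<lambda>k. \<Sum>j<n. x $ j * of_int (N j k)"]) (rule that)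
    obtain h :: "real \<Rightarrow> real" where h: "\<And>x y. h (x + y) = h x + h y" "\<And>q x. h (of_rat q * x) = of_rat q * h x"
      "\<And>n :: nat \<Rightarrow> rat. \<And>l. h (cstr (\<lambda>k. of_rat (n k)) l) = of_rat (op c n l)"
      using cstr_functional[OF c] by metis
    have hint: "h (y * of_int a) = h y * of_int a" for y a
      using h(2)[of "of_int a" y] by (simp add: mult.commute)
    have opk: "complex_of_int (op c m k) = (\<Sum>j<n. complex_of_real (vec n (\<lambda>j. h (x $ j)) $ j) * of_int (N j k))" if k: "k < 8" for k
    proof -
      have "real_of_int (op c m k) = of_rat (op c (\<lambda>k. of_int (m k)) k)"
        by (subst op_hom[where c = of_int]) (simp_all add: c)
      also have "\<dots> = h (cstr ?m k)" by (rule h(3)[symmetric])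
      also have "\<dots> = (\<Sum>j<n. h (x $ j) * of_int (N j k))" unfolding eq[OF k] additive_sum[OF h(1)] hint ..
      finally have "complex_of_real (real_of_int (op c m k)) = complex_of_real (\<Sum>j<n. h (x $ j) * of_int (N j k))" by simp
      then show ?thesis by simp
    qed
    have "per (cfun of_int (op c m)) = P *\<^sub>v map_vec complex_of_real (vec n (\<lambda>j. h (x $ j)))"
      unfolding Pper[OF vec_carrier] by (rule per_cong) (rule opk)
    then show ?thesis unfolding \<Lambda>_def using imW[OF vec_carrier] by simp
  qed
  have RXm: "RX m \<in> \<Lambda>" and Rjm: "Rj m \<in> \<Lambda>" if "m \<in> \<Lambda>" for m
    using op_mem[OF that, of 0] op_mem[OF that, of 2] by (simp_all add: op_def)
  have add: "(\<lambda>k. a k + b k) \<in> \<Lambda>" if "a \<in> \<Lambda>" "b \<in> \<Lambda>" for a b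
    using that Wadd unfolding \<Lambda>_def by (simp add: per_add)
  have scale: "(\<lambda>k. s * a k) \<in> \<Lambda>" if "a \<in> \<Lambda>" for s a
    using that Wsmult unfolding \<Lambda>_def by (simp add: per_smult)
  have cong: "b \<in> \<Lambda>" if "a \<in> \<Lambda>" "s \<noteq> 0" "\<And>k. k < 8 \<Longrightarrow> s * b k = a k" for a b s
  proof -
    have "per (cfun of_int b) = (1 / of_int s) \<cdot>\<^sub>v per (cfun of_int a)"
      unfolding per_smult[symmetric]
    proof (rule per_cong)
      fix k :: nat assume "k < 8"
      then have "of_int s * of_int (b k) = (of_int (a k) :: complex)" using that(3) by (simp flip: of_int_mult)
      then show "of_int (b k) = 1 / of_int s * (of_int (a k) :: complex)" using that(2) by (simp add: field_simps)
    qed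
    then show ?thesis using that(1) Wsmult unfolding \<Lambda>_def by simp
  qed
  show ?thesis
  proof (cases "\<exists>m\<in>\<Lambda>. \<exists>k<8. m k \<noteq> 0")
    case False
    have "w = 0\<^sub>v 4" if w: "w \<in> W" for w
    proof -
      obtain x where x: "x \<in> carrier_vec n" "w = P *\<^sub>v map_vec complex_of_real x"
        using bij w unfolding bij_betw_def by auto
      have "N j k = 0" if "j < n" "k < 8" for j k using False NW that unfolding \<Lambda>_def by blast
      then have "w = per (\<lambda>k. 0)" unfolding x(2) Pper[OF x(1)] by (intro per_cong) simp
      also have "\<dots> = 0\<^sub>v 4" by (rule eq_vec4I) (simp_all add: zev_def wev_def)
      finally show ?thesis .
    qed
    then show ?thesis using W0 by blast
  next
    case True
    then obtain m k where m: "m \<in> \<Lambda>" "k < 8" "m k \<noteq> 0" by auto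
    define N0 where "N0 = nf0 (m 0) (m 1) (m 2) (m 3) - 3 * nf0 (m 4) (m 5) (m 6) (m 7)"
    define N1 where "N1 = nf1 (m 0) (m 1) (m 2) (m 3) - 3 * nf1 (m 4) (m 5) (m 6) (m 7)"
    have N01: "N0 \<noteq> 0 \<or> N1 \<noteq> 0"
    proof (rule ccontr)
      assume "\<not> (N0 \<noteq> 0 \<or> N1 \<noteq> 0)"
      then have "nf0 (m 0) (m 1) (m 2) (m 3) = 3 * nf0 (m 4) (m 5) (m 6) (m 7)"
        "nf1 (m 0) (m 1) (m 2) (m 3) = 3 * nf1 (m 4) (m 5) (m 6) (m 7)" unfolding N0_def N1_def by simp_all
      then have "\<forall>k<8. m k = 0" by (rule norm_form_anisotropic)
      then show False using m(2,3) by simp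
    qed
    \<comment> \<open>The norm to the rationals of the reduced norm
      \<open>N0 + N1 \<phi>\<close>.\<close>
    define s where "s = N0 * N0 + N0 * N1 - N1 * N1"
    have s0: "s \<noteq> 0"
    proof
      assume "s = 0"
      then have "real_of_int (N0 * N0 + N0 * N1 - N1 * N1) = 0" unfolding s_def by simp
      moreover have "(real_of_int N0 + real_of_int N1 * gold) * (real_of_int (N0 + N1) - real_of_int N1 * gold) =
          real_of_int (N0 * N0 + N0 * N1) - real_of_int N1 * real_of_int N1 * (gold * gold - gold)"
        by (simp add: algebra_simps)
      ultimately have "(real_of_int N0 + real_of_int N1 * gold) * (real_of_int (N0 + N1) - real_of_int N1 * gold) = 0"
        unfolding gold_sq by simp
      then have "of_rat (of_int N0) + of_rat (of_int N1) * gold = 0 \<or> of_rat (of_int (N0 + N1)) + of_rat (of_int (- N1)) * gold = 0"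
        by (simp add: of_rat_add of_rat_minus)
      then have "(of_int N0 :: rat) = 0 \<and> (of_int N1 :: rat) = 0 \<or> (of_int (N0 + N1) :: rat) = 0 \<and> (of_int (- N1) :: rat) = 0"
        using gold_independent by blast
      then have "N0 = 0 \<and> N1 = 0" by (simp only: of_int_eq_0_iff) auto
      then show False using N01 by simp
    qed
    \<comment> \<open>The product of \<open>m = z + w j\<close> with its quaternion conjugate
      \<open>z(- i) - w j\<close>, written with right multiplications only.\<close>
    define y where "y l = m 0 * m l + (- m 1) * RX m l + m 2 * RX (RX m) l + (- m 3) * RX (RX (RX m)) l
       + ((- m 4) * Rj m l + (- m 5) * Rj (RX m) l + (- m 6) * Rj (RX (RX m)) l + (- m 7) * Rj (RX (RX (RX m))) l)" for l
    have ym: "y \<in> \<Lambda>" unfolding y_def by (intro add scale RXm Rjm m(1))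
    have y: "y l = N0 * dlt 0 l + N1 * dlt 2 l" if "l < 8" for l
      using less_8_cases[OF that] unfolding N0_def N1_def nf0_def nf1_def y_def
      by (elim disjE) (simp_all add: RX_def Rj_def dlt_def algebra_simps)
    \<comment> \<open>Since \<open>RX (RX y)\<close> is \<open>\<phi> y\<close>, this multiplies
      \<open>y\<close> by the conjugate \<open>N0 + N1 - N1 \<phi>\<close> and yields the rational
      integer \<open>s\<close>.\<close>
    have "(\<lambda>l. (N0 + N1) * y l + (- N1) * RX (RX y) l) \<in> \<Lambda>" by (intro add scale RXm ym)
    moreover have "s * dlt 0 l = (N0 + N1) * y l + (- N1) * RX (RX y) l" if "l < 8" for l
    proof -
      have yv: "y 0 = N0" "y 1 = 0" "y 2 = N1" "y 3 = 0" "y 4 = 0" "y 5 = 0" "y 6 = 0" "y 7 = 0"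
        by (simp_all add: y dlt_def)
      have yS: "y (Suc 0) = 0" using yv(2) by simp
      show ?thesis using less_8_cases[OF that]
        by (elim disjE) (simp_all add: RX_def dlt_def yv yS s_def algebra_simps)
    qed
    ultimately have d0: "dlt 0 \<in> \<Lambda>" using cong s0 by blast
    have "dlt 1 \<in> \<Lambda>" by (rule cong[OF RXm[OF d0], of 1]) (auto dest!: less_8_cases simp: RX_def dlt_def)
    note d1 = this
    have "dlt 2 \<in> \<Lambda>" by (rule cong[OF RXm[OF d1], of 1]) (auto dest!: less_8_cases simp: RX_def dlt_def)
    note d2 = this
    have "dlt 3 \<in> \<Lambda>" by (rule cong[OF RXm[OF d2], of 1]) (auto dest!: less_8_cases simp: RX_def dlt_def)
    note d3 = this
    have d4: "dlt 4 \<in> \<Lambda>" by (rule cong[OF Rjm[OF d0], of 1]) (auto dest!: less_8_cases simp: Rj_def dlt_def)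
    have d5: "dlt 5 \<in> \<Lambda>" by (rule cong[OF Rjm[OF d1], of 1]) (auto dest!: less_8_cases simp: Rj_def dlt_def)
    have d6: "dlt 6 \<in> \<Lambda>" by (rule cong[OF Rjm[OF d2], of 1]) (auto dest!: less_8_cases simp: Rj_def dlt_def)
    have d7: "dlt 7 \<in> \<Lambda>" by (rule cong[OF Rjm[OF d3], of 1]) (auto dest!: less_8_cases simp: Rj_def dlt_def)
    have dj: "per (dlt j) \<in> W" if "j < 8" for j
    proof -
      have "dlt j \<in> \<Lambda>" using less_8_cases[OF that] d0 d1 d2 d3 d4 d5 d6 d7 by auto
      moreover have "per (dlt j) = per (cfun of_int (dlt j))" by (rule per_cong) (simp add: dlt_def)
      ultimately show ?thesis unfolding \<Lambda>_def by simp
    qed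
    have "c \<in> W" if c: "c \<in> carrier_vec 4" for c
    proof -
      obtain y where y: "per (cfun complex_of_real y) = c" using per_surjective[OF c] by blast
      have part: "per (\<lambda>k. \<Sum>j<l. complex_of_real (y j) * dlt j k) \<in> W" if "l \<le> 8" for l
        using that
      proof (induction l)
        case 0
        have "per (\<lambda>k. 0) = 0\<^sub>v 4" by (rule eq_vec4I) (simp_all add: zev_def wev_def)
        then show ?case using W0 by simp
      next
        case (Suc l)
        have "per (\<lambda>k. (\<Sum>j<l. complex_of_real (y j) * dlt j k) + complex_of_real (y l) * dlt l k) \<in> W"
          unfolding per_add per_smult using Suc by (intro Wadd Wsmult dj) auto
        then show ?case by simp
      qed
      have "c = per (\<lambda>k. \<Sum>j<8. complex_of_real (y j) * dlt j k)"
        unfolding y[symmetric] by (rule per_cong) (simp add: dlt_def if_distrib cong: if_cong)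
      then show ?thesis using part[of 8] by simp
    qed
    then show ?thesis using Wc by blast
  qed
qed

section \<open>The polarization\<close>

text \<open>The form is \<open>(x, y) \<mapsto> tr (\<mu> x y\<^sup>*)\<close> for the pure quaternion \<open>\<mu> = 2 i + \<phi> i j\<close>, whose norm is totally positive.\<close>

definition polmat :: "complex mat" where
  "polmat = mat 4 4 (\<lambda>(i,j). complex_of_real (
     [[th * gold, 2 * th, 0, 0], [2 * th, 3 * gold * th, 0, 0],
      [0, 0, 4 * et, 6 * (1 - gold) * et], [0, 0, 6 * (1 - gold) * et, 12 * et]] ! i ! j))"

lemma polmat_form:
  assumes v: "v \<in> carrier_vec 4" and w: "w \<in> carrier_vec 4"
  shows "(polmat *\<^sub>v v) \<bullet>c w =
    complex_of_real th * (complex_of_real gold * (v $ 0 * cnj (w $ 0)) + 2 * (v $ 1 * cnj (w $ 0) + v $ 0 * cnj (w $ 1))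
       + 3 * complex_of_real gold * (v $ 1 * cnj (w $ 1)))
    + complex_of_real et * (4 * (v $ 2 * cnj (w $ 2)) + 6 * complex_of_real (1 - gold) * (v $ 3 * cnj (w $ 2) + v $ 2 * cnj (w $ 3))
       + 12 * (v $ 3 * cnj (w $ 3)))"
proof -
  have P: "polmat \<in> carrier_mat 4 4" by (simp add: polmat_def)
  have "(polmat *\<^sub>v v) \<bullet>c w = (\<Sum>i<4. (polmat *\<^sub>v v) $ i * cnj (w $ i))"
    unfolding scalar_prod_def using w by (simp add: atLeast0LessThan)
  also have "\<dots> = (\<Sum>i<4. (\<Sum>j<4. polmat $$ (i,j) * v $ j) * cnj (w $ i))"
    by (intro sum.cong refl arg_cong[where f = "\<lambda>y. y * _"] mat_vec_index_sum[OF P v]) simp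
  also have "\<dots> = complex_of_real th * (complex_of_real gold * (v $ 0 * cnj (w $ 0)) + 2 * (v $ 1 * cnj (w $ 0) + v $ 0 * cnj (w $ 1))
       + 3 * complex_of_real gold * (v $ 1 * cnj (w $ 1)))
    + complex_of_real et * (4 * (v $ 2 * cnj (w $ 2)) + 6 * complex_of_real (1 - gold) * (v $ 3 * cnj (w $ 2) + v $ 2 * cnj (w $ 3))
       + 12 * (v $ 3 * cnj (w $ 3)))"
    unfolding sum_less_4 polmat_def by (simp add: algebra_simps)
  finally show ?thesis .
qed

text \<open>Completing the square after multiplication by \<open>p\<close>.\<close>

lemma quadratic_positive:
  fixes p q r a b :: real
  assumes "p > 0" "p * r > q * q"
  shows "p * (a * a) + 2 * q * (a * b) + r * (b * b) \<ge> 0"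
    "a \<noteq> 0 \<or> b \<noteq> 0 \<Longrightarrow> p * (a * a) + 2 * q * (a * b) + r * (b * b) > 0"
proof -
  have eq: "p * (p * (a * a) + 2 * q * (a * b) + r * (b * b)) = (p * a + q * b) * (p * a + q * b) + (p * r - q * q) * (b * b)"
    by (simp add: algebra_simps)
  have "p * (p * (a * a) + 2 * q * (a * b) + r * (b * b)) \<ge> 0"
    unfolding eq using mult_nonneg_nonneg[of "p * r - q * q" "b * b"] zero_le_square[of "p * a + q * b"] zero_le_square[of b] assms(2)
    by linarith
  then show "p * (a * a) + 2 * q * (a * b) + r * (b * b) \<ge> 0" using assms(1) by (simp add: zero_le_mult_iff)
  assume ab: "a \<noteq> 0 \<or> b \<noteq> 0"
  have "p * (p * (a * a) + 2 * q * (a * b) + r * (b * b)) > 0"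
  proof (cases "b = 0")
    case True
    then have "a * a > 0" using ab by (simp add: zero_less_mult_iff linorder_neq_iff) linarith
    then show ?thesis using True assms(1) by simp
  next
    case False
    then have "b * b > 0" by (simp add: zero_less_mult_iff linorder_neq_iff) linarith
    then show ?thesis unfolding eq using mult_pos_pos[of "p * r - q * q" "b * b"] zero_le_square[of "p * a + q * b"] assms(2) by linarith
  qed
  then show "p * (a * a) + 2 * q * (a * b) + r * (b * b) > 0" using assms(1) by (simp add: zero_less_mult_iff)
qed

text \<open>Pairs of conjugate elements of the ring of integers of \<open>\<rat>(\<surd>5)\<close>.\<close>

definition conj_pair :: "real \<Rightarrow> real \<Rightarrow> bool" where
  "conj_pair x x' \<longleftrightarrow> (\<exists>k l :: int. x = of_int k + of_int l * gold \<and> x' = of_int k + of_int l * (1 - gold))"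

lemma conj_pair_intros:
  "conj_pair (of_int k) (of_int k)" "conj_pair gold (1 - gold)"
  "conj_pair x x' \<Longrightarrow> conj_pair y y' \<Longrightarrow> conj_pair (x + y) (x' + y')"
  "conj_pair x x' \<Longrightarrow> conj_pair y y' \<Longrightarrow> conj_pair (x - y) (x' - y')"
  "conj_pair x x' \<Longrightarrow> conj_pair y y' \<Longrightarrow> conj_pair (x * y) (x' * y')"
  "conj_pair (numeral n) (numeral n)"
proof -
  show int: "conj_pair (of_int k) (of_int k)" for k unfolding conj_pair_def by (intro exI[of _ k] exI[of _ 0]) simp
  show "conj_pair gold (1 - gold)" unfolding conj_pair_def by (intro exI[of _ 0] exI[of _ 1]) simp
  show "conj_pair (numeral n) (numeral n)" using int[of "numeral n"] by simp
  assume "conj_pair x x'" "conj_pair y y'"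
  then obtain a b c d :: int where e: "x = of_int a + of_int b * gold" "x' = of_int a + of_int b * (1 - gold)"
    "y = of_int c + of_int d * gold" "y' = of_int c + of_int d * (1 - gold)"
    unfolding conj_pair_def by blast
  show "conj_pair (x + y) (x' + y')" unfolding conj_pair_def e
    by (intro exI[of _ "a + c"] exI[of _ "b + d"]) (simp add: algebra_simps)
  show "conj_pair (x - y) (x' - y')" unfolding conj_pair_def e
    by (intro exI[of _ "a - c"] exI[of _ "b - d"]) (simp add: algebra_simps)
  show "conj_pair (x * y) (x' * y')" unfolding conj_pair_def e
  proof (rule exI[of _ "a * c + b * d"], rule exI[of _ "a * d + b * c + b * d"], rule conjI)
    have "(real_of_int a + of_int b * gold) * (of_int c + of_int d * gold) =
      of_int (a * c) + of_int (a * d + b * c) * gold + of_int (b * d) * (gold * gold)" by (simp add: algebra_simps)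
    then show "(real_of_int a + of_int b * gold) * (of_int c + of_int d * gold) =
      of_int (a * c + b * d) + of_int (a * d + b * c + b * d) * gold" unfolding gold_sq by (simp add: algebra_simps)
    have "(real_of_int a + of_int b * (1 - gold)) * (of_int c + of_int d * (1 - gold)) =
      of_int (a * c) + of_int (a * d + b * c) * (1 - gold) + of_int (b * d) * (1 - 2 * gold + gold * gold)" by (simp add: algebra_simps)
    then show "(real_of_int a + of_int b * (1 - gold)) * (of_int c + of_int d * (1 - gold)) =
      of_int (a * c + b * d) + of_int (a * d + b * c + b * d) * (1 - gold)" unfolding gold_sq by (simp add: algebra_simps)
  qed
qed

lemma conj_pair_trace: "conj_pair x x' \<Longrightarrow> x + x' \<in> Ints"
  unfolding conj_pair_def
proof (elim exE conjE)
  fix k l :: int assume "x = of_int k + of_int l * gold" "x' = of_int k + of_int l * (1 - gold)"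
  then have "x + x' = of_int (2 * k + l)" by (simp add: algebra_simps)
  then show ?thesis by (simp only: Ints_of_int)
qed

lemma polarization_Lat: "polarization 4 Lat polmat"
  unfolding polarization_def
proof (intro conjI ballI impI)
  show "polmat \<in> carrier_mat 4 4" by (simp add: polmat_def)
next
  fix v w :: "complex vec" assume vw: "v \<in> carrier_vec 4" "w \<in> carrier_vec 4"
  show "(polmat *\<^sub>v w) \<bullet>c v = cnj ((polmat *\<^sub>v v) \<bullet>c w)"
    unfolding polmat_form[OF vw(2,1)] polmat_form[OF vw] by (simp add: algebra_simps)
next
  fix v :: "complex vec" assume v: "v \<in> carrier_vec 4" "v \<noteq> 0\<^sub>v 4"
  define Q where "Q a b = gold * (a * a) + 2 * 2 * (a * b) + 3 * gold * (b * b)" for a b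
  define Q' where "Q' a b = 4 * (a * a) + 2 * (6 * (1 - gold)) * (a * b) + 12 * (b * b)" for a b
  have "2.56 < gold * gold" using gold_bounds unfolding gold_sq by simp
  \<comment> \<open>The discriminant conditions in \<open>c1\<close> and \<open>c2\<close> are, up
    to positive factors, the positivity at the two real places of the norm
    \<open>3 \<phi>\<^sup>3 - 4 \<phi>\<close> of the pure quaternion defining the form.\<close>
  then have c1: "gold > 0" "gold * (3 * gold) > 2 * 2" using gold_bounds by simp_all
  have "(6 * (1 - gold)) * (6 * (1 - gold)) = 36 * (1 - 2 * gold + gold * gold)" by (simp add: algebra_simps)
  then have c2: "4 * 12 > (6 * (1 - gold)) * (6 * (1 - gold))" using gold_bounds unfolding gold_sq by simp
  have Q: "Q a b \<ge> 0" "a \<noteq> 0 \<or> b \<noteq> 0 \<Longrightarrow> Q a b > 0" for a b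
    unfolding Q_def using quadratic_positive[OF c1] by auto
  have Q': "Q' a b \<ge> 0" "a \<noteq> 0 \<or> b \<noteq> 0 \<Longrightarrow> Q' a b > 0" for a b
    unfolding Q'_def using quadratic_positive[OF _ c2] by auto
  have Re: "Re ((polmat *\<^sub>v v) \<bullet>c v) = th * (Q (Re (v $ 0)) (Re (v $ 1)) + Q (Im (v $ 0)) (Im (v $ 1)))
      + et * (Q' (Re (v $ 2)) (Re (v $ 3)) + Q' (Im (v $ 2)) (Im (v $ 3)))"
    unfolding polmat_form[OF v(1,1)] Q_def Q'_def by (simp add: algebra_simps)
  have "\<exists>k<4. v $ k \<noteq> 0" using v by (metis carrier_vecD eq_vecI index_zero_vec)
  then have nz: "v $ 0 \<noteq> 0 \<or> v $ 1 \<noteq> 0 \<or> v $ 2 \<noteq> 0 \<or> v $ 3 \<noteq> 0" using less_4_cases by metis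
  have n1: "Q (Re (v $ 0)) (Re (v $ 1)) + Q (Im (v $ 0)) (Im (v $ 1)) \<ge> 0"
    "Q' (Re (v $ 2)) (Re (v $ 3)) + Q' (Im (v $ 2)) (Im (v $ 3)) \<ge> 0"
    using Q(1) Q'(1) by (simp_all add: add_nonneg_nonneg)
  have "Q (Re (v $ 0)) (Re (v $ 1)) + Q (Im (v $ 0)) (Im (v $ 1)) > 0 \<or>
    Q' (Re (v $ 2)) (Re (v $ 3)) + Q' (Im (v $ 2)) (Im (v $ 3)) > 0"
  proof -
    have "(Re (v $ 0) \<noteq> 0 \<or> Re (v $ 1) \<noteq> 0) \<or> (Im (v $ 0) \<noteq> 0 \<or> Im (v $ 1) \<noteq> 0) \<or>
      (Re (v $ 2) \<noteq> 0 \<or> Re (v $ 3) \<noteq> 0) \<or> (Im (v $ 2) \<noteq> 0 \<or> Im (v $ 3) \<noteq> 0)"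
      using nz by (simp only: complex_eq_iff zero_complex.sel) blast
    then show ?thesis
      using Q[of "Re (v $ 0)" "Re (v $ 1)"] Q[of "Im (v $ 0)" "Im (v $ 1)"]
        Q'[of "Re (v $ 2)" "Re (v $ 3)"] Q'[of "Im (v $ 2)" "Im (v $ 3)"] by linarith
  qed
  then show "Re ((polmat *\<^sub>v v) \<bullet>c v) > 0"
    unfolding Re using n1 th_pos et_pos
    by (elim disjE) (simp_all add: add_pos_nonneg add_nonneg_pos)
next
  fix v w assume "v \<in> Lat" "w \<in> Lat"
  then obtain m n :: "nat \<Rightarrow> int" where v: "v = per (cfun of_int m)" and w: "w = per (cfun of_int n)"
    unfolding Lat_def by auto
  have cfr: "(cfun of_int m :: nat \<Rightarrow> complex) = cfun complex_of_real (\<lambda>k. real_of_int (m k))" for m :: "nat \<Rightarrow> int"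
    by simp
  define A B C D where "A g m = real_of_int (m 0) + real_of_int (m 2) * g"
    and "B g m = real_of_int (m 1) + real_of_int (m 3) * g"
    and "C g m = real_of_int (m 4) + real_of_int (m 6) * g"
    and "D g m = real_of_int (m 5) + real_of_int (m 7) * g" for g and m :: "nat \<Rightarrow> int"
  have th2: "th ^ 2 = gold" "th ^ 3 = gold * th" using th_sq by (simp_all add: power2_eq_square power3_eq_cube)
  have ev: "zev (\<lambda>k. real_of_int (m k)) th = A gold m + th * B gold m" "zev (\<lambda>k. real_of_int (m k)) (- th) = A gold m - th * B gold m"
    "wev (\<lambda>k. real_of_int (m k)) th = C gold m + th * D gold m" "wev (\<lambda>k. real_of_int (m k)) (- th) = C gold m - th * D gold m"
    for m unfolding zev_def wev_def A_def B_def C_def D_def by (simp_all add: th2 algebra_simps)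
  have pv: "per (cfun of_int m) $ 0 = Complex (xp * (A gold m + th * B gold m) + 3 * (C gold m + th * D gold m)) (A gold m + th * B gold m)"
    "per (cfun of_int m) $ 1 = Complex (xp * (C gold m - th * D gold m) + (A gold m - th * B gold m)) (C gold m - th * D gold m)"
    "per (cfun of_int m) $ 2 = Complex (A (1 - gold) m) (- et * B (1 - gold) m)"
    "per (cfun of_int m) $ 3 = Complex (C (1 - gold) m) (et * D (1 - gold) m)" for m
  proof -
    show "per (cfun of_int m) $ 0 = Complex (xp * (A gold m + th * B gold m) + 3 * (C gold m + th * D gold m)) (A gold m + th * B gold m)"
      unfolding cfr per_index ev_real ev by (simp add: tau_def complex_eq_iff)
    show "per (cfun of_int m) $ 1 = Complex (xp * (C gold m - th * D gold m) + (A gold m - th * B gold m)) (C gold m - th * D gold m)"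
      unfolding cfr per_index1 ev_real ev by (simp add: tau_def complex_eq_iff)
    show "per (cfun of_int m) $ 2 = Complex (A (1 - gold) m) (- et * B (1 - gold) m)"
      "per (cfun of_int m) $ 3 = Complex (C (1 - gold) m) (et * D (1 - gold) m)"
      unfolding cfr per_index ev_t2 by (simp_all add: A_def B_def C_def D_def algebra_simps)
  qed
  \<comment> \<open>The imaginary part of the form will be the trace of
    \<open>\<phi> K(\<phi>)\<close>, an element of the ring of integers: one real place contributes
    its value at \<open>gold\<close>, the other its conjugate.\<close>
  define K where "K g = 6 * g * (A g m * D g n + B g m * C g n - C g m * B g n - D g m * A g n)
     + 4 * (B g m * A g n - A g m * B g n) + 12 * (C g m * D g n - D g m * C g n)" for g
  have vw: "v \<in> carrier_vec 4" "w \<in> carrier_vec 4" unfolding v w by simp_all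
  have Im: "Im ((polmat *\<^sub>v v) \<bullet>c w) = th * (gold * (Im (v $ 0) * Re (w $ 0) - Re (v $ 0) * Im (w $ 0))
      + 2 * (Im (v $ 1) * Re (w $ 0) - Re (v $ 1) * Im (w $ 0) + Im (v $ 0) * Re (w $ 1) - Re (v $ 0) * Im (w $ 1))
      + 3 * gold * (Im (v $ 1) * Re (w $ 1) - Re (v $ 1) * Im (w $ 1)))
    + et * (4 * (Im (v $ 2) * Re (w $ 2) - Re (v $ 2) * Im (w $ 2))
      + 6 * (1 - gold) * (Im (v $ 3) * Re (w $ 2) - Re (v $ 3) * Im (w $ 2) + Im (v $ 2) * Re (w $ 3) - Re (v $ 2) * Im (w $ 3))
      + 12 * (Im (v $ 3) * Re (w $ 3) - Re (v $ 3) * Im (w $ 3)))"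
    unfolding polmat_form[OF vw] by (simp add: algebra_simps)
  have E1: "gold * (Im (v $ 0) * Re (w $ 0) - Re (v $ 0) * Im (w $ 0))
      + 2 * (Im (v $ 1) * Re (w $ 0) - Re (v $ 1) * Im (w $ 0) + Im (v $ 0) * Re (w $ 1) - Re (v $ 0) * Im (w $ 1))
      + 3 * gold * (Im (v $ 1) * Re (w $ 1) - Re (v $ 1) * Im (w $ 1)) = th * K gold"
    unfolding v w pv K_def by (simp add: algebra_simps)
  have E2: "4 * (Im (v $ 2) * Re (w $ 2) - Re (v $ 2) * Im (w $ 2))
      + 6 * (1 - gold) * (Im (v $ 3) * Re (w $ 2) - Re (v $ 3) * Im (w $ 2) + Im (v $ 2) * Re (w $ 3) - Re (v $ 2) * Im (w $ 3))
      + 12 * (Im (v $ 3) * Re (w $ 3) - Re (v $ 3) * Im (w $ 3)) = - et * K (1 - gold)"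
    unfolding v w pv K_def by (simp add: algebra_simps)
  have "Im ((polmat *\<^sub>v v) \<bullet>c w) = th * th * K gold - et * et * K (1 - gold)"
    unfolding Im E1 E2 by simp
  also have "\<dots> = gold * K gold + (1 - gold) * K (1 - gold)" unfolding th_sq et_sq by (simp add: algebra_simps)
  finally have "Im ((polmat *\<^sub>v v) \<bullet>c w) = gold * K gold + (1 - gold) * K (1 - gold)" .
  moreover have "conj_pair (gold * K gold) ((1 - gold) * K (1 - gold))"
    unfolding K_def A_def B_def C_def D_def by (intro conj_pair_intros)
  ultimately show "Im ((polmat *\<^sub>v v) \<bullet>c w) \<in> Ints" using conj_pair_trace by simp
qed

lemma simple_Lat: "simple_abelian_variety 4 Lat"
  unfolding simple_abelian_variety_def abelian_variety_def
  using full_lattice_Lat polarization_Lat lattice_subspace_dichotomy by auto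

section \<open>An automorphism of positive entropy\<close>

lemma lmul_cong: "(\<And>k. k < 8 \<Longrightarrow> r k = s k) \<Longrightarrow> lmul r = lmul s"
  unfolding lmul_def zev_def wev_def by simp

lemma lmul_one: "lmul (dlt 0) = 1\<^sub>m 4"
proof (rule eq_matI)
  fix i j assume "i < dim_row (1\<^sub>m 4 :: complex mat)" "j < dim_col (1\<^sub>m 4 :: complex mat)"
  then have "i < 4" "j < 4" by simp_all
  then show "lmul (dlt 0) $$ (i,j) = 1\<^sub>m 4 $$ (i,j)"
    by (elim disjE[OF less_4_cases] disjE) (simp_all only: lmul_index, simp_all add: zev_def wev_def dlt_def)
qed simp_all

lemma lmul_mult: "lmul r * lmul s = lmul (lact r s)"
proof (rule eq_matI)
  fix i j assume "i < dim_row (lmul (lact r s))" "j < dim_col (lmul (lact r s))"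
  then have ij: "i < 4" "j < 4" by simp_all
  have "(lmul r * lmul s) $$ (i,j) = (\<Sum>k<4. lmul r $$ (i,k) * lmul s $$ (k,j))"
    using ij by (simp add: scalar_prod_def atLeast0LessThan)
  also have "\<dots> = lmul (lact r s) $$ (i,j)"
    unfolding sum_less_4 using less_4_cases[OF ij(1)] less_4_cases[OF ij(2)]
    by (elim disjE; simp only: lmul_index ev_lact[OF root_t0(1)] ev_lact[OF root_t0(2)]
          ev_lact[OF root_t2(1)] ev_lact[OF root_t2(2)] minus_minus) (simp_all add: algebra_simps)
  finally show "(lmul r * lmul s) $$ (i,j) = lmul (lact r s) $$ (i,j)" .
qed simp_all

lemma lmul_mult_int: "lmul (cfun of_int r) * lmul (cfun of_int s) = lmul (cfun of_int (lact r s))"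
  unfolding lmul_mult by (rule lmul_cong, rule lact_hom[where c = of_int]) simp_all

lemma lmul_mult_rat: "lmul (cfun of_rat r) * lmul (cfun of_rat s) = lmul (cfun of_rat (lact r s))"
  unfolding lmul_mult
  by (rule lmul_cong, rule lact_hom[where c = of_rat]) (simp_all add: of_rat_add of_rat_minus of_rat_mult)

text \<open>The element \<open>i + i\<^sup>2\<close>. Its reduced norm is 1, so its inverse is the
  conjugate \<open>i\<^sup>2 - i\<close>.\<close>

definition unit_coords :: "nat \<Rightarrow> int" where "unit_coords = sel [0, 1, 1]"

definition aut :: "complex mat" where "aut = lmul (cfun of_int unit_coords)"

lemma aut_Units: "aut \<in> Units (End_ring 4 Lat)"
proof -
  define inv_coords :: "nat \<Rightarrow> int" where "inv_coords = sel [0, - 1, 1]"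
  define B where "B = lmul (cfun of_int inv_coords)"
  have p: "lact unit_coords inv_coords k = dlt 0 k" "lact inv_coords unit_coords k = dlt 0 k" if "k < 8" for k
    using less_8_cases[OF that]
    by (elim disjE; simp add: lact_def LX_def Lj_def dlt_def unit_coords_def inv_coords_def)+
  have one: "lmul (cfun of_int s) = 1\<^sub>m 4" if "\<And>k. k < 8 \<Longrightarrow> s k = dlt 0 k" for s :: "nat \<Rightarrow> int"
    unfolding lmul_one[symmetric] by (rule lmul_cong) (simp add: that dlt_def)
  have "B * aut = 1\<^sub>m 4" "aut * B = 1\<^sub>m 4"
    unfolding B_def aut_def lmul_mult_int by (rule one, rule p, assumption)+
  moreover have "aut \<in> carrier (End_ring 4 Lat)" "B \<in> carrier (End_ring 4 Lat)"
    unfolding B_def aut_def by (rule lmul_int_in_End)+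
  moreover have "monoid.mult (End_ring 4 Lat) = (*)" "monoid.one (End_ring 4 Lat) = 1\<^sub>m 4"
    unfolding End_ring_def ring_mat_def by simp_all
  ultimately show ?thesis unfolding Units_def by auto
qed

definition aut_ev :: "nat \<Rightarrow> complex" where
  "aut_ev k = [t0 + t0 ^ 2, - t0 + t0 ^ 2, t2 + t2 ^ 2, - t2 + t2 ^ 2] ! k"

lemma aut_mult_vec:
  assumes "v \<in> carrier_vec 4" "k < 4"
  shows "(aut *\<^sub>v v) $ k = aut_ev k * v $ k"
proof -
  have z: "zev (cfun of_int unit_coords) t = t + t ^ 2" "wev (cfun of_int unit_coords) t = 0" for t :: complex
    unfolding zev_def wev_def unit_coords_def by simp_all
  show ?thesis
    using less_4_cases[OF assms(2)] unfolding aut_def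
    by (elim disjE; simp only: lmul_mult_vec[OF assms(1)] z) (simp_all add: aut_ev_def)
qed

definition eps :: real where "eps = gold + th"

lemma th_bounds: "1 < th" "th < gold"
proof -
  have "1 * 1 < th * th" unfolding th_sq using gold_bounds by simp
  then show th1: "1 < th" using th_pos by (simp add: power2_eq_square[symmetric] power_less_imp_less_base[of 1 2 th])
  have "th * 1 < th * th" using th1 th_pos by (intro mult_strict_left_mono)
  then show "th < gold" unfolding th_sq by simp
qed

text \<open>The eigenvalues at each place have product 1. They are real at the first place; at the
  second one \<open>i\<close> has imaginary values, so they are complex conjugate and lie on the
  unit circle.\<close>

lemma cmod_aut_ev:
  "aut_ev 0 = complex_of_real eps" "cmod (aut_ev 1) \<le> 1" "cmod (aut_ev 2) = 1" "cmod (aut_ev 3) = 1"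
proof -
  show "aut_ev 0 = complex_of_real eps" by (simp add: aut_ev_def root_t0(3) eps_def) (simp add: t0_def)
  have "aut_ev 1 = complex_of_real (gold - th)" by (simp add: aut_ev_def root_t0(3)) (simp add: t0_def)
  then show "cmod (aut_ev 1) \<le> 1" using th_bounds gold_bounds by (simp only: norm_of_real)
  have "(1 - gold) * (1 - gold) + et * et = 1" using gold_sq et_sq by (simp add: algebra_simps)
  then have n: "cmod (Complex (1 - gold) s) = 1" if "s * s = et * et" for s
    using that by (simp add: cmod_def power2_eq_square)
  have "aut_ev 2 = Complex (1 - gold) (- et)" "aut_ev 3 = Complex (1 - gold) et"
    by (simp_all add: aut_ev_def root_t2(3)) (simp_all add: t2_def complex_eq_iff)
  then show "cmod (aut_ev 2) = 1" "cmod (aut_ev 3) = 1" by (simp_all only: n minus_mult_minus)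
qed

lemma eps_gt_1: "eps > 1"
  using th_pos gold_bounds by (simp add: eps_def)

text \<open>In these coordinates \<open>aut\<close> is diagonal, so only the one expanding
  coordinate requires a finer grid, shrinking at rate \<open>eps\<close>. The resulting upper bound
  meets the lower bound given by the corresponding eigenline.\<close>

lemma entropy_aut: "entropy 4 Lat aut = ereal (2 * ln eps)"
proof -
  obtain r R where "torus_endomorphism 4 Lat r R aut"
    using End_torus_endomorphism[OF full_lattice_Lat lmul_int_in_End, of unit_coords] unfolding aut_def by blast
  then interpret torus_endomorphism 4 Lat r R aut .
  have eps0: "eps > 0" using eps_gt_1 by simp
  have pow: "(aut ^\<^sub>m i *\<^sub>v w) $ k = aut_ev k ^ i * w $ k" if "w \<in> carrier_vec 4" "k < 4" for w i k
    using that
  proof (induction i arbitrary: w)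
    case 0
    have "dim_row aut = 4" unfolding aut_def by simp
    then show ?case using 0 by simp
  next
    case (Suc i)
    have "aut ^\<^sub>m Suc i *\<^sub>v w = aut ^\<^sub>m i *\<^sub>v (aut *\<^sub>v w)"
      using assoc_mult_mat_vec[OF A_pow A Suc.prems(1), of i] by simp
    then show ?case using Suc.IH[OF A_vec[OF Suc.prems(1)] Suc.prems(2)] Suc.prems by (simp add: aut_mult_vec)
  qed
  show ?thesis
  proof (rule antisym)
    let ?\<rho> = "\<lambda>n (k::nat). if k = 0 then (1 / eps) ^ n else (1 :: real)"
    show "entropy 4 Lat aut \<le> ereal (2 * ln eps)"
    proof (rule entropy_le[where \<rho> = ?\<rho>])
      show "0 < ?\<rho> n k" for n k :: nat using eps0 by simp
      show "?\<rho> n k \<le> 1" for n k :: nat using eps_gt_1 by (simp add: power_le_one)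
      show "cmod ((aut ^\<^sub>m i *\<^sub>v w) $ k) \<le> 1"
        if w: "w \<in> carrier_vec 4" and b: "\<And>k. k < 4 \<Longrightarrow> cmod (w $ k) \<le> ?\<rho> n k" and i: "i < n" and k: "k < 4" for w i k n
      proof (cases "k = 0")
        case True
        have "cmod (aut_ev 0 ^ i * w $ 0) = eps ^ i * cmod (w $ 0)"
          unfolding cmod_aut_ev(1) using eps0 by (simp add: norm_mult norm_power)
        also have "\<dots> \<le> eps ^ i * (1 / eps) ^ n" using b[of 0] eps0 by (intro mult_left_mono) simp_all
        also have "\<dots> \<le> eps ^ n * (1 / eps) ^ n"
          using i eps_gt_1 by (intro mult_right_mono power_increasing) simp_all
        also have "\<dots> = 1" using eps0 by (simp flip: power_mult_distrib)
        finally show ?thesis using pow[OF w k] True by simp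
      next
        case False
        then have d: "cmod (aut_ev k) \<le> 1" using less_4_cases[OF k] cmod_aut_ev by auto
        have "cmod (aut_ev k ^ i * w $ k) = cmod (aut_ev k) ^ i * cmod (w $ k)" by (simp add: norm_mult norm_power)
        also have "\<dots> \<le> 1 * 1"
          using b[OF k] False d by (intro mult_mono power_le_one) simp_all
        finally show ?thesis unfolding pow[OF w k] by simp
      qed
      \<comment> \<open>For \<open>n = 0\<close> the quotient is 0 by convention, so the equality
        holds from 1 on.\<close>
      have "\<forall>\<^sub>F n in sequentially. 2 * ln eps = (\<Sum>k<4. - 2 * ln (?\<rho> n k)) / real n"
      proof (rule eventually_sequentiallyI)
        fix n :: nat assume n: "1 \<le> n"
        have "(\<Sum>k<4. - 2 * ln (?\<rho> n k)) = - 2 * ln ((1 / eps) ^ n)" unfolding sum_less_4 by simp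
        also have "\<dots> = real n * (2 * ln eps)" using eps0 by (simp add: ln_realpow ln_div)
        finally show "2 * ln eps = (\<Sum>k<4. - 2 * ln (?\<rho> n k)) / real n" using n by simp
      qed
      then show "(\<lambda>n. (\<Sum>k<4. - 2 * ln (?\<rho> n k)) / real n) \<longlonglongrightarrow> 2 * ln eps"
        by (rule Lim_transform_eventually[OF tendsto_const])
    qed
    have "eigenvalue aut (complex_of_real eps)"
      unfolding eigenvalue_def eigenvector_def
    proof (intro exI[of _ "unit_vec 4 0"] conjI)
      show "unit_vec 4 0 \<in> carrier_vec (dim_row aut)" unfolding aut_def by simp
      show "unit_vec 4 0 \<noteq> (0\<^sub>v (dim_row aut) :: complex vec)"
      proof
        assume "unit_vec 4 0 = (0\<^sub>v (dim_row aut) :: complex vec)"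
        then have "unit_vec 4 0 $ 0 = (0\<^sub>v 4 $ 0 :: complex)" unfolding aut_def by simp
        then show False by simp
      qed
      show "aut *\<^sub>v unit_vec 4 0 = complex_of_real eps \<cdot>\<^sub>v unit_vec 4 0"
      proof (rule eq_vecI)
        fix i assume "i < dim_vec (complex_of_real eps \<cdot>\<^sub>v unit_vec 4 0)"
        then have i: "i < 4" by simp
        show "(aut *\<^sub>v unit_vec 4 0) $ i = (complex_of_real eps \<cdot>\<^sub>v unit_vec 4 0) $ i"
          unfolding aut_mult_vec[OF unit_vec_carrier i] using i cmod_aut_ev(1) by (cases "i = 0") simp_all
      qed (simp add: aut_def)
    qed
    from entropy_ge[OF this] eps_gt_1 show "ereal (2 * ln eps) \<le> entropy 4 Lat aut" by simp
  qed
qed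

section \<open>The Salem number\<close>

text \<open>This is \<open>(t + t\<^sup>2)\<^sup>2\<close> reduced by
  \<open>t\<^sup>4 = t\<^sup>2 + 1\<close>, the square of an eigenvalue of
  \<open>aut\<close>.\<close>

definition salem_conj :: "complex \<Rightarrow> complex" where
  "salem_conj t = 1 + 2 * t ^ 2 + 2 * t ^ 3"

lemma eps_square: "complex_of_real (eps * eps) = salem_conj t0"
proof -
  have "eps * eps = gold * gold + 2 * gold * th + th * th" unfolding eps_def by (simp add: algebra_simps)
  also have "\<dots> = 1 + 2 * gold + 2 * gold * th" unfolding gold_sq th_sq by simp
  finally have e: "eps * eps = 1 + 2 * gold + 2 * gold * th" .
  have "t0 ^ 3 = t0 ^ 2 * t0" by (simp add: power2_eq_square power3_eq_cube)
  then show ?thesis unfolding e salem_conj_def root_t0(3) by (simp add: t0_def)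
qed

lemma salem_conj_pair:
  assumes "t ^ 4 = t ^ 2 + 1"
  shows "salem_conj t + salem_conj (- t) = 2 + 4 * t ^ 2" "salem_conj t * salem_conj (- t) = 1"
proof -
  show "salem_conj t + salem_conj (- t) = 2 + 4 * t ^ 2" by (simp add: salem_conj_def)
  have "salem_conj t * salem_conj (- t) = 1 + 4 * t ^ 2 + 4 * t ^ 4 - 4 * (t ^ 4 * t ^ 2)"
    by (simp add: salem_conj_def algebra_simps eval_nat_numeral)
  also have "\<dots> = 1 + 4 * t ^ 4 - 4 * t ^ 4" unfolding assms by (simp add: algebra_simps assms flip: power_add)
  finally show "salem_conj t * salem_conj (- t) = 1" by simp
qed

definition salem_poly :: "'a::comm_ring_1 poly" where "salem_poly = [:1, - 8, - 2, - 8, 1:]"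

text \<open>Pairing \<open>t\<close> with \<open>- t\<close> gives the reciprocal quadratics
  \<open>x\<^sup>2 - (2 + 4 t\<^sup>2) x + 1\<close>. For the conjugate values \<open>\<phi>\<close>
  and \<open>1 - \<phi>\<close> of \<open>t\<^sup>2\<close> their product has integer
  coefficients.\<close>

lemma salem_poly_factor:
  "poly salem_poly x = (x - salem_conj t0) * (x - salem_conj (- t0)) * ((x - salem_conj t2) * (x - salem_conj (- t2)))"
proof -
  have pair: "(x - salem_conj t) * (x - salem_conj (- t)) = x * x - (2 + 4 * t ^ 2) * x + 1" if "t ^ 4 = t ^ 2 + 1" for t
  proof -
    have "(x - salem_conj t) * (x - salem_conj (- t)) = x * x - (salem_conj t + salem_conj (- t)) * x + salem_conj t * salem_conj (- t)"
      by (simp add: algebra_simps)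
    then show ?thesis unfolding salem_conj_pair[OF that] .
  qed
  have g: "complex_of_real gold * complex_of_real gold = complex_of_real gold + 1"
    using gold_sq by (simp flip: of_real_mult)
  have "(x * x - (2 + 4 * complex_of_real gold) * x + 1) * (x * x - (2 + 4 * complex_of_real (1 - gold)) * x + 1) =
    x ^ 4 - 8 * x ^ 3 + 14 * x ^ 2 - 8 * x + 1 + 16 * x ^ 2 * (complex_of_real gold - complex_of_real gold * complex_of_real gold)"
    by (simp add: algebra_simps eval_nat_numeral)
  also have "\<dots> = poly salem_poly x" unfolding g by (simp add: salem_poly_def algebra_simps eval_nat_numeral)
  finally show ?thesis unfolding pair[OF root_t0(1)] pair[OF root_t2(1)] root_t0(3) root_t2(3) by simp
qed

section \<open>Rational polynomials and Galois conjugates\<close>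

lemma poly_of_rat_of_real: "complex_of_real (poly (map_poly of_rat p) x) = poly (map_poly of_rat p) (complex_of_real x)"
proof -
  have "complex_of_real (poly (map_poly of_rat p) x) = poly (map_poly of_real (map_poly of_rat p)) (complex_of_real x)"
    by (simp add: poly_altdef coeff_map_poly degree_map_poly)
  also have "map_poly of_real (map_poly real_of_rat p) = map_poly complex_of_rat p"
    by (simp add: poly_eq_iff coeff_map_poly of_real_of_rat)
  finally show ?thesis .
qed

lemma map_poly_of_rat_pCons [simp]:
  "map_poly (of_rat :: rat \<Rightarrow> 'a::field_char_0) (pCons a p) = pCons (of_rat a) (map_poly of_rat p)"
  by (rule poly_eqI) (simp add: coeff_map_poly coeff_pCons split: nat.split)

lemma map_poly_of_rat_hom:
  fixes p q :: "rat poly"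
  shows "poly (map_poly of_rat (p + q)) (x::'a::field_char_0) = poly (map_poly of_rat p) x + poly (map_poly of_rat q) x"
    "poly (map_poly of_rat (p * q)) (x::'a) = poly (map_poly of_rat p) x * poly (map_poly of_rat q) x"
    "poly (map_poly of_rat (p \<circ>\<^sub>p q)) (x::'a) = poly (map_poly of_rat p) (poly (map_poly of_rat q) x)"
proof -
  have add: "map_poly (of_rat :: rat \<Rightarrow> 'a) (p + q) = map_poly of_rat p + map_poly of_rat q" for p q
    by (simp add: poly_eq_iff coeff_map_poly of_rat_add)
  have smult: "map_poly (of_rat :: rat \<Rightarrow> 'a) (Polynomial.smult a p) = Polynomial.smult (of_rat a) (map_poly of_rat p)" for a p
    by (simp add: poly_eq_iff coeff_map_poly of_rat_mult)
  have mult: "map_poly (of_rat :: rat \<Rightarrow> 'a) (p * q) = map_poly of_rat p * map_poly of_rat q" for p q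
    by (induction p) (simp_all add: add smult)
  show "poly (map_poly of_rat (p + q)) x = poly (map_poly of_rat p) x + poly (map_poly of_rat q) x"
    "poly (map_poly of_rat (p * q)) x = poly (map_poly of_rat p) x * poly (map_poly of_rat q) x"
    by (simp_all add: add mult)
  show "poly (map_poly of_rat (p \<circ>\<^sub>p q)) x = poly (map_poly of_rat p) (poly (map_poly of_rat q) x)"
    by (induction p) (simp_all add: pcompose_pCons add mult)
qed

text \<open>As \<open>th\<close> has degree four, a rational polynomial vanishing at
  \<open>th\<close> is divisible by \<open>x\<^sup>4 - x\<^sup>2 - 1\<close> and vanishes at all
  four roots. Composing \<open>p\<close> with \<open>salem_conj\<close> reduces to this case; it
  shows that the point \<open>salem_conj t2\<close> of the unit circle is a genuine
  conjugate.\<close>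

lemma rational_relation_transfer:
  fixes p :: "rat poly"
  assumes "poly (map_poly of_rat p) (salem_conj t0) = 0" "t ^ 4 = t ^ 2 + 1"
  shows "poly (map_poly of_rat p) (salem_conj t) = 0"
proof -
  define R where "R = p \<circ>\<^sub>p [:1, 0, 2, 2:]"
  define m :: "rat poly" where "m = [:- 1, 0, - 1, 0, 1:]"
  have sc: "poly (map_poly of_rat [:1, 0, 2, 2:]) t = salem_conj t" for t
    by (simp add: salem_conj_def power2_eq_square power3_eq_cube algebra_simps)
  have mt: "poly (map_poly of_rat m) t = 0" if "t ^ 4 = t ^ 2 + 1" for t :: complex
  proof -
    have "poly (map_poly of_rat m) t = t ^ 4 - t ^ 2 - 1"
      by (simp add: m_def of_rat_minus eval_nat_numeral algebra_simps)
    then show ?thesis unfolding that by simp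
  qed
  have R: "poly (map_poly of_rat R) t = poly (map_poly of_rat (R mod m)) t" if "t ^ 4 = t ^ 2 + 1" for t :: complex
  proof -
    have "poly (map_poly of_rat (m * (R div m) + R mod m)) t = poly (map_poly of_rat (R mod m)) t"
      unfolding map_poly_of_rat_hom mt[OF that] by simp
    then show ?thesis by simp
  qed
  have m0: "m \<noteq> 0" "Polynomial.degree m = 4" by (simp_all add: m_def)
  have deg: "R mod m = 0 \<or> Polynomial.degree (R mod m) < 4" using degree_mod_less[OF m0(1), of R] unfolding m0(2) .
  have "R mod m = 0"
  proof (rule ccontr)
    assume "R mod m \<noteq> 0"
    then have "Polynomial.degree (R mod m) < 4" using deg by simp
    then obtain q0 q1 q2 q3 where q: "R mod m = [:q0, q1, q2, q3:]"
    proof -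
      assume d: "Polynomial.degree (R mod m) < 4"
        and goal: "\<And>q0 q1 q2 q3. R mod m = [:q0, q1, q2, q3:] \<Longrightarrow> thesis"
      have "R mod m = [:Polynomial.coeff (R mod m) 0, Polynomial.coeff (R mod m) 1, Polynomial.coeff (R mod m) 2, Polynomial.coeff (R mod m) 3:]"
      proof (rule poly_eqI)
        fix n
        show "Polynomial.coeff (R mod m) n = Polynomial.coeff [:Polynomial.coeff (R mod m) 0, Polynomial.coeff (R mod m) 1, Polynomial.coeff (R mod m) 2, Polynomial.coeff (R mod m) 3:] n"
        proof (cases "n < 4")
          case True
          then show ?thesis using less_4_cases[OF True] by (elim disjE) (simp_all add: numeral_2_eq_2 numeral_3_eq_3)
        next
          case False
          then have "Polynomial.coeff (R mod m) n = 0" using d by (intro coeff_eq_0) simp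
          moreover have "Polynomial.coeff [:Polynomial.coeff (R mod m) 0, Polynomial.coeff (R mod m) 1, Polynomial.coeff (R mod m) 2, Polynomial.coeff (R mod m) 3:] n = 0"
            using False by (auto simp: coeff_pCons split: nat.split)
          ultimately show ?thesis by simp
        qed
      qed
      then show thesis by (rule goal)
    qed
    have "poly (map_poly of_rat R) t0 = 0" unfolding R_def map_poly_of_rat_hom(3) sc by (rule assms(1))
    then have "complex_of_real (of_rat q0 + of_rat q1 * th + of_rat q2 * th ^ 2 + of_rat q3 * th ^ 3) = 0"
      unfolding R[OF root_t0(1)] q by (simp add: of_real_of_rat algebra_simps power2_eq_square power3_eq_cube t0_def)
    then have "of_rat q0 + of_rat q1 * th + of_rat q2 * th ^ 2 + of_rat q3 * th ^ 3 = 0" by (simp only: of_real_eq_0_iff)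
    then have "q0 = 0 \<and> q1 = 0 \<and> q2 = 0 \<and> q3 = 0" by (rule th_independent)
    then show False using q \<open>R mod m \<noteq> 0\<close> by simp
  qed
  then have "poly (map_poly of_rat R) t = 0" using R[OF assms(2)] by simp
  then show ?thesis unfolding R_def map_poly_of_rat_hom(3) sc .
qed

text \<open>For an annihilating polynomial of least degree, division with remainder gives the
  divisibility; and in a factorization, the factor vanishing at \<open>x\<close> already has full
  degree.\<close>

lemma minimal_polynomial_exists:
  fixes P :: "rat poly" and x :: "'a::field_char_0"
  assumes "P \<noteq> 0" "poly (map_poly of_rat P) x = 0"
  obtains m :: "rat poly" where "Factorial_Ring.irreducible m" "poly (map_poly of_rat m) x = 0"
    "\<And>p. poly (map_poly of_rat p) x = 0 \<Longrightarrow> m dvd p"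
proof -
  define S where "S = (\<lambda>p. p \<noteq> 0 \<and> poly (map_poly of_rat p) x = 0)"
  have "\<exists>m. S m \<and> (\<forall>p. S p \<longrightarrow> Polynomial.degree m \<le> Polynomial.degree p)"
    using ex_has_least_nat[of S P Polynomial.degree] assms unfolding S_def by simp
  then obtain m where m: "m \<noteq> 0" "poly (map_poly of_rat m) x = 0"
    and least: "\<And>p. p \<noteq> 0 \<Longrightarrow> poly (map_poly of_rat p) x = 0 \<Longrightarrow> Polynomial.degree m \<le> Polynomial.degree p"
    unfolding S_def by auto
  have dvd: "m dvd p" if p: "poly (map_poly of_rat p) x = 0" for p
  proof (rule ccontr)
    assume "\<not> m dvd p"
    then have r0: "p mod m \<noteq> 0" by (simp add: dvd_eq_mod_eq_0)
    have "poly (map_poly of_rat (m * (p div m) + p mod m)) x = poly (map_poly of_rat (p mod m)) x"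
      unfolding map_poly_of_rat_hom m(2) by simp
    then have "poly (map_poly of_rat (p mod m)) x = 0" using p by simp
    then have "Polynomial.degree m \<le> Polynomial.degree (p mod m)" by (rule least[OF r0])
    then show False using degree_mod_less[OF m(1), of p] r0 by simp
  qed
  have half: "is_unit b" if e: "m = a * b" and a: "poly (map_poly of_rat a) x = 0" for a b
  proof -
    have ab: "a \<noteq> 0" "b \<noteq> 0" using e m(1) by auto
    have "Polynomial.degree m \<le> Polynomial.degree a" by (rule least[OF ab(1) a])
    moreover have "Polynomial.degree m = Polynomial.degree a + Polynomial.degree b" unfolding e by (rule degree_mult_eq[OF ab])
    ultimately show ?thesis using ab(2) by (simp add: is_unit_iff_degree)
  qed
  have "Factorial_Ring.irreducible m"
  proof (rule Factorial_Ring.irreducibleI)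
    show "m \<noteq> 0" by (rule m)
    show "\<not> is_unit m"
    proof
      assume "is_unit m"
      then obtain u where "1 = m * u" by (elim dvdE)
      then have "poly (map_poly of_rat 1) x = poly (map_poly of_rat (m * u)) x" by simp
      then show False unfolding map_poly_of_rat_hom m(2) by simp
    qed
    fix a b assume e: "m = a * b"
    have "poly (map_poly of_rat a) x * poly (map_poly of_rat b) x = 0"
      using m(2) unfolding e map_poly_of_rat_hom .
    then show "is_unit a \<or> is_unit b"
      using half[OF e] half[of b a] e by (auto simp: mult.commute)
  qed
  then show ?thesis using that m(2) dvd by blast
qed

lemma salem_eps_square: "salem_number (eps * eps)"
proof -
  define \<gamma> where "\<gamma> = eps * eps"
  have g1: "\<gamma> > 1" using eps_gt_1 less_1_mult[of eps eps] by (simp add: \<gamma>_def)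
  have gc: "complex_of_real \<gamma> = salem_conj t0" unfolding \<gamma>_def by (rule eps_square)
  have real_root: "poly (map_poly of_rat p) \<gamma> = 0 \<longleftrightarrow> poly (map_poly of_rat p) (salem_conj t0) = 0" for p :: "rat poly"
    unfolding gc[symmetric] poly_of_rat_of_real[symmetric] by (simp only: of_real_eq_0_iff)
  have mapP: "map_poly of_rat (salem_poly :: rat poly) = (salem_poly :: complex poly)"
    by (simp add: salem_poly_def of_rat_minus)
  have P0: "poly (map_poly of_rat (salem_poly :: rat poly)) (salem_conj t0) = 0"
    unfolding mapP salem_poly_factor by simp
  have Pn0: "(salem_poly :: rat poly) \<noteq> 0" by (simp add: salem_poly_def)
  obtain m :: "rat poly" where m: "Factorial_Ring.irreducible m" "poly (map_poly of_rat m) (salem_conj t0) = 0"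
    "\<And>p. poly (map_poly of_rat p) (salem_conj t0) = 0 \<Longrightarrow> m dvd p"
    using minimal_polynomial_exists[OF Pn0 P0] by blast
  have c2: "cmod (salem_conj t2) = 1" "cmod (salem_conj (- t2)) = 1"
  proof -
    have t3: "t2 ^ 3 = t2 ^ 2 * t2" "(- t2) ^ 2 = t2 ^ 2" "(- t2) ^ 3 = - (t2 ^ 2 * t2)"
      by (simp_all add: power2_eq_square power3_eq_cube)
    have e: "salem_conj t2 = Complex (1 + 2 * (1 - gold)) (2 * (gold - 1) * et)"
      "salem_conj (- t2) = cnj (salem_conj t2)"
      unfolding salem_conj_def t3 root_t2(3) by (simp_all add: t2_def complex_eq_iff algebra_simps)
    have "complex_of_real (cmod (salem_conj t2) ^ 2) = 1"
      using salem_conj_pair(2)[OF root_t2(1)] complex_norm_square[of "salem_conj t2"] unfolding e(2) by simp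
    then have "cmod (salem_conj t2) ^ 2 = 1" by (simp only: of_real_eq_1_iff)
    then show "cmod (salem_conj t2) = 1" by (simp add: power2_eq_1_iff) (use norm_ge_zero[of "salem_conj t2"] in linarith)
    then show "cmod (salem_conj (- t2)) = 1" unfolding e(2) by simp
  qed
  have c1: "cmod (salem_conj (- t0)) \<le> 1"
  proof -
    have "cmod (salem_conj t0 * salem_conj (- t0)) = 1" unfolding salem_conj_pair(2)[OF root_t0(1)] by simp
    then have "\<gamma> * cmod (salem_conj (- t0)) = 1" unfolding norm_mult gc[symmetric] using g1 by simp
    moreover have "1 * cmod (salem_conj (- t0)) \<le> \<gamma> * cmod (salem_conj (- t0))" using g1 by (intro mult_right_mono) simp_all
    ultimately show ?thesis by simp
  qed
  show ?thesis
    unfolding salem_number_def \<gamma>_def[symmetric]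
  proof (intro conjI allI impI)
    show "\<gamma> > 1" by (rule g1)
    have "poly (map_poly real_of_int salem_poly) \<gamma> = poly (map_poly of_rat (salem_poly :: rat poly)) \<gamma>"
      by (simp add: salem_poly_def of_rat_minus)
    then have "poly (map_poly real_of_int salem_poly) \<gamma> = 0" using P0 by (simp only: real_root)
    moreover have "Polynomial.lead_coeff (salem_poly :: int poly) = 1" by (simp add: salem_poly_def)
    ultimately show "algebraic_int \<gamma>" unfolding algebraic_int_altdef_ipoly by blast
  next
    fix z assume z: "galois_conjugate \<gamma> z \<and> z \<noteq> complex_of_real \<gamma>"
    then obtain p :: "rat poly" where p: "Factorial_Ring.irreducible p" "poly (map_poly of_rat p) \<gamma> = 0" "poly (map_poly of_rat p) z = 0"
      unfolding galois_conjugate_def by blast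
    \<comment> \<open>\<open>galois_conjugate\<close> admits every irreducible polynomial with root
      \<open>\<gamma>\<close>; such a polynomial is associated to \<open>m\<close> and so divides
      \<open>salem_poly\<close>.\<close>
    have "m dvd p" using m(3) p(2) by (simp only: real_root)
    then obtain c where c: "p = m * c" by (elim dvdE)
    then have "is_unit c" using p(1) m(1) Factorial_Ring.irreducibleD[OF p(1) c] Factorial_Ring.irreducible_not_unit by blast
    then have "p dvd m" unfolding c by (simp add: mult_unit_dvd_iff)
    also have "m dvd salem_poly" by (rule m(3)[OF P0])
    finally obtain k where k: "salem_poly = p * k" by (elim dvdE)
    have "poly (map_poly of_rat (salem_poly :: rat poly)) z = 0" unfolding k map_poly_of_rat_hom p(3) by simp
    then have "z = salem_conj t0 \<or> z = salem_conj (- t0) \<or> z = salem_conj t2 \<or> z = salem_conj (- t2)"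
      unfolding mapP salem_poly_factor by auto
    then show "cmod z \<le> 1" using z c1 c2 gc by auto
  next
    have "galois_conjugate \<gamma> (salem_conj t2)"
      unfolding galois_conjugate_def
      using m(1,2) rational_relation_transfer[OF m(2) root_t2(1)] by (intro exI[of _ m]) (simp add: real_root)
    moreover have "salem_conj t2 \<noteq> complex_of_real \<gamma>"
    proof
      assume "salem_conj t2 = complex_of_real \<gamma>"
      then have "cmod (complex_of_real \<gamma>) = 1" using c2(1) by simp
      then show False using g1 by simp
    qed
    ultimately show "\<exists>z. galois_conjugate \<gamma> z \<and> z \<noteq> complex_of_real \<gamma> \<and> cmod z = 1" using c2(1) by blast
  qed
qed

section \<open>The field \<open>\<rat>(\<surd>5)\<close>\<close>

lemma subfield_class_ring:
  fixes S :: "'a::field set"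
  assumes "1 \<in> S" "\<And>x y. x \<in> S \<Longrightarrow> y \<in> S \<Longrightarrow> x + y \<in> S" "\<And>x y. x \<in> S \<Longrightarrow> y \<in> S \<Longrightarrow> x * y \<in> S"
    and "\<And>x. x \<in> S \<Longrightarrow> - x \<in> S" "\<And>x. x \<in> S \<Longrightarrow> inverse x \<in> S"
  shows "field ((class_ring :: 'a ring)\<lparr>carrier := S\<rparr>)"
proof -
  have fF: "field (class_ring :: 'a ring)" by (rule class_field)
  then have cF: "cring (class_ring :: 'a ring)" by (rule fieldE(1))
  then have rF: "ring (class_ring :: 'a ring)" by (rule cring.axioms(1))
  have um: "\<ominus>\<^bsub>(class_ring :: 'a ring)\<^esub> x = - x" for x :: 'a
    by (simp add: class_ring_simps)
  have "subfield S (class_ring :: 'a ring)"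
  proof (rule field.subfieldI'[OF fF])
    show "subring S (class_ring :: 'a ring)"
      by (rule ring.subringI[OF rF]) (simp_all add: assms um class_ring_simps)
    fix k :: 'a assume k: "k \<in> S - {\<zero>\<^bsub>class_ring\<^esub>}"
    then have "k * inverse k = 1" by (simp add: class_ring_simps)
    then have "inv\<^bsub>(class_ring :: 'a ring)\<^esub> k = inverse k"
      by (intro comm_monoid.comm_inv_char[OF cring.axioms(2)[OF cF]]) (simp_all add: class_ring_simps)
    then show "inv\<^bsub>(class_ring :: 'a ring)\<^esub> k \<in> S" using k assms(5) by simp
  qed
  then show ?thesis by (rule ring.subfield_iff(2)[OF rF])
qed

lemma rational_hom_unique:
  fixes h :: "rat \<Rightarrow> 'a::field_char_0"
  assumes add: "\<And>x y. h (x + y) = h x + h y" and mult: "\<And>x y. h (x * y) = h x * h y" and one: "h 1 = 1"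
  shows "h q = of_rat q"
proof -
  have "h (0 + 0) = h 0 + h 0" by (rule add)
  then have h0: "h 0 = 0" by simp
  have nat: "h (of_nat n) = of_nat n" for n by (induction n) (simp_all add: h0 add one)
  have minus: "h (- x) = - h x" for x
  proof -
    have "h (- x + x) = h (- x) + h x" by (rule add)
    then show ?thesis using h0 by (simp add: eq_neg_iff_add_eq_0)
  qed
  have int: "h (of_int m) = of_int m" for m
    by (cases m rule: int_cases2) (simp_all add: nat minus)
  obtain a b where ab: "quotient_of q = (a, b)" by (cases "quotient_of q")
  then have q: "q = of_int a / of_int b" and b: "b > 0"
    by (auto simp: quotient_of_div quotient_of_denom_pos)
  have "of_int b * h q = of_int a"
    using mult[of "of_int b" q] b unfolding int q by (simp add: int)
  then show ?thesis using b by (simp add: q of_rat_divide field_simps)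
qed

definition fe :: "rat \<Rightarrow> rat \<Rightarrow> complex" where
  "fe p q = complex_of_rat p + complex_of_rat q * complex_of_real gold"

lemma fe_real: "fe p q = complex_of_real (of_rat p + of_rat q * gold)"
  by (simp add: fe_def of_real_of_rat)

lemma fe_eq_iff: "fe p q = fe p' q' \<longleftrightarrow> p = p' \<and> q = q'"
proof
  assume "fe p q = fe p' q'"
  then have "of_rat p + of_rat q * gold = of_rat p' + of_rat q' * gold" unfolding fe_real by (simp only: of_real_eq_iff)
  then show "p = p' \<and> q = q'" by (rule gold_independent_eq)
qed simp

lemma fe_add: "fe p q + fe p' q' = fe (p + p') (q + q')"
  by (simp add: fe_def of_rat_add algebra_simps)

lemma fe_uminus: "- fe p q = fe (- p) (- q)"
  by (simp add: fe_def of_rat_minus)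

lemma fe_diff: "fe p q - fe p' q' = fe (p - p') (q - q')"
  by (simp add: fe_def of_rat_diff algebra_simps)

lemma fe_mult: "fe p q * fe p' q' = fe (p * p' + q * q') (p * q' + q * p' + q * q')"
  unfolding fe_real of_real_mult[symmetric] gold_field_mult ..

lemma fe_numeral: "1 = fe 1 0" "0 = fe 0 0" "3 = fe 3 0" "complex_of_real gold = fe 0 1"
  by (simp_all add: fe_def)

lemma fe_inverse: "\<exists>p' q'. inverse (fe p q) = fe p' q'"
proof (cases "of_rat p + of_rat q * gold = 0")
  case True
  then have "inverse (fe p q) = fe 0 0" unfolding fe_real by (simp add: fe_def)
  then show ?thesis by blast
next
  case False
  then obtain a b where "inverse (of_rat p + of_rat q * gold) = of_rat a + of_rat b * gold"
    using gold_field_inverse by blast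
  then have "inverse (fe p q) = fe a b" unfolding fe_real of_real_inverse[symmetric] by simp
  then show ?thesis by blast
qed

definition K5_set :: "complex set" where "K5_set = {fe p q | p q. True}"

lemma fe_mem: "fe p q \<in> K5_set"
  unfolding K5_set_def by blast

lemma K5_setE: "x \<in> K5_set \<Longrightarrow> (\<And>p q. x = fe p q \<Longrightarrow> P) \<Longrightarrow> P"
  unfolding K5_set_def by blast

lemma K5_closed:
  "1 \<in> K5_set" "0 \<in> K5_set" "x \<in> K5_set \<Longrightarrow> y \<in> K5_set \<Longrightarrow> x + y \<in> K5_set"
  "x \<in> K5_set \<Longrightarrow> y \<in> K5_set \<Longrightarrow> x * y \<in> K5_set" "x \<in> K5_set \<Longrightarrow> - x \<in> K5_set"
  "x \<in> K5_set \<Longrightarrow> inverse x \<in> K5_set"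
proof -
  show "1 \<in> K5_set" "0 \<in> K5_set" using fe_mem[of 1 0] fe_mem[of 0 0] by (simp_all add: fe_def)
  show "x + y \<in> K5_set" "x * y \<in> K5_set" if "x \<in> K5_set" "y \<in> K5_set"
    using that by (auto elim!: K5_setE simp: fe_add fe_mult fe_mem)
  show "- x \<in> K5_set" if "x \<in> K5_set" using that by (auto elim!: K5_setE simp: fe_uminus fe_mem)
  show "inverse x \<in> K5_set" if "x \<in> K5_set"
    using that
  proof (rule K5_setE)
    fix p q assume "x = fe p q"
    then show ?thesis using fe_inverse[of p q] by (auto simp: fe_mem)
  qed
qed

text \<open>Realised inside the complex numbers, so that its operations are the ordinary ones and
  the inclusion is an embedding.\<close>

definition K5 :: "complex ring" where "K5 = (class_ring :: complex ring)\<lparr>carrier := K5_set\<rparr>"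

lemma K5_simps [simp]:
  "carrier K5 = K5_set" "monoid.mult K5 = (*)" "ring.add K5 = (+)" "monoid.one K5 = 1" "ring.zero K5 = 0"
  unfolding K5_def by (simp_all add: class_ring_simps)

lemma field_K5: "field K5"
  unfolding K5_def by (rule subfield_class_ring) (rule K5_closed; assumption)+

lemma K5_minus:
  assumes "x \<in> K5_set" "y \<in> K5_set"
  shows "x \<ominus>\<^bsub>K5\<^esub> y = x - y"
proof -
  have "(\<lambda>x. x) \<in> Ring.ring_hom K5 (class_ring :: complex ring)"
    by (rule ring_hom_memI) (simp_all add: class_ring_simps)
  from hom_minus[OF field_K5 this, of x y] assms show ?thesis by simp
qed

lemma number_field_K5: "number_field K5"
proof -
  let ?Q = "range complex_of_rat"
  interpret field K5 by (rule field_K5)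
  have QK: "?Q \<subseteq> K5_set"
  proof
    fix x assume "x \<in> ?Q"
    then obtain q where "x = complex_of_rat q" by blast
    then have "x = fe q 0" by (simp add: fe_def)
    then show "x \<in> K5_set" using fe_mem by simp
  qed
  have K5Q: "K5\<lparr>carrier := ?Q\<rparr> = (class_ring :: complex ring)\<lparr>carrier := ?Q\<rparr>" by (simp add: K5_def)
  have "field (K5\<lparr>carrier := ?Q\<rparr>)"
    unfolding K5Q
  proof (rule subfield_class_ring)
    show "1 \<in> ?Q" by (rule range_eqI[of _ _ 1]) simp
    show "x + y \<in> ?Q" "x * y \<in> ?Q" if "x \<in> ?Q" "y \<in> ?Q" for x y
      using that by (auto simp flip: of_rat_add of_rat_mult)
    show "- x \<in> ?Q" "inverse x \<in> ?Q" if "x \<in> ?Q" for x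
      using that by (auto simp flip: of_rat_minus of_rat_inverse)
  qed
  then have sf: "subfield ?Q K5" by (rule subfield_iff(1)) (simp add: QK)
  have "of_rat \<in> ring_iso (class_ring :: rat ring) (K5\<lparr>carrier := ?Q\<rparr>)"
    by (rule ring_iso_memI) (simp_all add: class_ring_simps of_rat_mult of_rat_add bij_betw_def inj_on_def)
  then have iso: "(class_ring :: rat ring) \<simeq> K5\<lparr>carrier := ?Q\<rparr>" unfolding is_ring_iso_def by blast
  have "Span ?Q [1, complex_of_real gold] = carrier K5"
  proof (rule equalityI; rule subsetI)
    fix x assume "x \<in> Span ?Q [1, complex_of_real gold]"
    then obtain a b where "x = complex_of_rat a * 1 + (complex_of_rat b * complex_of_real gold + 0)"
      by (auto simp: line_extension_mem_iff)
    then show "x \<in> carrier K5" using fe_mem[of a b] by (simp add: fe_def)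
  next
    fix x assume "x \<in> carrier K5"
    then obtain a b where x: "x = complex_of_rat a * 1 + (complex_of_rat b * complex_of_real gold + 0)"
      by (auto elim!: K5_setE simp: fe_def)
    let ?E = "line_extension ?Q (complex_of_real gold) {0}"
    have "complex_of_rat b * complex_of_real gold + 0 \<in> ?E"
      unfolding line_extension_mem_iff by simp
    then have "\<exists>k\<in>?Q. \<exists>v\<in>?E. x = k * 1 + v" using x rangeI by blast
    then have "x \<in> line_extension ?Q 1 ?E" using line_extension_mem_iff[of x ?Q 1 ?E] by simp
    then show "x \<in> Span ?Q [1, complex_of_real gold]" by simp
  qed
  moreover have "finite_dimension ?Q (Span ?Q [1, complex_of_real gold])"
    by (rule Span_finite_dimension[OF sf]) (use fe_mem[of 1 0] fe_mem[of 0 1] in \<open>simp add: fe_def\<close>)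
  ultimately have "finite_dimension ?Q (carrier K5)" by simp
  then show ?thesis unfolding number_field_def using sf iso field_K5 by blast
qed

lemma K5_hom_rat:
  fixes \<sigma> :: "complex \<Rightarrow> 'a::field_char_0"
  assumes \<sigma>: "\<sigma> \<in> Ring.ring_hom K5 (class_ring :: 'a ring)"
  shows "\<sigma> (fe p q) = of_rat p + of_rat q * \<sigma> (complex_of_real gold)"
proof -
  note h = hom_add[OF field_K5 \<sigma>] hom_mult[OF field_K5 \<sigma>]
  have r: "\<sigma> (fe p 0) = of_rat p" for p
  proof (rule rational_hom_unique)
    show "\<sigma> (fe (x + y) 0) = \<sigma> (fe x 0) + \<sigma> (fe y 0)" for x y
      using h(1)[of "fe x 0" "fe y 0"] by (simp add: fe_mem fe_add)
    show "\<sigma> (fe (x * y) 0) = \<sigma> (fe x 0) * \<sigma> (fe y 0)" for x y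
      using h(2)[of "fe x 0" "fe y 0"] by (simp add: fe_mem fe_mult)
    show "\<sigma> (fe 1 0) = 1" using hom_one[OF field_K5 \<sigma>] by (simp add: fe_def)
  qed
  have "fe p q = fe p 0 + fe q 0 * fe 0 1" by (simp add: fe_def)
  then have "\<sigma> (fe p q) = \<sigma> (fe p 0) + \<sigma> (fe q 0) * \<sigma> (fe 0 1)"
    using h(1)[of "fe p 0" "fe q 0 * fe 0 1"] h(2)[of "fe q 0" "fe 0 1"] by (simp add: fe_mem K5_closed)
  then show ?thesis unfolding r by (simp add: fe_def)
qed

text \<open>A homomorphism sends \<open>\<phi>\<close> to a solution of
  \<open>y\<^sup>2 = y + 1\<close>, and both solutions, \<open>\<phi>\<close> and
  \<open>1 - \<phi>\<close>, are real.\<close>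

lemma totally_real_K5: "totally_real_field K5"
  unfolding totally_real_field_def
proof (intro conjI ballI number_field_K5)
  fix \<sigma> assume \<sigma>: "\<sigma> \<in> Ring.ring_hom K5 (class_ring :: complex ring)"
  define y where "y = \<sigma> (complex_of_real gold)"
  have "\<sigma> (fe 0 1 * fe 0 1) = \<sigma> (fe 0 1) * \<sigma> (fe 0 1)" using hom_mult[OF field_K5 \<sigma>] by (simp add: fe_mem)
  then have "y * y = y + 1" unfolding fe_mult K5_hom_rat[OF \<sigma>] by (simp add: y_def add.commute)
  then have "(y - complex_of_real gold) * (y - complex_of_real (1 - gold)) = complex_of_real (1 + gold - gold * gold)"
    by (simp add: algebra_simps)
  then have "(y - complex_of_real gold) * (y - complex_of_real (1 - gold)) = 0" unfolding gold_sq by simp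
  then have "y = complex_of_real gold \<or> y = complex_of_real (1 - gold)" by (simp only: mult_eq_0_iff right_minus_eq)
  then have "y \<in> \<real>" by (elim disjE) (simp_all only: Reals_of_real)
  moreover have "complex_of_rat p \<in> \<real>" for p unfolding of_real_of_rat[symmetric] by (rule Reals_of_real)
  ultimately have "\<sigma> (fe p q) \<in> \<real>" for p q
    unfolding K5_hom_rat[OF \<sigma>] y_def by (intro Reals_add Reals_mult)
  then show "\<sigma> ` carrier K5 \<subseteq> \<real>" by (auto elim: K5_setE)
qed

section \<open>The endomorphism algebra is totally indefinite\<close>

definition mat22 :: "'a \<Rightarrow> 'a \<Rightarrow> 'a \<Rightarrow> 'a \<Rightarrow> 'a mat" where
  "mat22 a b c d = mat 2 2 (\<lambda>(i,j). [[a, b], [c, d]] ! i ! j)"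

lemma mat22_carrier: "mat22 a b c d \<in> carrier_mat 2 2"
  by (simp add: mat22_def)

lemma mat22_index: "mat22 a b c d $$ (0,0) = a" "mat22 a b c d $$ (0,Suc 0) = b"
    "mat22 a b c d $$ (Suc 0,0) = c" "mat22 a b c d $$ (Suc 0,Suc 0) = d"
  by (simp_all add: mat22_def)

lemma eq_mat22I:
  assumes "A \<in> carrier_mat 2 2" "A $$ (0,0) = a" "A $$ (0,Suc 0) = b" "A $$ (Suc 0,0) = c" "A $$ (Suc 0,Suc 0) = d"
  shows "A = mat22 a b c d"
proof (rule eq_matI)
  fix i j assume "i < dim_row (mat22 a b c d)" "j < dim_col (mat22 a b c d)"
  then have "i = 0 \<or> i = Suc 0" "j = 0 \<or> j = Suc 0" by (auto simp: mat22_def)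
  then show "A $$ (i,j) = mat22 a b c d $$ (i,j)" using assms by (elim disjE) (simp_all add: mat22_index)
qed (use assms(1) in \<open>simp_all add: mat22_def\<close>)

lemma mat22_eq_iff: "mat22 a b c d = mat22 a' b' c' d' \<longleftrightarrow> a = a' \<and> b = b' \<and> c = c' \<and> d = d'"
  by (metis mat22_index)

lemma mat22_mult:
  fixes a :: "'a::comm_ring_1"
  shows "mat22 a b c d * mat22 a' b' c' d' = mat22 (a * a' + b * c') (a * b' + b * d') (c * a' + d * c') (c * b' + d * d')"
proof -
  have i: "(mat22 a b c d * mat22 a' b' c' d') $$ (i,j) =
      mat22 a b c d $$ (i,0) * mat22 a' b' c' d' $$ (0,j) + mat22 a b c d $$ (i,Suc 0) * mat22 a' b' c' d' $$ (Suc 0,j)"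
    if "i < 2" "j < 2" for i j
    using that mat22_carrier[of a b c d] mat22_carrier[of a' b' c' d'] by (simp add: scalar_prod_def numeral_2_eq_2)
  show ?thesis
    by (rule eq_mat22I[OF mult_carrier_mat[OF mat22_carrier mat22_carrier]]) (simp_all add: i mat22_index del: index_mult_mat)
qed

lemma mat22_add:
  fixes a :: "'a::comm_ring_1"
  shows "mat22 a b c d + mat22 a' b' c' d' = mat22 (a + a') (b + b') (c + c') (d + d')"
  by (rule eq_mat22I[OF add_carrier_mat[OF mat22_carrier]])
    (use mat22_carrier[of a' b' c' d'] in \<open>simp_all add: mat22_index\<close>)

text \<open>With \<open>s\<^sup>2 = \<beta>\<close>, the matrix with rows
  \<open>(0, \<alpha>)\<close>, \<open>(1, 0)\<close> and the diagonal matrix with entries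
  \<open>s\<close>, \<open>- s\<close> satisfy the relations of \<open>i\<close> and
  \<open>j\<close>. The sign of \<open>\<alpha>\<close> is free, as \<open>\<phi>\<close> changes
  sign between the places.\<close>

lemma split_quaternion_algebra:
  fixes \<alpha> \<beta> :: real
  assumes "\<alpha> \<noteq> 0" "\<beta> > 0"
  shows "quaternion_algebra (class_ring :: real ring) \<alpha> \<beta> \<simeq> ring_mat TYPE(real) 2 ()"
proof -
  define s where "s = sqrt \<beta>"
  have s: "s > 0" "\<beta> = s * s" using assms(2) by (simp_all add: s_def)
  let ?Q = "quaternion_algebra (class_ring :: real ring) \<alpha> \<beta>" and ?M = "ring_mat TYPE(real) 2 ()"
  define h where "h = (\<lambda>(a, b, c, d). mat22 (a + s * c) (\<alpha> * (b - s * d)) (b + s * d) (a - s * c))"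
  have h: "h (a, b, c, d) = mat22 (a + s * c) (\<alpha> * (b - s * d)) (b + s * d) (a - s * c)" for a b c d
    by (simp add: h_def)
  have hc: "h x \<in> carrier ?M" for x by (cases x) (simp add: ring_mat_simps h mat22_carrier)
  have "h \<in> ring_iso ?Q ?M"
  proof (rule ring_iso_memI)
    fix x y :: "real \<times> real \<times> real \<times> real"
    obtain a b c d where x: "x = (a, b, c, d)" by (cases x)
    obtain a' b' c' d' where y: "y = (a', b', c', d')" by (cases y)
    show "h x \<in> carrier ?M" by (rule hc)
    have m: "x \<otimes>\<^bsub>?Q\<^esub> y = (a * a' + \<alpha> * b * b' + s * s * c * c' - \<alpha> * (s * s) * d * d',
        a * b' + b * a' - s * s * c * d' + s * s * d * c', a * c' + c * a' + \<alpha> * b * d' - \<alpha> * d * b', a * d' + d * a' + b * c' - c * b')"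
      unfolding x y quaternion_algebra_simps class_ring_minus by (simp add: class_ring_simps s(2))
    show "h (x \<otimes>\<^bsub>?Q\<^esub> y) = h x \<otimes>\<^bsub>?M\<^esub> h y"
      unfolding ring_mat_simps m unfolding x y h mat22_mult mat22_eq_iff by (simp add: algebra_simps)
    have p: "x \<oplus>\<^bsub>?Q\<^esub> y = (a + a', b + b', c + c', d + d')"
      unfolding x y quaternion_algebra_simps by (simp add: class_ring_simps)
    show "h (x \<oplus>\<^bsub>?Q\<^esub> y) = h x \<oplus>\<^bsub>?M\<^esub> h y"
      unfolding ring_mat_simps p unfolding x y h mat22_add mat22_eq_iff by (simp add: algebra_simps)
  next
    have "1\<^sub>m 2 = mat22 1 0 0 (1 :: real)" by (rule eq_mat22I) simp_all
    then show "h \<one>\<^bsub>?Q\<^esub> = \<one>\<^bsub>?M\<^esub>"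
      unfolding ring_mat_simps quaternion_algebra_simps by (simp add: h class_ring_simps)
    have inj: "x = y" if e: "h x = h y" for x y
    proof -
      obtain a b c d where x: "x = (a, b, c, d)" by (cases x)
      obtain a' b' c' d' where y: "y = (a', b', c', d')" by (cases y)
      have "a + s * c = a' + s * c'" "b - s * d = b' - s * d'" "b + s * d = b' + s * d'" "a - s * c = a' - s * c'"
        using e assms(1) unfolding x y h mat22_eq_iff by simp_all
      then have "b = b'" "s * d = s * d'" "a = a'" "s * c = s * c'" by linarith+
      then show ?thesis using s(1) by (simp add: x y)
    qed
    have surj: "\<exists>x. A = h x" if A: "A \<in> carrier_mat 2 2" for A
    proof -
      define p where "p = A $$ (0,Suc 0) / \<alpha>"
      have p: "A $$ (0,Suc 0) = \<alpha> * p" using assms(1) by (simp add: p_def)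
      have half: "(u + v) / 2 + s * ((u - v) / (2 * s)) = u" "(u + v) / 2 - s * ((u - v) / (2 * s)) = v" for u v
        using s(1) by (simp_all add: field_simps)
      have "A = h ((A $$ (0,0) + A $$ (Suc 0,Suc 0)) / 2, (A $$ (Suc 0,0) + p) / 2,
        (A $$ (0,0) - A $$ (Suc 0,Suc 0)) / (2 * s), (A $$ (Suc 0,0) - p) / (2 * s))"
        unfolding h half by (rule eq_mat22I[OF A]) (simp_all add: p)
      then show ?thesis by blast
    qed
    show "bij_betw h (carrier ?Q) (carrier ?M)"
      unfolding bij_betw_def
    proof
      show "inj_on h (carrier ?Q)" using inj by (rule inj_onI)
      have "carrier ?Q = UNIV" by (simp add: quaternion_algebra_simps class_ring_simps)
      moreover have "range h = carrier ?M"
      proof (rule equalityI; rule subsetI)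
        show "A \<in> carrier ?M" if "A \<in> range h" for A using that hc by (elim rangeE) simp
        show "A \<in> range h" if "A \<in> carrier ?M" for A
        proof -
          have "A \<in> carrier_mat 2 2" using that by (simp add: ring_mat_simps)
          then obtain x where "A = h x" using surj by blast
          then show ?thesis by simp
        qed
      qed
      ultimately show "h ` carrier ?Q = carrier ?M" by simp
    qed
  qed
  then show ?thesis unfolding is_ring_iso_def by blast
qed

lemma totally_indefinite_K5: "totally_indefinite_quaternion K5 (complex_of_real gold) 3"
  unfolding totally_indefinite_quaternion_def
proof (intro conjI ballI totally_real_K5)
  show "complex_of_real gold \<in> carrier K5 - {\<zero>\<^bsub>K5\<^esub>}"
    using fe_mem[of 0 1] gold_bounds by (simp add: fe_def)
  show "3 \<in> carrier K5 - {\<zero>\<^bsub>K5\<^esub>}" using fe_mem[of 3 0] by (simp add: fe_def)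
  fix \<sigma> assume \<sigma>: "\<sigma> \<in> Ring.ring_hom K5 (class_ring :: real ring)"
  show "quaternion_algebra class_ring (\<sigma> (complex_of_real gold)) (\<sigma> 3) \<simeq> ring_mat TYPE(real) 2 ()"
  proof (rule split_quaternion_algebra)
    show "\<sigma> (complex_of_real gold) \<noteq> 0"
    proof
      assume "\<sigma> (complex_of_real gold) = 0"
      then have "complex_of_real gold = \<zero>\<^bsub>K5\<^esub>"
        using fe_mem[of 0 1] by (intro hom_eq_0[OF field_K5 \<sigma>]) (simp_all add: fe_def)
      then show False using gold_bounds by simp
    qed
    have "\<sigma> 3 = 3" using K5_hom_rat[OF \<sigma>, of 3 0] by (simp add: fe_def)
    then show "\<sigma> 3 > 0" by simp
  qed
qed

text \<open>Even powers of \<open>i\<close> lie in \<open>\<rat>(\<surd>5)\<close>, so the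
  coordinates pair up as \<open>m\<^sub>0 + m\<^sub>2 \<phi>\<close>,
  \<open>m\<^sub>1 + m\<^sub>3 \<phi>\<close>, and similarly for \<open>w\<close>.\<close>

definition quat :: "(nat \<Rightarrow> rat) \<Rightarrow> complex \<times> complex \<times> complex \<times> complex" where
  "quat n = (fe (n 0) (n 2), fe (n 1) (n 3), fe (n 4) (n 6), fe (n 5) (n 7))"

abbreviation quat_ring :: "(complex \<times> complex \<times> complex \<times> complex) ring" where
  "quat_ring \<equiv> quaternion_algebra K5 (complex_of_real gold) 3"

lemma quat_carrier: "quat n \<in> carrier quat_ring"
  by (simp add: quat_def quaternion_algebra_simps fe_mem)

lemma quat_eq_iff: "quat n = quat m \<longleftrightarrow> (\<forall>k<8. n k = m k)"
proof
  assume "quat n = quat m"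
  then show "\<forall>k<8. n k = m k" unfolding quat_def by (auto simp: fe_eq_iff dest!: less_8_cases)
qed (simp add: quat_def)

lemma quat_surj:
  assumes "x \<in> carrier quat_ring"
  shows "\<exists>n. x = quat n"
proof -
  obtain a b c d where x: "x = (a, b, c, d)" by (cases x)
  have "a \<in> K5_set" "b \<in> K5_set" "c \<in> K5_set" "d \<in> K5_set"
    using assms unfolding x quaternion_algebra_simps by simp_all
  then obtain a0 a1 b0 b1 c0 c1 d0 d1 where "a = fe a0 a1" "b = fe b0 b1" "c = fe c0 c1" "d = fe d0 d1"
    by (auto elim!: K5_setE)
  then have "x = quat (sel [a0, b0, a1, b1, c0, d0, c1, d1])" unfolding x quat_def by simp
  then show ?thesis by blast
qed

lemma quat_add: "quat n \<oplus>\<^bsub>quat_ring\<^esub> quat m = quat (\<lambda>k. n k + m k)"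
  unfolding quat_def quaternion_algebra_simps by (simp add: fe_add)

lemma quat_mult: "quat n \<otimes>\<^bsub>quat_ring\<^esub> quat m = quat (lact n m)"
proof -
  have c: "fe p q \<otimes>\<^bsub>K5\<^esub> fe p' q' = fe (p * p' + q * q') (p * q' + q * p' + q * q')"
    "fe p q \<oplus>\<^bsub>K5\<^esub> fe p' q' = fe (p + p') (q + q')" "fe p q \<ominus>\<^bsub>K5\<^esub> fe p' q' = fe (p - p') (q - q')" for p q p' q'
    by (simp_all add: fe_add fe_mult fe_diff K5_minus fe_mem)
  show ?thesis
    unfolding quat_def quaternion_algebra_simps fe_numeral c prod.inject fe_eq_iff
    by (simp add: lact_def LX_def Lj_def algebra_simps)
qed

lemma lmul_add: "lmul r + lmul s = lmul (\<lambda>k. r k + s k)"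
proof (rule eq_matI)
  fix i j assume "i < dim_row (lmul (\<lambda>k. r k + s k))" "j < dim_col (lmul (\<lambda>k. r k + s k))"
  then have ij: "i < 4" "j < 4" by simp_all
  have e: "zev (\<lambda>k. r k + s k) t = zev r t + zev s t" "wev (\<lambda>k. r k + s k) t = wev r t + wev s t" for t :: complex
    unfolding zev_def wev_def by (simp_all add: algebra_simps)
  have "(lmul r + lmul s) $$ (i,j) = lmul r $$ (i,j) + lmul s $$ (i,j)" using ij by simp
  also have "\<dots> = lmul (\<lambda>k. r k + s k) $$ (i,j)"
    using less_4_cases[OF ij(1)] less_4_cases[OF ij(2)]
    by (elim disjE; simp only: lmul_index e) (simp_all add: algebra_simps)
  finally show "(lmul r + lmul s) $$ (i,j) = lmul (\<lambda>k. r k + s k) $$ (i,j)" .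
qed simp_all

lemma lmul_rat_eq_iff:
  "lmul (cfun of_rat n) = lmul (cfun of_rat m) \<longleftrightarrow> (\<forall>k<8. n k = m k)"
proof
  assume e: "lmul (cfun of_rat n) = lmul (cfun of_rat m)"
  have p: "lmul (cfun of_rat n) *\<^sub>v per (dlt 0) = per (cfun complex_of_real (\<lambda>k. of_rat (n k)))" for n :: "nat \<Rightarrow> rat"
    unfolding lmul_per
  proof (rule per_cong)
    fix k :: nat assume k: "k < 8"
    show "lact (cfun of_rat n) (dlt 0) k = complex_of_real (of_rat (n k))"
      using less_8_cases[OF k] by (elim disjE) (simp_all add: lact_def LX_def Lj_def dlt_def of_real_of_rat)
  qed
  have "per (cfun complex_of_real (\<lambda>k. of_rat (n k))) = per (cfun complex_of_real (\<lambda>k. of_rat (m k)))"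
    unfolding p[symmetric] e ..
  note i = per_inj[of "\<lambda>k. of_rat (n k)" "\<lambda>k. of_rat (m k)", OF this]
  show "\<forall>k<8. n k = m k"
  proof (intro allI impI)
    fix k :: nat assume "k < 8"
    then have "real_of_rat (n k) = of_rat (m k)" by (rule i)
    then show "n k = m k" by simp
  qed
next
  assume "\<forall>k<8. n k = m k"
  then show "lmul (cfun of_rat n) = lmul (cfun of_rat m)" by (intro lmul_cong) simp
qed

lemma EndQ_Lat_iso: "EndQ_ring 4 Lat \<simeq> quat_ring"
proof -
  let ?E = "EndQ_ring 4 Lat"
  \<comment> \<open>The coordinates chosen by \<open>SOME\<close> are determined up to index 7, and
    \<open>quat\<close> uses no others.\<close>
  define h where "h T = quat (SOME n. T = lmul (cfun of_rat n))" for T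
  have h: "h (lmul (cfun of_rat n)) = quat n" for n
  proof -
    have "lmul (cfun of_rat n) = lmul (cfun of_rat (SOME m. lmul (cfun of_rat n) = lmul (cfun of_rat m)))"
      by (rule someI[of "\<lambda>m. lmul (cfun of_rat n) = lmul (cfun of_rat m)" n]) simp
    then show ?thesis unfolding h_def quat_eq_iff lmul_rat_eq_iff by simp
  qed
  have "h \<in> ring_iso ?E quat_ring"
  proof (rule ring_iso_memI)
    fix S T assume "S \<in> carrier ?E" "T \<in> carrier ?E"
    then obtain n m :: "nat \<Rightarrow> rat" where S: "S = lmul (cfun of_rat n)" and T: "T = lmul (cfun of_rat m)"
      using EndQ_lmul by blast
    show "h S \<in> carrier quat_ring" unfolding S h by (rule quat_carrier)
    show "h (S \<otimes>\<^bsub>?E\<^esub> T) = h S \<otimes>\<^bsub>quat_ring\<^esub> h T"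
      unfolding EndQ_ring_simps S T lmul_mult_rat h quat_mult ..
    have "lmul (cfun of_rat n) + lmul (cfun of_rat m) = lmul (cfun of_rat (\<lambda>k. n k + m k))"
      unfolding lmul_add by (simp add: of_rat_add)
    then show "h (S \<oplus>\<^bsub>?E\<^esub> T) = h S \<oplus>\<^bsub>quat_ring\<^esub> h T"
      unfolding EndQ_ring_simps S T h quat_add by (simp only: h)
  next
    have "1\<^sub>m 4 = lmul (cfun of_rat (dlt 0))"
      unfolding lmul_one[symmetric] by (rule lmul_cong) (simp add: dlt_def)
    then have "h (1\<^sub>m 4) = quat (dlt 0)" by (simp only: h)
    then show "h \<one>\<^bsub>?E\<^esub> = \<one>\<^bsub>quat_ring\<^esub>"
      unfolding EndQ_ring_simps quaternion_algebra_simps quat_def by (simp add: dlt_def fe_def)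
    show "bij_betw h (carrier ?E) (carrier quat_ring)"
      unfolding bij_betw_def
    proof
      show "inj_on h (carrier ?E)"
      proof (rule inj_onI)
        fix S T assume ST: "S \<in> carrier ?E" "T \<in> carrier ?E" "h S = h T"
        then obtain n m :: "nat \<Rightarrow> rat" where S: "S = lmul (cfun of_rat n)" and T: "T = lmul (cfun of_rat m)"
          using EndQ_lmul by blast
        show "S = T" using ST(3) unfolding S T h quat_eq_iff lmul_rat_eq_iff .
      qed
      show "h ` carrier ?E = carrier quat_ring"
      proof (rule equalityI; rule subsetI)
        fix x assume "x \<in> h ` carrier ?E"
        then obtain T where T: "T \<in> carrier ?E" "x = h T" by blast
        obtain n :: "nat \<Rightarrow> rat" where n: "T = lmul (cfun of_rat n)" using EndQ_lmul[OF T(1)] by blast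
        show "x \<in> carrier quat_ring" unfolding T(2) n h by (rule quat_carrier)
      next
        fix x assume "x \<in> carrier quat_ring"
        then obtain n where n: "x = quat n" using quat_surj by blast
        show "x \<in> h ` carrier ?E" unfolding n h[symmetric] by (rule imageI) (rule lmul_rat_in_EndQ)
      qed
    qed
  qed
  then show ?thesis unfolding is_ring_iso_def by blast
qed

theorem theorem2:
  fixes g :: nat and L :: "complex vec set" and f :: "complex mat"
    and F :: "'k ring" and \<alpha> \<beta> :: 'k
  shows
    "(simple_abelian_variety g L \<and> f \<in> carrier (End_ring g L) \<and> f \<noteq> 0\<^sub>m g g \<longrightarrow>
       (totally_real_field (EndQ_ring g L) \<or> CM_field (EndQ_ring g L) \<longrightarrow>
          (\<forall>\<sigma> \<in> Ring.ring_hom (EndQ_ring g L) (class_ring :: complex ring).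
             (cmod (\<sigma> f) = 1 \<longrightarrow> entropy g L f = 0) \<and>
             (cmod (\<sigma> f) \<noteq> 1 \<longrightarrow> entropy g L f > 0))) \<and>
       (totally_definite_quaternion F \<alpha> \<beta> \<longrightarrow>
          (\<forall>\<phi> \<in> ring_iso (quaternion_algebra F \<alpha> \<beta>) (EndQ_ring g L).
           \<forall>a \<in> carrier F. \<forall>b \<in> carrier F. \<forall>c \<in> carrier F. \<forall>d \<in> carrier F.
             f = \<phi> (a, b, c, d) \<longrightarrow>
             (\<forall>\<sigma> \<in> Ring.ring_hom F (class_ring :: real ring). \<forall>s :: complex.
                s\<^sup>2 = of_real (\<sigma> (b \<otimes>\<^bsub>F\<^esub> b \<otimes>\<^bsub>F\<^esub> \<alpha> \<oplus>\<^bsub>F\<^esub> c \<otimes>\<^bsub>F\<^esub> c \<otimes>\<^bsub>F\<^esub> \<beta> \<ominus>\<^bsub>F\<^esub> d \<otimes>\<^bsub>F\<^esub> d \<otimes>\<^bsub>F\<^esub> \<alpha> \<otimes>\<^bsub>F\<^esub> \<beta>)) \<longrightarrow>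
                (cmod (of_real (\<sigma> a) + s) = 1 \<longrightarrow> entropy g L f = 0) \<and>
                (cmod (of_real (\<sigma> a) + s) \<noteq> 1 \<longrightarrow> entropy g L f > 0)))))
     \<and>
     (\<exists>(g' :: nat) (L' :: complex vec set) (F' :: complex ring) \<alpha>' \<beta>'.
        simple_abelian_variety g' L' \<and>
        totally_indefinite_quaternion F' \<alpha>' \<beta>' \<and>
        EndQ_ring g' L' \<simeq> quaternion_algebra F' \<alpha>' \<beta>' \<and>
        (\<exists>A \<gamma>. A \<in> Units (End_ring g' L') \<and> salem_number \<gamma> \<and> entropy g' L' A = ereal (ln \<gamma>)))"
  proof (intro conjI impI; (elim conjE)?)
  assume s: "simple_abelian_variety g L" and f: "f \<in> carrier (End_ring g L)" "f \<noteq> 0\<^sub>m g g"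
  have lat: "full_lattice g (carrier_vec g) L" "g > 0"
    using s unfolding simple_abelian_variety_def abelian_variety_def by simp_all
  show "\<forall>\<sigma> \<in> Ring.ring_hom (EndQ_ring g L) (class_ring :: complex ring).
      (cmod (\<sigma> f) = 1 \<longrightarrow> entropy g L f = 0) \<and> (cmod (\<sigma> f) \<noteq> 1 \<longrightarrow> entropy g L f > 0)"
    if "totally_real_field (EndQ_ring g L) \<or> CM_field (EndQ_ring g L)"
    by (intro ballI) (rule entropy_field[OF lat f that])
  show "\<forall>\<phi> \<in> ring_iso (quaternion_algebra F \<alpha> \<beta>) (EndQ_ring g L).
      \<forall>a \<in> carrier F. \<forall>b \<in> carrier F. \<forall>c \<in> carrier F. \<forall>d \<in> carrier F. f = \<phi> (a, b, c, d) \<longrightarrow>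
        (\<forall>\<sigma> \<in> Ring.ring_hom F (class_ring :: real ring). \<forall>s :: complex.
          s\<^sup>2 = of_real (\<sigma> (b \<otimes>\<^bsub>F\<^esub> b \<otimes>\<^bsub>F\<^esub> \<alpha> \<oplus>\<^bsub>F\<^esub> c \<otimes>\<^bsub>F\<^esub> c \<otimes>\<^bsub>F\<^esub> \<beta> \<ominus>\<^bsub>F\<^esub> d \<otimes>\<^bsub>F\<^esub> d \<otimes>\<^bsub>F\<^esub> \<alpha> \<otimes>\<^bsub>F\<^esub> \<beta>)) \<longrightarrow>
          (cmod (of_real (\<sigma> a) + s) = 1 \<longrightarrow> entropy g L f = 0) \<and>
          (cmod (of_real (\<sigma> a) + s) \<noteq> 1 \<longrightarrow> entropy g L f > 0))"
    if "totally_definite_quaternion F \<alpha> \<beta>"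
    by (intro ballI allI impI) (rule entropy_quaternion[OF lat f that])
next
  show "\<exists>(g' :: nat) (L' :: complex vec set) (F' :: complex ring) \<alpha>' \<beta>'.
        simple_abelian_variety g' L' \<and>
        totally_indefinite_quaternion F' \<alpha>' \<beta>' \<and>
        EndQ_ring g' L' \<simeq> quaternion_algebra F' \<alpha>' \<beta>' \<and>
        (\<exists>A \<gamma>. A \<in> Units (End_ring g' L') \<and> salem_number \<gamma> \<and> entropy g' L' A = ereal (ln \<gamma>))"
  proof (intro exI conjI)
    show "entropy 4 Lat aut = ereal (ln (eps * eps))"
      using eps_gt_1 by (simp add: entropy_aut ln_mult)
  qed (rule simple_Lat totally_indefinite_K5 EndQ_Lat_iso aut_Units salem_eps_square)+
qed

end
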